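(* Let $d,k$ be integers with $k>d\ge3$. There are subsets $\Omega_n'\subseteq\mathrm{Hom}_{\mathrm{unif}}(\Gamma,\mathrm{Sym}(V_n))$ (with $n$ ranging over multiples of $k$) such that $\mathbb{P}_n(\Omega_n')\to1$ and the following holds. If $\sigma_n\in\Omega_n'$ for each $n$, and $\mu_n$ is the uniform distribution on $X_{\sigma_n}$, then 1. $(\mu_n)_n$ has property M (with respect to the measure $m_X$); 2. $(\mu_n)_n$ converges locally and empirically to $m_X$; 3. $(X,m_X,T)$ has totally shattered microstate spaces along $\Sigma=(\sigma_n)_n$.
   Context: **The system.** $\Gamma=\Gamma_{d,k}=\langle s_1,\dots,s_d : s_1^k=\dots=s_d^k=e\rangle$ is the free product of $d$ copies of $\mathbb{Z}_k=\mathbb{Z}/k\mathbb{Z}$. $X=\{x\in\mathbb{Z}_2^\Gamma : \sum_{j=0}^{k-1}x_{gs_i^j}=0 \ \forall g\in\Gamma,\ i=1,\dots,d\}$, $m_X$ is the Haar probability measure of this compact group (also regarded as a measure on $\mathbb{Z}_2^\Gamma$), and $T$ is the shift action $(T^gx)_h=x_{g^{-1}h}$. **Random homomorphisms and codes.** For $n$ divisible by $k$, $V_n=\{1,\dots,n\}$, $\mathrm{Hom}_{\mathrm{unif}}(\Gamma,\mathrm{Sym}(V_n))$ is the set of homomorphisms $\sigma$ such that each $\sigma_i:=\sigma(s_i)$ consists entirely of $k$-cycles, and $\mathbb{P}_n$ is the uniform distribution on it. For such $\sigma$, $$X_\sigma=\Big\{\mathbf{x}\in\mathbb{Z}_2^{V_n}:\sum_{j=0}^{k-1}x_{\sigma_i^j(v)}=0\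 \ \forall v\in V_n,\ i=1,\dots,d\Big\}.$$ **Microstates.** For a finite set $\mathtt{A}$, $\sigma:\Gamma\to\mathrm{Sym}(V)$, $\mathbf{x}\in\mathtt{A}^V$: $\Pi^\sigma_v(\mathbf{x})(g)=\mathbf{x}_{\sigma(g^{-1})v}$, $P^\sigma_{\mathbf{x}}=|V|^{-1}\sum_v\delta_{\Pi^\sigma_v(\mathbf{x})}$, and $\Omega(\sigma,\mathcal{O})=\{\mathbf{x}\in\mathtt{A}^V:P^\sigma_{\mathbf{x}}\in\mathcal{O}\}$ for weak* open $\mathcal{O}\subset\mathrm{Prob}(\mathtt{A}^\Gamma)$. **Property M.** Let $B_r\subset\Gamma$ be the ball of radius $r$ about $e$ in the word metric for the generating set $\{s_i^j:1\le i\le d,1\le j\le k-1\}$. For $F\subset\Gamma$ finite and $S\subset V_n$ let $\sigma_n^F(S)=\{\sigma_n(f)s:f\in F,s\in S\}$. For a measure on a product space, a subscript denotes the marginal on the indicated coordinates; $H$ is Shannon entropy (natural logarithm). A sequence $(\mu_n)$ of probability measures on $\mathtt{A}^{V_n}$ has property M with respect to an invariant $\mu\in\mathrm{Prob}(\mathtt{A}^\Gamma)$ if for every $\epsilon>0$ and $0<r<\infty$ there are $S_n\subset V_n$ with $\liminf|S_n|/|V_n|>0$ and $H\big((\mu_n)_{\sigma_n^{B_r}(S_n)}\big)\ge|S_n|\,(H(\mu_{B_r})-\epsilon)$ for all $n$. **Local and empirical convergence.** $(\mu_n)$ converges locally and empirically to $\mu$ if for every open $\mathcal{O}\ni\mu$,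 $|V_n|^{-1}|\{v\in V_n:(\Pi^{\sigma_n}_v)_*\mu_n\in\mathcal{O}\}|\to1$ and $\mu_n(\{\mathbf{x}:P^{\sigma_n}_{\mathbf{x}}\in\mathcal{O}\})\to1$. **Total shattering.** Let $\mathrm{d}^{(V)}(\mathbf{x},\mathbf{y})=|V|^{-1}|\{v:\mathbf{x}(v)\ne\mathbf{y}(v)\}|$. A shift system $(\mathtt{A}^\Gamma,\mu,T)$ has totally shattered microstate spaces along $\Sigma$ if (i) it has microstates along $\Sigma$, i.e. for every neighbourhood $\mathcal{O}$ of $\mu$, $\Omega(\sigma_n,\mathcal{O})\neq\emptyset$ for all large $n$; and (ii) there is $\delta>0$ such that for every $\varepsilon>0$ there are a weak* neighbourhood $\mathcal{O}$ of $\mu$ and $n_0$ such that for all $n\ge n_0$ and $\mathbf{x},\mathbf{y}\in\Omega(\sigma_n,\mathcal{O})$, either $\mathrm{d}^{(V_n)}(\mathbf{x},\mathbf{y})\ge\delta$ or $\mathrm{d}^{(V_n)}(\mathbf{x},\mathbf{y})<\varepsilon$. *)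

theory Defs
  imports
    "HOL-Probability.Probability"
    "HOL-Algebra.Sym_Groups"
    "HOL-Combinatorics.Orbits"
    "HOL-Library.Z2"
begin

instance bit :: finite
proof
  have "(UNIV :: bit set) = {0, 1}"
    by (auto intro: bit.exhaust)
  then show "finite (UNIV :: bit set)"
    by (metis finite.emptyI finite.insertI)
qed

section \<open>The free product of cyclic groups\<close>

text \<open>The group with generators \<open>s\<^sub>1, \<dots>, s\<^sub>d\<close> and relators \<open>s\<^sub>i ^ k\<close>: words in the letters
  \<open>1, \<dots>, d\<close> modulo the congruence generated by the relators.  Letters for the inverses of the
  generators are not needed, since \<open>s\<^sub>i ^ (k - 1)\<close> inverts \<open>s\<^sub>i\<close> when \<open>k > 0\<close>.\<close>

inductive word_eq :: "nat \<Rightarrow> nat \<Rightarrow> nat list \<Rightarrow> nat list \<Rightarrow> bool" for d k where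
  refl: "set u \<subseteq> {1..d} \<Longrightarrow> word_eq d k u u"
| sym: "word_eq d k u v \<Longrightarrow> word_eq d k v u"
| trans: "word_eq d k u v \<Longrightarrow> word_eq d k v w \<Longrightarrow> word_eq d k u w"
| relator: "set u \<subseteq> {1..d} \<Longrightarrow> set v \<subseteq> {1..d} \<Longrightarrow> i \<in> {1..d} \<Longrightarrow>
    word_eq d k (u @ replicate k i @ v) (u @ v)"

definition word_class :: "nat \<Rightarrow> nat \<Rightarrow> nat list \<Rightarrow> nat list set" where
  "word_class d k u = {v. word_eq d k u v}"

definition \<Gamma> :: "nat \<Rightarrow> nat \<Rightarrow> nat list set monoid" where
  "\<Gamma> d k = \<lparr>carrier = word_class d k ` {u. set u \<subseteq> {1..d}},
     mult = (\<lambda>A B. \<Union>u\<in>A. \<Union>v\<in>B. word_class d k (u @ v)),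
     one = word_class d k []\<rparr>"

definition gen :: "nat \<Rightarrow> nat \<Rightarrow> nat \<Rightarrow> nat list set" where
  "gen d k i = word_class d k [i]"

lemma word_eq_letters: "word_eq d k u v \<Longrightarrow> set u \<subseteq> {1..d} \<and> set v \<subseteq> {1..d}"
  by (induction rule: word_eq.induct) auto

lemma word_class_eq_iff:
  "set u \<subseteq> {1..d} \<Longrightarrow> word_class d k u = word_class d k v \<longleftrightarrow> word_eq d k u v"
  unfolding word_class_def
  using word_eq.refl word_eq.sym word_eq.trans by blast

lemma word_eq_append_left:
  "word_eq d k u v \<Longrightarrow> set w \<subseteq> {1..d} \<Longrightarrow> word_eq d k (w @ u) (w @ v)"
proof (induction rule: word_eq.induct)
  case (refl u) then show ?case by (intro word_eq.refl) simp
next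
  case (sym u v) then show ?case by (auto intro: word_eq.sym)
next
  case (trans u v x) then show ?case by (auto intro: word_eq.trans)
next
  case (relator u v i)
  then show ?case using word_eq.relator[of "w @ u" d v i k] by simp
qed

lemma word_eq_append_right:
  "word_eq d k u v \<Longrightarrow> set w \<subseteq> {1..d} \<Longrightarrow> word_eq d k (u @ w) (v @ w)"
proof (induction rule: word_eq.induct)
  case (refl u) then show ?case by (intro word_eq.refl) simp
next
  case (sym u v) then show ?case by (auto intro: word_eq.sym)
next
  case (trans u v x) then show ?case by (auto intro: word_eq.trans)
next
  case (relator u v i)
  then show ?case using word_eq.relator[of u d "v @ w" i k] by simp
qed

lemma word_eq_append:
  assumes "word_eq d k u u'" "word_eq d k v v'"
  shows "word_eq d k (u @ v) (u' @ v')"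
proof -
  have "word_eq d k (u @ v) (u' @ v)"
    using assms word_eq_letters by (intro word_eq_append_right) auto
  moreover have "word_eq d k (u' @ v) (u' @ v')"
    using assms word_eq_letters by (intro word_eq_append_left) auto
  ultimately show ?thesis by (rule word_eq.trans)
qed

lemma carrier_\<Gamma>: "carrier (\<Gamma> d k) = word_class d k ` {u. set u \<subseteq> {1..d}}"
  by (simp add: \<Gamma>_def)

lemma one_\<Gamma>: "\<one>\<^bsub>\<Gamma> d k\<^esub> = word_class d k []"
  by (simp add: \<Gamma>_def)

lemma mult_\<Gamma>:
  assumes "set u \<subseteq> {1..d}" "set v \<subseteq> {1..d}"
  shows "word_class d k u \<otimes>\<^bsub>\<Gamma> d k\<^esub> word_class d k v = word_class d k (u @ v)"
proof -
  have "word_class d k (u' @ v') = word_class d k (u @ v)"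
    if "u' \<in> word_class d k u" "v' \<in> word_class d k v" for u' v'
  proof -
    have "word_eq d k (u @ v) (u' @ v')"
      using that by (intro word_eq_append) (simp_all add: word_class_def)
    then show ?thesis using assms by (simp add: word_class_eq_iff[symmetric])
  qed
  moreover have "u \<in> word_class d k u" "v \<in> word_class d k v"
    using assms[THEN word_eq.refl] by (auto simp: word_class_def)
  ultimately have "(\<Union>u'\<in>word_class d k u. \<Union>v'\<in>word_class d k v. word_class d k (u' @ v'))
      = word_class d k (u @ v)"
    by blast
  then show ?thesis by (simp add: \<Gamma>_def)
qed

lemma gen_closed: "i \<in> {1..d} \<Longrightarrow> gen d k i \<in> carrier (\<Gamma> d k)"
  by (auto simp: gen_def carrier_\<Gamma>)

lemma group_\<Gamma>:
  assumes "0 < k"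
  shows "group (\<Gamma> d k)"
proof (rule groupI)
  fix x y assume "x \<in> carrier (\<Gamma> d k)" "y \<in> carrier (\<Gamma> d k)"
  then obtain u v where "x = word_class d k u" "y = word_class d k v"
    "set u \<subseteq> {1..d}" "set v \<subseteq> {1..d}"
    by (auto simp: carrier_\<Gamma>)
  then show "x \<otimes>\<^bsub>\<Gamma> d k\<^esub> y \<in> carrier (\<Gamma> d k)"
    by (auto simp: mult_\<Gamma> carrier_\<Gamma>)
next
  show "\<one>\<^bsub>\<Gamma> d k\<^esub> \<in> carrier (\<Gamma> d k)"
    by (auto simp: one_\<Gamma> carrier_\<Gamma>)
next
  fix x y z
  assume "x \<in> carrier (\<Gamma> d k)" "y \<in> carrier (\<Gamma> d k)" "z \<in> carrier (\<Gamma> d k)"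
  then show "x \<otimes>\<^bsub>\<Gamma> d k\<^esub> y \<otimes>\<^bsub>\<Gamma> d k\<^esub> z = x \<otimes>\<^bsub>\<Gamma> d k\<^esub> (y \<otimes>\<^bsub>\<Gamma> d k\<^esub> z)"
    by (auto simp: carrier_\<Gamma> mult_\<Gamma>)
next
  fix x assume "x \<in> carrier (\<Gamma> d k)"
  then show "\<one>\<^bsub>\<Gamma> d k\<^esub> \<otimes>\<^bsub>\<Gamma> d k\<^esub> x = x"
    by (auto simp: carrier_\<Gamma> one_\<Gamma> mult_\<Gamma>)
next
  have inv: "\<exists>v. set v \<subseteq> {1..d} \<and> word_eq d k (v @ u) []" if "set u \<subseteq> {1..d}" for u
    using that
  proof (induction u)
    case Nil then show ?case by (intro exI[of _ "[]"] conjI) (simp_all add: word_eq.refl)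
  next
    case (Cons i u)
    then obtain v where v: "set v \<subseteq> {1..d}" "word_eq d k (v @ u) []" by auto
    have "word_eq d k (v @ replicate k i @ u) (v @ u)"
      using v Cons.prems by (intro word_eq.relator) auto
    moreover have "replicate k i = replicate (k - 1) i @ [i]"
      using assms by (metis Suc_diff_1 replicate_Suc replicate_append_same)
    ultimately have "word_eq d k ((v @ replicate (k - 1) i) @ i # u) []"
      using v word_eq.trans by auto
    then show ?case using v Cons.prems
      by (intro exI[of _ "v @ replicate (k - 1) i"]) auto
  qed
  fix x assume "x \<in> carrier (\<Gamma> d k)"
  then obtain u where u: "x = word_class d k u" "set u \<subseteq> {1..d}" by (auto simp: carrier_\<Gamma>)
  from inv[OF u(2)] obtain v where v: "set v \<subseteq> {1..d}" "word_eq d k (v @ u) []" by blast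
  have "word_class d k v \<otimes>\<^bsub>\<Gamma> d k\<^esub> x = \<one>\<^bsub>\<Gamma> d k\<^esub>"
    using u v by (simp add: mult_\<Gamma> one_\<Gamma> word_class_eq_iff)
  then show "\<exists>y\<in>carrier (\<Gamma> d k). y \<otimes>\<^bsub>\<Gamma> d k\<^esub> x = \<one>\<^bsub>\<Gamma> d k\<^esub>"
    using v by (auto simp: carrier_\<Gamma>)
qed

lemma gen_pow:
  assumes "0 < k" "i \<in> {1..d}"
  shows "gen d k i [^]\<^bsub>\<Gamma> d k\<^esub> k = \<one>\<^bsub>\<Gamma> d k\<^esub>"
proof -
  interpret group "\<Gamma> d k" by (rule group_\<Gamma>[OF assms(1)])
  have "gen d k i [^]\<^bsub>\<Gamma> d k\<^esub> n = word_class d k (replicate n i)" for n :: nat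
  proof (induction n)
    case (Suc n)
    have "set (replicate n i) \<subseteq> {1..d}" "set [i] \<subseteq> {1..d}" using assms by auto
    then show ?case using Suc
      by (simp add: gen_def mult_\<Gamma> replicate_append_same)
  qed (simp add: one_\<Gamma>)
  moreover have "word_eq d k (replicate k i) []"
    using word_eq.relator[of "[]" d "[]" i k] assms by simp
  ultimately show ?thesis
    using assms by (simp add: one_\<Gamma> word_class_eq_iff)
qed

text \<open>The universal property of the presentation (uniqueness of \<open>h\<close> on the carrier is clear,
  as the generators generate).\<close>

lemma \<Gamma>_universal:
  assumes "group H" "0 < k"
    and "\<And>i. i \<in> {1..d} \<Longrightarrow> f i \<in> carrier H"
    and "\<And>i. i \<in> {1..d} \<Longrightarrow> f i [^]\<^bsub>H\<^esub> k = \<one>\<^bsub>H\<^esub>"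
  shows "\<exists>h \<in> hom (\<Gamma> d k) H. \<forall>i\<in>{1..d}. h (gen d k i) = f i"
proof -
  interpret H: group H by fact
  define p where "p u = foldr (\<lambda>i x. f i \<otimes>\<^bsub>H\<^esub> x) u \<one>\<^bsub>H\<^esub>" for u
  have p_in: "p u \<in> carrier H" if "set u \<subseteq> {1..d}" for u
    using that by (induction u) (auto simp: p_def assms)
  have p_app: "p (u @ v) = p u \<otimes>\<^bsub>H\<^esub> p v" if "set u \<subseteq> {1..d}" "set v \<subseteq> {1..d}" for u v
    using that
  proof (induction u)
    case Nil then show ?case using p_in[of v] by (simp add: p_def)
  next
    case (Cons i u)
    then have "p (i # (u @ v)) = f i \<otimes>\<^bsub>H\<^esub> (p u \<otimes>\<^bsub>H\<^esub> p v)" by (simp add: p_def)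
    also have "\<dots> = p (i # u) \<otimes>\<^bsub>H\<^esub> p v"
      using Cons.prems assms(3) p_in[of u] p_in[of v] by (simp add: p_def H.m_assoc)
    finally show ?case by simp
  qed
  have p_rep: "p (replicate n i) = f i [^]\<^bsub>H\<^esub> n" if "i \<in> {1..d}" for n i
  proof (induction n)
    case (Suc n)
    then have "p (replicate (Suc n) i) = f i \<otimes>\<^bsub>H\<^esub> f i [^]\<^bsub>H\<^esub> n" by (simp add: p_def)
    also have "\<dots> = f i [^]\<^bsub>H\<^esub> Suc n" by (rule H.nat_pow_Suc2[symmetric]) (rule assms(3)[OF that])
    finally show ?case .
  qed (simp add: p_def)
  have p_eq: "p u = p v" if "word_eq d k u v" for u v
    using that
  proof (induction rule: word_eq.induct)
    case (relator u v i)
    then show ?case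
      using p_app[of u v] p_app[of u "replicate k i @ v"] p_app[of "replicate k i" v]
        p_rep[of i k] assms(4)[of i] p_in[of v] assms(2) by simp
  qed auto
  define h where "h A = p (SOME u. u \<in> A)" for A
  have h: "h (word_class d k u) = p u" if "set u \<subseteq> {1..d}" for u
  proof -
    have "word_eq d k u (SOME v. v \<in> word_class d k u)"
      unfolding word_class_def mem_Collect_eq by (rule someI) (rule word_eq.refl[OF that])
    then show ?thesis unfolding h_def using p_eq by metis
  qed
  have "h \<in> hom (\<Gamma> d k) H"
    by (rule homI) (auto simp: carrier_\<Gamma> h p_in p_app mult_\<Gamma>)
  moreover have "h (gen d k i) = f i" if "i \<in> {1..d}" for i
    using that assms(3) by (simp add: gen_def h) (simp add: p_def)
  ultimately show ?thesis by blast
qed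

subsection \<open>Word metric\<close>

definition gens :: "nat \<Rightarrow> nat \<Rightarrow> nat list set set" where
  "gens d k = {gen d k i [^]\<^bsub>\<Gamma> d k\<^esub> j | i j. i \<in> {1..d} \<and> j \<in> {1..k - 1}}"

definition word_length :: "('g, 'b) monoid_scheme \<Rightarrow> 'g set \<Rightarrow> 'g \<Rightarrow> nat" where
  "word_length G T g =
     (LEAST m. \<exists>ws. length ws = m \<and> set ws \<subseteq> T \<and> g = foldr (\<lambda>x y. x \<otimes>\<^bsub>G\<^esub> y) ws \<one>\<^bsub>G\<^esub>)"

definition word_ball :: "('g, 'b) monoid_scheme \<Rightarrow> 'g set \<Rightarrow> real \<Rightarrow> 'g set" where
  "word_ball G T r = {g \<in> carrier G. real (word_length G T g) \<le> r}"

section \<open>Measures on configuration spaces\<close>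

text \<open>Elements of \<open>A\<^sup>I\<close> are the extensional functions on \<open>I\<close>, the alphabet \<open>A\<close> being all of a finite
  type.  For countable \<open>I\<close> the product sigma-algebra is the Borel sigma-algebra of the product
  topology.\<close>

definition config :: "'i set \<Rightarrow> ('i \<Rightarrow> 'a::finite) measure" where
  "config I = (\<Pi>\<^sub>M i\<in>I. count_space UNIV)"

definition Prob :: "'i set \<Rightarrow> ('i \<Rightarrow> 'a::finite) measure set" where
  "Prob I = {\<mu>. prob_space \<mu> \<and> sets \<mu> = sets (config I)}"

definition weak_star :: "'i set \<Rightarrow> ('i \<Rightarrow> 'a::finite) measure topology" where
  "weak_star I = topology_generated_by
     {{\<nu> \<in> Prob I. (\<integral>x. f x \<partial>\<nu>) \<in> U} | f U.
       continuous_map (product_topology (\<lambda>_. discrete_topology UNIV) I) euclideanreal f \<and> open U}"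

definition marginal :: "'i set \<Rightarrow> ('i \<Rightarrow> 'a::finite) measure \<Rightarrow> ('i \<Rightarrow> 'a) measure" where
  "marginal F \<mu> = distr \<mu> (config F) (\<lambda>x. restrict x F)"

text \<open>Only used for measures on a finite set all of whose subsets are measurable, such as the
  marginals to finitely many coordinates.\<close>

definition shannon :: "'x measure \<Rightarrow> real" where
  "shannon \<nu> = prob_space.entropy \<nu> (exp 1) (count_space (space \<nu>)) (\<lambda>x. x)"

lemma shannon_eq:
  assumes "prob_space \<nu>" "sets \<nu> = Pow (space \<nu>)" "finite (space \<nu>)"
  shows "shannon \<nu> = - (\<Sum>x\<in>space \<nu>. measure \<nu> {x} * ln (measure \<nu> {x}))"
proof -
  interpret information_space \<nu> "exp 1"
    using assms(1) by (simp add: information_space_def information_space_axioms_def)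
  have "simple_distributed \<nu> (\<lambda>x. x) (\<lambda>x. measure \<nu> ((\<lambda>x. x) -` {x} \<inter> space \<nu>))"
    using assms by (intro simple_distributedI) (auto simp: simple_function_def)
  from entropy_simple_distributed[OF this] have "shannon \<nu> =
      - (\<Sum>x\<in>space \<nu>. measure \<nu> ({x} \<inter> space \<nu>) * ln (measure \<nu> ({x} \<inter> space \<nu>)))"
    by (simp add: shannon_def log_def)
  also have "\<dots> = - (\<Sum>x\<in>space \<nu>. measure \<nu> {x} * ln (measure \<nu> {x}))"
  proof -
    have "{x} \<inter> space \<nu> = {x}" if "x \<in> space \<nu>" for x
      using that by blast
    then show ?thesis by (metis (mono_tags, lifting) sum.cong)
  qed
  finally show ?thesis .
qed

definition shift :: "('g, 'b) monoid_scheme \<Rightarrow> 'g \<Rightarrow> ('g \<Rightarrow> 'a) \<Rightarrow> 'g \<Rightarrow> 'a" where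
  "shift G g x = (\<lambda>h\<in>carrier G. x (inv\<^bsub>G\<^esub> g \<otimes>\<^bsub>G\<^esub> h))"

definition shift_invariant :: "('g, 'b) monoid_scheme \<Rightarrow> ('g \<Rightarrow> 'a::finite) measure \<Rightarrow> bool" where
  "shift_invariant G \<mu> \<longleftrightarrow>
     \<mu> \<in> Prob (carrier G) \<and> (\<forall>g\<in>carrier G. distr \<mu> (config (carrier G)) (shift G g) = \<mu>)"

section \<open>Microstates\<close>

definition pullback_name ::
  "('g, 'b) monoid_scheme \<Rightarrow> ('g \<Rightarrow> 'v \<Rightarrow> 'v) \<Rightarrow> 'v \<Rightarrow> ('v \<Rightarrow> 'a) \<Rightarrow> 'g \<Rightarrow> 'a" where
  "pullback_name G \<sigma> v x = (\<lambda>g\<in>carrier G. x (\<sigma> (inv\<^bsub>G\<^esub> g) v))"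

text \<open>The push-forward of the uniform distribution on \<open>V\<close> is the average of the point masses
  at the pullback names.\<close>

definition empirical ::
  "('g, 'b) monoid_scheme \<Rightarrow> 'v set \<Rightarrow> ('g \<Rightarrow> 'v \<Rightarrow> 'v) \<Rightarrow> ('v \<Rightarrow> 'a::finite) \<Rightarrow> ('g \<Rightarrow> 'a) measure"
where
  "empirical G V \<sigma> x =
     distr (uniform_count_measure V) (config (carrier G)) (\<lambda>v. pullback_name G \<sigma> v x)"

definition microstates ::
  "('g, 'b) monoid_scheme \<Rightarrow> 'v set \<Rightarrow> ('g \<Rightarrow> 'v \<Rightarrow> 'v) \<Rightarrow> ('g \<Rightarrow> 'a::finite) measure set
    \<Rightarrow> ('v \<Rightarrow> 'a) set" where
  "microstates G V \<sigma> W = {x \<in> V \<rightarrow>\<^sub>E UNIV. empirical G V \<sigma> x \<in> W}"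

definition hamming :: "'v set \<Rightarrow> ('v \<Rightarrow> 'a) \<Rightarrow> ('v \<Rightarrow> 'a) \<Rightarrow> real" where
  "hamming V x y = card {v \<in> V. x v \<noteq> y v} / card V"

text \<open>In the following notions \<open>V\<close>, \<open>\<sigma>\<close> and \<open>\<mu>\<close> are sequences: \<open>\<sigma> m\<close> maps the group to permutations of
  the finite set \<open>V m\<close>, and \<open>\<mu> m\<close> is a probability measure on configurations over \<open>V m\<close>.\<close>

definition property_M ::
  "('g, 'b) monoid_scheme \<Rightarrow> 'g set \<Rightarrow> (nat \<Rightarrow> 'v set) \<Rightarrow> (nat \<Rightarrow> 'g \<Rightarrow> 'v \<Rightarrow> 'v)
    \<Rightarrow> (nat \<Rightarrow> ('v \<Rightarrow> 'a::finite) measure) \<Rightarrow> ('g \<Rightarrow> 'a) measure \<Rightarrow> bool" where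
  "property_M G T V \<sigma> \<mu> \<nu> \<longleftrightarrow> shift_invariant G \<nu> \<and>
     (\<forall>\<epsilon>>0. \<forall>r>0. \<exists>S :: nat \<Rightarrow> 'v set.
        (\<forall>m. S m \<subseteq> V m) \<and>
        liminf (\<lambda>m. ereal (card (S m) / card (V m))) > 0 \<and>
        (\<forall>m. shannon (marginal {\<sigma> m f s | f s. f \<in> word_ball G T r \<and> s \<in> S m} (\<mu> m))
           \<ge> card (S m) * (shannon (marginal (word_ball G T r) \<nu>) - \<epsilon>)))"

definition converges_locally_empirically ::
  "('g, 'b) monoid_scheme \<Rightarrow> (nat \<Rightarrow> 'v set) \<Rightarrow> (nat \<Rightarrow> 'g \<Rightarrow> 'v \<Rightarrow> 'v)
    \<Rightarrow> (nat \<Rightarrow> ('v \<Rightarrow> 'a::finite) measure) \<Rightarrow> ('g \<Rightarrow> 'a) measure \<Rightarrow> bool" where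
  "converges_locally_empirically G V \<sigma> \<mu> \<nu> \<longleftrightarrow>
     (\<forall>W. openin (weak_star (carrier G)) W \<and> \<nu> \<in> W \<longrightarrow>
        (\<lambda>m. card {v \<in> V m.
            distr (\<mu> m) (config (carrier G)) (pullback_name G (\<sigma> m) v) \<in> W} / card (V m))
          \<longlonglongrightarrow> 1 \<and>
        (\<lambda>m. measure (\<mu> m) {x \<in> space (\<mu> m). empirical G (V m) (\<sigma> m) x \<in> W}) \<longlonglongrightarrow> 1)"

definition has_microstates ::
  "('g, 'b) monoid_scheme \<Rightarrow> (nat \<Rightarrow> 'v set) \<Rightarrow> (nat \<Rightarrow> 'g \<Rightarrow> 'v \<Rightarrow> 'v)
    \<Rightarrow> ('g \<Rightarrow> 'a::finite) measure \<Rightarrow> bool" where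
  "has_microstates G V \<sigma> \<nu> \<longleftrightarrow>
     (\<forall>W. openin (weak_star (carrier G)) W \<and> \<nu> \<in> W \<longrightarrow>
        (\<forall>\<^sub>F m in sequentially. microstates G (V m) (\<sigma> m) W \<noteq> {}))"

definition totally_shattered ::
  "('g, 'b) monoid_scheme \<Rightarrow> (nat \<Rightarrow> 'v set) \<Rightarrow> (nat \<Rightarrow> 'g \<Rightarrow> 'v \<Rightarrow> 'v)
    \<Rightarrow> ('g \<Rightarrow> 'a::finite) measure \<Rightarrow> bool" where
  "totally_shattered G V \<sigma> \<nu> \<longleftrightarrow> shift_invariant G \<nu> \<and> has_microstates G V \<sigma> \<nu> \<and>
     (\<exists>\<delta>>0. \<forall>\<epsilon>>0. \<exists>W m0. openin (weak_star (carrier G)) W \<and> \<nu> \<in> W \<and>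
        (\<forall>m\<ge>m0. \<forall>x \<in> microstates G (V m) (\<sigma> m) W. \<forall>y \<in> microstates G (V m) (\<sigma> m) W.
           hamming (V m) x y \<ge> \<delta> \<or> hamming (V m) x y < \<epsilon>))"

section \<open>The parity-check system, random homomorphisms and codes\<close>

definition X_sys :: "nat \<Rightarrow> nat \<Rightarrow> (nat list set \<Rightarrow> bit) set" where
  "X_sys d k = {x \<in> carrier (\<Gamma> d k) \<rightarrow>\<^sub>E UNIV. \<forall>g\<in>carrier (\<Gamma> d k). \<forall>i\<in>{1..d}.
     (\<Sum>j<k. x (g \<otimes>\<^bsub>\<Gamma> d k\<^esub> (gen d k i [^]\<^bsub>\<Gamma> d k\<^esub> j))) = 0}"

text \<open>A Haar probability measure of a compact subgroup \<open>X\<close> of \<open>\<int>\<^sub>2\<^sup>I\<close>, with \<open>I\<close> countable: a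
  translation-invariant probability measure on the Borel subsets of \<open>X\<close>.\<close>

definition is_haar_prob :: "'i set \<Rightarrow> ('i \<Rightarrow> bit) set \<Rightarrow> ('i \<Rightarrow> bit) measure \<Rightarrow> bool" where
  "is_haar_prob I X \<mu> \<longleftrightarrow> prob_space \<mu> \<and> sets \<mu> = sets (restrict_space (config I) X) \<and>
     (\<forall>x\<in>X. distr \<mu> \<mu> (\<lambda>y. \<lambda>i\<in>I. x i + y i) = \<mu>)"

definition m_X :: "nat \<Rightarrow> nat \<Rightarrow> (nat list set \<Rightarrow> bit) measure" where
  "m_X d k = distr (THE \<mu>. is_haar_prob (carrier (\<Gamma> d k)) (X_sys d k) \<mu>)
     (config (carrier (\<Gamma> d k))) (\<lambda>x. x)"

text \<open>Homomorphisms are taken extensional outside the carrier, so that there are only finitely many.\<close>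

definition Hom_unif :: "nat \<Rightarrow> nat \<Rightarrow> nat \<Rightarrow> (nat list set \<Rightarrow> nat \<Rightarrow> nat) set" where
  "Hom_unif d k n = {\<sigma> \<in> hom (\<Gamma> d k) (sym_group n) \<inter> extensional (carrier (\<Gamma> d k)).
     \<forall>i\<in>{1..d}. \<forall>v\<in>{1..n}. card (orbit (\<sigma> (gen d k i)) v) = k}"

definition X_code :: "nat \<Rightarrow> nat \<Rightarrow> nat \<Rightarrow> (nat list set \<Rightarrow> nat \<Rightarrow> nat) \<Rightarrow> (nat \<Rightarrow> bit) set" where
  "X_code d k n \<sigma> = {x \<in> {1..n} \<rightarrow>\<^sub>E UNIV.
     \<forall>v\<in>{1..n}. \<forall>i\<in>{1..d}. (\<Sum>j<k. x ((\<sigma> (gen d k i) ^^ j) v)) = 0}"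

definition code_measure ::
  "nat \<Rightarrow> nat \<Rightarrow> nat \<Rightarrow> (nat list set \<Rightarrow> nat \<Rightarrow> nat) \<Rightarrow> (nat \<Rightarrow> bit) measure" where
  "code_measure d k n \<sigma> = uniform_measure (count_space ({1..n} \<rightarrow>\<^sub>E UNIV)) (X_code d k n \<sigma>)"

end

theory Submission
  imports Defs "HOL-Real_Asymp.Real_Asymp"
begin

text \<open>
  Both \<open>m_X\<close> and the uniform measure on the code of \<open>\<sigma>\<close> are determined by their characters: the
  integral of \<open>\<chi>\<^sub>u\<close> is 1 if \<open>u\<close> is a sum mod 2 of checks (the cosets of \<open>\<langle>s\<^sub>i\<rangle>\<close>, respectively the
  cycles of \<open>\<sigma>\<^sub>i\<close>) and 0 otherwise. So everything reduces to comparing two dual codes.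

  A fixed set of \<open>k m\<close> points is invariant under a uniform permutation with cycles of length \<open>k\<close> on
  \<open>k M\<close> points with probability \<open>binom M m / binom (k M) (k m)\<close>, where
  \<open>(binom M m) ^ k \<le> binom (k M) (k m)\<close>. As \<open>k > d\<close>, a first moment bound shows that for a typical
  \<open>\<sigma>\<close> a sum of few checks has weight at least linear in the number of checks used; hence a dual word
  supported on neighbourhoods of well-separated points splits into connected pieces that never leave
  slightly larger neighbourhoods. Typically \<open>\<sigma>\<close> has few short cycles, so most of these
  neighbourhoods are isomorphic to balls of \<open>\<Gamma>\<close>, on which the two dual codes agree. This gives the
  convergence (by a second moment bound) and property M.

  As \<open>d \<ge> 3\<close>, a first moment bound over sets \<open>B\<close> with at most \<open>\<delta> n\<close> points shows that for some \<open>i\<close>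
  a positive proportion of \<open>card B\<close> many cycles of \<open>\<sigma>\<^sub>i\<close> meet \<open>B\<close> oddly. For \<open>B\<close> the set where two
  good microstates differ only few such cycles exist, so \<open>B\<close> is either tiny or has more than \<open>\<delta> n\<close>
  points: the microstate spaces are shattered.
\<close>

section \<open>Sums of sets modulo two and their characters\<close>

text \<open>Both thresholds on the parameters come from union bounds. A sum of checks is a choice,
  for each of the d colours, of an invariant set. Prescribing the sum leaves d - 1 of these sets
  free, and their number cancels all denominators but that of the largest set; what is left is at
  most the power d - k of binom(M, L). In the sparse bound, a set of b points with at most b / 9 odd
  cycles of each colour lies in 5 b / 9 cycles of each colour. With x = b / M this has probability
  about x to the 4 b / 9 per colour, against about x to the - b sets: three colours win (12 / 9 >
  1), two would not.

  The obstacle in the dual code is that all cycles of one colour sum to the all-ones vector, so a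
  light word may be written with very many checks. Hence expansion is stated for invariant sets of
  at most half the points and bounds the weight from both sides.

  No distribution of a random permutation is computed. The uniform distribution on
  \<open>kperms\<close> is invariant under conjugation, so the probability of an event about one set
  or list is at most the proportion of sets or lists for which a single permutation can satisfy
  it.\<close>

definition osum :: "'q set \<Rightarrow> ('q \<Rightarrow> 'i set) \<Rightarrow> 'i set" where
  "osum Q s = {v. odd (card {q \<in> Q. v \<in> s q})}"

text \<open>The linear span over the field with two elements, addition being symmetric difference.
  The inductive form keeps sums finite even for an infinite family such as the cosets in the
  group.\<close>

inductive_set bspan :: "'i set set \<Rightarrow> 'i set set" for \<K> where
  empty: "{} \<in> bspan \<K>"
| step: "c \<in> \<K> \<Longrightarrow> u \<in> bspan \<K> \<Longrightarrow> sym_diff c u \<in> bspan \<K>"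

lemma bspan_sym_diff: "u \<in> bspan \<K> \<Longrightarrow> w \<in> bspan \<K> \<Longrightarrow> sym_diff u w \<in> bspan \<K>"
proof (induction rule: bspan.induct)
  case (step c u)
  have "sym_diff (sym_diff c u) w = sym_diff c (sym_diff u w)" by auto
  then show ?case using step bspan.step by metis
qed auto

lemma bspan_base: "c \<in> \<K> \<Longrightarrow> c \<in> bspan \<K>"
  using bspan.step[OF _ bspan.empty] by fastforce

lemma bspan_sub:
  assumes "u \<in> bspan \<K>" "\<And>c. c \<in> \<K> \<Longrightarrow> finite c \<and> c \<subseteq> I"
  shows "finite u \<and> u \<subseteq> I"
  using assms(1) by induction (use assms(2) in auto)

lemma osum_empty [simp]: "osum {} s = {}"
  by (simp add: osum_def)

lemma osum_insert:
  assumes "finite Q" "q \<notin> Q"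
  shows "osum (insert q Q) s = sym_diff (s q) (osum Q s)"
proof -
  have "{p \<in> insert q Q. v \<in> s p} = (if v \<in> s q then insert q {p \<in> Q. v \<in> s p} else {p \<in> Q. v \<in> s p})" for v
    by auto
  then show ?thesis using assms by (auto simp: osum_def)
qed

lemma osum_in_bspan:
  assumes "finite Q" "\<And>q. q \<in> Q \<Longrightarrow> s q \<in> bspan \<K>"
  shows "osum Q s \<in> bspan \<K>"
  using assms by (induction Q) (auto simp: osum_insert intro: bspan.empty bspan_sym_diff)

lemma osum_subset: "osum Q s \<subseteq> \<Union> (s ` Q)"
proof
  fix v assume "v \<in> osum Q s"
  then have "{q \<in> Q. v \<in> s q} \<noteq> {}" by (auto simp: osum_def simp del: Collect_empty_eq)
  then show "v \<in> \<Union> (s ` Q)" by auto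
qed

lemma finite_osum:
  assumes "finite Q" "\<And>q. q \<in> Q \<Longrightarrow> finite (s q)"
  shows "finite (osum Q s)"
  using assms by (intro finite_subset[OF osum_subset]) auto

lemma osum_sym_diff:
  assumes "finite Q"
  shows "osum Q (\<lambda>q. sym_diff (s q) (t q)) = sym_diff (osum Q s) (osum Q t)"
  using assms by (induction Q) (auto simp: osum_insert)

lemma osum_singleton: "finite u \<Longrightarrow> osum u (\<lambda>i. {i}) = u"
  by (induction u rule: finite_induct) (auto simp: osum_insert)

lemma osum_Un_disjoint:
  assumes "finite P" "finite Q" "P \<inter> Q = {}"
  shows "osum (P \<union> Q) s = sym_diff (osum P s) (osum Q s)"
  using assms(1,3) by (induction P) (use assms(2) in \<open>auto simp: osum_insert\<close>)

text \<open>A generator used twice cancels, so every element of the span is the sum of a set of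
  distinct indices. The indices are labelled sets, so that equal sets with different labels remain
  different generators.\<close>

lemma bspan_osum:
  assumes "u \<in> bspan (snd ` K)"
  obtains Q where "Q \<subseteq> K" "finite Q" "u = osum Q snd"
proof -
  from assms have "\<exists>Q. Q \<subseteq> K \<and> finite Q \<and> u = osum Q snd"
  proof induction
    case empty
    show ?case by (intro exI[of _ "{}"]) simp
  next
    case (step c u)
    then obtain q Q where Q: "Q \<subseteq> K" "finite Q" "u = osum Q snd" "q \<in> K" "c = snd q" by auto
    show ?case
    proof (cases "q \<in> Q")
      case True
      then have "u = sym_diff c (osum (Q - {q}) snd)"
        using Q osum_insert[of "Q - {q}" q snd] by (simp add: insert_absorb)
      then have "sym_diff c u = osum (Q - {q}) snd" by auto
      then show ?thesis using Q by (intro exI[of _ "Q - {q}"]) auto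
    next
      case False
      then show ?thesis using Q by (intro exI[of _ "insert q Q"]) (auto simp: osum_insert)
    qed
  qed
  then show ?thesis using that by blast
qed

lemma sum_sym_diff_bit:
  fixes x :: "'i \<Rightarrow> bit"
  assumes "finite A" "finite B"
  shows "sum x (sym_diff A B) = sum x A + sum x B"
proof -
  have "sum x A = sum x (A - B) + sum x (A \<inter> B)"
    by (subst sum.union_disjoint[symmetric]) (auto simp: assms intro!: sum.cong)
  moreover have "sum x B = sum x (B - A) + sum x (A \<inter> B)"
    by (subst sum.union_disjoint[symmetric]) (auto simp: assms intro!: sum.cong)
  moreover have "sum x (sym_diff A B) = sum x (A - B) + sum x (B - A)"
    by (rule sum.union_disjoint) (auto simp: assms)
  moreover have "p + r + (q + r) = p + q" for p q r :: bit
    by (cases p; cases q; cases r) auto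
  ultimately show ?thesis by metis
qed

lemma sum_osum_bit:
  fixes x :: "'i \<Rightarrow> bit"
  assumes "finite Q" "\<And>q. q \<in> Q \<Longrightarrow> finite (s q)"
  shows "sum x (osum Q s) = (\<Sum>q\<in>Q. sum x (s q))"
  using assms
proof (induction Q)
  case (insert q Q)
  then show ?case
    using sum_sym_diff_bit[of "s q" "osum Q s" x] finite_osum[of Q s] by (simp add: osum_insert)
qed simp

text \<open>A binary linear code given by its parity checks. \<open>X_sys\<close> and
  \<open>X_code\<close> are both brought to this form, so that one duality theory serves the
  infinite and the finite code.\<close>

definition annihilator :: "'i set \<Rightarrow> 'i set set \<Rightarrow> ('i \<Rightarrow> bit) set" where
  "annihilator I \<K> = {x \<in> I \<rightarrow>\<^sub>E UNIV. \<forall>u\<in>\<K>. sum x u = 0}"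

lemma annihilator_bspan:
  assumes "x \<in> annihilator I \<K>" "u \<in> bspan \<K>" "\<And>c. c \<in> \<K> \<Longrightarrow> finite c"
  shows "sum x u = 0"
  using assms(2)
proof induction
  case (step c u)
  have "finite u" using bspan_sub[OF step.hyps(2), of UNIV] assms(3) by auto
  then show ?case using sum_sym_diff_bit[of c u x] step assms by (auto simp: annihilator_def)
qed simp

text \<open>Gaussian elimination on countably many coordinates. A coordinate is a pivot if it is the
  largest one, in a fixed enumeration of \<open>I\<close>, of some element of the span;
  \<open>F\<close> consists of the others. Eliminating a pivot only introduces smaller coordinates,
  so the reduction ends, and a nonempty element of the span cannot lie in \<open>F\<close> because
  its largest coordinate is a pivot.\<close>

lemma free_coordinates:
  fixes I :: "'i set"
  assumes "countable I" "\<And>c. c \<in> \<K> \<Longrightarrow> finite c \<and> c \<subseteq> I"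
  obtains F r where "F \<subseteq> I" "\<And>i. i \<in> I \<Longrightarrow> finite (r i) \<and> r i \<subseteq> F \<and> sym_diff {i} (r i) \<in> bspan \<K>"
    "\<And>u. u \<subseteq> F \<Longrightarrow> u \<in> bspan \<K> \<Longrightarrow> u = {}"
proof -
  define e where "e = to_nat_on I"
  have inj: "inj_on e I" unfolding e_def by (rule inj_on_to_nat_on[OF assms(1)])
  define pivot where "pivot u i \<longleftrightarrow> u \<in> bspan \<K> \<and> i \<in> u \<and> (\<forall>j\<in>u. e j \<le> e i)" for u i
  define F where "F = {i\<in>I. \<nexists>u. pivot u i}"
  have red: "\<exists>w\<subseteq>F. finite w \<and> sym_diff u w \<in> bspan \<K>" if "finite u" "u \<subseteq> I" "\<forall>i\<in>u. e i < n" for u n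
    using that
  proof (induction n arbitrary: u)
    case 0
    then show ?case by (intro exI[of _ "{}"]) (auto intro: bspan.empty)
  next
    case (Suc n)
    define u' where "u' = {i\<in>u. e i < n}"
    have u': "finite u'" "u' \<subseteq> I" "\<forall>i\<in>u'. e i < n"
      using Suc.prems(1,2) by (auto simp: u'_def)
    obtain w where w: "w \<subseteq> F" "finite w" "sym_diff u' w \<in> bspan \<K>"
      using Suc.IH[OF u'] by metis
    show ?case
    proof (cases "\<exists>i\<in>u. e i = n")
      case False
      then have "u' = u" using Suc.prems(3) by (auto simp: u'_def less_Suc_eq)
      then show ?thesis using w by auto
    next
      case True
      then obtain i where i: "i \<in> u" "e i = n" by auto
      have u: "u = insert i u'" "i \<notin> u'"
      proof -
        show "i \<notin> u'" using i by (simp add: u'_def)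
        show "u = insert i u'"
        proof
          show "u \<subseteq> insert i u'"
          proof
            fix j assume j: "j \<in> u"
            then have "e j < n \<or> e j = e i" using Suc.prems(3) i by (auto simp: less_Suc_eq)
            moreover have "e j = e i \<Longrightarrow> j = i"
              using inj_onD[OF inj, of j i] j i Suc.prems(2) by blast
            ultimately show "j \<in> insert i u'" using j by (auto simp: u'_def)
          qed
        qed (use i in \<open>auto simp: u'_def\<close>)
      qed
      show ?thesis
      proof (cases "i \<in> F")
        case iF: True
        have "sym_diff u (sym_diff {i} w) = sym_diff u' w" using u by auto
        then show ?thesis using w iF by (intro exI[of _ "sym_diff {i} w"]) auto
      next
        case iF: False
        then obtain p where p: "p \<in> bspan \<K>" "i \<in> p" "\<forall>j\<in>p. e j \<le> e i"
          using i Suc.prems by (auto simp: F_def pivot_def)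
        have ps: "finite p" "p \<subseteq> I" using bspan_sub[OF p(1) assms(2)] by auto
        have "\<forall>j\<in>sym_diff u p. e j < n"
        proof
          fix j assume j: "j \<in> sym_diff u p"
          then have "j \<noteq> i" using i p by auto
          moreover have "j \<in> I" using j Suc.prems ps by auto
          moreover have "i \<in> I" using i Suc.prems(2) by auto
          ultimately have "e j \<noteq> n" using i inj_onD[OF inj, of j i] by metis
          moreover have "e j \<le> n" using j Suc.prems(3) p i by (auto simp: less_Suc_eq_le)
          ultimately show "e j < n" by simp
        qed
        moreover have "finite (sym_diff u p)" "sym_diff u p \<subseteq> I" using Suc.prems ps by auto
        ultimately obtain w' where w': "w' \<subseteq> F" "finite w'" "sym_diff (sym_diff u p) w' \<in> bspan \<K>"
          using Suc.IH[of "sym_diff u p"] by metis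
        have "sym_diff u w' = sym_diff p (sym_diff (sym_diff u p) w')" by auto
        then have "sym_diff u w' \<in> bspan \<K>" using bspan_sym_diff[OF p(1) w'(3)] by simp
        then show ?thesis using w' by auto
      qed
    qed
  qed
  have "\<exists>w\<subseteq>F. finite w \<and> sym_diff {i} w \<in> bspan \<K>" if "i \<in> I" for i
    using red[of "{i}" "Suc (e i)"] that by auto
  then obtain r where r: "\<And>i. i \<in> I \<Longrightarrow> r i \<subseteq> F \<and> finite (r i) \<and> sym_diff {i} (r i) \<in> bspan \<K>"
    by metis
  have indep: "u = {}" if "u \<subseteq> F" "u \<in> bspan \<K>" for u
  proof (rule ccontr)
    assume ne: "u \<noteq> {}"
    have "finite u" using bspan_sub[OF that(2) assms(2)] by auto
    then have "finite (e ` u)" "e ` u \<noteq> {}" using ne by auto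
    from Max_in[OF this] obtain i where i: "i \<in> u" "e i = Max (e ` u)" by auto
    have "pivot u i" unfolding pivot_def using that i \<open>finite u\<close> by auto
    then show False using i that by (auto simp: F_def)
  qed
  show ?thesis by (rule that[of F r]) (use r indep in \<open>auto simp: F_def\<close>)
qed

text \<open>Take arbitrary bits and replace the bit at \<open>i\<close> by the sum over
  \<open>r i\<close>. The character of \<open>u\<close> then becomes that of
  \<open>osum u r\<close>, which is trivial exactly for \<open>u\<close> in the span. This one map
  serves both to separate words from the span and to push fair coins forward to Haar
  measure.\<close>

lemma annihilator_parametrisation:
  fixes I :: "'i set"
  assumes "countable I" and \<K>: "\<And>c. c \<in> \<K> \<Longrightarrow> finite c \<and> c \<subseteq> I"
  obtains r where "\<And>i. i \<in> I \<Longrightarrow> finite (r i) \<and> r i \<subseteq> I"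
    "\<And>y. (\<lambda>i\<in>I. sum y (r i)) \<in> annihilator I \<K>"
    "\<And>u. finite u \<Longrightarrow> u \<subseteq> I \<Longrightarrow> osum u r = {} \<longleftrightarrow> u \<in> bspan \<K>"
proof -
  obtain F r where F: "F \<subseteq> I" "\<And>i. i \<in> I \<Longrightarrow> finite (r i) \<and> r i \<subseteq> F \<and> sym_diff {i} (r i) \<in> bspan \<K>"
    "\<And>u. u \<subseteq> F \<Longrightarrow> u \<in> bspan \<K> \<Longrightarrow> u = {}"
    using free_coordinates[OF assms] by blast
  have eq: "osum u r = {} \<longleftrightarrow> u \<in> bspan \<K>" if u: "finite u" "u \<subseteq> I" for u
  proof -
    have 1: "sym_diff u (osum u r) \<in> bspan \<K>"
    proof -
      have "osum u (\<lambda>i. sym_diff {i} (r i)) \<in> bspan \<K>"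
        using u F by (intro osum_in_bspan) blast+
      then show ?thesis
        using u by (simp only: osum_sym_diff[of u "\<lambda>i. {i}" r] osum_singleton[of u])
    qed
    have 2: "osum u r \<subseteq> F" using osum_subset[of u r] F u by blast
    show ?thesis
    proof
      assume "osum u r = {}"
      then show "u \<in> bspan \<K>" using 1 by simp
    next
      assume "u \<in> bspan \<K>"
      from bspan_sym_diff[OF this 1] have "osum u r \<in> bspan \<K>"
        by (auto elim!: back_subst[of "\<lambda>A. A \<in> bspan \<K>"])
      then show "osum u r = {}" using F(3) 2 by auto
    qed
  qed
  show ?thesis
  proof (rule that[of r])
    fix y :: "'i \<Rightarrow> bit"
    have "sum (\<lambda>i\<in>I. sum y (r i)) u = 0" if "u \<in> \<K>" for u
    proof -
      have u: "finite u" "u \<subseteq> I" using \<K>[OF that] by auto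
      have "sum (\<lambda>i\<in>I. sum y (r i)) u = (\<Sum>i\<in>u. sum y (r i))" using u by (intro sum.cong) auto
      also have "\<dots> = sum y (osum u r)" by (rule sum_osum_bit[symmetric]) (use u F in auto)
      also have "\<dots> = 0" using eq[OF u] bspan_base[OF that] by simp
      finally show ?thesis .
    qed
    then show "(\<lambda>i\<in>I. sum y (r i)) \<in> annihilator I \<K>" by (auto simp: annihilator_def)
  qed (use F eq in auto)
qed

text \<open>Double annihilator: a single bit set at a point of the nonempty set
  \<open>osum u r\<close> yields an element of the code whose sum over \<open>u\<close> is
  1.\<close>

lemma annihilator_separates:
  fixes I :: "'i set"
  assumes "countable I" and "\<And>c. c \<in> \<K> \<Longrightarrow> finite c \<and> c \<subseteq> I"
    and u: "finite u" "u \<subseteq> I" "u \<notin> bspan \<K>"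
  obtains x where "x \<in> annihilator I \<K>" "sum x u = 1"
proof -
  obtain r where r: "\<And>i. i \<in> I \<Longrightarrow> finite (r i) \<and> r i \<subseteq> I"
    "\<And>y. (\<lambda>i\<in>I. sum y (r i)) \<in> annihilator I \<K>"
    "\<And>u. finite u \<Longrightarrow> u \<subseteq> I \<Longrightarrow> osum u r = {} \<longleftrightarrow> u \<in> bspan \<K>"
    using annihilator_parametrisation[OF assms(1,2)] by blast
  then obtain j where j: "j \<in> osum u r" using u by blast
  define y where "y = (\<lambda>i. if i = j then 1 else 0 :: bit)"
  have fin: "finite (osum u r)" using u r by (intro finite_osum) auto
  have "sum (\<lambda>i\<in>I. sum y (r i)) u = (\<Sum>i\<in>u. sum y (r i))" using u by (intro sum.cong) auto
  also have "\<dots> = sum y (osum u r)" by (rule sum_osum_bit[symmetric]) (use u r in auto)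
  also have "\<dots> = 1" using j fin by (simp add: y_def)
  finally show ?thesis using that r(2) by blast
qed

section \<open>Characters and Fourier expansion on binary configurations\<close>

definition chi :: "'i set \<Rightarrow> ('i \<Rightarrow> bit) \<Rightarrow> real" where
  "chi u x = (\<Prod>i\<in>u. if x i = 0 then 1 else - 1)"

lemma chi_eq: "finite u \<Longrightarrow> chi u x = (if sum x u = 0 then 1 else - 1)"
proof (induction u rule: finite_induct)
  case (insert i u)
  then show ?case by (cases "x i"; cases "sum x u") (auto simp: chi_def)
qed (simp add: chi_def)

lemma chi_empty [simp]: "chi {} x = 1"
  by (simp add: chi_def)

lemma abs_chi [simp]: "\<bar>chi u x\<bar> = 1"
  unfolding chi_def abs_prod by (rule prod.neutral) auto

lemma chi_cong: "(\<And>i. i \<in> u \<Longrightarrow> x i = y i) \<Longrightarrow> chi u x = chi u y"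
  by (simp add: chi_def)

lemma chi_add:
  assumes "u \<subseteq> I"
  shows "chi u (\<lambda>i\<in>I. x i + y i) = chi u x * chi u y"
proof -
  have sgn: "(if a + b = 0 then 1 else - 1 :: real)
      = (if a = 0 then 1 else - 1) * (if b = 0 then 1 else - 1)" for a b :: bit
    by (cases a; cases b) auto
  have "chi u (\<lambda>i\<in>I. x i + y i) = (\<Prod>i\<in>u. if x i + y i = 0 then 1 else - 1)"
    unfolding chi_def by (intro prod.cong) (use assms in auto)
  then show ?thesis unfolding chi_def sgn prod.distrib by simp
qed

lemma chi_sym_diff:
  assumes "finite u" "finite w"
  shows "chi (sym_diff u w) x = chi u x * chi w x"
proof -
  have fin: "finite (sym_diff u w)" using assms by simp
  show ?thesis unfolding chi_eq[OF fin] chi_eq[OF assms(1)] chi_eq[OF assms(2)]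
      sum_sym_diff_bit[OF assms]
    by (cases "sum x u"; cases "sum x w") auto
qed

text \<open>Expand the product over \<open>J\<close> of the factors
  \<open>s (y j) * s (x j) + 1\<close>, each of which is 2 when the two bits agree and 0
  otherwise.\<close>

lemma indicator_eq_sum_chi:
  assumes "finite J"
  shows "of_bool (\<forall>j\<in>J. x j = y j) = (\<Sum>u\<in>Pow J. chi u y * chi u x) / 2 ^ card J"
proof -
  define s where "s b = (if b = 0 then 1 else - 1 :: real)" for b :: bit
  have "(\<Sum>u\<in>Pow J. chi u y * chi u x) = (\<Sum>u\<in>Pow J. (\<Prod>j\<in>u. s (y j) * s (x j)) * (\<Prod>j\<in>J - u. 1))"
    by (simp add: chi_def s_def prod.distrib)
  also have "\<dots> = (\<Prod>j\<in>J. s (y j) * s (x j) + 1)"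
    by (rule prod_add[symmetric]) fact
  also have "\<dots> = (\<Prod>j\<in>J. 2 * of_bool (x j = y j))"
  proof (rule prod.cong)
    fix j
    show "s (y j) * s (x j) + 1 = 2 * of_bool (x j = y j)"
      by (cases "x j"; cases "y j") (auto simp: s_def)
  qed simp
  also have "\<dots> = 2 ^ card J * (\<Prod>j\<in>J. of_bool (x j = y j))"
    by (simp add: prod.distrib)
  also have "(\<Prod>j\<in>J. of_bool (x j = y j)) = (of_bool (\<forall>j\<in>J. x j = y j) :: real)"
    using assms by (induction J) auto
  finally show ?thesis by simp
qed

lemma local_eq_sum_chi:
  assumes "finite J"
  obtains c where "\<And>x :: 'i \<Rightarrow> bit. g (restrict x J) = (\<Sum>u\<in>Pow J. c u * chi u x :: real)"
proof -
  define E where "E = (J \<rightarrow>\<^sub>E (UNIV :: bit set))"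
  have finE: "finite E" unfolding E_def using assms by (intro finite_PiE) auto
  define c where "c u = (\<Sum>y\<in>E. g y * chi u y) / 2 ^ card J" for u
  have "g (restrict x J) = (\<Sum>u\<in>Pow J. c u * chi u x)" for x :: "'i \<Rightarrow> bit"
  proof -
    have x: "restrict x J \<in> E" by (auto simp: E_def)
    have "(\<forall>j\<in>J. x j = y j) \<longleftrightarrow> y = restrict x J" if "y \<in> E" for y
      using that by (auto simp: E_def PiE_def extensional_def restrict_def fun_eq_iff)
    then have "(\<Sum>y\<in>E. g y * of_bool (\<forall>j\<in>J. x j = y j)) = (\<Sum>y\<in>E. if y = restrict x J then g y else 0)"
      by (intro sum.cong) auto
    also have "\<dots> = g (restrict x J)" using x finE by simp
    finally have "g (restrict x J) = (\<Sum>y\<in>E. g y * of_bool (\<forall>j\<in>J. x j = y j))" ..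
    also have "\<dots> = (\<Sum>y\<in>E. \<Sum>u\<in>Pow J. g y * (chi u y * chi u x) / 2 ^ card J)"
      by (simp add: indicator_eq_sum_chi[OF assms] sum_distrib_left sum_divide_distrib)
    also have "\<dots> = (\<Sum>u\<in>Pow J. \<Sum>y\<in>E. g y * (chi u y * chi u x) / 2 ^ card J)"
      by (rule sum.swap)
    also have "\<dots> = (\<Sum>u\<in>Pow J. c u * chi u x)"
    proof (rule sum.cong)
      fix u
      show "(\<Sum>y\<in>E. g y * (chi u y * chi u x) / 2 ^ card J) = c u * chi u x"
        unfolding c_def sum_divide_distrib sum_distrib_right by (intro sum.cong) auto
    qed simp
    finally show ?thesis .
  qed
  then show ?thesis by (rule that)
qed

lemma space_config: "space (config I) = I \<rightarrow>\<^sub>E UNIV"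
  by (simp add: config_def space_PiM)

lemma measurable_config_component: "i \<in> I \<Longrightarrow> (\<lambda>x. x i) \<in> measurable (config I) (count_space UNIV)"
  unfolding config_def by (rule measurable_component_singleton)

lemma measurable_chi [measurable]:
  assumes "u \<subseteq> I"
  shows "chi u \<in> borel_measurable (config I)"
proof -
  have "(\<lambda>x. if x i = (0::bit) then 1 else - 1 :: real) \<in> borel_measurable (config I)" if "i \<in> u" for i
    by (rule measurable_compose[OF measurable_config_component[of i I]]) (use that assms in auto)
  then show ?thesis unfolding chi_def[abs_def] by (rule borel_measurable_prod)
qed

lemma Prob_measurable_iff: "\<mu> \<in> Prob I \<Longrightarrow> measurable \<mu> N = measurable (config I) N"
  by (intro measurable_cong_sets) (auto simp: Prob_def)

lemma Prob_space: "\<mu> \<in> Prob I \<Longrightarrow> space \<mu> = I \<rightarrow>\<^sub>E UNIV"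
  using sets_eq_imp_space_eq[of \<mu> "config I"] by (simp add: Prob_def space_config)

lemma integrable_chi:
  assumes "\<mu> \<in> Prob I" "u \<subseteq> I"
  shows "integrable \<mu> (chi u)"
proof -
  interpret prob_space \<mu> using assms by (simp add: Prob_def)
  show ?thesis
    by (rule integrable_const_bound[of _ 1])
      (use assms measurable_chi[of u I] in \<open>auto simp: Prob_measurable_iff\<close>)
qed

text \<open>Indicators of cylinders are finite combinations of characters, and cylinders determine a
  probability measure on the product sigma-algebra.\<close>

lemma Prob_eqI:
  assumes \<mu>: "\<mu> \<in> Prob I" and \<nu>: "\<nu> \<in> Prob I"
    and eq: "\<And>u. finite u \<Longrightarrow> u \<subseteq> I \<Longrightarrow> (\<integral>x. chi u x \<partial>\<mu>) = (\<integral>x. chi u x \<partial>\<nu>)"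
  shows "\<mu> = \<nu>"
proof (rule measure_eqI_PiM_infinite)
  show "sets \<mu> = sets (PiM I (\<lambda>_. count_space UNIV))" "sets \<nu> = sets (PiM I (\<lambda>_. count_space UNIV))"
    using assms by (auto simp: Prob_def config_def)
  interpret \<mu>: prob_space \<mu> using \<mu> by (simp add: Prob_def)
  interpret \<nu>: prob_space \<nu> using \<nu> by (simp add: Prob_def)
  show "finite_measure \<mu>" by (rule \<mu>.finite_measure_axioms)
  fix A :: "'a \<Rightarrow> bit set" and J assume J: "finite J" "J \<subseteq> I"
  let ?B = "prod_emb I (\<lambda>_. count_space UNIV) J (Pi\<^sub>E J A)"
  obtain c where c: "\<And>x :: 'a \<Rightarrow> bit. indicator (Pi\<^sub>E J A) (restrict x J) = (\<Sum>u\<in>Pow J. c u * chi u x :: real)"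
    using local_eq_sum_chi[OF J(1), where g = "indicator (Pi\<^sub>E J A)"] by metis
  have B: "?B \<in> sets (config I)"
    unfolding config_def using J by (intro sets_PiM_I) auto
  have *: "measure \<rho> ?B = (\<Sum>u\<in>Pow J. c u * (\<integral>x. chi u x \<partial>\<rho>))" if \<rho>: "\<rho> \<in> Prob I" for \<rho>
  proof -
    interpret \<rho>: prob_space \<rho> using \<rho> by (simp add: Prob_def)
    have B': "?B \<in> sets \<rho>" using B \<rho> by (simp add: Prob_def)
    have "measure \<rho> ?B = (\<integral>x. indicator ?B x \<partial>\<rho>)"
      using B' by (simp add: Int_absorb2[OF sets.sets_into_space])
    also have "\<dots> = (\<integral>x. (\<Sum>u\<in>Pow J. c u * chi u x) \<partial>\<rho>)"
      unfolding c[symmetric]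
      by (intro Bochner_Integration.integral_cong) (auto simp: Prob_space[OF \<rho>] prod_emb_def indicator_def)
    also have "\<dots> = (\<Sum>u\<in>Pow J. c u * (\<integral>x. chi u x \<partial>\<rho>))"
      by (subst Bochner_Integration.integral_sum) (use J integrable_chi[OF \<rho>] in auto)
    finally show ?thesis .
  qed
  have "measure \<mu> ?B = measure \<nu> ?B"
    unfolding *[OF \<mu>] *[OF \<nu>]
  proof (rule sum.cong)
    fix u assume "u \<in> Pow J"
    then have "finite u" "u \<subseteq> I" using J finite_subset by auto
    then show "c u * (\<integral>x. chi u x \<partial>\<mu>) = c u * (\<integral>x. chi u x \<partial>\<nu>)" by (simp add: eq)
  qed simp
  then show "emeasure \<mu> ?B = emeasure \<nu> ?B"
    by (simp add: \<mu>.emeasure_eq_measure \<nu>.emeasure_eq_measure)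
qed

text \<open>The Fourier transform of the measure is the indicator of \<open>D\<close>; for the
  uniform measure on a linear code this says that \<open>D\<close> is the dual code. Marginals,
  entropies and local statistics are all read off from this property.\<close>

definition has_dual :: "'i set \<Rightarrow> 'i set set \<Rightarrow> ('i \<Rightarrow> bit) measure \<Rightarrow> bool" where
  "has_dual I D \<mu> \<longleftrightarrow> \<mu> \<in> Prob I \<and>
     (\<forall>u. finite u \<longrightarrow> u \<subseteq> I \<longrightarrow> (\<integral>x. chi u x \<partial>\<mu>) = of_bool (u \<in> D))"

lemma has_dual_unique: "has_dual I D \<mu> \<Longrightarrow> has_dual I D \<nu> \<Longrightarrow> \<mu> = \<nu>"
  by (rule Prob_eqI[of _ I]) (auto simp: has_dual_def)

lemma translate_measurable:
  fixes x :: "'i \<Rightarrow> bit"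
  shows "(\<lambda>y. \<lambda>i\<in>I. x i + y i) \<in> measurable (config I) (config I)"
  unfolding config_def
  by (intro measurable_restrict measurable_compose[OF measurable_component_singleton]) auto

lemma space_restrict_annihilator: "space (restrict_space (config I) (annihilator I \<K>)) = annihilator I \<K>"
  by (auto simp: space_restrict_space space_config annihilator_def)

text \<open>Lets measures living on a subset of configuration space be compared after pushing them
  forward to the whole space, where characters are available.\<close>

lemma restrict_space_eqI:
  assumes "sets \<mu> = sets (restrict_space M X)" "sets \<nu> = sets (restrict_space M X)"
    and "distr \<mu> M (\<lambda>x. x) = distr \<nu> M (\<lambda>x. x)"
  shows "\<mu> = \<nu>"
proof (rule measure_eqI)
  have id: "(\<lambda>x. x) \<in> measurable \<rho> M" if "sets \<rho> = sets (restrict_space M X)" for \<rho>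
    using that measurable_cong_sets[of \<rho> "restrict_space M X" M M] measurable_restrict_space1[of "\<lambda>x. x" M M X]
    by auto
  fix A assume "A \<in> sets \<mu>"
  then obtain B where B: "B \<in> sets M" "A = X \<inter> B"
    using assms(1) by (auto simp: sets_restrict_space)
  have A: "A = B \<inter> space \<rho>" if "sets \<rho> = sets (restrict_space M X)" for \<rho>
    using sets_eq_imp_space_eq[OF that] B sets.sets_into_space[OF B(1)] by (auto simp: space_restrict_space)
  have "emeasure \<mu> A = emeasure (distr \<mu> M (\<lambda>x. x)) B"
    by (subst emeasure_distr[OF id[OF assms(1)] B(1)]) (simp add: A[OF assms(1)])
  also have "\<dots> = emeasure \<nu> A"
    unfolding assms(3) by (subst emeasure_distr[OF id[OF assms(2)] B(1)]) (simp add: A[OF assms(2)])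
  finally show "emeasure \<mu> A = emeasure \<nu> A" .
qed (use assms in simp)

text \<open>Orthogonality of characters: \<open>chi u\<close> is 1 on the code if \<open>u\<close>
  lies in the span. Otherwise translation by an element \<open>x\<close> of the code with
  \<open>chi u x = - 1\<close> preserves the measure and changes the sign of the integral.\<close>

lemma haar_has_dual:
  fixes \<K> :: "'i set set"
  assumes "countable I" and \<K>: "\<And>c. c \<in> \<K> \<Longrightarrow> finite c \<and> c \<subseteq> I"
    and \<mu>: "is_haar_prob I (annihilator I \<K>) \<mu>"
  shows "has_dual I (bspan \<K>) (distr \<mu> (config I) (\<lambda>x. x))"
proof -
  define X where "X = annihilator I \<K>"
  interpret prob_space \<mu> using \<mu> by (simp add: is_haar_prob_def)
  have sets: "sets \<mu> = sets (restrict_space (config I) X)" using \<mu> by (simp add: is_haar_prob_def X_def)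
  have sp: "space \<mu> = X"
    using sets_eq_imp_space_eq[OF sets] space_restrict_annihilator by (simp add: X_def)
  have id: "(\<lambda>x. x) \<in> measurable \<mu> (config I)"
    using measurable_cong_sets[OF sets HOL.refl] measurable_restrict_space1[of "\<lambda>x. x" "config I" "config I" X]
    by auto
  have "(\<integral>x. chi u x \<partial>distr \<mu> (config I) (\<lambda>x. x)) = of_bool (u \<in> bspan \<K>)"
    if u: "finite u" "u \<subseteq> I" for u
  proof -
    have chi: "chi u \<in> borel_measurable \<mu>" using measurable_compose[OF id measurable_chi[OF u(2)]] by simp
    have "(\<integral>x. chi u x \<partial>distr \<mu> (config I) (\<lambda>x. x)) = (\<integral>x. chi u x \<partial>\<mu>)"
      by (rule integral_distr[OF id measurable_chi[OF u(2)]])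
    also have "\<dots> = of_bool (u \<in> bspan \<K>)"
    proof (cases "u \<in> bspan \<K>")
      case True
      have "chi u x = 1" if "x \<in> space \<mu>" for x
        using annihilator_bspan[of x I \<K> u] that True \<K> u by (simp add: chi_eq sp X_def)
      then have "(\<integral>x. chi u x \<partial>\<mu>) = (\<integral>x. 1 \<partial>\<mu>)" by (intro Bochner_Integration.integral_cong) auto
      then show ?thesis using True by (simp add: prob_space)
    next
      case False
      obtain x where x: "x \<in> X" "sum x u = 1"
        using annihilator_separates[OF assms(1) \<K> u False] unfolding X_def by blast
      define T where "T = (\<lambda>y. \<lambda>i\<in>I. x i + y i)"
      have inv: "distr \<mu> \<mu> T = \<mu>" using \<mu> x(1) by (simp add: is_haar_prob_def X_def T_def)
      have T: "T \<in> measurable \<mu> \<mu>"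
      proof -
        have "T \<in> measurable (restrict_space (config I) X) (restrict_space (config I) X)"
        proof (rule measurable_restrict_space2)
          show "T \<in> measurable (restrict_space (config I) X) (config I)"
            unfolding T_def by (intro measurable_restrict_space1 translate_measurable)
          have "T y \<in> X" if "y \<in> X" for y
          proof -
            have "sum (T y) c = 0" if c: "c \<in> \<K>" for c
            proof -
              have "sum (T y) c = (\<Sum>i\<in>c. x i + y i)"
                using \<K>[OF c] by (intro sum.cong) (auto simp: T_def)
              also have "\<dots> = sum x c + sum y c" by (rule sum.distrib)
              finally show ?thesis using x \<open>y \<in> X\<close> c by (simp add: X_def annihilator_def)
            qed
            then show ?thesis by (auto simp: X_def annihilator_def T_def)
          qed
          then show "T \<in> space (restrict_space (config I) X) \<rightarrow> X"
            using space_restrict_annihilator[of I \<K>] by (auto simp: X_def)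
        qed
        then show ?thesis using measurable_cong_sets[OF sets sets] by simp
      qed
      have "(\<integral>y. chi u y \<partial>\<mu>) = (\<integral>y. chi u y \<partial>distr \<mu> \<mu> T)" by (simp add: inv)
      also have "\<dots> = (\<integral>y. chi u (T y) \<partial>\<mu>)" by (rule integral_distr[OF T chi])
      also have "\<dots> = (\<integral>y. - chi u y \<partial>\<mu>)"
        unfolding T_def chi_add[OF u(2)] by (simp add: chi_eq[OF u(1), of x] x(2))
      also have "\<dots> = - (\<integral>y. chi u y \<partial>\<mu>)" by simp
      finally show ?thesis using False by simp
    qed
    finally show ?thesis .
  qed
  moreover have "distr \<mu> (config I) (\<lambda>x. x) \<in> Prob I"
    using prob_space_distr[OF id] by (simp add: Prob_def)
  ultimately show ?thesis by (simp add: has_dual_def)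
qed

lemma measurable_sum_bit:
  assumes "finite A" "\<And>i. i \<in> A \<Longrightarrow> f i \<in> measurable M (count_space (UNIV :: bit set))"
  shows "(\<lambda>x. \<Sum>i\<in>A. f i x) \<in> measurable M (count_space UNIV)"
  using assms
proof (induction A)
  case (insert a A)
  have 1: "f a \<in> measurable M (count_space UNIV)"
    and 2: "(\<lambda>x. \<Sum>i\<in>A. f i x) \<in> measurable M (count_space UNIV)"
    using insert by auto
  have "(\<lambda>x. (if f a x = 0 then \<Sum>i\<in>A. f i x else 1 + (\<Sum>i\<in>A. f i x))) \<in> measurable M (count_space UNIV)"
    by (rule measurable_If[OF 2 measurable_compose[OF 2]])
      (use measurable_sets[OF 1, of "{0}"] in \<open>auto simp: vimage_def Int_def conj_commute\<close>)
  also have "(\<lambda>x. (if f a x = 0 then \<Sum>i\<in>A. f i x else 1 + (\<Sum>i\<in>A. f i x))) = (\<lambda>x. \<Sum>i\<in>insert a A. f i x)"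
    using insert by (auto simp: fun_eq_iff)
  finally show ?case .
qed simp

lemma integral_chi_coins:
  fixes I :: "'i set"
  assumes w: "finite w" "w \<subseteq> I"
  shows "(\<integral>y. chi w y \<partial>PiM I (\<lambda>_. uniform_count_measure (UNIV :: bit set))) = of_bool (w = {})"
proof -
  let ?M = "\<lambda>_::'i. uniform_count_measure (UNIV :: bit set)"
  have M: "prob_space (uniform_count_measure (UNIV :: bit set))"
    by (rule prob_space_uniform_count_measure) auto
  interpret product_prob_space ?M I
    using M by (simp add: product_prob_space_def product_prob_space_axioms_def product_sigma_finite_def
        prob_space_imp_sigma_finite)
  have chi: "chi w \<in> borel_measurable (PiM w ?M)"
  proof -
    have "sets (PiM w ?M) = sets (config w)"
      unfolding config_def by (intro sets_PiM_cong) (auto simp: sets_uniform_count_measure)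
    then show ?thesis using measurable_chi[of w w] measurable_cong_sets[of "PiM w ?M" "config w" borel borel] by blast
  qed
  have "(\<integral>y. chi w y \<partial>PiM I ?M) = (\<integral>y. chi w (restrict y w) \<partial>PiM I ?M)"
    by (intro Bochner_Integration.integral_cong chi_cong) auto
  also have "\<dots> = (\<integral>y. chi w y \<partial>distr (PiM I ?M) (PiM w ?M) (\<lambda>y. restrict y w))"
    by (rule integral_distr[symmetric, OF measurable_restrict_subset[OF w(2)] chi])
  also have "\<dots> = (\<integral>y. chi w y \<partial>PiM w ?M)"
    using distr_PiM_restrict_finite[OF w] by (simp add: restrict_def)
  also have "\<dots> = (\<Prod>i\<in>w. \<integral>b. (if b = 0 then 1 else - 1) \<partial>?M i)"
    unfolding chi_def
    by (rule product_integral_prod[OF w(1)])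
      (auto intro!: finite_measure.integrable_const_bound[of _ _ 1] prob_space.finite_measure[OF M])
  also have "(\<integral>b. (if b = 0 then 1 else - 1) \<partial>uniform_count_measure (UNIV :: bit set)) = (0 :: real)"
  proof -
    have U: "(UNIV :: bit set) = {0, 1}" by (auto intro: bit.exhaust)
    have "sum f UNIV = f 0 + f 1" for f :: "bit \<Rightarrow> real" unfolding U by simp
    then show ?thesis
      unfolding uniform_count_measure_def by (subst lebesgue_integral_point_measure_finite) auto
  qed
  finally show ?thesis using w(1) by (auto simp: prod_constant)
qed

text \<open>The push-forward of independent fair coins under the parametrisation is invariant:
  translation by \<open>x\<close> multiplies the integral of \<open>chi u\<close> by
  \<open>chi u x\<close>, which is 1 for \<open>u\<close> in the span, while for other
  \<open>u\<close> the integral vanishes.\<close>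

lemma haar_exists:
  fixes I :: "'i set"
  assumes I: "countable I" and \<K>: "\<And>c. c \<in> \<K> \<Longrightarrow> finite c \<and> c \<subseteq> I"
  obtains \<mu> where "is_haar_prob I (annihilator I \<K>) \<mu>"
proof -
  define X where "X = annihilator I \<K>"
  obtain r where r: "\<And>i. i \<in> I \<Longrightarrow> finite (r i) \<and> r i \<subseteq> I"
    "\<And>y. (\<lambda>i\<in>I. sum y (r i)) \<in> annihilator I \<K>"
    "\<And>u. finite u \<Longrightarrow> u \<subseteq> I \<Longrightarrow> osum u r = {} \<longleftrightarrow> u \<in> bspan \<K>"
    using annihilator_parametrisation[OF assms] by blast
  define \<Phi> where "\<Phi> y = (\<lambda>i\<in>I. sum y (r i))" for y :: "'i \<Rightarrow> bit"
  define M where "M = (\<lambda>_::'i. uniform_count_measure (UNIV :: bit set))"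
  define \<Lambda> where "\<Lambda> = PiM I M"
  define R where "R = restrict_space (config I) X"
  have setsL: "sets \<Lambda> = sets (config I)"
    unfolding \<Lambda>_def config_def M_def by (intro sets_PiM_cong) (auto simp: sets_uniform_count_measure)
  have psL: "prob_space \<Lambda>" unfolding \<Lambda>_def
    by (intro prob_space_PiM) (auto simp: M_def intro: prob_space_uniform_count_measure)
  have \<Phi>1: "\<Phi> \<in> measurable (config I) (config I)"
    unfolding \<Phi>_def config_def
    by (intro measurable_restrict measurable_sum_bit measurable_component_singleton) (use r in auto)
  have \<Phi>2: "\<Phi> \<in> measurable \<Lambda> R"
  proof -
    have "\<Phi> \<in> measurable (config I) R"
      unfolding R_def by (rule measurable_restrict_space2[OF _ \<Phi>1]) (use r in \<open>auto simp: \<Phi>_def X_def\<close>)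
    then show ?thesis using measurable_cong_sets[OF setsL HOL.refl] by metis
  qed
  have idR: "(\<lambda>x. x) \<in> measurable R (config I)"
    unfolding R_def by (rule measurable_restrict_space1) simp
  have \<Phi>3: "\<Phi> \<in> measurable \<Lambda> (config I)" using measurable_compose[OF \<Phi>2 idR] by simp
  define \<mu> where "\<mu> = distr \<Lambda> R \<Phi>"
  have chi\<Phi>: "(\<integral>y. chi u (\<Phi> y) \<partial>\<Lambda>) = of_bool (u \<in> bspan \<K>)" if u: "finite u" "u \<subseteq> I" for u
  proof -
    have fin: "finite (osum u r)" using u r by (intro finite_osum) auto
    have sub: "osum u r \<subseteq> I" using osum_subset[of u r] r u by blast
    have "chi u (\<Phi> y) = chi (osum u r) y" for y
    proof -
      have "sum (\<Phi> y) u = (\<Sum>i\<in>u. sum y (r i))" unfolding \<Phi>_def using u by (intro sum.cong) auto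
      also have "\<dots> = sum y (osum u r)" by (rule sum_osum_bit[symmetric]) (use u r in auto)
      finally show ?thesis using u fin by (simp add: chi_eq)
    qed
    then have "(\<integral>y. chi u (\<Phi> y) \<partial>\<Lambda>) = of_bool (osum u r = {})"
      using integral_chi_coins[OF fin sub] by (simp add: \<Lambda>_def M_def)
    then show ?thesis using r(3)[OF u] by simp
  qed
  have ps: "prob_space \<mu>" unfolding \<mu>_def by (rule prob_space.prob_space_distr[OF psL \<Phi>2])
  have sets: "sets \<mu> = sets (restrict_space (config I) X)" by (simp add: \<mu>_def R_def)
  have "distr \<mu> \<mu> (\<lambda>y. \<lambda>i\<in>I. x i + y i) = \<mu>" if x: "x \<in> X" for x
  proof -
    define T where "T = (\<lambda>y. \<lambda>i\<in>I. x i + y i)"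
    have T1: "T \<in> measurable R R" unfolding R_def
    proof (rule measurable_restrict_space2)
      show "T \<in> measurable (restrict_space (config I) X) (config I)"
        unfolding T_def by (intro measurable_restrict_space1 translate_measurable)
      have "T y \<in> X" if "y \<in> X" for y
      proof -
        have "sum (T y) c = 0" if c: "c \<in> \<K>" for c
        proof -
          have "sum (T y) c = (\<Sum>i\<in>c. x i + y i)"
            using \<K>[OF c] by (intro sum.cong) (auto simp: T_def)
          also have "\<dots> = sum x c + sum y c" by (rule sum.distrib)
          finally show ?thesis using x \<open>y \<in> X\<close> c by (simp add: X_def annihilator_def)
        qed
        then show ?thesis by (auto simp: X_def annihilator_def T_def)
      qed
      then show "T \<in> space (restrict_space (config I) X) \<rightarrow> X"
        using space_restrict_annihilator[of I \<K>] by (auto simp: X_def)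
    qed
    have T2: "(\<lambda>y. T (\<Phi> y)) \<in> measurable \<Lambda> (config I)"
      using measurable_compose[OF measurable_compose[OF \<Phi>2 T1] idR] by simp
    have "distr \<Lambda> (config I) (\<lambda>y. T (\<Phi> y)) = distr \<Lambda> (config I) \<Phi>"
    proof (rule Prob_eqI[of _ I])
      show "distr \<Lambda> (config I) (\<lambda>y. T (\<Phi> y)) \<in> Prob I" "distr \<Lambda> (config I) \<Phi> \<in> Prob I"
        using prob_space.prob_space_distr[OF psL T2] prob_space.prob_space_distr[OF psL \<Phi>3]
        by (auto simp: Prob_def)
      fix u assume u: "finite u" "u \<subseteq> I"
      have *: "(\<integral>z. chi u z \<partial>distr \<Lambda> (config I) h) = (\<integral>y. chi u (h y) \<partial>\<Lambda>)"
        if "h \<in> measurable \<Lambda> (config I)" for h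
        by (rule integral_distr[OF that measurable_chi[OF u(2)]])
      have "(\<integral>y. chi u (T (\<Phi> y)) \<partial>\<Lambda>) = chi u x * (\<integral>y. chi u (\<Phi> y) \<partial>\<Lambda>)"
        unfolding T_def chi_add[OF u(2)] by simp
      also have "\<dots> = (\<integral>y. chi u (\<Phi> y) \<partial>\<Lambda>)"
        unfolding chi\<Phi>[OF u] using annihilator_bspan[of x I \<K> u] x \<K> u by (auto simp: X_def chi_eq)
      finally show "(\<integral>z. chi u z \<partial>distr \<Lambda> (config I) (\<lambda>y. T (\<Phi> y))) = (\<integral>z. chi u z \<partial>distr \<Lambda> (config I) \<Phi>)"
        unfolding *[OF T2] *[OF \<Phi>3] .
    qed
    then have "distr (distr \<mu> \<mu> T) (config I) (\<lambda>x. x) = distr \<mu> (config I) (\<lambda>x. x)"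
      unfolding \<mu>_def
      using T1 idR \<Phi>2 measurable_compose[OF \<Phi>2 T1]
      by (subst distr_distr[where N = "R"])
        (auto simp: distr_distr comp_def measurable_distr_eq1 measurable_distr_eq2 cong: distr_cong)
    moreover have "sets (distr \<mu> \<mu> T) = sets (restrict_space (config I) X)" using sets by simp
    ultimately show ?thesis using restrict_space_eqI sets unfolding T_def by blast
  qed
  then have "is_haar_prob I X \<mu>" using ps sets by (simp add: is_haar_prob_def)
  then show ?thesis using that by (simp add: X_def)
qed

text \<open>Existence, together with uniqueness through the characters, shows that the definite
  description in \<open>m_X\<close> denotes an actual Haar measure.\<close>

lemma haar_the_has_dual:
  fixes I :: "'i set"
  assumes I: "countable I" and \<K>: "\<And>c. c \<in> \<K> \<Longrightarrow> finite c \<and> c \<subseteq> I"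
  shows "has_dual I (bspan \<K>) (distr (THE \<mu>. is_haar_prob I (annihilator I \<K>) \<mu>) (config I) (\<lambda>x. x))"
proof -
  obtain \<mu> where \<mu>: "is_haar_prob I (annihilator I \<K>) \<mu>" using haar_exists[OF assms] by blast
  have "\<nu> = \<mu>" if \<nu>: "is_haar_prob I (annihilator I \<K>) \<nu>" for \<nu>
    by (rule restrict_space_eqI[OF _ _ has_dual_unique[OF haar_has_dual[OF assms \<nu>] haar_has_dual[OF assms \<mu>]]])
      (use \<mu> \<nu> in \<open>auto simp: is_haar_prob_def\<close>)
  then have "(THE \<mu>. is_haar_prob I (annihilator I \<K>) \<mu>) = \<mu>" using \<mu> by blast
  then show ?thesis using haar_has_dual[OF assms \<mu>] by simp
qed

section \<open>The weak-star topology in terms of characters\<close>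

lemma continuous_local_approx:
  fixes f :: "('i \<Rightarrow> bit) \<Rightarrow> real"
  assumes f: "continuous_map (product_topology (\<lambda>_. discrete_topology UNIV) I) euclideanreal f"
    and e: "0 < e"
  obtains J where "finite J" "J \<subseteq> I"
    "\<And>x y. x \<in> I \<rightarrow>\<^sub>E UNIV \<Longrightarrow> y \<in> I \<rightarrow>\<^sub>E UNIV \<Longrightarrow> (\<And>j. j \<in> J \<Longrightarrow> x j = y j) \<Longrightarrow> \<bar>f x - f y\<bar> < e"
proof -
  define T where "T = product_topology (\<lambda>_::'i. discrete_topology (UNIV :: bit set)) I"
  have top: "topspace T = I \<rightarrow>\<^sub>E UNIV" by (simp add: T_def)
  have "compact_space T" unfolding T_def
    by (simp add: compact_space_product_topology compact_space_discrete_topology)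
  \<comment> \<open>Continuity at one point involves only finitely many coordinates. Compactness
    then yields finitely many coordinates for all points, where both arguments are compared with a
    common centre, hence \<open>e / 2\<close>.\<close>
  have "\<exists>J. finite J \<and> J \<subseteq> I \<and> (\<forall>z\<in>I \<rightarrow>\<^sub>E UNIV. (\<forall>j\<in>J. z j = x j) \<longrightarrow> \<bar>f z - f x\<bar> < e / 2)"
    if x: "x \<in> I \<rightarrow>\<^sub>E UNIV" for x
  proof -
    have "openin T {z \<in> topspace T. f z \<in> ball (f x) (e / 2)}"
      using f by (intro openin_continuous_map_preimage) (auto simp: T_def)
    moreover have "x \<in> {z \<in> topspace T. f z \<in> ball (f x) (e / 2)}" using x e by (simp add: top)
    ultimately obtain U where U: "finite {i \<in> I. U i \<noteq> topspace (discrete_topology (UNIV :: bit set))}"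
      "x \<in> Pi\<^sub>E I U" "Pi\<^sub>E I U \<subseteq> {z \<in> topspace T. f z \<in> ball (f x) (e / 2)}"
      unfolding T_def openin_product_topology_alt by blast
    define J where "J = {i \<in> I. U i \<noteq> UNIV}"
    have "\<bar>f z - f x\<bar> < e / 2" if z: "z \<in> I \<rightarrow>\<^sub>E UNIV" "\<forall>j\<in>J. z j = x j" for z
    proof -
      have "z i \<in> U i" if "i \<in> I" for i
        using that z U(2) by (cases "i \<in> J") (auto simp: J_def PiE_iff)
      then have "z \<in> Pi\<^sub>E I U" using z by (auto simp: PiE_iff)
      then have "f z \<in> ball (f x) (e / 2)" using U(3) by blast
      then show ?thesis by (simp add: dist_real_def abs_minus_commute)
    qed
    then show ?thesis using U(1) by (intro exI[of _ J]) (auto simp: J_def)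
  qed
  then obtain Jx where Jx: "\<And>x. x \<in> I \<rightarrow>\<^sub>E UNIV \<Longrightarrow> finite (Jx x) \<and> Jx x \<subseteq> I \<and>
      (\<forall>z\<in>I \<rightarrow>\<^sub>E UNIV. (\<forall>j\<in>Jx x. z j = x j) \<longrightarrow> \<bar>f z - f x\<bar> < e / 2)"
    by metis
  define N where "N x = {z \<in> I \<rightarrow>\<^sub>E UNIV. \<forall>j\<in>Jx x. z j = x j}" for x
  have N: "openin T (N x)" if x: "x \<in> I \<rightarrow>\<^sub>E UNIV" for x
  proof -
    have "Jx x \<subseteq> I" using Jx[OF x] by metis
    then have "N x = (\<Pi>\<^sub>E i\<in>I. if i \<in> Jx x then {x i} else UNIV)"
      unfolding N_def PiE_iff set_eq_iff by (auto split: if_splits)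
    moreover have "openin T (\<Pi>\<^sub>E i\<in>I. if i \<in> Jx x then {x i} else UNIV)"
      unfolding T_def
      by (intro product_topology_basis) (use Jx[OF x] in \<open>auto elim: rev_finite_subset split: if_splits\<close>)
    ultimately show ?thesis by simp
  qed
  have "\<exists>\<F>. finite \<F> \<and> \<F> \<subseteq> N ` topspace T \<and> topspace T \<subseteq> \<Union> \<F>"
    using \<open>compact_space T\<close> unfolding compact_space_alt
  proof (elim allE[of _ "N ` topspace T"] impE)
    show "(\<forall>U\<in>N ` topspace T. openin T U) \<and> topspace T \<subseteq> \<Union> (N ` topspace T)"
      using N by (auto simp: top N_def)
  qed auto
  then obtain P where P: "finite P" "P \<subseteq> topspace T" "topspace T \<subseteq> (\<Union>x\<in>P. N x)"
    by (metis finite_subset_image)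
  show ?thesis
  proof (rule that[of "\<Union>x\<in>P. Jx x"])
    have "finite (Jx x) \<and> Jx x \<subseteq> I" if "x \<in> P" for x using Jx[of x] P(2) that by (auto simp: top)
    then show "finite (\<Union>x\<in>P. Jx x)" "(\<Union>x\<in>P. Jx x) \<subseteq> I" using P(1) by blast+
    fix y z assume yz: "y \<in> I \<rightarrow>\<^sub>E (UNIV :: bit set)" "z \<in> I \<rightarrow>\<^sub>E (UNIV :: bit set)"
      "\<And>j. j \<in> (\<Union>x\<in>P. Jx x) \<Longrightarrow> y j = z j"
    obtain x where x: "x \<in> P" "y \<in> N x" using P(3) yz(1) by (auto simp: top)
    have "z j = x j" if "j \<in> Jx x" for j
    proof -
      have "y j = z j" using yz(3) that x(1) by blast
      moreover have "y j = x j" using x(2) that by (simp add: N_def)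
      ultimately show ?thesis by simp
    qed
    then have "z \<in> N x" using yz by (auto simp: N_def)
    then have "\<bar>f y - f x\<bar> < e / 2" "\<bar>f z - f x\<bar> < e / 2"
      using Jx[of x] x P(2) by (auto simp: N_def top)
    then show "\<bar>f y - f z\<bar> < e" by linarith
  qed
qed

lemma continuous_chi_approx:
  fixes f :: "('i \<Rightarrow> bit) \<Rightarrow> real"
  assumes f: "continuous_map (product_topology (\<lambda>_. discrete_topology UNIV) I) euclideanreal f"
    and e: "0 < e"
  obtains J c where "finite J" "J \<subseteq> I"
    "\<And>x. x \<in> I \<rightarrow>\<^sub>E UNIV \<Longrightarrow> \<bar>f x - (\<Sum>u\<in>Pow J. c u * chi u x)\<bar> < e"
proof -
  obtain J where J: "finite J" "J \<subseteq> I"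
    "\<And>x y. x \<in> I \<rightarrow>\<^sub>E UNIV \<Longrightarrow> y \<in> I \<rightarrow>\<^sub>E UNIV \<Longrightarrow> (\<And>j. j \<in> J \<Longrightarrow> x j = y j) \<Longrightarrow> \<bar>f x - f y\<bar> < e"
    by (rule continuous_local_approx[OF assms]) blast
  \<comment> \<open>Coordinates outside \<open>J\<close> receive the default value 0; by the choice
    of \<open>J\<close> this moves \<open>f\<close> by less than \<open>e\<close>.\<close>
  define g where "g y = f (\<lambda>i\<in>I. if i \<in> J then y i else 0)" for y
  obtain c where c: "\<And>x :: 'i \<Rightarrow> bit. g (restrict x J) = (\<Sum>u\<in>Pow J. c u * chi u x)"
    using local_eq_sum_chi[OF J(1), where g = g] by metis
  show ?thesis
  proof (rule that[of J c])
    fix x :: "'i \<Rightarrow> bit" assume x: "x \<in> I \<rightarrow>\<^sub>E UNIV"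
    show "\<bar>f x - (\<Sum>u\<in>Pow J. c u * chi u x)\<bar> < e"
      unfolding c[symmetric] g_def by (rule J(3)) (use x J(2) in auto)
  qed (use J in auto)
qed

text \<open>For uncountable \<open>I\<close> the product sigma-algebra can be smaller than the Borel
  one, so continuity does not give measurability at once. It holds because \<open>f\<close> is a
  uniform limit of functions of finitely many coordinates.\<close>

lemma continuous_measurable_config:
  fixes f :: "('i \<Rightarrow> bit) \<Rightarrow> real"
  assumes f: "continuous_map (product_topology (\<lambda>_. discrete_topology UNIV) I) euclideanreal f"
  shows "f \<in> borel_measurable (config I)"
proof -
  have "\<exists>h. h \<in> borel_measurable (config I) \<and> (\<forall>x\<in>I \<rightarrow>\<^sub>E UNIV. \<bar>f x - h x\<bar> < 1 / real (Suc n))" for n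
  proof -
    obtain J c where J: "finite J" "J \<subseteq> I"
      "\<And>x. x \<in> I \<rightarrow>\<^sub>E UNIV \<Longrightarrow> \<bar>f x - (\<Sum>u\<in>Pow J. c u * chi u x)\<bar> < 1 / real (Suc n)"
      by (rule continuous_chi_approx[OF f, of "1 / real (Suc n)"]) auto
    have "(\<lambda>x. \<Sum>u\<in>Pow J. c u * chi u x) \<in> borel_measurable (config I)"
      by (intro borel_measurable_sum borel_measurable_times borel_measurable_const measurable_chi)
        (use J in auto)
    then show ?thesis using J(3) by blast
  qed
  then obtain h where h: "\<And>n. h n \<in> borel_measurable (config I)"
    "\<And>n x. x \<in> I \<rightarrow>\<^sub>E UNIV \<Longrightarrow> \<bar>f x - h n x\<bar> < 1 / real (Suc n)"
    by metis
  show ?thesis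
  proof (rule borel_measurable_LIMSEQ_metric[of h])
    fix x :: "'i \<Rightarrow> bit" assume "x \<in> space (config I)"
    then have x: "x \<in> I \<rightarrow>\<^sub>E UNIV" by (simp add: space_config)
    have "(\<lambda>n. h n x - f x) \<longlonglongrightarrow> 0"
    proof (rule Lim_null_comparison[OF _ LIMSEQ_inverse_real_of_nat], rule always_eventually, rule allI)
      fix n show "norm (h n x - f x) \<le> inverse (real (Suc n))"
        using h(2)[OF x, of n] by (simp add: abs_minus_commute inverse_eq_divide)
    qed
    then show "(\<lambda>n. h n x) \<longlonglongrightarrow> f x" by (simp add: LIM_zero_iff)
  qed (use h in auto)
qed

lemma integral_chi_approx:
  fixes f :: "('i \<Rightarrow> bit) \<Rightarrow> real"
  assumes f: "continuous_map (product_topology (\<lambda>_. discrete_topology UNIV) I) euclideanreal f"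
    and \<mu>: "\<mu> \<in> Prob I" and J: "finite J" "J \<subseteq> I"
    and a: "\<And>x. x \<in> I \<rightarrow>\<^sub>E UNIV \<Longrightarrow> \<bar>f x - (\<Sum>u\<in>Pow J. c u * chi u x)\<bar> < e"
  shows "\<bar>(\<integral>x. f x \<partial>\<mu>) - (\<Sum>u\<in>Pow J. c u * (\<integral>x. chi u x \<partial>\<mu>))\<bar> \<le> e"
proof -
  interpret prob_space \<mu> using \<mu> by (simp add: Prob_def)
  have int: "integrable \<mu> (chi u)" if "u \<in> Pow J" for u using integrable_chi[OF \<mu>] that J by blast
  have int2: "integrable \<mu> (\<lambda>x. \<Sum>u\<in>Pow J. c u * chi u x)" using int by auto
  have fm: "f \<in> borel_measurable \<mu>"
    using continuous_measurable_config[OF f] Prob_measurable_iff[OF \<mu>] by blast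
  have "integrable \<mu> (\<lambda>x. f x - (\<Sum>u\<in>Pow J. c u * chi u x))"
  proof (rule integrable_const_bound[of _ e])
    show "AE x in \<mu>. norm (f x - (\<Sum>u\<in>Pow J. c u * chi u x)) \<le> e"
      by (rule AE_I2) (use a Prob_space[OF \<mu>] in \<open>auto intro: less_imp_le\<close>)
    show "(\<lambda>x. f x - (\<Sum>u\<in>Pow J. c u * chi u x)) \<in> borel_measurable \<mu>"
      using fm int2 by (intro borel_measurable_diff) auto
  qed
  note int3 = this
  have "integrable \<mu> (\<lambda>x. (f x - (\<Sum>u\<in>Pow J. c u * chi u x)) + (\<Sum>u\<in>Pow J. c u * chi u x))"
    by (rule Bochner_Integration.integrable_add[OF int3 int2])
  then have intf: "integrable \<mu> f" by simp
  have "(\<Sum>u\<in>Pow J. c u * (\<integral>x. chi u x \<partial>\<mu>)) = (\<integral>x. (\<Sum>u\<in>Pow J. c u * chi u x) \<partial>\<mu>)"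
    using int by (subst Bochner_Integration.integral_sum) auto
  then have "(\<integral>x. f x \<partial>\<mu>) - (\<Sum>u\<in>Pow J. c u * (\<integral>x. chi u x \<partial>\<mu>))
      = (\<integral>x. f x - (\<Sum>u\<in>Pow J. c u * chi u x) \<partial>\<mu>)"
    using intf int2 by simp
  also have "\<bar>\<dots>\<bar> \<le> (\<integral>x. \<bar>f x - (\<Sum>u\<in>Pow J. c u * chi u x)\<bar> \<partial>\<mu>)"
    by (rule integral_abs_bound)
  also have "\<dots> \<le> (\<integral>x. e \<partial>\<mu>)"
    by (rule integral_mono) (use int3 a Prob_space[OF \<mu>] in \<open>auto intro: less_imp_le\<close>)
  finally show ?thesis by (simp add: prob_space)
qed

definition chi_close :: "'i set set \<Rightarrow> real \<Rightarrow> ('i \<Rightarrow> bit) measure \<Rightarrow> ('i \<Rightarrow> bit) measure \<Rightarrow> bool" where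
  "chi_close \<F> \<eta> \<mu> \<nu> \<longleftrightarrow> (\<forall>u\<in>\<F>. \<bar>(\<integral>x. chi u x \<partial>\<nu>) - (\<integral>x. chi u x \<partial>\<mu>)\<bar> < \<eta>)"

text \<open>Every neighbourhood is seen by finitely many characters. Induction over the generation
  of the topology reduces this to a basic set, whose test function is uniformly close to a
  combination of characters.\<close>

lemma weak_star_nhd:
  fixes \<mu> :: "('i \<Rightarrow> bit) measure"
  assumes "openin (weak_star I) W" "\<mu> \<in> W"
  obtains \<F> \<eta> where "finite \<F>" "\<And>u. u \<in> \<F> \<Longrightarrow> finite u \<and> u \<subseteq> I" "0 < \<eta>"
    "\<And>\<nu>. \<nu> \<in> Prob I \<Longrightarrow> chi_close \<F> \<eta> \<mu> \<nu> \<Longrightarrow> \<nu> \<in> W"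
proof -
  let ?P = "\<lambda>W. \<exists>\<F> \<eta>. finite \<F> \<and> (\<forall>u\<in>\<F>. finite u \<and> u \<subseteq> I) \<and> 0 < \<eta> \<and>
    (\<forall>\<nu>\<in>Prob I. chi_close \<F> \<eta> \<mu> \<nu> \<longrightarrow> \<nu> \<in> W)"
  have "\<mu> \<in> W \<longrightarrow> ?P W"
    using assms(1) unfolding weak_star_def openin_topology_generated_by_iff
  proof induction
    case (Int a b)
    show ?case
    proof
      assume "\<mu> \<in> a \<inter> b"
      then have "?P a" "?P b" using Int by auto
      then obtain \<F> \<eta> \<G> \<theta> where *: "finite \<F>" "\<forall>u\<in>\<F>. finite u \<and> u \<subseteq> I" "0 < \<eta>"
        "\<forall>\<nu>\<in>Prob I. chi_close \<F> \<eta> \<mu> \<nu> \<longrightarrow> \<nu> \<in> a"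
        "finite \<G>" "\<forall>u\<in>\<G>. finite u \<and> u \<subseteq> I" "0 < \<theta>"
        "\<forall>\<nu>\<in>Prob I. chi_close \<G> \<theta> \<mu> \<nu> \<longrightarrow> \<nu> \<in> b" by metis
      have "chi_close \<F> \<eta> \<mu> \<nu>" "chi_close \<G> \<theta> \<mu> \<nu>" if "chi_close (\<F> \<union> \<G>) (min \<eta> \<theta>) \<mu> \<nu>" for \<nu>
        using that by (auto simp: chi_close_def)
      then show "?P (a \<inter> b)" using *
        by (intro exI[of _ "\<F> \<union> \<G>"] exI[of _ "min \<eta> \<theta>"]) auto
    qed
  next
    case (UN K)
    show ?case
    proof
      assume "\<mu> \<in> \<Union>K"
      then obtain k where k: "k \<in> K" "\<mu> \<in> k" by auto
      then have "?P k" using UN by auto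
      then obtain \<F> \<eta> where "finite \<F>" "\<forall>u\<in>\<F>. finite u \<and> u \<subseteq> I" "0 < \<eta>"
        "\<forall>\<nu>\<in>Prob I. chi_close \<F> \<eta> \<mu> \<nu> \<longrightarrow> \<nu> \<in> k" by metis
      then show "?P (\<Union>K)" using k by (intro exI[of _ \<F>] exI[of _ \<eta>]) auto
    qed
  next
    case (Basis s)
    show ?case
    proof
      assume \<mu>s: "\<mu> \<in> s"
      from Basis obtain f U where s: "s = {\<nu> \<in> Prob I. (\<integral>x. f x \<partial>\<nu>) \<in> U}"
        and f: "continuous_map (product_topology (\<lambda>_. discrete_topology UNIV) I) euclideanreal f"
        and U: "open U" by auto
      have \<mu>: "\<mu> \<in> Prob I" using \<mu>s s by auto
      obtain e where e: "0 < e" "ball (\<integral>x. f x \<partial>\<mu>) e \<subseteq> U"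
        using \<mu>s U unfolding s by (metis (mono_tags, lifting) mem_Collect_eq openE)
      obtain J c where J: "finite J" "J \<subseteq> I"
        "\<And>x. x \<in> I \<rightarrow>\<^sub>E UNIV \<Longrightarrow> \<bar>f x - (\<Sum>u\<in>Pow J. c u * chi u x)\<bar> < e / 4"
        by (rule continuous_chi_approx[OF f, of "e / 4"]) (use e in auto)
      \<comment> \<open>The summand 1 keeps \<open>C\<close> positive. With
        \<open>\<eta> = e / (4 * C)\<close> the change of the characters contributes at most
        \<open>e / 4\<close>, and the approximation of \<open>f\<close> another \<open>e / 4\<close>
        under each of the two measures.\<close>
      define C where "C = (\<Sum>u\<in>Pow J. \<bar>c u\<bar>) + 1"
      have C: "C > 0" unfolding C_def by (intro add_nonneg_pos sum_nonneg) auto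
      define \<eta> where "\<eta> = e / (4 * C)"
      have \<eta>: "\<eta> > 0" using e C by (simp add: \<eta>_def)
      have "\<nu> \<in> s" if \<nu>: "\<nu> \<in> Prob I" "chi_close (Pow J) \<eta> \<mu> \<nu>" for \<nu>
      proof -
        have "\<bar>(\<Sum>u\<in>Pow J. c u * (\<integral>x. chi u x \<partial>\<nu>)) - (\<Sum>u\<in>Pow J. c u * (\<integral>x. chi u x \<partial>\<mu>))\<bar>
            = \<bar>\<Sum>u\<in>Pow J. c u * ((\<integral>x. chi u x \<partial>\<nu>) - (\<integral>x. chi u x \<partial>\<mu>))\<bar>"
          by (simp add: sum_subtractf right_diff_distrib)
        also have "\<dots> \<le> (\<Sum>u\<in>Pow J. \<bar>c u\<bar> * \<eta>)"
        proof (rule order_trans[OF sum_abs sum_mono])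
          fix u assume "u \<in> Pow J"
          then have "\<bar>(\<integral>x. chi u x \<partial>\<nu>) - (\<integral>x. chi u x \<partial>\<mu>)\<bar> \<le> \<eta>"
            using \<nu>(2) by (auto simp: chi_close_def intro: less_imp_le)
          then show "\<bar>c u * ((\<integral>x. chi u x \<partial>\<nu>) - (\<integral>x. chi u x \<partial>\<mu>))\<bar> \<le> \<bar>c u\<bar> * \<eta>"
            unfolding abs_mult by (intro mult_left_mono) auto
        qed
        also have "\<dots> \<le> C * \<eta>"
          using \<eta> by (simp add: C_def sum_distrib_right[symmetric] mult_right_mono distrib_right)
        also have "\<dots> = e / 4" using C by (simp add: \<eta>_def)
        finally have "\<bar>(\<integral>x. f x \<partial>\<nu>) - (\<integral>x. f x \<partial>\<mu>)\<bar> < e"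
          using integral_chi_approx[OF f \<mu> J] integral_chi_approx[OF f \<nu>(1) J] e(1) by linarith
        then show ?thesis using e(2) \<nu>(1) by (auto simp: s dist_real_def abs_minus_commute)
      qed
      then show "?P s" using J \<eta>
        by (intro exI[of _ "Pow J"] exI[of _ \<eta>]) (auto intro: finite_subset)
    qed
  qed auto
  then show ?thesis using assms(2) that by metis
qed

lemma continuous_map_chi:
  assumes "finite u" "u \<subseteq> I"
  shows "continuous_map (product_topology (\<lambda>_. discrete_topology UNIV) I) euclideanreal (chi u)"
  unfolding chi_def[abs_def]
proof (rule continuous_map_prod[OF assms(1)])
  fix i assume "i \<in> u"
  then have "continuous_map (product_topology (\<lambda>_. discrete_topology (UNIV :: bit set)) I)
      (discrete_topology UNIV) (\<lambda>x. x i)"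
    using assms continuous_map_product_projection[of i I "\<lambda>_. discrete_topology (UNIV :: bit set)"] by auto
  moreover have "continuous_map (discrete_topology UNIV) euclideanreal (\<lambda>b::bit. if b = 0 then 1 else - 1)"
    by simp
  ultimately show "continuous_map (product_topology (\<lambda>_. discrete_topology UNIV) I) euclideanreal
      (\<lambda>x. if x i = (0::bit) then 1 else - 1)"
    by (rule continuous_map_compose[unfolded comp_def])
qed

lemma openin_weak_star_chi:
  assumes "finite u" "u \<subseteq> I" "open U"
  shows "openin (weak_star I) {\<nu> \<in> Prob I. (\<integral>x. chi u x \<partial>\<nu>) \<in> U}"
  unfolding weak_star_def
  by (rule topology_generated_by_Basis) (use continuous_map_chi[OF assms(1,2)] assms(3) in blast)

text \<open>Such a measure is uniform on its support. By Fourier inversion the mass of a point is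
  the sum of its characters over \<open>D \<inter> Pow T\<close>, divided by
  \<open>2 ^ card T\<close>; that sum is the full cardinality if all these characters are 1, and
  otherwise 0, since adding a word with character - 1 reverses its sign. The entropy is thus minus
  the logarithm of the common mass \<open>q\<close>.\<close>

lemma shannon_has_dual:
  assumes "finite T" and \<nu>: "has_dual T D \<nu>"
    and D: "\<And>u w. u \<in> D \<Longrightarrow> w \<in> D \<Longrightarrow> sym_diff u w \<in> D" "{} \<in> D"
  shows "shannon \<nu> = card T * ln 2 - ln (card (D \<inter> Pow T))"
proof -
  have P: "\<nu> \<in> Prob T" using \<nu> by (simp add: has_dual_def)
  interpret prob_space \<nu> using P by (simp add: Prob_def)
  have sp: "space \<nu> = T \<rightarrow>\<^sub>E UNIV" by (rule Prob_space[OF P])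
  have fin: "finite (space \<nu>)" unfolding sp using assms(1) by (intro finite_PiE) auto
  have singl: "{x} \<in> sets \<nu>" if "x \<in> space \<nu>" for x
  proof -
    have "{x} = (\<Pi>\<^sub>E i\<in>T. {x i})" using that PiE_singleton[of x T] by (auto simp: sp PiE_iff)
    moreover have "(\<Pi>\<^sub>E i\<in>T. {x i}) \<in> sets (config T)"
      unfolding config_def using assms(1) by (intro sets_PiM_I_finite) auto
    ultimately show ?thesis using P by (simp add: Prob_def)
  qed
  have sets: "sets \<nu> = Pow (space \<nu>)"
  proof
    show "sets \<nu> \<subseteq> Pow (space \<nu>)" using sets.sets_into_space by auto
    show "Pow (space \<nu>) \<subseteq> sets \<nu>"
    proof
      fix A assume A: "A \<in> Pow (space \<nu>)"
      then have "(\<Union>x\<in>A. {x}) \<in> sets \<nu>"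
        using fin singl finite_subset by (intro sets.finite_UN) auto
      then show "A \<in> sets \<nu>" by simp
    qed
  qed
  define E where "E = D \<inter> Pow T"
  have finE: "finite E" using assms(1) by (simp add: E_def)
  have E0: "{} \<in> E" using D by (simp add: E_def)
  define q where "q = card E / 2 ^ card T"
  have cE: "card E > 0" using finE E0 by (auto simp: card_gt_0_iff)
  then have q: "q > 0" by (simp add: q_def)
  have meas: "measure \<nu> {x} = 0 \<or> measure \<nu> {x} = q" if x: "x \<in> space \<nu>" for x
  proof -
    have "measure \<nu> {x} = (\<integral>z. indicator {x} z \<partial>\<nu>)" using x by simp
    also have "\<dots> = (\<integral>z. of_bool (\<forall>j\<in>T. z j = x j) \<partial>\<nu>)"
      by (intro Bochner_Integration.integral_cong)
        (use x in \<open>auto simp: sp indicator_def intro: PiE_ext\<close>)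
    also have "\<dots> = (\<Sum>u\<in>Pow T. chi u x * (\<integral>z. chi u z \<partial>\<nu>)) / 2 ^ card T"
      unfolding indicator_eq_sum_chi[OF assms(1)]
      by (subst integral_divide_zero, subst Bochner_Integration.integral_sum)
        (use integrable_chi[OF P] in auto)
    also have "(\<Sum>u\<in>Pow T. chi u x * (\<integral>z. chi u z \<partial>\<nu>)) = (\<Sum>u\<in>Pow T. if u \<in> D then chi u x else 0)"
    proof (rule sum.cong)
      fix u assume "u \<in> Pow T"
      then have "u \<subseteq> T" "finite u" using assms(1) by (auto intro: finite_subset)
      then have "(\<integral>z. chi u z \<partial>\<nu>) = of_bool (u \<in> D)"
        using \<nu> by (simp add: has_dual_def)
      then show "chi u x * (\<integral>z. chi u z \<partial>\<nu>) = (if u \<in> D then chi u x else 0)" by simp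
    qed simp
    also have "\<dots> = (\<Sum>u\<in>E. chi u x)"
      unfolding E_def Int_commute[of D] using assms(1) by (simp add: sum.inter_restrict)
    finally have m: "measure \<nu> {x} = (\<Sum>u\<in>E. chi u x) / 2 ^ card T" .
    show ?thesis
    proof (cases "\<forall>u\<in>E. chi u x = 1")
      case True
      then show ?thesis by (simp add: m q_def)
    next
      case False
      then obtain w where w: "w \<in> E" "chi w x \<noteq> 1" by auto
      then have "finite w" using assms(1) by (auto simp: E_def intro: finite_subset)
      then have wx: "chi w x = - 1" using w(2) by (simp add: chi_eq split: if_splits)
      have "(\<Sum>u\<in>E. chi u x) = (\<Sum>u\<in>E. chi (sym_diff w u) x)"
      proof (rule sum.reindex_bij_witness[of _ "\<lambda>u. sym_diff w u" "\<lambda>u. sym_diff w u"])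
        fix a assume "a \<in> E"
        then show "sym_diff w a \<in> E" using w D(1)[of w a] by (auto simp: E_def)
        then show "sym_diff w a \<in> E" .
        show "sym_diff w (sym_diff w a) = a" by auto
        then show "sym_diff w (sym_diff w a) = a" .
        then show "chi (sym_diff w (sym_diff w a)) x = chi a x" by simp
      qed
      also have "\<dots> = (\<Sum>u\<in>E. chi w x * chi u x)"
      proof (rule sum.cong)
        fix u assume "u \<in> E"
        then have "u \<subseteq> T" "w \<subseteq> T" using w by (auto simp: E_def)
        then have "finite u" "finite w" using assms(1) by (auto intro: finite_subset)
        then show "chi (sym_diff w u) x = chi w x * chi u x" by (rule chi_sym_diff[rotated])
      qed simp
      also have "\<dots> = - (\<Sum>u\<in>E. chi u x)" by (simp add: wx sum_negf)
      finally show ?thesis by (simp add: m)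
    qed
  qed
  have tot: "(\<Sum>x\<in>space \<nu>. measure \<nu> {x}) = 1"
    using finite_measure_finite_Union[of "space \<nu>" "\<lambda>x. {x}"] fin singl
    by (simp add: prob_space disjoint_family_on_def image_subset_iff)
  have "shannon \<nu> = - (\<Sum>x\<in>space \<nu>. measure \<nu> {x} * ln (measure \<nu> {x}))"
    by (rule shannon_eq) (use sets fin prob_space_axioms in auto)
  \<comment> \<open>Points of mass 0 contribute 0 on both sides, so \<open>ln q\<close> may stand
    for every logarithm.\<close>
  also have "(\<Sum>x\<in>space \<nu>. measure \<nu> {x} * ln (measure \<nu> {x})) = (\<Sum>x\<in>space \<nu>. measure \<nu> {x} * ln q)"
    by (intro sum.cong) (use meas in fastforce)+
  also have "\<dots> = ln q" unfolding sum_distrib_right[symmetric] tot by simp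
  also have "ln q = ln (card E) - card T * ln 2"
    using cE by (simp add: q_def ln_div ln_realpow)
  finally show ?thesis by (simp add: E_def)
qed

section \<open>Permutations with all cycles of length \<open>k\<close>\<close>

definition kperms :: "nat \<Rightarrow> nat \<Rightarrow> (nat \<Rightarrow> nat) set" where
  "kperms k n = {p. p permutes {1..n} \<and> (\<forall>v\<in>{1..n}. card (orbit p v) = k)}"

lemma kperms_permutes: "p \<in> kperms k n \<Longrightarrow> p permutes {1..n}"
  by (simp add: kperms_def)

lemma finite_kperms: "finite (kperms k n)"
  by (rule finite_subset[of _ "{p. p permutes {1..n}}"]) (auto simp: kperms_def finite_permutations)

lemma card_orbit: "p \<in> kperms k n \<Longrightarrow> v \<in> {1..n} \<Longrightarrow> card (orbit p v) = k"
  by (simp add: kperms_def)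

text \<open>\<open>orbit\<close> starts with the first image, so membership of the point itself
  comes from \<open>p\<close> being a permutation of a finite set.\<close>

lemma self_in_orbit: "p \<in> kperms k n \<Longrightarrow> v \<in> orbit p v"
  using kperms_permutes[of p k n] by (intro permutation_self_in_orbit permutes_imp_permutation) auto

lemma orbit_in: "p \<in> kperms k n \<Longrightarrow> v \<in> {1..n} \<Longrightarrow> orbit p v \<subseteq> {1..n}"
  by (rule permutes_orbit_subset[OF kperms_permutes])

lemma finite_orbit': "p \<in> kperms k n \<Longrightarrow> v \<in> {1..n} \<Longrightarrow> finite (orbit p v)"
  by (meson finite_atLeastAtMost finite_subset orbit_in)

lemma orbit_sym: "p \<in> kperms k n \<Longrightarrow> w \<in> orbit p v \<Longrightarrow> v \<in> orbit p w"
  by (metis orbit_swap self_in_orbit)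

lemma orbit_eq: "p \<in> kperms k n \<Longrightarrow> w \<in> orbit p v \<Longrightarrow> orbit p w = orbit p v"
  by (metis orbit_sym orbit_trans subsetI subset_antisym)

lemma orbit_disjoint: "p \<in> kperms k n \<Longrightarrow> x \<in> orbit p v \<Longrightarrow> x \<in> orbit p w \<Longrightarrow> orbit p v = orbit p w"
  by (metis orbit_eq)

text \<open>\<open>funpow_dist1\<close> is the first return time to \<open>v\<close>; for these
  permutations it equals the cycle length \<open>k\<close>.\<close>

lemma kperms_funpow:
  assumes "p \<in> kperms k n" "v \<in> {1..n}"
  shows "(p ^^ k) v = v" "inj_on (\<lambda>j. (p ^^ j) v) {..<k}" "orbit p v = (\<lambda>j. (p ^^ j) v) ` {..<k}"
proof -
  have o: "v \<in> orbit p v" by (rule self_in_orbit[OF assms(1)])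
  define m where "m = funpow_dist1 p v v"
  have 1: "orbit p v = (\<lambda>j. (p ^^ j) v) ` {0..<m}" unfolding m_def by (rule orbit_conv_funpow_dist1[OF o])
  have 2: "inj_on (\<lambda>j. (p ^^ j) v) {0..<m}" unfolding m_def by (rule inj_on_funpow_dist1[OF o])
  have m: "m = k" using card_orbit[OF assms] unfolding 1 card_image[OF 2] by simp
  show "(p ^^ k) v = v" using funpow_dist1_prop[OF o] unfolding m[symmetric] m_def .
  show "inj_on (\<lambda>j. (p ^^ j) v) {..<k}" "orbit p v = (\<lambda>j. (p ^^ j) v) ` {..<k}"
    using 1 2 by (simp_all add: m atLeast0LessThan)
qed

lemma kperms_pow_id:
  assumes "p \<in> kperms k n"
  shows "p ^^ k = id"
proof
  fix v
  show "(p ^^ k) v = id v"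
  proof (cases "v \<in> {1..n}")
    case False
    then have "p v = v" using kperms_permutes[OF assms] by (simp add: permutes_not_in)
    then have "(p ^^ j) v = v" for j by (induction j) auto
    then show ?thesis by simp
  qed (use kperms_funpow[OF assms] in simp)
qed

lemma sum_orbit:
  assumes "p \<in> kperms k n" "v \<in> {1..n}"
  shows "(\<Sum>j<k. x ((p ^^ j) v)) = sum x (orbit p v)"
  unfolding kperms_funpow(3)[OF assms] by (simp add: sum.reindex[OF kperms_funpow(2)[OF assms]])

text \<open>Witness: rotate each block of \<open>k\<close> consecutive integers. The point
  \<open>k * q + s + 1\<close> has position \<open>s\<close> in block \<open>q\<close>; the 1 is
  there because points are numbered from 1.\<close>

lemma kperms_nonempty:
  assumes "0 < k" "k dvd n"
  shows "kperms k n \<noteq> {}"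
proof -
  define t where "t v = (if v \<in> {1..n} then k * ((v - 1) div k) + Suc (v - 1) mod k + 1 else v)" for v
  have bnd: "k * q + s + 1 \<in> {1..n}" if "q < n div k" "s < k" for q s
  proof -
    have "k * q + s < k * Suc q" using that by simp
    also have "k * Suc q \<le> k * (n div k)" using that by (intro mult_le_mono2) simp
    finally show ?thesis using assms by simp
  qed
  have tq: "t (k * q + s + 1) = k * q + Suc s mod k + 1" if "q < n div k" "s < k" for q s
    using bnd[OF that] that assms by (simp add: t_def mod_Suc)
  have dec: "\<exists>q s. q < n div k \<and> s < k \<and> v = k * q + s + 1" if "v \<in> {1..n}" for v
  proof (intro exI conjI)
    show "v = k * ((v - 1) div k) + (v - 1) mod k + 1" using that by simp
    show "(v - 1) mod k < k" using assms by simp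
    have "v - 1 < k * (n div k)" using that assms by simp linarith
    then show "(v - 1) div k < n div k" using assms by (simp add: less_mult_imp_div_less mult.commute)
  qed
  have pow: "(t ^^ j) (k * q + s + 1) = k * q + (s + j) mod k + 1" if "q < n div k" "s < k" for q s j
  proof (induction j)
    case (Suc j)
    have "(t ^^ Suc j) (k * q + s + 1) = t (k * q + (s + j) mod k + 1)" using Suc by simp
    also have "\<dots> = k * q + Suc ((s + j) mod k) mod k + 1"
      using that assms by (intro tq) auto
    finally show ?case by (simp add: mod_Suc_eq)
  qed (use that in simp)
  have inj: "inj_on t {1..n}"
  proof (rule inj_on_inverseI)
    fix v assume "v \<in> {1..n}"
    from dec[OF this] obtain q s where v: "q < n div k" "s < k" "v = k * q + s + 1" by blast
    have "(t ^^ k) v = v" using pow[OF v(1,2), of k] v by simp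
    moreover have "(t ^^ k) v = (t ^^ (k - 1)) (t v)" using assms
      by (metis Suc_pred' comp_apply funpow_Suc_right)
    ultimately show "(t ^^ (k - 1)) (t v) = v" by simp
  qed
  have into: "t v \<in> {1..n}" if "v \<in> {1..n}" for v
    using dec[OF that] tq bnd assms by (metis mod_less_divisor)
  have "bij_betw t {1..n} {1..n}"
    unfolding bij_betw_def using inj into endo_inj_surj[OF _ _ inj] by blast
  then have "t permutes {1..n}"
    by (rule bij_imp_permutes) (unfold t_def, rule if_not_P)
  moreover have "card (orbit t v) = k" if v: "v \<in> {1..n}" for v
  proof -
    from dec[OF v] obtain q s where v: "q < n div k" "s < k" "v = k * q + s + 1" by blast
    have "orbit t v = (\<lambda>r. k * q + r + 1) ` {..<k}"
    proof (intro equalityI subsetI)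
      fix x assume "x \<in> orbit t v"
      then obtain j where "x = (t ^^ j) v" by (auto simp: orbit_altdef)
      then show "x \<in> (\<lambda>r. k * q + r + 1) ` {..<k}" using pow[OF v(1,2), of j] v assms by auto
    next
      fix x assume "x \<in> (\<lambda>r. k * q + r + 1) ` {..<k}"
      then obtain r where r: "r < k" "x = k * q + r + 1" by auto
      have "(s + (r + k - s)) mod k = r" using r v by simp
      then have "x = (t ^^ (r + k - s)) v" using pow[OF v(1,2), of "r + k - s"] v r by simp
      moreover have "0 < r + k - s" using v by simp
      ultimately show "x \<in> orbit t v" unfolding orbit_altdef by blast
    qed
    then show ?thesis by (simp add: card_image inj_on_def)
  qed
  ultimately have "t \<in> kperms k n" by (simp add: kperms_def)
  then show ?thesis by auto
qed

section \<open>Conjugation and averaging over the uniform distribution\<close>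

definition conj_perm :: "(nat \<Rightarrow> nat) \<Rightarrow> (nat \<Rightarrow> nat) \<Rightarrow> nat \<Rightarrow> nat" where
  "conj_perm g p = g \<circ> p \<circ> inv' g"

lemma conj_perm_apply: "g permutes V \<Longrightarrow> conj_perm g p (g v) = g (p v)"
  by (simp add: conj_perm_def permutes_inverses)

lemma conj_perm_funpow: "g permutes V \<Longrightarrow> (conj_perm g p ^^ j) (g v) = g ((p ^^ j) v)"
  by (induction j) (auto simp: conj_perm_apply)

lemma orbit_conj_perm: "g permutes V \<Longrightarrow> orbit (conj_perm g p) (g v) = g ` orbit p v"
  by (auto simp: orbit_altdef conj_perm_funpow)

lemma conj_perm_kperms:
  assumes "g permutes {1..n}" "p \<in> kperms k n"
  shows "conj_perm g p \<in> kperms k n"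
proof -
  have "card (orbit (conj_perm g p) v) = k" if "v \<in> {1..n}" for v
  proof -
    obtain w where w: "v = g w" using permutes_surj[OF assms(1)] by (metis surjD)
    then have "w \<in> {1..n}" using that permutes_in_image[OF assms(1)] by simp
    then show ?thesis unfolding w orbit_conj_perm[OF assms(1)]
      using card_orbit[OF assms(2)] card_image[OF permutes_inj_on[OF assms(1)]] by simp
  qed
  moreover have "conj_perm g p permutes {1..n}"
    unfolding conj_perm_def
    by (intro permutes_compose permutes_inv assms(1) kperms_permutes[OF assms(2)])
  ultimately show ?thesis by (simp add: kperms_def)
qed

lemma conj_perm_inj:
  assumes "g permutes V"
  shows "inj (conj_perm g)"
proof (rule injI)
  fix p q assume "conj_perm g p = conj_perm g q"
  then have "g (p v) = g (q v)" for v by (metis conj_perm_apply[OF assms])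
  then show "p = q" using permutes_inj[OF assms] by (auto simp: inj_eq)
qed

text \<open>Double counting of pairs of a permutation and an element of \<open>A\<close>.
  Conjugation makes the event at \<open>a\<close> at most as frequent as the event at any other
  \<open>b\<close>, so its frequency is at most the average over \<open>A\<close>, and this is at
  most \<open>K / card A\<close> if no single permutation satisfies more than \<open>K\<close> of
  the events.\<close>

lemma kperms_averaging:
  assumes fin: "finite A" and a: "a \<in> A"
    and trans: "\<And>b. b \<in> A \<Longrightarrow> \<exists>g. g permutes {1..n} \<and> (\<forall>p\<in>kperms k n. E p a \<longrightarrow> E (conj_perm g p) b)"
    and K: "\<And>p. p \<in> kperms k n \<Longrightarrow> real (card {b\<in>A. E p b}) \<le> K"
  shows "real (card {p \<in> kperms k n. E p a}) * real (card A) \<le> real (card (kperms k n)) * K"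
proof -
  have "card {p \<in> kperms k n. E p a} \<le> card {p \<in> kperms k n. E p b}" if b: "b \<in> A" for b
  proof -
    obtain g where g: "g permutes {1..n}" "\<forall>p\<in>kperms k n. E p a \<longrightarrow> E (conj_perm g p) b"
      using trans[OF b] by blast
    show ?thesis
      by (rule card_inj_on_le[of "conj_perm g"])
        (use g conj_perm_kperms conj_perm_inj finite_kperms in \<open>auto intro: inj_on_subset[OF conj_perm_inj]\<close>)
  qed
  then have "card {p \<in> kperms k n. E p a} * card A \<le> (\<Sum>b\<in>A. card {p \<in> kperms k n. E p b})"
    using sum_bounded_below[of A "card {p \<in> kperms k n. E p a}"] by (simp add: mult.commute)
  also have "\<dots> = (\<Sum>b\<in>A. \<Sum>p\<in>kperms k n. of_bool (E p b))"
    by (intro sum.cong) (auto simp: finite_kperms Int_def)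
  also have "\<dots> = (\<Sum>p\<in>kperms k n. \<Sum>b\<in>A. of_bool (E p b))" by (rule sum.swap)
  also have "\<dots> = (\<Sum>p\<in>kperms k n. card {b\<in>A. E p b})"
    by (intro sum.cong) (auto simp: fin Int_def)
  finally have "real (card {p \<in> kperms k n. E p a} * card A) \<le> real (\<Sum>p\<in>kperms k n. card {b\<in>A. E p b})"
    by (simp only: of_nat_le_iff)
  also have "\<dots> \<le> (\<Sum>p\<in>kperms k n. K)" unfolding of_nat_sum by (intro sum_mono K)
  finally show ?thesis by simp
qed

lemma extend_to_permutation:
  assumes "finite V" "A \<subseteq> V" "inj_on h A" "h ` A \<subseteq> V"
  obtains g where "g permutes V" "\<And>a. a \<in> A \<Longrightarrow> g a = h a"
proof -
  have "card (V - A) = card (V - h ` A)"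
    using assms by (simp add: card_Diff_subset finite_subset card_image)
  then obtain h' where h': "bij_betw h' (V - A) (V - h ` A)"
    using assms(1) by (metis finite_Diff finite_same_card_bij)
  define g where "g x = (if x \<in> A then h x else if x \<in> V then h' x else x)" for x
  have "bij_betw g (A \<union> (V - A)) (h ` A \<union> (V - h ` A))"
  proof (rule bij_betw_combine)
    show "bij_betw g A (h ` A)"
      using inj_on_imp_bij_betw[OF assms(3)] by (subst bij_betw_cong[of _ _ h]) (auto simp: g_def)
    show "bij_betw g (V - A) (V - h ` A)"
      using h' by (subst bij_betw_cong[of _ _ h']) (auto simp: g_def)
  qed auto
  moreover have "A \<union> (V - A) = V" "h ` A \<union> (V - h ` A) = V" using assms by auto
  ultimately have "g permutes V"
    using assms(2) by (intro bij_imp_permutes) (auto simp: g_def)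
  then show ?thesis using that by (simp add: g_def)
qed

lemma sym_group_pow: "f [^]\<^bsub>sym_group n\<^esub> (j::nat) = f ^^ j"
  by (induction j) (auto simp: sym_group_one sym_group_mult fun_eq_iff funpow_swap1)

text \<open>By the universal property a homomorphism is the same as a tuple of generator images, so
  under the uniform distribution the generators act by independent uniform elements of
  \<open>kperms\<close>. Probabilities are estimated by counting such tuples.\<close>

lemma Hom_unif_bij:
  assumes "0 < k"
  shows "bij_betw (\<lambda>\<sigma>. \<lambda>i\<in>{1..d}. \<sigma> (gen d k i)) (Hom_unif d k n) ({1..d} \<rightarrow>\<^sub>E kperms k n)"
  unfolding bij_betw_def
proof
  let ?F = "\<lambda>\<sigma>. \<lambda>i\<in>{1..d}. \<sigma> (gen d k i)"
  interpret G: group "\<Gamma> d k" by (rule group_\<Gamma>[OF assms])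
  interpret S: group "sym_group n" by (rule sym_group_is_group)
  show "inj_on ?F (Hom_unif d k n)"
  proof (rule inj_onI)
    fix \<sigma> \<tau> assume st: "\<sigma> \<in> Hom_unif d k n" "\<tau> \<in> Hom_unif d k n" "?F \<sigma> = ?F \<tau>"
    then have gens: "\<sigma> (gen d k i) = \<tau> (gen d k i)" if "i \<in> {1..d}" for i
      using that by (metis restrict_apply')
    have hom: "\<sigma> \<in> hom (\<Gamma> d k) (sym_group n)" "\<tau> \<in> hom (\<Gamma> d k) (sym_group n)"
      using st by (auto simp: Hom_unif_def)
    have "\<sigma> (word_class d k u) = \<tau> (word_class d k u)" if "set u \<subseteq> {1..d}" for u
      using that
    proof (induction u)
      case Nil
      show ?case unfolding one_\<Gamma>[symmetric] using hom_one[OF hom(1)] hom_one[OF hom(2)]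
        by (simp add: G.is_group S.is_group)
    next
      case (Cons i u)
      have "word_class d k (i # u) = gen d k i \<otimes>\<^bsub>\<Gamma> d k\<^esub> word_class d k u"
        unfolding gen_def by (subst mult_\<Gamma>) (use Cons.prems in auto)
      moreover have "gen d k i \<in> carrier (\<Gamma> d k)" "word_class d k u \<in> carrier (\<Gamma> d k)"
        using Cons.prems by (auto intro!: gen_closed simp: carrier_\<Gamma>[of d k, symmetric])
          (auto simp: carrier_\<Gamma>)
      ultimately show ?case using Cons gens[of i] hom_mult[OF hom(1)] hom_mult[OF hom(2)] by simp
    qed
    then have "\<sigma> g = \<tau> g" if "g \<in> carrier (\<Gamma> d k)" for g using that by (auto simp: carrier_\<Gamma>)
    moreover have "\<sigma> \<in> extensional (carrier (\<Gamma> d k))" "\<tau> \<in> extensional (carrier (\<Gamma> d k))"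
      using st by (auto simp: Hom_unif_def)
    ultimately show "\<sigma> = \<tau>" by (rule extensionalityI[rotated 2])
  qed
  show "?F ` Hom_unif d k n = ({1..d} \<rightarrow>\<^sub>E kperms k n)"
  proof
    show "?F ` Hom_unif d k n \<subseteq> ({1..d} \<rightarrow>\<^sub>E kperms k n)"
    proof (clarify, rule restrict_PiE_iff[THEN iffD2], rule ballI)
      fix \<sigma> i assume "\<sigma> \<in> Hom_unif d k n" "i \<in> {1..d}"
      then show "\<sigma> (gen d k i) \<in> kperms k n"
        using hom_in_carrier[of \<sigma> "\<Gamma> d k" "sym_group n" "gen d k i"]
        by (auto simp: Hom_unif_def kperms_def sym_group_carrier gen_closed)
    qed
    show "({1..d} \<rightarrow>\<^sub>E kperms k n) \<subseteq> ?F ` Hom_unif d k n"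
    proof
      fix f assume f: "f \<in> {1..d} \<rightarrow>\<^sub>E kperms k n"
      have fi: "f i \<in> kperms k n" if "i \<in> {1..d}" for i using f that by auto
      obtain h where h: "h \<in> hom (\<Gamma> d k) (sym_group n)" "\<forall>i\<in>{1..d}. h (gen d k i) = f i"
      proof -
        have "f i \<in> carrier (sym_group n)" "f i [^]\<^bsub>sym_group n\<^esub> k = \<one>\<^bsub>sym_group n\<^esub>"
          if "i \<in> {1..d}" for i
          using kperms_permutes[OF fi[OF that]] kperms_pow_id[OF fi[OF that]]
          by (simp_all only: sym_group_carrier sym_group_pow sym_group_one)
        from \<Gamma>_universal[OF sym_group_is_group assms, of d f n, OF this] show ?thesis using that by blast
      qed
      define \<sigma> where "\<sigma> = restrict h (carrier (\<Gamma> d k))"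
      have "\<sigma> \<in> hom (\<Gamma> d k) (sym_group n)"
        using h(1) G.m_closed by (auto simp: hom_def \<sigma>_def)
      moreover have sg: "\<sigma> (gen d k i) = f i" if "i \<in> {1..d}" for i
        using h(2) that gen_closed[OF that] by (simp add: \<sigma>_def)
      ultimately have "\<sigma> \<in> Hom_unif d k n"
        using card_orbit[OF fi] sg by (auto simp: Hom_unif_def) (simp add: \<sigma>_def)
      moreover have "?F \<sigma> = f"
        by (rule extensionalityI[of _ "{1..d}"]) (use f sg in \<open>auto simp: PiE_iff\<close>)
      ultimately show "f \<in> ?F ` Hom_unif d k n" by blast
    qed
  qed
qed

section \<open>Binomial estimates behind the union bounds\<close>

lemma binomial_mult_le: "(a choose x) * (b choose y) \<le> (a + b) choose (x + y)"
proof -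
  have "(a choose x) * (b choose (x + y - x)) \<le> (\<Sum>j\<le>x + y. (a choose j) * (b choose (x + y - j)))"
    by (rule member_le_sum) auto
  then show ?thesis by (simp add: vandermonde)
qed

text \<open>Choosing \<open>L\<close> points in each of \<open>k\<close> blocks of size
  \<open>M\<close> is one way of choosing \<open>k * L\<close> points among
  \<open>k * M\<close>.\<close>

lemma binomial_power_le: "(M choose L) ^ k \<le> (k * M) choose (k * L)"
proof (induction k)
  case (Suc k)
  have "(M choose L) ^ Suc k \<le> (M choose L) * ((k * M) choose (k * L))"
    using Suc by simp
  also have "\<dots> \<le> (M + k * M) choose (L + k * L)" by (rule binomial_mult_le)
  finally show ?case by simp
qed simp

text \<open>Exponential weights: since \<open>t \<le> 1\<close>, the factor \<open>t ^ W\<close> is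
  at most \<open>t ^ w\<close> for every term of the sum, and the weighted sum is bounded by the
  binomial expansion of \<open>(t + 1) ^ n\<close>.\<close>

lemma sum_binomial_le:
  fixes t :: real
  assumes "0 < t" "t \<le> 1"
  shows "(\<Sum>w\<le>W. real (n choose w)) \<le> exp (t * n) / t ^ W"
proof -
  have "(\<Sum>w\<le>W. real (n choose w)) * t ^ W = (\<Sum>w\<le>W. real (n choose w) * t ^ W)"
    by (simp add: sum_distrib_right)
  also have "\<dots> \<le> (\<Sum>w\<le>W. real (n choose w) * t ^ w)"
    using assms by (intro sum_mono mult_left_mono power_decreasing) auto
  \<comment> \<open>The range up to \<open>n + W\<close> contains both \<open>{..W}\<close> and
    \<open>{..n}\<close>; beyond \<open>n\<close> the binomials vanish.\<close>
  also have "\<dots> \<le> (\<Sum>w\<le>n + W. real (n choose w) * t ^ w)"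
    using assms by (intro sum_mono2) auto
  also have "\<dots> = (\<Sum>w\<le>n. real (n choose w) * t ^ w)"
    by (intro sum.mono_neutral_right) auto
  also have "\<dots> = (t + 1) ^ n"
    using binomial_ring[of t 1 n] by simp
  also have "\<dots> \<le> exp t ^ n"
    using assms exp_ge_add_one_self[of t] by (intro power_mono) (auto simp: add.commute)
  also have "\<dots> = exp (t * n)" by (rule exp_of_nat2_mult[symmetric])
  finally show ?thesis using assms by (simp add: field_simps)
qed

text \<open>Bounds the number of light words in a first moment argument by the square root of an
  inverse probability, so that a square root is left over. With \<open>y = M / L \<ge> 2\<close> the
  left side is at most the exponential of
  \<open>L * (2 * a * (1 + ln (k / a)) + 2 * a * ln y)\<close>, while the right side is at least
  \<open>y ^ L\<close>.\<close>

lemma small_sets_count: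
  assumes "0 < k"
  obtains a :: real where "0 < a"
    "\<And>M L W. 0 < L \<Longrightarrow> 2 * L \<le> M \<Longrightarrow> real W \<le> a * L \<Longrightarrow>
       (\<Sum>w\<le>W. real ((k * M) choose w))\<^sup>2 \<le> real (M choose L)"
proof -
  \<comment> \<open>\<open>a\<close> is taken so small that the term without \<open>y\<close> stays
    below \<open>ln 2 / 2 \<le> ln y / 2\<close>; \<open>a \<le> 1 / 4\<close> keeps the other term
    at most \<open>ln y / 2\<close>.\<close>
  have "((\<lambda>a. 2 * a * (1 + ln (real k / a))) \<longlongrightarrow> 0) (at_right 0)"
    using assms by real_asymp
  then have "\<forall>\<^sub>F a in at_right 0. 2 * a * (1 + ln (real k / a)) < ln 2 / 2"
    by (rule order_tendstoD) simp
  moreover have "\<forall>\<^sub>F a in at_right (0::real). 0 < a \<and> a \<le> 1 / 4"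
    by (auto simp: eventually_at_right_field intro!: exI[of _ "1/4"])
  ultimately have "\<forall>\<^sub>F a in at_right 0. 2 * a * (1 + ln (real k / a)) < ln 2 / 2 \<and> 0 < a \<and> a \<le> 1 / 4"
    by (rule eventually_conj)
  then obtain a where a: "2 * a * (1 + ln (real k / a)) < ln 2 / 2" "0 < a" "a \<le> 1 / 4"
    using eventually_happens trivial_limit_at_right_real by blast
  have "(\<Sum>w\<le>W. real ((k * M) choose w))\<^sup>2 \<le> real (M choose L)"
    if L: "0 < L" "2 * L \<le> M" "real W \<le> a * L" for M L W
  proof -
    define y where "y = real M / real L"
    have "real (2 * L) \<le> real M" using L(2) by (rule of_nat_mono)
    then have y: "y \<ge> 2" using L(1) by (simp add: y_def field_simps)
    have M: "M > 0" using L by simp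
    \<comment> \<open>This weight makes \<open>t * (k * M) = a * L\<close>, which is the bound on
      \<open>W\<close>.\<close>
    define t where "t = a * L / (k * M)"
    have t0: "0 < t" using a L M assms by (simp add: t_def)
    have "a * real L \<le> 1 * real L" using a by (intro mult_right_mono) auto
    also have "\<dots> \<le> real (1 * M)" using L by simp
    also have "\<dots> \<le> real (k * M)" using assms by (intro of_nat_mono mult_right_mono) auto
    finally have t1: "t \<le> 1" using assms M by (simp add: t_def field_simps)
    have "(\<Sum>w\<le>W. real ((k * M) choose w)) \<le> exp (t * (k * M)) / t ^ W"
      using sum_binomial_le[OF t0 t1, where W = W and n = "k * M"] by simp
    also have "exp (t * (k * M)) = exp (a * L)" using M assms by (simp add: t_def)
    also have "exp (a * L) / t ^ W = exp (a * L) * exp (W * (- ln t))"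
      using t0 by (simp add: exp_minus exp_of_nat_mult field_simps)
    also have "\<dots> \<le> exp (a * L) * exp (a * L * (- ln t))"
      using t0 t1 L(3) by (intro mult_left_mono exp_le_cancel_iff[THEN iffD2] mult_right_mono) auto
    also have "- ln t = ln (k / a) + ln y"
      using a L M assms by (simp add: t_def y_def ln_div ln_mult)
    also have "exp (a * L) * exp (a * L * (ln (k / a) + ln y)) = exp (L * (a * (1 + ln (k / a)) + a * ln y))"
      by (simp add: exp_add[symmetric] algebra_simps)
    finally have "(\<Sum>w\<le>W. real ((k * M) choose w))\<^sup>2 \<le> (exp (L * (a * (1 + ln (k / a)) + a * ln y)))\<^sup>2"
      by (intro power_mono sum_nonneg) auto
    also have "\<dots> = exp (L * (2 * a * (1 + ln (k / a)) + 2 * a * ln y))"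
      by (simp add: power2_eq_square exp_add[symmetric] algebra_simps)
    also have "\<dots> \<le> exp (L * ln y)"
    proof -
      have "2 * a * ln y \<le> ln y / 2" using a y by (simp add: field_simps mult_right_mono)
      moreover have "ln 2 \<le> ln y" using y by simp
      ultimately have "2 * a * (1 + ln (k / a)) + 2 * a * ln y \<le> ln y" using a(1) by linarith
      then show ?thesis by (auto intro: mult_left_mono)
    qed
    also have "\<dots> = y ^ L" using y by (simp add: exp_of_nat_mult)
    also have "\<dots> \<le> real (M choose L)"
      unfolding y_def by (rule binomial_ge_n_over_k_pow_k) (use L in simp)
    finally show ?thesis .
  qed
  then show ?thesis using a that by blast
qed

lemma binomial_ge_linear:
  assumes "0 < L" "2 * L \<le> M"
  shows "M \<le> M choose L"
  using binomial_mono[of 1 L M] assms by simp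

lemma binomial_ge_two_power:
  assumes "0 < L" "2 * L \<le> M"
  shows "2 ^ L \<le> real (M choose L)"
proof -
  have "real (2 * L) \<le> real M" using assms(2) by (rule of_nat_mono)
  then have "(2::real) ^ L \<le> (real M / real L) ^ L"
    using assms(1) by (intro power_mono) (auto simp: field_simps)
  also have "\<dots> \<le> real (M choose L)" by (rule binomial_ge_n_over_k_pow_k) (use assms in simp)
  finally show ?thesis .
qed

text \<open>Of the two factors \<open>B powr (- 1 / 4)\<close> one is spent on decay in
  \<open>M\<close>, the other on summability over \<open>L\<close>.\<close>

lemma inverse_sqrt_binomial_le:
  assumes "0 < L" "2 * L \<le> M"
  shows "1 / sqrt (real (M choose L)) \<le> real M powr (- 1 / 4) * (2 powr (- 1 / 4)) ^ L"
proof -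
  define B where "B = real (M choose L)"
  have M: "0 < real M" using assms by simp
  have B1: "real M \<le> B" using binomial_ge_linear[OF assms] by (simp add: B_def)
  have B2: "2 ^ L \<le> B" using binomial_ge_two_power[OF assms] by (simp add: B_def)
  have B: "0 < B" using M B1 by simp
  have "1 / sqrt B = B powr (- 1 / 4) * B powr (- 1 / 4)"
    using B by (simp add: powr_add[symmetric] powr_half_sqrt powr_minus_divide)
  also have "\<dots> \<le> real M powr (- 1 / 4) * (2 ^ L) powr (- 1 / 4)"
    using M B1 B2 by (intro mult_mono powr_mono2') auto
  also have "(2 ^ L) powr (- 1 / 4) = ((2::real) powr (- 1 / 4)) ^ L"
    by (simp add: powr_realpow[symmetric] powr_powr mult.commute)
  finally show ?thesis by (simp add: B_def)
qed

lemma summable_poly_geometric: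
  fixes q :: real
  assumes "0 < q" "q < 1"
  shows "summable (\<lambda>L. real (L + 1) ^ d * q ^ L)"
proof (rule summable_comparison_test_bigo[where g = "\<lambda>L. (sqrt q) ^ L"])
  show "summable (\<lambda>L. norm (sqrt q ^ L))"
    using assms by (auto intro: summable_geometric)
  have "sqrt q ^ L * sqrt q ^ L = q ^ L" for L
    using assms by (simp add: power_mult_distrib[symmetric])
  moreover have "((\<lambda>L. real (L + 1) ^ d * (sqrt q) ^ L) \<longlongrightarrow> 0) sequentially"
    using assms by real_asymp
  ultimately show "(\<lambda>L. real (L + 1) ^ d * q ^ L) \<in> O(\<lambda>L. sqrt q ^ L)"
    using assms
    by (intro bigoI_tendsto[where c = 0]) (auto simp: field_simps simp flip: power_mult_distrib elim!: Lim_transform_eventually)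
qed

text \<open>Put \<open>x = b / M\<close>. Up to \<open>G ^ b\<close> the cube is at most x to the
  power - 5 b / 3, and the squared binomial is at least x to the power - 2 b, which leaves x to the
  power b / 3. Half of this exponent absorbs \<open>G ^ b\<close> because x is small, the other half
  yields the decay in \<open>M\<close>. The cube stands for three colours; the denominator is
  squared because the number of sets cancels one of three factors.\<close>

lemma even_cover_count:
  assumes k: "0 < k"
  obtains \<delta> :: real where "0 < \<delta>" "\<delta> \<le> 1"
    "\<And>M b. 0 < b \<Longrightarrow> real b \<le> \<delta> * M \<Longrightarrow>
       (real (M choose (5 * b div 9)) * 2 ^ (k * (5 * b div 9))) ^ 3 / (real ((k * M) choose b))\<^sup>2
         \<le> real M powr (- 1 / 6) * (real b * (1 / 2) ^ b)"
proof -
  \<comment> \<open>\<open>G\<close> collects, per point of the set, the cubes of the factors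
    \<open>exp 1\<close> and \<open>2 ^ k\<close>.\<close>
  define G :: real where "G = exp 3 * 2 ^ (3 * k)"
  have G: "G \<ge> 1" unfolding G_def using one_le_exp_iff[of 3] one_le_power[of "2::real"]
    by (metis (full_types) mult_mono' mult_1 one_le_numeral zero_le_one zero_le_numeral)
  \<comment> \<open>Chosen so that \<open>x \<le> \<delta>\<close> gives
    \<open>x powr (1 / 6) \<le> 1 / (2 * G)\<close>, which turns \<open>G ^ b\<close> into
    \<open>(1 / 2) ^ b\<close>.\<close>
  define \<delta> where "\<delta> = (2 * G) powr - 6"
  have "1 \<le> (2 * G) ^ 6" using G by (intro one_le_power) simp
  then have \<delta>: "0 < \<delta>" "\<delta> \<le> 1" using G by (auto simp: \<delta>_def powr_minus_divide)
  have \<delta>6: "\<delta> powr (1 / 6) = 1 / (2 * G)" using G unfolding \<delta>_def powr_powr by (simp add: powr_minus_divide)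
  have "(real (M choose t) * 2 ^ (k * t)) ^ 3 / (real ((k * M) choose b))\<^sup>2
         \<le> real M powr (- 1 / 6) * (real b * (1 / 2) ^ b)"
    if b: "0 < b" "real b \<le> \<delta> * M" and t: "t = 5 * b div 9" for M b t
  proof -
    have M: "0 < real M" using b \<delta> by (metis mult_zero_right not_less of_nat_0_less_iff of_nat_0_le_iff less_eq_real_def)
    have bM: "real b \<le> real M" using b \<delta> M by (metis dual_order.trans mult_left_le_one_le less_eq_real_def)
    define x where "x = real b / real M"
    have x: "0 < x" "x \<le> 1" "x \<le> \<delta>" using b M bM by (auto simp: x_def field_simps)
    have tb: "real t \<le> 5 * b / 9" "t \<le> b" using t by linarith+
    have "real (M choose t) \<le> (\<Sum>w\<le>t. real (M choose w))" by (rule member_le_sum) auto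
    also have "\<dots> \<le> exp (x * M) / x ^ t" by (rule sum_binomial_le[OF x(1,2)])
    also have "x * M = b" using M by (simp add: x_def)
    also have "exp (real b) / x ^ t = exp b * x powr (- real t)"
      using x by (simp add: powr_minus_divide powr_realpow)
    also have "\<dots> \<le> exp b * x powr (- (5 * b / 9))"
      using x tb by (intro mult_left_mono powr_mono') auto
    finally have 1: "real (M choose t) \<le> exp b * x powr (- (5 * b / 9))" .
    have "(real (M choose t) * 2 ^ (k * t)) ^ 3 \<le> (exp b * x powr (- (5 * b / 9)) * 2 ^ (k * b)) ^ 3"
      using 1 tb(2) by (intro power_mono mult_mono power_increasing) auto
    also have "\<dots> = G ^ b * x powr (- (5 * b / 3))"
      using x by (simp add: G_def power_mult_distrib powr_powr powr_realpow[symmetric] exp_of_nat_mult[symmetric]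
          power_mult[symmetric] powr_powr mult_ac del: powr_realpow)
    finally have 2: "(real (M choose t) * 2 ^ (k * t)) ^ 3 \<le> G ^ b * x powr (- (5 * b / 3))" .
    have "x powr (- real b) = (real M / real b) ^ b"
      using x M b by (simp add: powr_minus_divide powr_realpow x_def power_divide)
    also have "\<dots> \<le> (real (k * M) / real b) ^ b"
      using k b by (intro power_mono divide_right_mono of_nat_mono) auto
    also have "\<dots> \<le> real ((k * M) choose b)"
      by (rule binomial_ge_n_over_k_pow_k) (use mult_le_mono[of 1 k b M] bM k in auto)
    finally have 3: "x powr (- real b) \<le> real ((k * M) choose b)" .
    have "(real (M choose t) * 2 ^ (k * t)) ^ 3 / (real ((k * M) choose b))\<^sup>2
       \<le> G ^ b * x powr (- (5 * b / 3)) / (x powr (- real b))\<^sup>2"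
      using 2 3 x G by (intro frac_le power_mono) auto
    also have "\<dots> = G ^ b * x powr (b / 3)"
    proof -
      have "(x powr (- real b))\<^sup>2 = x powr (- 2 * real b)"
        using x by (simp add: power2_eq_square powr_add[symmetric])
      then have "x powr (- (5 * b / 3)) / (x powr (- real b))\<^sup>2 = x powr (- (5 * b / 3) - - 2 * real b)"
        by (simp only: powr_diff)
      also have "- (5 * b / 3) - - 2 * real b = b / 3" by simp
      finally show ?thesis by (metis times_divide_eq_right)
    qed
    also have "x powr (b / 3) = (x powr (1 / 6)) ^ b * x powr (b / 6)"
      using x by (simp add: powr_realpow[symmetric] powr_powr powr_add[symmetric])
    also have "G ^ b * ((x powr (1 / 6)) ^ b * x powr (b / 6)) \<le> G ^ b * ((1 / (2 * G)) ^ b * x powr (1 / 6))"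
    proof (intro mult_left_mono mult_mono power_mono)
      show "x powr (1 / 6) \<le> 1 / (2 * G)" unfolding \<delta>6[symmetric] using x by (intro powr_mono2) auto
      show "x powr (b / 6) \<le> x powr (1 / 6)" using x b by (intro powr_mono') auto
    qed (use G in auto)
    also have "\<dots> = (1 / 2) ^ b * x powr (1 / 6)" using G by (simp add: power_divide power_mult_distrib)
    also have "x powr (1 / 6) = real M powr (- 1 / 6) * real b powr (1 / 6)"
      using M b by (simp add: x_def powr_divide powr_minus_divide)
    also have "(1 / 2) ^ b * (real M powr (- 1 / 6) * real b powr (1 / 6))
        \<le> (1 / 2) ^ b * (real M powr (- 1 / 6) * real b powr 1)"
      using b by (intro mult_left_mono powr_mono) auto
    finally show ?thesis using b by (simp add: mult_ac)
  qed
  then show ?thesis using that \<delta> by blast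
qed

section \<open>Expansion of the dual code\<close>

definition orbit_closed :: "(nat \<Rightarrow> nat) \<Rightarrow> nat set \<Rightarrow> bool" where
  "orbit_closed p A \<longleftrightarrow> (\<forall>v\<in>A. orbit p v \<subseteq> A)"

lemma orbit_closed_conj_perm:
  assumes "g permutes V" "orbit_closed p A"
  shows "orbit_closed (conj_perm g p) (g ` A)"
  using assms by (auto simp: orbit_closed_def orbit_conj_perm)

lemma card_orbits:
  assumes p: "p \<in> kperms k n" and A: "A \<subseteq> {1..n}" "orbit_closed p A"
  shows "k * card (orbit p ` A) = card A"
proof -
  have U: "\<Union> (orbit p ` A) = A"
    using A(2) self_in_orbit[OF p] by (auto simp: orbit_closed_def)
  have "finite A" using A(1) by (rule finite_subset) simp
  then have "k * card (orbit p ` A) = card (\<Union> (orbit p ` A))"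
  proof (intro card_partition)
    show "finite (\<Union> (orbit p ` A))" using \<open>finite A\<close> by (simp only: U)
    fix c assume "c \<in> orbit p ` A" then show "card c = k" using A card_orbit[OF p] by auto
  next
    fix c1 c2 assume "c1 \<in> orbit p ` A" "c2 \<in> orbit p ` A" "c1 \<noteq> c2"
    then show "c1 \<inter> c2 = {}" using orbit_disjoint[OF p] by blast
  qed auto
  then show ?thesis unfolding U .
qed

lemma orbit_closed_UNIV: "p \<in> kperms k n \<Longrightarrow> orbit_closed p {1..n}"
  unfolding orbit_closed_def by (intro ballI orbit_in)

lemma card_all_orbits: "0 < k \<Longrightarrow> p \<in> kperms k (k * M) \<Longrightarrow> card (orbit p ` {1..k * M}) = M"
  using card_orbits[of p k "k * M" "{1..k * M}"] orbit_closed_UNIV by simp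

text \<open>An invariant set is a union of cycles, of which there are \<open>M\<close> in all, and
  it is recovered from the \<open>m\<close> cycles it consists of.\<close>

lemma card_orbit_closed_sets:
  assumes k: "0 < k" and p: "p \<in> kperms k (k * M)"
  shows "card {A. A \<subseteq> {1..k * M} \<and> card A = k * m \<and> orbit_closed p A} \<le> M choose m"
proof -
  let ?S = "{A. A \<subseteq> {1..k * M} \<and> card A = k * m \<and> orbit_closed p A}"
  let ?O = "orbit p ` {1..k * M}"
  have "card ?S \<le> card {D. D \<subseteq> ?O \<and> card D = m}"
  proof (rule card_inj_on_le[of "(`) (orbit p)"])
    show "inj_on ((`) (orbit p)) ?S"
    proof (rule inj_on_inverseI)
      fix A assume "A \<in> ?S"
      then show "\<Union> (orbit p ` A) = A" using self_in_orbit[OF p] by (auto simp: orbit_closed_def)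
    qed
    show "(`) (orbit p) ` ?S \<subseteq> {D. D \<subseteq> ?O \<and> card D = m}"
    proof
      fix D assume "D \<in> (`) (orbit p) ` ?S"
      then obtain A where A: "A \<subseteq> {1..k * M}" "card A = k * m" "orbit_closed p A" "D = orbit p ` A" by auto
      have "k * card D = k * m" using card_orbits[OF p A(1,3)] A(2,4) by simp
      then show "D \<in> {D. D \<subseteq> ?O \<and> card D = m}" using k A by auto
    qed
  qed simp
  also have "\<dots> = M choose m" by (subst n_subsets) (use card_all_orbits[OF assms] in auto)
  finally show ?thesis .
qed

lemma subset_transitive:
  assumes "A \<subseteq> {1..n::nat}" "B \<subseteq> {1..n}" "card A = card B"
  obtains g where "g permutes {1..n}" "g ` A = B"
proof -
  have fin: "finite A" "finite B" using assms by (auto intro: finite_subset)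
  then obtain h where h: "bij_betw h A B" using assms(3) finite_same_card_bij by blast
  obtain g where g: "g permutes {1..n}" "\<And>a. a \<in> A \<Longrightarrow> g a = h a"
    by (rule extend_to_permutation[of "{1..n}" A h]) (use h assms in \<open>auto simp: bij_betw_def\<close>)
  have "g ` A = B" using h g(2) by (auto simp: bij_betw_def)
  then show ?thesis using that g(1) by blast
qed

text \<open>Averaging over all sets of \<open>k * m\<close> points: a conjugation moves any of them
  to any other, and a single permutation leaves at most \<open>M choose m\<close> of them
  invariant.\<close>

lemma prob_orbit_closed:
  assumes k: "0 < k" and A: "A \<subseteq> {1..k * M}" "card A = k * m"
  shows "real (card {p \<in> kperms k (k * M). orbit_closed p A}) * real ((k * M) choose (k * m))
    \<le> real (card (kperms k (k * M))) * real (M choose m)"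
proof -
  let ?\<A> = "{B. B \<subseteq> {1..k * M} \<and> card B = k * m}"
  have "real (card {p \<in> kperms k (k * M). orbit_closed p A}) * real (card ?\<A>)
    \<le> real (card (kperms k (k * M))) * real (M choose m)"
  proof (rule kperms_averaging)
    fix B assume "B \<in> ?\<A>"
    then obtain g where "g permutes {1..k * M}" "g ` A = B"
      using A by (metis (mono_tags, lifting) mem_Collect_eq subset_transitive)
    then show "\<exists>g. g permutes {1..k * M} \<and>
        (\<forall>p\<in>kperms k (k * M). orbit_closed p A \<longrightarrow> orbit_closed (conj_perm g p) B)"
      using orbit_closed_conj_perm by blast
  next
    fix p assume p: "p \<in> kperms k (k * M)"
    have "card {B \<in> ?\<A>. orbit_closed p B} \<le> M choose m"
      using card_orbit_closed_sets[OF k p, of m] by (simp add: conj_assoc)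
    then show "real (card {B \<in> ?\<A>. orbit_closed p B}) \<le> real (M choose m)" by simp
  qed (use A in auto)
  then show ?thesis by (simp add: n_subsets)
qed

text \<open>\<open>A i\<close> stands for the union of the cycles of colour \<open>i\<close> in a
  sum of checks. Cycles of one colour are disjoint, so the multiplicity of a point is the number of
  colours whose set contains it.\<close>

definition parity_set :: "nat \<Rightarrow> nat set \<Rightarrow> (nat \<Rightarrow> nat set) \<Rightarrow> nat set" where
  "parity_set d V A = {v \<in> V. odd (card {i \<in> {1..d}. v \<in> A i})}"

lemma parity_set_determines:
  assumes j: "j \<in> {1..d}" and eq: "parity_set d V A = parity_set d V B" "\<And>i. i \<in> {1..d} - {j} \<Longrightarrow> A i = B i"
    and sub: "A j \<subseteq> V" "B j \<subseteq> V"
  shows "A j = B j"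
proof -
  have *: "{i \<in> {1..d}. v \<in> X i} = (if v \<in> X j then insert j {i \<in> {1..d} - {j}. v \<in> X i} else {i \<in> {1..d} - {j}. v \<in> X i})"
    for v and X :: "nat \<Rightarrow> nat set" using j by auto
  have **: "odd (card {i \<in> {1..d}. v \<in> X i}) \<longleftrightarrow> (v \<in> X j \<longleftrightarrow> even (card {i \<in> {1..d} - {j}. v \<in> X i}))"
    for v and X :: "nat \<Rightarrow> nat set" unfolding *[of v X] by auto
  have "v \<in> A j \<longleftrightarrow> v \<in> B j" if v: "v \<in> V" for v
  proof -
    have "{i \<in> {1..d} - {j}. v \<in> A i} = {i \<in> {1..d} - {j}. v \<in> B i}" using eq(2) by blast
    moreover have "odd (card {i \<in> {1..d}. v \<in> A i}) \<longleftrightarrow> odd (card {i \<in> {1..d}. v \<in> B i})"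
      using eq(1) v by (auto simp: parity_set_def)
    ultimately show ?thesis unfolding ** by auto
  qed
  then show ?thesis using sub by blast
qed

text \<open>Once the sum and all sets but one are given, the remaining set is determined. Leaving
  out the index \<open>j\<close> saves one binomial factor; in the application \<open>j\<close> is
  the colour with the largest set.\<close>

lemma card_parity_families:
  assumes j: "j \<in> {1..d}" and fin: "finite V"
  shows "card {A \<in> {1..d} \<rightarrow>\<^sub>E UNIV. (\<forall>i\<in>{1..d}. A i \<subseteq> V \<and> card (A i) = s i) \<and> parity_set d V A = u}
    \<le> (\<Prod>i\<in>{1..d} - {j}. card V choose s i)"
proof -
  let ?S = "{A \<in> {1..d} \<rightarrow>\<^sub>E UNIV. (\<forall>i\<in>{1..d}. A i \<subseteq> V \<and> card (A i) = s i) \<and> parity_set d V A = u}"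
  let ?T = "\<Pi>\<^sub>E i\<in>{1..d} - {j}. {X. X \<subseteq> V \<and> card X = s i}"
  have "card ?S \<le> card ?T"
  proof (rule card_inj_on_le[of "\<lambda>A. restrict A ({1..d} - {j})"])
    show "inj_on (\<lambda>A. restrict A ({1..d} - {j})) ?S"
    proof (rule inj_onI)
      fix A B assume AB: "A \<in> ?S" "B \<in> ?S" "restrict A ({1..d} - {j}) = restrict B ({1..d} - {j})"
      have eq: "A i = B i" if "i \<in> {1..d} - {j}" for i
        using fun_cong[OF AB(3), of i] that by simp
      have "A j = B j"
      proof (rule parity_set_determines[OF j _ eq])
        show "parity_set d V A = parity_set d V B" using AB(1,2) by simp
        show "A j \<subseteq> V" "B j \<subseteq> V" using AB(1,2) j by simp_all
      qed
      then have "A i = B i" if "i \<in> {1..d}" for i using eq that by (cases "i = j") auto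
      then show "A = B" using AB by (intro PiE_ext[of A "{1..d}" "\<lambda>_. UNIV" B]) auto
    qed
    show "(\<lambda>A. restrict A ({1..d} - {j})) ` ?S \<subseteq> ?T"
    proof (rule image_subsetI, rule restrict_PiE_iff[THEN iffD2], rule ballI)
      fix A i assume "A \<in> ?S" "i \<in> {1..d} - {j}"
      then show "A i \<in> {X. X \<subseteq> V \<and> card X = s i}" by simp
    qed
    show "finite ?T" using fin by (intro finite_PiE) auto
  qed
  also have "card ?T = (\<Prod>i\<in>{1..d} - {j}. card {X. X \<subseteq> V \<and> card X = s i})" by (simp add: card_PiE)
  also have "\<dots> = (\<Prod>i\<in>{1..d} - {j}. card V choose s i)" by (simp add: n_subsets fin)
  finally show ?thesis .
qed

text \<open>The number of families cancels the denominators of the probabilities for all colours but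
  \<open>j\<close>. What remains is the product of all \<open>M choose m i\<close> over
  \<open>(k * M) choose (k * m j)\<close>. As \<open>m j\<close> is the largest and at most
  \<open>M / 2\<close>, this is at most \<open>(M choose m j) ^ d / (M choose m j) ^ k\<close>,
  where \<open>d < k\<close> gains one factor.\<close>

lemma count_profile:
  assumes dk: "d < k" and j: "j \<in> {1..d}" and L: "0 < m j" "2 * m j \<le> M" "\<And>i. i \<in> {1..d} \<Longrightarrow> m i \<le> m j"
  shows "real (card {f \<in> {1..d} \<rightarrow>\<^sub>E kperms k (k * M). \<exists>A. (\<forall>i\<in>{1..d}. A i \<subseteq> {1..k * M} \<and> card (A i) = k * m i
      \<and> orbit_closed (f i) (A i)) \<and> parity_set d {1..k * M} A = u})
    \<le> real (card (kperms k (k * M))) ^ d / real (M choose m j)"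
proof -
  let ?C = "kperms k (k * M)" and ?V = "{1..k * M}"
  let ?\<A> = "{A \<in> {1..d} \<rightarrow>\<^sub>E UNIV. (\<forall>i\<in>{1..d}. A i \<subseteq> ?V \<and> card (A i) = k * m i) \<and> parity_set d ?V A = u}"
  let ?B = "\<lambda>A. \<Pi>\<^sub>E i\<in>{1..d}. {p \<in> ?C. orbit_closed p (A i)}"
  have k: "0 < k" using dk by simp
  have "finite ({1..d} \<rightarrow>\<^sub>E Pow ?V)" by (rule finite_PiE) auto
  then have fin\<A>: "finite ?\<A>"
  proof (rule finite_subset[rotated], intro subsetI)
    fix A assume "A \<in> ?\<A>"
    then show "A \<in> {1..d} \<rightarrow>\<^sub>E Pow ?V" unfolding PiE_iff by blast
  qed
  have finB: "finite (?B A)" for A by (intro finite_PiE) (auto simp: finite_kperms)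
  have pos: "real ((k * M) choose (k * m i)) > 0" if "i \<in> {1..d}" for i
    using L(2) L(3)[OF that] by (simp add: zero_less_binomial)
  have "card {f \<in> {1..d} \<rightarrow>\<^sub>E ?C. \<exists>A. (\<forall>i\<in>{1..d}. A i \<subseteq> ?V \<and> card (A i) = k * m i
      \<and> orbit_closed (f i) (A i)) \<and> parity_set d ?V A = u} \<le> card (\<Union>A\<in>?\<A>. ?B A)"
  proof (rule card_mono)
    show "finite (\<Union>A\<in>?\<A>. ?B A)" using fin\<A> finB by blast
    show "{f \<in> {1..d} \<rightarrow>\<^sub>E ?C. \<exists>A. (\<forall>i\<in>{1..d}. A i \<subseteq> ?V \<and> card (A i) = k * m i
      \<and> orbit_closed (f i) (A i)) \<and> parity_set d ?V A = u} \<subseteq> (\<Union>A\<in>?\<A>. ?B A)"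
    proof
      fix f assume "f \<in> {f \<in> {1..d} \<rightarrow>\<^sub>E ?C. \<exists>A. (\<forall>i\<in>{1..d}. A i \<subseteq> ?V \<and> card (A i) = k * m i
      \<and> orbit_closed (f i) (A i)) \<and> parity_set d ?V A = u}"
      then obtain A where f: "f \<in> {1..d} \<rightarrow>\<^sub>E ?C" and A: "\<forall>i\<in>{1..d}. A i \<subseteq> ?V \<and> card (A i) = k * m i
          \<and> orbit_closed (f i) (A i)" "parity_set d ?V A = u" by blast
      have "parity_set d ?V (restrict A {1..d}) = parity_set d ?V A"
      proof -
        have "{i \<in> {1..d}. v \<in> restrict A {1..d} i} = {i \<in> {1..d}. v \<in> A i}" for v by auto
        then show ?thesis by (simp add: parity_set_def)
      qed
      then have "restrict A {1..d} \<in> ?\<A>" using A by auto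
      moreover have "f \<in> ?B (restrict A {1..d})" using f A by (auto simp: PiE_iff)
      ultimately show "f \<in> (\<Union>A\<in>?\<A>. ?B A)" by blast
    qed
  qed
  also have "\<dots> \<le> (\<Sum>A\<in>?\<A>. card (?B A))" by (rule card_UN_le[OF fin\<A>])
  finally have "real (card {f \<in> {1..d} \<rightarrow>\<^sub>E ?C. \<exists>A. (\<forall>i\<in>{1..d}. A i \<subseteq> ?V \<and> card (A i) = k * m i
      \<and> orbit_closed (f i) (A i)) \<and> parity_set d ?V A = u}) \<le> (\<Sum>A\<in>?\<A>. real (card (?B A)))"
    by (simp only: of_nat_sum[symmetric] of_nat_le_iff)
  also have "\<dots> \<le> (\<Sum>A\<in>?\<A>. \<Prod>i\<in>{1..d}. real (card ?C) * real (M choose m i) / real ((k * M) choose (k * m i)))"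
  proof (rule sum_mono)
    fix A assume A: "A \<in> ?\<A>"
    have "real (card (?B A)) = (\<Prod>i\<in>{1..d}. real (card {p \<in> ?C. orbit_closed p (A i)}))"
      by (simp add: card_PiE)
    also have "\<dots> \<le> (\<Prod>i\<in>{1..d}. real (card ?C) * real (M choose m i) / real ((k * M) choose (k * m i)))"
    proof (rule prod_mono, intro conjI)
      fix i assume i: "i \<in> {1..d}"
      show "real (card {p \<in> ?C. orbit_closed p (A i)})
          \<le> real (card ?C) * real (M choose m i) / real ((k * M) choose (k * m i))"
        using prob_orbit_closed[OF k, of "A i" M "m i"] A i pos[OF i] by (simp add: pos_le_divide_eq)
    qed simp
    finally show "real (card (?B A))
       \<le> (\<Prod>i\<in>{1..d}. real (card ?C) * real (M choose m i) / real ((k * M) choose (k * m i)))" .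
  qed
  also have "\<dots> = real (card ?\<A>) * (\<Prod>i\<in>{1..d}. real (card ?C) * real (M choose m i) / real ((k * M) choose (k * m i)))"
    by simp
  also have "\<dots> \<le> (\<Prod>i\<in>{1..d} - {j}. real ((k * M) choose (k * m i))) *
      (\<Prod>i\<in>{1..d}. real (card ?C) * real (M choose m i) / real ((k * M) choose (k * m i)))"
    using of_nat_mono[OF card_parity_families[OF j, of ?V "\<lambda>i. k * m i" u], where 'a = real]
    by (intro mult_right_mono prod_nonneg) auto
  also have "\<dots> = (\<Prod>i\<in>{1..d} - {j}. real ((k * M) choose (k * m i)) *
      (real (card ?C) * real (M choose m i) / real ((k * M) choose (k * m i)))) *
      (real (card ?C) * real (M choose m j) / real ((k * M) choose (k * m j)))"
    unfolding prod.remove[OF finite_atLeastAtMost j] prod.distrib by (simp only: mult_ac)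
  also have "\<dots> = (\<Prod>i\<in>{1..d} - {j}. real (card ?C) * real (M choose m i)) *
      (real (card ?C) * real (M choose m j) / real ((k * M) choose (k * m j)))"
  proof -
    have "real ((k * M) choose (k * m i)) * (real (card ?C) * real (M choose m i) / real ((k * M) choose (k * m i)))
        = real (card ?C) * real (M choose m i)" if "i \<in> {1..d} - {j}" for i
      using pos[of i] that by simp
    then have "(\<Prod>i\<in>{1..d} - {j}. real ((k * M) choose (k * m i)) *
        (real (card ?C) * real (M choose m i) / real ((k * M) choose (k * m i))))
      = (\<Prod>i\<in>{1..d} - {j}. real (card ?C) * real (M choose m i))"
      by (rule prod.cong[OF HOL.refl])
    then show ?thesis by (simp only:)
  qed
  also have "\<dots> = (\<Prod>i\<in>{1..d}. real (card ?C) * real (M choose m i)) / real ((k * M) choose (k * m j))"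
    unfolding prod.remove[OF finite_atLeastAtMost j] by (simp only: mult_ac times_divide_eq_right)
  also have "\<dots> \<le> (\<Prod>i\<in>{1..d}. real (card ?C) * real (M choose m j)) / real (M choose m j) ^ k"
  proof (rule frac_le)
    show "(\<Prod>i\<in>{1..d}. real (card ?C) * real (M choose m i)) \<le> (\<Prod>i\<in>{1..d}. real (card ?C) * real (M choose m j))"
    proof (rule prod_mono, intro conjI mult_left_mono)
      fix i assume "i \<in> {1..d}"
      then show "real (M choose m i) \<le> real (M choose m j)"
        using binomial_mono[OF L(3) L(2)] by simp
    qed auto
    show "real (M choose m j) ^ k \<le> real ((k * M) choose (k * m j))"
      using binomial_power_le[of M "m j" k] by (metis of_nat_le_iff of_nat_power)
    show "0 < real (M choose m j) ^ k" using L(2) by (simp add: zero_less_binomial)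
  qed (auto intro: prod_nonneg)
  also have "\<dots> = real (card ?C) ^ d * (real (M choose m j) ^ d / real (M choose m j) ^ k)"
    by (simp add: power_mult_distrib)
  also have "\<dots> \<le> real (card ?C) ^ d * (1 / real (M choose m j))"
  proof (rule mult_left_mono)
    have c: "real (M choose m j) \<ge> 1" using L(2) by (simp add: Suc_le_eq zero_less_binomial)
    have "real (M choose m j) ^ d * real (M choose m j) \<le> real (M choose m j) ^ k"
      using power_increasing[OF _ c, of "Suc d" k] dk by (simp add: mult.commute)
    moreover have pos: "0 < real (M choose m j)" using c by linarith
    ultimately have "real (M choose m j) ^ d * real (M choose m j) / real (M choose m j) ^ k \<le> 1"
      by (simp only: divide_le_eq_1_pos zero_less_power)
    then have "real (M choose m j) ^ d * real (M choose m j) / real (M choose m j) ^ k / real (M choose m j)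
        \<le> 1 / real (M choose m j)"
      using pos by (intro divide_right_mono) auto
    then show "real (M choose m j) ^ d / real (M choose m j) ^ k \<le> 1 / real (M choose m j)"
      using pos by (metis nonzero_mult_div_cancel_right order_less_irrefl times_divide_eq_left)
  qed simp
  finally show ?thesis by simp
qed

text \<open>The sets are confined to half of the points because replacing one by its complement adds
  the all-ones vector to the sum. For the same reason the sum is also kept away from full weight: an
  odd number of such replacements complements it.\<close>

definition dual_expanding :: "nat \<Rightarrow> nat \<Rightarrow> real \<Rightarrow> (nat \<Rightarrow> nat \<Rightarrow> nat) \<Rightarrow> bool" where
  "dual_expanding d n c f \<longleftrightarrow>
     (\<forall>A. (\<forall>i\<in>{1..d}. A i \<subseteq> {1..n} \<and> orbit_closed (f i) (A i) \<and> 2 * card (A i) \<le> n) \<longrightarrow>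
        c * real (\<Sum>i\<in>{1..d}. card (A i)) \<le> real (card (parity_set d {1..n} A)) \<and>
        real (card (parity_set d {1..n} A)) \<le> real n - c * real (\<Sum>i\<in>{1..d}. card (A i)))"

lemma card_subsets_le:
  "real (card {u. u \<subseteq> {1..n::nat} \<and> card u \<le> W}) \<le> (\<Sum>w\<le>W. real (n choose w))"
proof -
  have "{u. u \<subseteq> {1..n} \<and> card u \<le> W} = (\<Union>w\<in>{..W}. {u. u \<subseteq> {1..n} \<and> card u = w})" by auto
  then have "card {u. u \<subseteq> {1..n} \<and> card u \<le> W} \<le> (\<Sum>w\<le>W. card {u. u \<subseteq> {1..n} \<and> card u = w})"
    using card_UN_le[of "{..W}" "\<lambda>w. {u. u \<subseteq> {1..n} \<and> card u = w}"] by simp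
  also have "\<dots> = (\<Sum>w\<le>W. n choose w)" by (simp add: n_subsets)
  finally show ?thesis by (metis of_nat_le_iff of_nat_sum)
qed

lemma card_small_or_cosmall:
  "real (card {u. u \<subseteq> {1..n::nat} \<and> (card u \<le> W \<or> card ({1..n} - u) \<le> W)})
    \<le> 2 * (\<Sum>w\<le>W. real (n choose w))"
proof -
  let ?S = "{u. u \<subseteq> {1..n::nat} \<and> card u \<le> W}"
  have fin: "finite ?S" by simp
  have "{u. u \<subseteq> {1..n::nat} \<and> (card u \<le> W \<or> card ({1..n} - u) \<le> W)} \<subseteq> ?S \<union> (\<lambda>u. {1..n} - u) ` ?S"
  proof
    fix u assume u: "u \<in> {u. u \<subseteq> {1..n::nat} \<and> (card u \<le> W \<or> card ({1..n} - u) \<le> W)}"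
    then have "u = {1..n} - ({1..n} - u)" by auto
    then show "u \<in> ?S \<union> (\<lambda>u. {1..n} - u) ` ?S" using u by blast
  qed
  then have "card {u. u \<subseteq> {1..n::nat} \<and> (card u \<le> W \<or> card ({1..n} - u) \<le> W)} \<le> card (?S \<union> (\<lambda>u. {1..n} - u) ` ?S)"
    using fin by (intro card_mono) auto
  also have "\<dots> \<le> card ?S + card ?S"
    using card_Un_le[of ?S "(\<lambda>u. {1..n} - u) ` ?S"] card_image_le[OF fin, of "\<lambda>u. {1..n} - u"] by linarith
  finally have "real (card {u. u \<subseteq> {1..n::nat} \<and> (card u \<le> W \<or> card ({1..n} - u) \<le> W)}) \<le> 2 * real (card ?S)"
    by simp
  then show ?thesis using card_subsets_le[of n W] by linarith
qed

text \<open>Union bound over the largest number \<open>L\<close> of cycles of one colour, the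
  profile \<open>m\<close> of these numbers and the sum \<open>u\<close>. Each case has probability
  at most \<open>1 / (M choose L)\<close>; there are at most \<open>(L + 1) ^ d\<close> profiles and
  \<open>2 * sqrt (M choose L)\<close> sums, so the total is a convergent series in \<open>L\<close>
  times \<open>M powr (- 1 / 4)\<close>.\<close>

lemma dual_expanding_typical:
  assumes d: "0 < d" and dk: "d < k"
  obtains c K where "0 < c"
    "\<And>M. 0 < M \<Longrightarrow> real (card {f \<in> {1..d} \<rightarrow>\<^sub>E kperms k (k * M). \<not> dual_expanding d (k * M) c f})
      \<le> real (card (kperms k (k * M))) ^ d * (K * real M powr (- 1 / 4))"
proof -
  have k: "0 < k" using dk by simp
  obtain a :: real where a: "0 < a" "\<And>M L W. 0 < L \<Longrightarrow> 2 * L \<le> M \<Longrightarrow> real W \<le> a * L \<Longrightarrow>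
       (\<Sum>w\<le>W. real ((k * M) choose w))\<^sup>2 \<le> real (M choose L)"
    by (rule small_sets_count[OF k]) blast
  \<comment> \<open>The sets \<open>A i\<close> together have at most \<open>d * k * L\<close>
    points, so \<open>c\<close> times their total size is at most \<open>a * L\<close>.\<close>
  define c where "c = a / (d * k)"
  have c: "0 < c" using a d k by (simp add: c_def)
  define q :: real where "q = 2 powr (- 1 / 4)"
  have q: "0 < q" "q < 1" using powr_less_mono[of "- 1 / 4" 0 "2::real"] by (auto simp: q_def)
  define K where "K = 2 * (\<Sum>L. real (L + 1) ^ d * q ^ L)"
  have "real (card {f \<in> {1..d} \<rightarrow>\<^sub>E kperms k (k * M). \<not> dual_expanding d (k * M) c f})
      \<le> real (card (kperms k (k * M))) ^ d * (K * real M powr (- 1 / 4))" if M: "0 < M" for M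
  proof -
    define n where "n = k * M"
    let ?C = "kperms k n" and ?V = "{1..n}"
    define W where "W L = nat \<lfloor>a * real L\<rfloor>" for L :: nat
    define U where "U L = {u. u \<subseteq> ?V \<and> (card u \<le> W L \<or> card (?V - u) \<le> W L)}" for L
    define P where "P L = {m \<in> {1..d} \<rightarrow>\<^sub>E {0..L}. \<exists>j\<in>{1..d}. m j = L}" for L :: nat
    define B where "B m u = {f \<in> {1..d} \<rightarrow>\<^sub>E ?C. \<exists>A. (\<forall>i\<in>{1..d}. A i \<subseteq> ?V \<and> card (A i) = k * m i
      \<and> orbit_closed (f i) (A i)) \<and> parity_set d ?V A = u}" for m u
    have finF: "finite ({1..d} \<rightarrow>\<^sub>E ?C)" by (intro finite_PiE) (auto simp: finite_kperms)
    have finP: "finite (P L)" for L unfolding P_def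
      by (rule finite_subset[of _ "{1..d} \<rightarrow>\<^sub>E {0..L}"]) (auto intro!: finite_PiE)
    have finU: "finite (U L)" for L unfolding U_def by simp
    have Bb: "real (card (B m u)) \<le> real (card ?C) ^ d / real (M choose L)"
      if "m \<in> P L" "L \<in> {1..M div 2}" for m u L
    proof -
      obtain j where j: "j \<in> {1..d}" "m j = L" using \<open>m \<in> P L\<close> by (auto simp: P_def)
      have "m i \<le> L" if "i \<in> {1..d}" for i using \<open>m \<in> P L\<close> that by (auto simp: P_def PiE_iff)
      then show ?thesis
        using count_profile[OF dk j(1), of m M u] j(2) \<open>L \<in> {1..M div 2}\<close>
        unfolding B_def n_def by auto
    qed
    have sub: "{f \<in> {1..d} \<rightarrow>\<^sub>E ?C. \<not> dual_expanding d n c f} \<subseteq> (\<Union>L\<in>{1..M div 2}. \<Union>m\<in>P L. \<Union>u\<in>U L. B m u)"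
    proof
      fix f assume "f \<in> {f \<in> {1..d} \<rightarrow>\<^sub>E ?C. \<not> dual_expanding d n c f}"
      then obtain A where f: "f \<in> {1..d} \<rightarrow>\<^sub>E ?C"
        and A: "\<And>i. i \<in> {1..d} \<Longrightarrow> A i \<subseteq> ?V \<and> orbit_closed (f i) (A i) \<and> 2 * card (A i) \<le> n"
        and bad': "\<not> (c * real (\<Sum>i\<in>{1..d}. card (A i)) \<le> real (card (parity_set d ?V A)) \<and>
          real (card (parity_set d ?V A)) \<le> real n - c * real (\<Sum>i\<in>{1..d}. card (A i)))"
        unfolding dual_expanding_def by blast
      have bad: "real (card (parity_set d ?V A)) < c * real (\<Sum>i\<in>{1..d}. card (A i)) \<or>
          real (card (parity_set d ?V A)) > real n - c * real (\<Sum>i\<in>{1..d}. card (A i))"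
        using bad' by linarith
      define m where "m = (\<lambda>i\<in>{1..d}. card (A i) div k)"
      have cA: "card (A i) = k * m i" if "i \<in> {1..d}" for i
      proof -
        have "k * card (orbit (f i) ` A i) = card (A i)"
          using card_orbits[of "f i" k n "A i"] f A[OF that] that by (auto simp: PiE_iff)
        then have "k dvd card (A i)" by (metis dvd_triv_left)
        then show ?thesis using that by (simp add: m_def)
      qed
      define L where "L = Max (m ` {1..d})"
      have "L \<in> m ` {1..d}" unfolding L_def using d by (intro Max_in) auto
      then obtain j where j: "j \<in> {1..d}" "m j = L" by auto
      have mL: "m i \<le> L" if "i \<in> {1..d}" for i unfolding L_def using that by (intro Max_ge) auto
      have "(\<Sum>i\<in>{1..d}. card (A i)) \<le> (\<Sum>i\<in>{1..d}. k * L)"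
        using cA mL by (intro sum_mono) simp
      then have "(\<Sum>i\<in>{1..d}. card (A i)) \<le> d * (k * L)" by simp
      then have "c * real (\<Sum>i\<in>{1..d}. card (A i)) \<le> c * real (d * (k * L))"
        using c by (intro mult_left_mono of_nat_mono) auto
      also have "\<dots> = a * L" using d k by (simp add: c_def)
      finally have sum: "c * real (\<Sum>i\<in>{1..d}. card (A i)) \<le> a * L" .
      have psub: "parity_set d ?V A \<subseteq> ?V" by (auto simp: parity_set_def)
      have pc: "card (?V - parity_set d ?V A) = n - card (parity_set d ?V A)"
        "card (parity_set d ?V A) \<le> n"
        using psub card_mono[OF _ psub] by (auto simp: card_Diff_subset finite_subset)
      \<comment> \<open>With \<open>L = 0\<close> all sets are empty and both inequalities of
        expansion hold, so a failure needs \<open>L > 0\<close>.\<close>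
      have L0: "0 < L"
      proof (rule ccontr)
        assume "\<not> 0 < L"
        then have "A i = {}" if "i \<in> {1..d}" for i
          using mL[OF that] cA[OF that] A[OF that] finite_subset[of "A i" ?V] by auto
        then have "{i \<in> {1..d}. v \<in> A i} = {}" "(\<Sum>i\<in>{1..d}. card (A i)) = 0" for v by auto
        then have "parity_set d ?V A = {}" "(\<Sum>i\<in>{1..d}. card (A i)) = 0"
          unfolding parity_set_def by (simp_all del: Collect_empty_eq)
        then show False using bad by simp
      qed
      have "2 * (k * L) \<le> k * M" using A[OF j(1)] cA[OF j(1)] j(2) by (simp add: n_def)
      then have LM: "L \<in> {1..M div 2}" using L0 k by (simp add: mult.left_commute[of 2 k])
      have "real (card (parity_set d ?V A)) \<le> a * L \<or> real (card (?V - parity_set d ?V A)) \<le> a * L"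
        using bad sum pc(1) of_nat_diff[OF pc(2), where 'a = real] by linarith
      then have "parity_set d ?V A \<in> U L"
        using psub by (auto simp: U_def W_def le_nat_floor)
      moreover have "m \<in> P L" using mL j by (auto simp: P_def m_def)
      moreover have "f \<in> B m (parity_set d ?V A)" using f A cA unfolding B_def by blast
      ultimately show "f \<in> (\<Union>L\<in>{1..M div 2}. \<Union>m\<in>P L. \<Union>u\<in>U L. B m u)" using LM by blast
    qed
    have cardP: "real (card (P L)) \<le> real (L + 1) ^ d" for L
    proof -
      have "card (P L) \<le> card ({1..d} \<rightarrow>\<^sub>E {0..L})"
        by (intro card_mono finite_PiE) (auto simp: P_def)
      also have "\<dots> = (L + 1) ^ d" by (simp add: card_PiE)
      finally show ?thesis by (metis of_nat_le_iff of_nat_power)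
    qed
    have cardU: "real (card (U L)) \<le> 2 * sqrt (real (M choose L))" if "L \<in> {1..M div 2}" for L
    proof -
      have "real (W L) \<le> a * L" using a by (simp add: W_def)
      then have "(\<Sum>w\<le>W L. real (n choose w))\<^sup>2 \<le> real (M choose L)"
        unfolding n_def using that by (intro a(2)) auto
      then have "(\<Sum>w\<le>W L. real (n choose w)) \<le> sqrt (real (M choose L))" by (rule real_le_rsqrt)
      then show ?thesis using card_small_or_cosmall[of n "W L"] unfolding U_def by linarith
    qed
    have "card {f \<in> {1..d} \<rightarrow>\<^sub>E ?C. \<not> dual_expanding d n c f} \<le> card (\<Union>L\<in>{1..M div 2}. \<Union>m\<in>P L. \<Union>u\<in>U L. B m u)"
    proof (rule card_mono[OF _ sub])
      have "finite (B m u)" for m u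
        by (rule finite_subset[OF _ finF]) (auto simp: B_def)
      then show "finite (\<Union>L\<in>{1..M div 2}. \<Union>m\<in>P L. \<Union>u\<in>U L. B m u)"
        by (intro finite_UN_I finP finU) auto
    qed
    also have "\<dots> \<le> (\<Sum>L\<in>{1..M div 2}. card (\<Union>m\<in>P L. \<Union>u\<in>U L. B m u))"
      by (rule card_UN_le) simp
    also have "\<dots> \<le> (\<Sum>L\<in>{1..M div 2}. \<Sum>m\<in>P L. \<Sum>u\<in>U L. card (B m u))"
      by (intro sum_mono order_trans[OF card_UN_le[OF finP]] card_UN_le[OF finU])
    finally have "real (card {f \<in> {1..d} \<rightarrow>\<^sub>E ?C. \<not> dual_expanding d n c f})
        \<le> (\<Sum>L\<in>{1..M div 2}. \<Sum>m\<in>P L. \<Sum>u\<in>U L. real (card (B m u)))"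
      by (simp only: of_nat_sum[symmetric] of_nat_le_iff)
    also have "\<dots> \<le> (\<Sum>L\<in>{1..M div 2}. \<Sum>m\<in>P L. \<Sum>u\<in>U L. real (card ?C) ^ d / real (M choose L))"
      by (intro sum_mono Bb)
    also have "\<dots> = (\<Sum>L\<in>{1..M div 2}. real (card (P L)) * (real (card (U L)) * (real (card ?C) ^ d / real (M choose L))))"
      by simp
    also have "\<dots> \<le> (\<Sum>L\<in>{1..M div 2}. real (L + 1) ^ d * ((2 * sqrt (real (M choose L))) * (real (card ?C) ^ d / real (M choose L))))"
      by (intro sum_mono mult_mono cardP cardU) auto
    also have "\<dots> \<le> (\<Sum>L\<in>{1..M div 2}. real (card ?C) ^ d * (2 * real M powr (- 1 / 4)) * (real (L + 1) ^ d * q ^ L))"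
    proof (rule sum_mono)
      fix L assume L: "L \<in> {1..M div 2}"
      have "sqrt (real (M choose L)) / real (M choose L) = 1 / sqrt (real (M choose L))"
      proof -
        have "x / (x * x) = 1 / x" for x :: real by (cases "x = 0") auto
        from this[of "sqrt (real (M choose L))"] show ?thesis by simp
      qed
      also have "\<dots> \<le> real M powr (- 1 / 4) * q ^ L"
        unfolding q_def by (rule inverse_sqrt_binomial_le) (use L in auto)
      finally have *: "sqrt (real (M choose L)) / real (M choose L) \<le> real M powr (- 1 / 4) * q ^ L" .
      have "real (L + 1) ^ d * ((2 * sqrt (real (M choose L))) * (real (card ?C) ^ d / real (M choose L)))
          = real (L + 1) ^ d * 2 * real (card ?C) ^ d * (sqrt (real (M choose L)) / real (M choose L))"
        by simp
      also have "\<dots> \<le> real (L + 1) ^ d * 2 * real (card ?C) ^ d * (real M powr (- 1 / 4) * q ^ L)"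
        by (intro mult_left_mono *) auto
      finally show "real (L + 1) ^ d * ((2 * sqrt (real (M choose L))) * (real (card ?C) ^ d / real (M choose L)))
         \<le> real (card ?C) ^ d * (2 * real M powr (- 1 / 4)) * (real (L + 1) ^ d * q ^ L)"
        by (simp add: mult_ac)
    qed
    also have "\<dots> = real (card ?C) ^ d * (2 * real M powr (- 1 / 4)) * (\<Sum>L\<in>{1..M div 2}. real (L + 1) ^ d * q ^ L)"
      by (simp add: sum_distrib_left)
    also have "\<dots> \<le> real (card ?C) ^ d * (2 * real M powr (- 1 / 4)) * (\<Sum>L. real (L + 1) ^ d * q ^ L)"
      using q by (intro mult_left_mono sum_le_suminf summable_poly_geometric) auto
    finally show ?thesis by (simp add: K_def n_def mult_ac)
  qed
  then show ?thesis by (rule that[OF c])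
qed

section \<open>Sparse sets\<close>

definition odd_orbits :: "(nat \<Rightarrow> nat) \<Rightarrow> nat \<Rightarrow> nat set \<Rightarrow> nat set set" where
  "odd_orbits p n B = {c \<in> orbit p ` {1..n}. odd (card (c \<inter> B))}"

text \<open>The factor 9 belongs with the count of \<open>5 * b div 9\<close> cycles: if at most
  \<open>b / 9\<close> cycles meet a set of \<open>b\<close> points oddly, then at most
  \<open>(b + b / 9) / 2\<close> cycles meet it at all.\<close>

definition sparse_detecting :: "nat \<Rightarrow> nat \<Rightarrow> real \<Rightarrow> (nat \<Rightarrow> nat \<Rightarrow> nat) \<Rightarrow> bool" where
  "sparse_detecting d n \<beta> f \<longleftrightarrow> (\<forall>B. B \<subseteq> {1..n} \<and> B \<noteq> {} \<and> real (card B) \<le> \<beta> \<longrightarrow>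
     (\<exists>i\<in>{1..d}. card B < 9 * card (odd_orbits (f i) n B)))"

lemma odd_orbits_conj_perm:
  assumes "g permutes {1..n}"
  shows "card (odd_orbits (conj_perm g p) n (g ` B)) = card (odd_orbits p n B)"
proof -
  have inj: "inj g" by (rule permutes_inj[OF assms])
  have "odd_orbits (conj_perm g p) n (g ` B) = (`) g ` odd_orbits p n B"
  proof -
    have "orbit (conj_perm g p) ` {1..n} = orbit (conj_perm g p) ` g ` {1..n}"
      by (simp only: permutes_image[OF assms])
    also have "\<dots> = (`) g ` orbit p ` {1..n}"
      by (simp add: image_image orbit_conj_perm[OF assms])
    finally have "orbit (conj_perm g p) ` {1..n} = (`) g ` orbit p ` {1..n}" .
    moreover have "card (g ` c \<inter> g ` B) = card (c \<inter> B)" for c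
      by (simp add: image_Int[OF inj, symmetric] card_image inj_on_subset[OF inj])
    ultimately show ?thesis unfolding odd_orbits_def by auto
  qed
  then show ?thesis
    using inj by (simp add: card_image inj_on_def inj_image_eq_iff)
qed

text \<open>Every cycle meeting \<open>B\<close> contains two of its points or meets it oddly, so
  twice the number of these cycles is at most \<open>b\<close> plus the number of odd ones, and
  there are at most \<open>t\<close> of them. Hence \<open>B\<close> is a subset of the union of
  some \<open>t\<close> cycles, which has \<open>k * t\<close> points.\<close>

lemma card_even_covered:
  assumes k: "0 < k" and p: "p \<in> kperms k (k * M)" and t: "t = 5 * b div 9" "t \<le> M"
  shows "card {B. B \<subseteq> {1..k * M} \<and> card B = b \<and> 9 * card (odd_orbits p (k * M) B) \<le> b}
    \<le> (M choose t) * 2 ^ (k * t)"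
proof -
  define n where "n = k * M"
  let ?O = "orbit p ` {1..n}"
  have p': "p \<in> kperms k n" using p by (simp add: n_def)
  have cO: "card ?O = M" using card_all_orbits[OF k p] by (simp add: n_def)
  have sub: "{B. B \<subseteq> {1..n} \<and> card B = b \<and> 9 * card (odd_orbits p n B) \<le> b}
      \<subseteq> (\<Union>D\<in>{D. D \<subseteq> ?O \<and> card D = t}. Pow (\<Union>D))"
  proof
    fix B assume "B \<in> {B. B \<subseteq> {1..n} \<and> card B = b \<and> 9 * card (odd_orbits p n B) \<le> b}"
    then have B: "B \<subseteq> {1..n}" "card B = b" "9 * card (odd_orbits p n B) \<le> b" by auto
    define D where "D = {c \<in> ?O. c \<inter> B \<noteq> {}}"
    have finD: "finite D" by (simp add: D_def)
    have finB: "finite B" using B by (auto intro: finite_subset)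
    have BU: "B = (\<Union>c\<in>D. c \<inter> B)" using B self_in_orbit[OF p'] by (auto simp: D_def)
    have "card (\<Union>c\<in>D. c \<inter> B) = (\<Sum>c\<in>D. card (c \<inter> B))"
    proof (rule card_UN_disjoint[OF finD])
      show "\<forall>c1\<in>D. \<forall>c2\<in>D. c1 \<noteq> c2 \<longrightarrow> c1 \<inter> B \<inter> (c2 \<inter> B) = {}"
        using orbit_disjoint[OF p'] unfolding D_def by blast
    qed (use finB in auto)
    then have b: "b = (\<Sum>c\<in>D. card (c \<inter> B))" using BU B(2) by simp
    have odd: "odd_orbits p n B = {c\<in>D. odd (card (c \<inter> B))}"
      unfolding odd_orbits_def D_def by (auto intro!: Collect_cong)
    have "2 * card D = (\<Sum>c\<in>D. 2)" by simp
    also have "\<dots> \<le> (\<Sum>c\<in>D. card (c \<inter> B) + of_bool (odd (card (c \<inter> B))))"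
    proof (rule sum_mono)
      fix c assume "c \<in> D"
      then have "card (c \<inter> B) \<noteq> 0" using finB by (auto simp: D_def)
      then show "2 \<le> card (c \<inter> B) + of_bool (odd (card (c \<inter> B)))"
        by (cases "card (c \<inter> B) = 1") auto
    qed
    also have "\<dots> = b + card (odd_orbits p n B)"
      unfolding odd b using finD by (simp add: sum.distrib Int_def)
    finally have "card D \<le> t" using B(3) t(1) by linarith
    then obtain D' where D': "D \<subseteq> D'" "D' \<subseteq> ?O" "card D' = t"
      using exists_subset_between[of D t ?O] cO t(2) by (auto simp: D_def)
    have "B \<subseteq> \<Union>D" using self_in_orbit[OF p'] B(1) by (auto simp: D_def)
    then have "B \<subseteq> \<Union>D'" using D'(1) by (rule order_trans[OF _ Union_mono])
    then show "B \<in> (\<Union>D\<in>{D. D \<subseteq> ?O \<and> card D = t}. Pow (\<Union>D))"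
      using D' by (intro UN_I[of D']) auto
  qed
  have Ub: "finite (\<Union>D) \<and> card (\<Union>D) \<le> k * t" if DO: "D \<subseteq> ?O" "card D = t" for D
  proof -
    have finD: "finite D" using that by (auto intro: finite_subset)
    have "\<forall>c\<in>D. finite c \<and> card c = k"
    proof
      fix c assume "c \<in> D"
      then obtain v where "v \<in> {1..n}" "c = orbit p v" using DO(1) by blast
      then show "finite c \<and> card c = k" using card_orbit[OF p'] finite_orbit'[OF p'] by simp
    qed
    moreover have "card (\<Union>c\<in>D. c) \<le> (\<Sum>c\<in>D. card c)" by (rule card_UN_le[OF finD])
    ultimately show ?thesis using finD DO by (simp add: mult.commute)
  qed
  have fin: "finite {D. D \<subseteq> ?O \<and> card D = t}" by simp
  have "card {B. B \<subseteq> {1..n} \<and> card B = b \<and> 9 * card (odd_orbits p n B) \<le> b}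
      \<le> card (\<Union>D\<in>{D. D \<subseteq> ?O \<and> card D = t}. Pow (\<Union>D))"
    using sub by (rule card_mono[rotated]) (use Ub fin in auto)
  also have "\<dots> \<le> (\<Sum>D\<in>{D. D \<subseteq> ?O \<and> card D = t}. card (Pow (\<Union>D)))" by (rule card_UN_le[OF fin])
  also have "\<dots> \<le> (\<Sum>D\<in>{D. D \<subseteq> ?O \<and> card D = t}. 2 ^ (k * t))"
    by (rule sum_mono) (use Ub in \<open>auto simp: card_Pow intro!: power_increasing\<close>)
  also have "\<dots> = (M choose t) * 2 ^ (k * t)" using cO by (simp add: n_subsets)
  finally show ?thesis by (simp add: n_def)
qed

lemma prob_even_covered:
  assumes k: "0 < k" and B: "B \<subseteq> {1..k * M}" "card B = b" and t: "t = 5 * b div 9" "t \<le> M"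
  shows "real (card {p \<in> kperms k (k * M). 9 * card (odd_orbits p (k * M) B) \<le> b}) * real ((k * M) choose b)
    \<le> real (card (kperms k (k * M))) * (real (M choose t) * 2 ^ (k * t))"
proof -
  let ?\<A> = "{B. B \<subseteq> {1..k * M} \<and> card B = b}"
  have "real (card {p \<in> kperms k (k * M). 9 * card (odd_orbits p (k * M) B) \<le> b}) * real (card ?\<A>)
    \<le> real (card (kperms k (k * M))) * (real (M choose t) * 2 ^ (k * t))"
  proof (rule kperms_averaging)
    fix B' assume "B' \<in> ?\<A>"
    then obtain g where g: "g permutes {1..k * M}" "g ` B = B'"
      using B by (metis (mono_tags, lifting) mem_Collect_eq subset_transitive)
    then show "\<exists>g. g permutes {1..k * M} \<and> (\<forall>p\<in>kperms k (k * M).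
        9 * card (odd_orbits p (k * M) B) \<le> b \<longrightarrow> 9 * card (odd_orbits (conj_perm g p) (k * M) B') \<le> b)"
      using odd_orbits_conj_perm[OF g(1)] by metis
  next
    fix p assume p: "p \<in> kperms k (k * M)"
    have "card {B \<in> ?\<A>. 9 * card (odd_orbits p (k * M) B) \<le> b} \<le> (M choose t) * 2 ^ (k * t)"
      using card_even_covered[OF k p t] by (simp add: conj_assoc)
    then have "real (card {B \<in> ?\<A>. 9 * card (odd_orbits p (k * M) B) \<le> b}) \<le> real ((M choose t) * 2 ^ (k * t))"
      by (rule of_nat_mono)
    then show "real (card {B \<in> ?\<A>. 9 * card (odd_orbits p (k * M) B) \<le> b}) \<le> real (M choose t) * 2 ^ (k * t)"
      by simp
  qed (use B in auto)
  then show ?thesis by (simp add: n_subsets)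
qed

text \<open>A failing tuple has, for some \<open>B\<close>, few odd cycles in all colours at once.
  By independence this has a probability that is a d-th power, and the number of sets
  \<open>B\<close> cancels one of the factors \<open>1 / (n choose b)\<close>.\<close>

lemma sparse_detecting_typical:
  assumes d: "3 \<le> d" and k: "0 < k"
  obtains \<delta> K :: real where "0 < \<delta>"
    "\<And>M. 0 < M \<Longrightarrow> real (card {f \<in> {1..d} \<rightarrow>\<^sub>E kperms k (k * M). \<not> sparse_detecting d (k * M) (\<delta> * M) f})
      \<le> real (card (kperms k (k * M))) ^ d * (K * real M powr (- 1 / 6))"
proof -
  obtain \<delta> :: real where \<delta>: "0 < \<delta>" "\<delta> \<le> 1" "\<And>M b. 0 < b \<Longrightarrow> real b \<le> \<delta> * M \<Longrightarrow>
       (real (M choose (5 * b div 9)) * 2 ^ (k * (5 * b div 9))) ^ 3 / (real ((k * M) choose b))\<^sup>2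
         \<le> real M powr (- 1 / 6) * (real b * (1 / 2) ^ b)"
    by (rule even_cover_count[OF k]) blast
  \<comment> \<open>\<open>b + 1\<close> dominates the factor \<open>b\<close> and gives the series
    the shape of \<open>summable_poly_geometric\<close>.\<close>
  define K where "K = (\<Sum>b. real (b + 1) ^ 1 * (1 / 2 :: real) ^ b)"
  have "real (card {f \<in> {1..d} \<rightarrow>\<^sub>E kperms k (k * M). \<not> sparse_detecting d (k * M) (\<delta> * M) f})
      \<le> real (card (kperms k (k * M))) ^ d * (K * real M powr (- 1 / 6))" if M: "0 < M" for M
  proof -
    define n where "n = k * M"
    let ?C = "kperms k n"
    have Cpos: "0 < real (card ?C)"
      using kperms_nonempty[OF k, of n] finite_kperms[of k n] by (simp add: n_def card_gt_0_iff)
    define R where "R = {b. 0 < b \<and> real b \<le> \<delta> * M}"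
    have RM: "b \<le> M" if "b \<in> R" for b
    proof -
      have "real b \<le> \<delta> * M" using that by (simp add: R_def)
      also have "\<dots> \<le> 1 * real M" using \<delta> by (intro mult_right_mono) auto
      finally show ?thesis by simp
    qed
    then have finR: "finite R" by (rule_tac finite_subset[of _ "{..M}"]) auto
    define \<B> where "\<B> b = {B. B \<subseteq> {1..n} \<and> card B = b}" for b
    define G where "G B = {p \<in> ?C. 9 * card (odd_orbits p n B) \<le> card B}" for B
    have fin\<B>: "finite (\<B> b)" for b by (simp add: \<B>_def)
    have finG: "finite ({1..d} \<rightarrow>\<^sub>E G B)" for B
      by (intro finite_PiE) (auto simp: G_def finite_kperms)
    have sub: "{f \<in> {1..d} \<rightarrow>\<^sub>E ?C. \<not> sparse_detecting d n (\<delta> * M) f} \<subseteq> (\<Union>b\<in>R. \<Union>B\<in>\<B> b. {1..d} \<rightarrow>\<^sub>E G B)"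
    proof
      fix f assume "f \<in> {f \<in> {1..d} \<rightarrow>\<^sub>E ?C. \<not> sparse_detecting d n (\<delta> * M) f}"
      then obtain B where f: "f \<in> {1..d} \<rightarrow>\<^sub>E ?C" and B: "B \<subseteq> {1..n}" "B \<noteq> {}" "real (card B) \<le> \<delta> * M"
        and B': "\<not> (\<exists>i\<in>{1..d}. card B < 9 * card (odd_orbits (f i) n B))"
        unfolding sparse_detecting_def by blast
      have B4: "9 * card (odd_orbits (f i) n B) \<le> card B" if "i \<in> {1..d}" for i
        using B' that by (simp add: not_less)
      have "card B \<in> R" "B \<in> \<B> (card B)"
        using B by (auto simp: R_def \<B>_def card_gt_0_iff finite_subset)
      moreover have "f \<in> {1..d} \<rightarrow>\<^sub>E G B" using f B4 by (auto simp: G_def PiE_iff)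
      ultimately show "f \<in> (\<Union>b\<in>R. \<Union>B\<in>\<B> b. {1..d} \<rightarrow>\<^sub>E G B)" by blast
    qed
    have summand: "real (card ({1..d} \<rightarrow>\<^sub>E G B)) \<le> real (card ?C) ^ d *
        ((real (M choose (5 * b div 9)) * 2 ^ (k * (5 * b div 9))) / real (n choose b)) ^ 3"
      if b: "b \<in> R" and B: "B \<in> \<B> b" for b B
    proof -
      define r where "r = real (card (G B)) / real (card ?C)"
      have r: "0 \<le> r" "r \<le> 1"
        using Cpos card_mono[OF finite_kperms, of "G B" k n] by (auto simp: r_def G_def)
      have binpos: "0 < real (n choose b)"
      proof -
        have "b \<le> n" using RM[OF b] k unfolding n_def by (metis le_trans mult.commute mult_le_mono1 mult_1 Suc_leI One_nat_def)
        then show ?thesis by (simp add: zero_less_binomial)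
      qed
      have "5 * b div 9 \<le> M" using RM[OF b] by linarith
      then have "real (card (G B)) * real (n choose b)
          \<le> real (card ?C) * (real (M choose (5 * b div 9)) * 2 ^ (k * (5 * b div 9)))"
        using prob_even_covered[OF k, of B M b "5 * b div 9"] B by (simp add: G_def \<B>_def n_def)
      then have rb: "r \<le> (real (M choose (5 * b div 9)) * 2 ^ (k * (5 * b div 9))) / real (n choose b)"
        using Cpos binpos by (simp add: r_def field_simps)
      have "real (card ({1..d} \<rightarrow>\<^sub>E G B)) = (real (card ?C) * r) ^ d"
        using Cpos by (simp add: card_PiE r_def)
      also have "\<dots> = real (card ?C) ^ d * r ^ d" by (rule power_mult_distrib)
      \<comment> \<open>The probability \<open>r\<close> is at most 1, so it suffices to keep three
        of the \<open>d \<ge> 3\<close> factors.\<close>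
      also have "\<dots> \<le> real (card ?C) ^ d * r ^ 3"
        using r d by (intro mult_left_mono power_decreasing) auto
      also have "\<dots> \<le> real (card ?C) ^ d *
        ((real (M choose (5 * b div 9)) * 2 ^ (k * (5 * b div 9))) / real (n choose b)) ^ 3"
        using r rb by (intro mult_left_mono power_mono) auto
      finally show ?thesis .
    qed
    have "card {f \<in> {1..d} \<rightarrow>\<^sub>E ?C. \<not> sparse_detecting d n (\<delta> * M) f} \<le> card (\<Union>b\<in>R. \<Union>B\<in>\<B> b. {1..d} \<rightarrow>\<^sub>E G B)"
      using sub by (rule card_mono[rotated]) (intro finite_UN_I finR fin\<B> finG)
    also have "\<dots> \<le> (\<Sum>b\<in>R. card (\<Union>B\<in>\<B> b. {1..d} \<rightarrow>\<^sub>E G B))" by (rule card_UN_le[OF finR])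
    also have "\<dots> \<le> (\<Sum>b\<in>R. \<Sum>B\<in>\<B> b. card ({1..d} \<rightarrow>\<^sub>E G B))"
      by (intro sum_mono card_UN_le[OF fin\<B>])
    finally have "real (card {f \<in> {1..d} \<rightarrow>\<^sub>E ?C. \<not> sparse_detecting d n (\<delta> * M) f})
        \<le> (\<Sum>b\<in>R. \<Sum>B\<in>\<B> b. real (card ({1..d} \<rightarrow>\<^sub>E G B)))"
      by (simp only: of_nat_sum[symmetric] of_nat_le_iff)
    also have "\<dots> \<le> (\<Sum>b\<in>R. \<Sum>B\<in>\<B> b. real (card ?C) ^ d *
        ((real (M choose (5 * b div 9)) * 2 ^ (k * (5 * b div 9))) / real (n choose b)) ^ 3)"
      by (intro sum_mono summand)
    also have "\<dots> = (\<Sum>b\<in>R. real (n choose b) * (real (card ?C) ^ d *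
        ((real (M choose (5 * b div 9)) * 2 ^ (k * (5 * b div 9))) / real (n choose b)) ^ 3))"
      by (simp add: \<B>_def n_subsets)
    also have "\<dots> = (\<Sum>b\<in>R. real (card ?C) ^ d *
        ((real (M choose (5 * b div 9)) * 2 ^ (k * (5 * b div 9))) ^ 3 / (real (n choose b))\<^sup>2))"
    proof (rule sum.cong)
      fix b
      have "x * (y * (z / x) ^ 3) = y * (z ^ 3 / x\<^sup>2)" for x y z :: real
        by (cases "x = 0") (auto simp: power_divide power3_eq_cube power2_eq_square)
      then show "real (n choose b) * (real (card ?C) ^ d *
        ((real (M choose (5 * b div 9)) * 2 ^ (k * (5 * b div 9))) / real (n choose b)) ^ 3)
        = real (card ?C) ^ d *
        ((real (M choose (5 * b div 9)) * 2 ^ (k * (5 * b div 9))) ^ 3 / (real (n choose b))\<^sup>2)" .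
    qed simp
    also have "\<dots> \<le> (\<Sum>b\<in>R. real (card ?C) ^ d * (real M powr (- 1 / 6) * (real (b + 1) ^ 1 * (1 / 2) ^ b)))"
    proof (intro sum_mono mult_left_mono)
      fix b assume "b \<in> R"
      then have "(real (M choose (5 * b div 9)) * 2 ^ (k * (5 * b div 9))) ^ 3 / (real (n choose b))\<^sup>2
          \<le> real M powr (- 1 / 6) * (real b * (1 / 2) ^ b)"
        unfolding n_def by (intro \<delta>(3)) (auto simp: R_def)
      also have "\<dots> \<le> real M powr (- 1 / 6) * (real (b + 1) ^ 1 * (1 / 2) ^ b)"
        by (intro mult_left_mono mult_right_mono) auto
      finally show "(real (M choose (5 * b div 9)) * 2 ^ (k * (5 * b div 9))) ^ 3 / (real (n choose b))\<^sup>2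
        \<le> real M powr (- 1 / 6) * (real (b + 1) ^ 1 * (1 / 2) ^ b)" .
    qed auto
    also have "\<dots> = real (card ?C) ^ d * (real M powr (- 1 / 6) * (\<Sum>b\<in>R. real (b + 1) ^ 1 * (1 / 2) ^ b))"
      by (simp add: sum_distrib_left)
    also have "\<dots> \<le> real (card ?C) ^ d * (real M powr (- 1 / 6) * K)"
      unfolding K_def using finR summable_poly_geometric[of "1/2" 1]
      by (intro mult_left_mono sum_le_suminf) auto
    finally show ?thesis by (simp add: n_def mult_ac)
  qed
  then show ?thesis by (rule that[OF \<delta>(1)])
qed

section \<open>Short cycles\<close>

text \<open>A cycle in the hypergraph whose edges are the cycles of the permutations. Neighbouring
  colours differ, also across the end of the list, so the conditions on any one permutation concern
  disjoint pairs of vertices, which makes their joint probability easy to bound.\<close>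

definition nice_cycle :: "nat \<Rightarrow> nat \<Rightarrow> (nat \<Rightarrow> nat \<Rightarrow> nat) \<Rightarrow> nat list \<Rightarrow> nat list \<Rightarrow> bool" where
  "nice_cycle d n f cs xs \<longleftrightarrow> (let l = length xs in 2 \<le> l \<and> length cs = l \<and> set cs \<subseteq> {1..d} \<and>
     distinct xs \<and> set xs \<subseteq> {1..n} \<and> (\<forall>a<l. cs ! a \<noteq> cs ! (Suc a mod l)) \<and>
     (\<forall>a<l. xs ! (Suc a mod l) \<in> orbit (f (cs ! a)) (xs ! a)))"

definition cycle_starts :: "nat \<Rightarrow> nat \<Rightarrow> (nat \<Rightarrow> nat \<Rightarrow> nat) \<Rightarrow> nat \<Rightarrow> nat set" where
  "cycle_starts d n f L = {xs ! 0 | cs xs. length xs \<le> L \<and> nice_cycle d n f cs xs}"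

definition distinct_lists :: "nat \<Rightarrow> nat \<Rightarrow> nat list set" where
  "distinct_lists n l = {xs. length xs = l \<and> distinct xs \<and> set xs \<subseteq> {1..n}}"

lemma finite_distinct_lists: "finite (distinct_lists n l)"
  unfolding distinct_lists_def
  by (rule finite_subset[OF _ finite_lists_length_eq[of "{1..n}" l]]) auto

lemma distinct_lists_nth: "xs \<in> distinct_lists n l \<Longrightarrow> a < l \<Longrightarrow> xs ! a \<in> {1..n}"
  using nth_mem[of a xs] unfolding distinct_lists_def by blast

lemma card_distinct_lists_ge:
  assumes "2 * l \<le> n"
  shows "(real n / 2) ^ l \<le> real (card (distinct_lists n l))"
proof -
  have "(real n / 2) ^ l = (\<Prod>i\<in>{n - l + 1..n}. real n / 2)" using assms by simp
  also have "\<dots> \<le> (\<Prod>i\<in>{n - l + 1..n}. real i)"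
    by (rule prod_mono) (use assms in auto)
  also have "\<dots> = real (card (distinct_lists n l))"
    using card_lists_distinct_length_eq[of "{1..n}" l] assms by (simp add: distinct_lists_def)
  finally show ?thesis .
qed

lemma card_distinct_lists_le: "card (distinct_lists n l) \<le> n ^ l"
proof -
  have "card (distinct_lists n l) \<le> card {xs. set xs \<subseteq> {1..n} \<and> length xs = l}"
    by (rule card_mono) (auto simp: distinct_lists_def finite_lists_length_eq)
  also have "\<dots> = n ^ l" by (simp add: card_lists_length_eq)
  finally show ?thesis .
qed

lemma inj_on_Suc_mod: "inj_on (\<lambda>a. Suc a mod l) {..<l}"
proof (rule inj_onI)
  fix a b assume "a \<in> {..<l}" "b \<in> {..<l}" "Suc a mod l = Suc b mod l"
  then show "a = b" by (cases "Suc a = l"; cases "Suc b = l") auto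
qed

text \<open>Positions in \<open>J\<close> are never cyclically adjacent, so the entry after
  \<open>a \<in> J\<close> is one of \<open>k\<close> points determined by the entry at
  \<open>a\<close>, and that entry is itself free.\<close>

lemma card_cycle_lists:
  assumes p: "p \<in> kperms k n" and J: "J \<subseteq> {..<l}" "\<And>a. a \<in> J \<Longrightarrow> Suc a mod l \<notin> J"
  shows "card {xs \<in> distinct_lists n l. \<forall>a\<in>J. xs ! (Suc a mod l) \<in> orbit p (xs ! a)}
    \<le> n ^ (l - card J) * k ^ card J"
proof -
  let ?S = "{xs \<in> distinct_lists n l. \<forall>a\<in>J. xs ! (Suc a mod l) \<in> orbit p (xs ! a)}"
  define J' where "J' = (\<lambda>a. Suc a mod l) ` J"
  define e where "e xs a = (SOME j. j < k \<and> xs ! (Suc a mod l) = (p ^^ j) (xs ! a))" for xs a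
  have finJ: "finite J" using J(1) by (rule finite_subset) simp
  have e: "e xs a < k \<and> xs ! (Suc a mod l) = (p ^^ e xs a) (xs ! a)" if "xs \<in> ?S" "a \<in> J" for xs a
  proof -
    have "xs ! a \<in> {1..n}" using distinct_lists_nth[of xs n l a] that J(1) by blast
    then have "\<exists>j. j < k \<and> xs ! (Suc a mod l) = (p ^^ j) (xs ! a)"
      using that kperms_funpow(3)[OF p, of "xs ! a"] by auto
    then show ?thesis unfolding e_def by (rule someI_ex)
  qed
  have J'l: "J' \<subseteq> {..<l}" using J(1) by (auto simp: J'_def)
  have cardJ': "card J' = card J"
    unfolding J'_def by (rule card_image) (rule inj_on_subset[OF inj_on_Suc_mod J(1)])
  let ?T = "(({..<l} - J') \<rightarrow>\<^sub>E {1..n}) \<times> (J \<rightarrow>\<^sub>E {..<k})"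
  have "card ?S \<le> card ?T"
  proof (rule card_inj_on_le[of "\<lambda>xs. (\<lambda>b\<in>{..<l} - J'. xs ! b, \<lambda>a\<in>J. e xs a)"])
    show "inj_on (\<lambda>xs. (\<lambda>b\<in>{..<l} - J'. xs ! b, \<lambda>a\<in>J. e xs a)) ?S"
    proof (rule inj_onI)
      fix xs ys assume xy: "xs \<in> ?S" "ys \<in> ?S"
        "(\<lambda>b\<in>{..<l} - J'. xs ! b, \<lambda>a\<in>J. e xs a) = (\<lambda>b\<in>{..<l} - J'. ys ! b, \<lambda>a\<in>J. e ys a)"
      have 1: "xs ! b = ys ! b" if "b \<in> {..<l} - J'" for b
        using xy(3) that by (metis (no_types, lifting) prod.inject restrict_apply')
      have 2: "e xs a = e ys a" if "a \<in> J" for a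
        using xy(3) that by (metis (no_types, lifting) prod.inject restrict_apply')
      show "xs = ys"
      proof (rule nth_equalityI)
        show "length xs = length ys" using xy by (simp add: distinct_lists_def)
        fix b assume "b < length xs"
        then have b: "b < l" using xy by (simp add: distinct_lists_def)
        show "xs ! b = ys ! b"
        proof (cases "b \<in> J'")
          case True
          then obtain a where a: "a \<in> J" "b = Suc a mod l" by (auto simp: J'_def)
          have "a \<notin> J'" using a J(2) by (auto simp: J'_def)
          then have "xs ! a = ys ! a" using a J(1) by (intro 1) auto
          then show ?thesis using e[OF xy(1) a(1)] e[OF xy(2) a(1)] 2[OF a(1)] a(2) by metis
        qed (use 1 b in auto)
      qed
    qed
    show "(\<lambda>xs. (\<lambda>b\<in>{..<l} - J'. xs ! b, \<lambda>a\<in>J. e xs a)) ` ?S \<subseteq> ?T"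
    proof (rule image_subsetI)
      fix xs assume xs: "xs \<in> ?S"
      have "xs ! b \<in> {1..n}" if "b < l" for b
        using distinct_lists_nth[of xs n l b] xs that by blast
      then show "(\<lambda>b\<in>{..<l} - J'. xs ! b, \<lambda>a\<in>J. e xs a) \<in> ?T"
        using e[OF xs] by auto
    qed
    show "finite ?T" using finJ by (intro finite_cartesian_product finite_PiE) auto
  qed
  also have "card ?T = n ^ (l - card J) * k ^ card J"
    using J'l finJ by (simp add: card_cartesian_product card_PiE card_Diff_subset finite_subset cardJ')
  finally show ?thesis .
qed

text \<open>Averaging over lists of distinct points, any two of which are related by a permutation.
  The factor \<open>2 ^ l\<close> pays for bounding the number of such lists below by
  \<open>(n / 2) ^ l\<close>.\<close>

lemma prob_cycle_list:
  assumes J: "J \<subseteq> {..<l}" "\<And>a. a \<in> J \<Longrightarrow> Suc a mod l \<notin> J" and xs: "xs \<in> distinct_lists n l"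
    and n: "2 * l \<le> n" "0 < n"
  shows "real (card {p \<in> kperms k n. \<forall>a\<in>J. xs ! (Suc a mod l) \<in> orbit p (xs ! a)})
    \<le> real (card (kperms k n)) * (2 ^ l * (real k / real n) ^ card J)"
proof -
  let ?E = "\<lambda>p xs. \<forall>a\<in>J. xs ! (Suc a mod l) \<in> orbit p (xs ! a)"
  have cJ: "card J \<le> l" using card_mono[OF _ J(1)] by simp
  have "real (card {p \<in> kperms k n. ?E p xs}) * real (card (distinct_lists n l))
      \<le> real (card (kperms k n)) * real (n ^ (l - card J) * k ^ card J)"
  proof (rule kperms_averaging[OF finite_distinct_lists xs])
    fix ys assume ys: "ys \<in> distinct_lists n l"
    define h where "h v = ys ! (SOME a. a < l \<and> xs ! a = v)" for v
    have hx: "h (xs ! a) = ys ! a" if "a < l" for a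
    proof -
      have "(SOME a'. a' < l \<and> xs ! a' = xs ! a) = a"
        using that xs by (intro some_equality) (auto simp: distinct_lists_def nth_eq_iff_index_eq)
      then show ?thesis by (simp add: h_def)
    qed
    obtain g where g: "g permutes {1..n}" "\<And>a. a \<in> set xs \<Longrightarrow> g a = h a"
    proof (rule extend_to_permutation[of "{1..n}" "set xs" h])
      show "inj_on h (set xs)"
      proof (rule inj_onI)
        fix v w assume vw: "v \<in> set xs" "w \<in> set xs" "h v = h w"
        then obtain a b where "a < l" "b < l" "v = xs ! a" "w = xs ! b"
          using xs by (auto simp: distinct_lists_def in_set_conv_nth)
        then show "v = w" using hx vw(3) ys by (auto simp: distinct_lists_def nth_eq_iff_index_eq)
      qed
      show "h ` set xs \<subseteq> {1..n}"
      proof (rule image_subsetI)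
        fix v assume "v \<in> set xs"
        then obtain a where "a < l" "v = xs ! a"
          using xs by (auto simp: distinct_lists_def in_set_conv_nth)
        then show "h v \<in> {1..n}" using hx distinct_lists_nth[OF ys] by simp
      qed
    qed (use xs in \<open>auto simp: distinct_lists_def\<close>)
    have gx: "g (xs ! a) = ys ! a" if "a < l" for a
      using g(2)[of "xs ! a"] hx[OF that] that xs by (simp add: distinct_lists_def)
    have "?E (conj_perm g p) ys" if "?E p xs" for p
    proof
      fix a assume a: "a \<in> J"
      then have al: "a < l" using J by auto
      then have "Suc a mod l < l" by simp
      then have "ys ! (Suc a mod l) = g (xs ! (Suc a mod l))" "ys ! a = g (xs ! a)"
        using gx al by auto
      then show "ys ! (Suc a mod l) \<in> orbit (conj_perm g p) (ys ! a)"
        using that a orbit_conj_perm[OF g(1)] by auto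
    qed
    then show "\<exists>g. g permutes {1..n} \<and> (\<forall>p\<in>kperms k n. ?E p xs \<longrightarrow> ?E (conj_perm g p) ys)"
      using g(1) by blast
  next
    fix p assume "p \<in> kperms k n"
    from card_cycle_lists[OF this J]
    show "real (card {xs \<in> distinct_lists n l. ?E p xs}) \<le> real (n ^ (l - card J) * k ^ card J)"
      by (rule of_nat_mono)
  qed
  moreover have "real (card {p \<in> kperms k n. ?E p xs}) * (real n / 2) ^ l
     \<le> real (card {p \<in> kperms k n. ?E p xs}) * real (card (distinct_lists n l))"
    by (intro mult_left_mono card_distinct_lists_ge n) auto
  ultimately have "real (card {p \<in> kperms k n. ?E p xs}) * (real n / 2) ^ l
     \<le> real (card (kperms k n)) * real (n ^ (l - card J) * k ^ card J)" by linarith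
  then have "real (card {p \<in> kperms k n. ?E p xs})
     \<le> real (card (kperms k n)) * real (n ^ (l - card J) * k ^ card J) / (real n / 2) ^ l"
    using n by (simp add: pos_le_divide_eq)
  also have "\<dots> = real (card (kperms k n)) * (2 ^ l * (real k / real n) ^ card J)"
  proof -
    have "real n ^ (l - card J) * real n ^ card J = real n ^ l" using cJ by (simp flip: power_add)
    then show ?thesis using n by (simp add: power_divide field_simps)
  qed
  finally show ?thesis .
qed

text \<open>A list of \<open>l\<close> points has to satisfy \<open>l\<close> conditions, each
  costing a factor of order \<open>1 / n\<close>, and there are at most \<open>n ^ l\<close> lists;
  so the expectation is bounded independently of \<open>n\<close>.\<close>

lemma expected_cycle_starts:
  assumes n: "2 * L \<le> n" "0 < n"
  shows "(\<Sum>f\<in>{1..d} \<rightarrow>\<^sub>E kperms k n. real (card (cycle_starts d n f L)))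
    \<le> real (card (kperms k n)) ^ d * (\<Sum>l\<le>L. real (d * 2 ^ d * k) ^ l)"
proof -
  let ?C = "kperms k n"
  let ?F = "{1..d} \<rightarrow>\<^sub>E ?C"
  define CS where "CS l = {cs. set cs \<subseteq> {1..d} \<and> length cs = l}" for l
  have finCS: "finite (CS l)" for l unfolding CS_def by (rule finite_lists_length_eq) simp
  have finF: "finite ?F" by (intro finite_PiE) (auto simp: finite_kperms)
  have cs: "card (cycle_starts d n f L)
      \<le> (\<Sum>l\<le>L. \<Sum>cs\<in>CS l. \<Sum>xs\<in>distinct_lists n l. of_bool (nice_cycle d n f cs xs))" for f
  proof -
    let ?S = "\<lambda>l cs. {xs \<in> distinct_lists n l. nice_cycle d n f cs xs}"
    have "cycle_starts d n f L \<subseteq> (\<Union>l\<in>{..L}. \<Union>cs\<in>CS l. (\<lambda>xs. xs ! 0) ` ?S l cs)"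
    proof
      fix v assume "v \<in> cycle_starts d n f L"
      then obtain cs xs where *: "v = xs ! 0" "length xs \<le> L" "nice_cycle d n f cs xs"
        by (auto simp: cycle_starts_def)
      then have "cs \<in> CS (length xs)" "xs \<in> distinct_lists n (length xs)"
        by (auto simp: nice_cycle_def Let_def CS_def distinct_lists_def)
      then show "v \<in> (\<Union>l\<in>{..L}. \<Union>cs\<in>CS l. (\<lambda>xs. xs ! 0) ` ?S l cs)" using * by blast
    qed
    then have "card (cycle_starts d n f L) \<le> card (\<Union>l\<in>{..L}. \<Union>cs\<in>CS l. (\<lambda>xs. xs ! 0) ` ?S l cs)"
      by (rule card_mono[rotated]) (auto simp: finCS finite_distinct_lists)
    also have "\<dots> \<le> (\<Sum>l\<le>L. \<Sum>cs\<in>CS l. card ((\<lambda>xs. xs ! 0) ` ?S l cs))"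
      by (intro order_trans[OF card_UN_le] sum_mono card_UN_le finCS) simp
    also have "\<dots> \<le> (\<Sum>l\<le>L. \<Sum>cs\<in>CS l. card (?S l cs))"
      by (intro sum_mono card_image_le) (simp add: finite_distinct_lists)
    also have "\<dots> = (\<Sum>l\<le>L. \<Sum>cs\<in>CS l. \<Sum>xs\<in>distinct_lists n l. of_bool (nice_cycle d n f cs xs))"
      by (simp add: finite_distinct_lists Int_def)
    finally show ?thesis .
  qed
  have prob: "real (card {f \<in> ?F. nice_cycle d n f cs xs})
      \<le> real (card ?C) ^ d * (2 ^ d * (real k / real n)) ^ l"
    if l: "l \<le> L" and csl: "cs \<in> CS l" and xsl: "xs \<in> distinct_lists n l" for l cs xs
  proof (cases "2 \<le> l \<and> (\<forall>a<l. cs ! a \<noteq> cs ! (Suc a mod l))")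
    case False
    then have "{f \<in> ?F. nice_cycle d n f cs xs} = {}"
      using xsl by (auto simp: nice_cycle_def Let_def distinct_lists_def)
    then have "card {f \<in> ?F. nice_cycle d n f cs xs} = 0" by (simp only: card.empty)
    then show ?thesis by simp
  next
    case True
    define J where "J i = {a. a < l \<and> cs ! a = i}" for i
    have J: "J i \<subseteq> {..<l}" "\<And>a. a \<in> J i \<Longrightarrow> Suc a mod l \<notin> J i" for i
      using True by (auto simp: J_def)
    have "{f \<in> ?F. nice_cycle d n f cs xs}
      \<subseteq> (\<Pi>\<^sub>E i\<in>{1..d}. {p \<in> ?C. \<forall>a\<in>J i. xs ! (Suc a mod l) \<in> orbit p (xs ! a)})"
    proof (rule subsetI, rule PiE_I)
      fix f i assume f: "f \<in> {f \<in> ?F. nice_cycle d n f cs xs}" and i: "i \<in> {1..d}"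
      have "xs ! (Suc a mod l) \<in> orbit (f i) (xs ! a)" if "a \<in> J i" for a
        using f that xsl by (auto simp: nice_cycle_def Let_def distinct_lists_def J_def)
      moreover have "f i \<in> ?C" using f i by (auto simp: PiE_iff)
      ultimately show "f i \<in> {p \<in> ?C. \<forall>a\<in>J i. xs ! (Suc a mod l) \<in> orbit p (xs ! a)}" by simp
    next
      fix f i assume "f \<in> {f \<in> ?F. nice_cycle d n f cs xs}" "i \<notin> {1..d}"
      then show "f i = undefined" by (auto simp: PiE_iff extensional_def)
    qed
    then have "card {f \<in> ?F. nice_cycle d n f cs xs}
      \<le> card (\<Pi>\<^sub>E i\<in>{1..d}. {p \<in> ?C. \<forall>a\<in>J i. xs ! (Suc a mod l) \<in> orbit p (xs ! a)})"
      by (rule card_mono[rotated]) (auto intro!: finite_PiE simp: finite_kperms)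
    then have "real (card {f \<in> ?F. nice_cycle d n f cs xs})
      \<le> real (card (\<Pi>\<^sub>E i\<in>{1..d}. {p \<in> ?C. \<forall>a\<in>J i. xs ! (Suc a mod l) \<in> orbit p (xs ! a)}))"
      by (rule of_nat_mono)
    also have "\<dots> = (\<Prod>i\<in>{1..d}. real (card {p \<in> ?C. \<forall>a\<in>J i. xs ! (Suc a mod l) \<in> orbit p (xs ! a)}))"
      by (simp add: card_PiE)
    also have "\<dots> \<le> (\<Prod>i\<in>{1..d}. real (card ?C) * (2 ^ l * (real k / real n) ^ card (J i)))"
      by (intro prod_mono conjI prob_cycle_list J xsl n(2)) (use l n in auto)
    also have "\<dots> = real (card ?C) ^ d * ((2 ^ l) ^ d * (real k / real n) ^ (\<Sum>i\<in>{1..d}. card (J i)))"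
      by (simp add: prod.distrib power_sum)
    \<comment> \<open>Each of the \<open>l\<close> positions carries exactly one colour, so the
      exponents over all colours add up to \<open>l\<close>.\<close>
    also have "(\<Sum>i\<in>{1..d}. card (J i)) = card (\<Union>i\<in>{1..d}. J i)"
      by (rule card_UN_disjoint[symmetric]) (auto simp: J_def)
    also have "(\<Union>i\<in>{1..d}. J i) = {..<l}"
      using csl nth_mem[of _ cs] by (auto simp: J_def CS_def subset_iff)
    also have "real (card ?C) ^ d * ((2 ^ l) ^ d * (real k / real n) ^ card {..<l})
        = real (card ?C) ^ d * (2 ^ d * (real k / real n)) ^ l"
    proof -
      have "((2::real) ^ l) ^ d = (2 ^ d) ^ l" by (simp add: power_mult[symmetric] mult.commute)
      then show ?thesis by (simp only: power_mult_distrib card_lessThan)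
    qed
    finally show ?thesis .
  qed
  have "(\<Sum>f\<in>?F. real (card (cycle_starts d n f L)))
      \<le> (\<Sum>f\<in>?F. \<Sum>l\<le>L. \<Sum>cs\<in>CS l. \<Sum>xs\<in>distinct_lists n l. of_bool (nice_cycle d n f cs xs))"
  proof (rule sum_mono)
    fix f
    have "real (card (cycle_starts d n f L))
      \<le> real (\<Sum>l\<le>L. \<Sum>cs\<in>CS l. \<Sum>xs\<in>distinct_lists n l. of_bool (nice_cycle d n f cs xs))"
      using cs by (rule of_nat_mono)
    then show "real (card (cycle_starts d n f L))
      \<le> (\<Sum>l\<le>L. \<Sum>cs\<in>CS l. \<Sum>xs\<in>distinct_lists n l. of_bool (nice_cycle d n f cs xs))"
      by (simp only: of_nat_sum of_nat_of_bool)
  qed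
  also have "\<dots> = (\<Sum>l\<le>L. \<Sum>cs\<in>CS l. \<Sum>xs\<in>distinct_lists n l. \<Sum>f\<in>?F. of_bool (nice_cycle d n f cs xs))"
    by (simp only: sum.swap[where A = ?F])
  also have "\<dots> = (\<Sum>l\<le>L. \<Sum>cs\<in>CS l. \<Sum>xs\<in>distinct_lists n l. real (card {f \<in> ?F. nice_cycle d n f cs xs}))"
    using finF by (simp add: Int_def)
  also have "\<dots> \<le> (\<Sum>l\<le>L. \<Sum>cs\<in>CS l. \<Sum>xs\<in>distinct_lists n l. real (card ?C) ^ d * (2 ^ d * (real k / real n)) ^ l)"
    by (intro sum_mono prob) auto
  also have "\<dots> = (\<Sum>l\<le>L. real (d ^ l) * (real (card (distinct_lists n l)) * (real (card ?C) ^ d * (2 ^ d * (real k / real n)) ^ l)))"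
    by (simp add: CS_def card_lists_length_eq)
  also have "\<dots> \<le> (\<Sum>l\<le>L. real (d ^ l) * (real (n ^ l) * (real (card ?C) ^ d * (2 ^ d * (real k / real n)) ^ l)))"
    by (intro sum_mono mult_left_mono mult_right_mono of_nat_mono card_distinct_lists_le) auto
  also have "\<dots> = real (card ?C) ^ d * (\<Sum>l\<le>L. real (d * 2 ^ d * k) ^ l)"
    unfolding sum_distrib_left
  proof (rule sum.cong)
    fix l
    have "real d * (real n * (2 ^ d * (real k / real n))) = real (d * 2 ^ d * k)"
      using n by simp
    then have "real d ^ l * (real n ^ l * (2 ^ d * (real k / real n)) ^ l) = real (d * 2 ^ d * k) ^ l"
      by (simp only: power_mult_distrib[symmetric])
    moreover have "real (d ^ l) * (real (n ^ l) * (real (card ?C) ^ d * (2 ^ d * (real k / real n)) ^ l))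
        = real (card ?C) ^ d * (real d ^ l * (real n ^ l * (2 ^ d * (real k / real n)) ^ l))"
      by (simp only: of_nat_power mult_ac)
    ultimately show "real (d ^ l) * (real (n ^ l) * (real (card ?C) ^ d * (2 ^ d * (real k / real n)) ^ l))
        = real (card ?C) ^ d * real (d * 2 ^ d * k) ^ l"
      by simp
  qed simp
  finally show ?thesis .
qed

text \<open>Tailored to Markov's inequality with a bounded expectation: \<open>sqrt n\<close> is a
  convenient unbounded rate below linear growth, and the factors \<open>2 ^ Suc L\<close> make the
  failure probabilities for all \<open>L\<close> together sum to at most
  \<open>1 / sqrt n\<close>.\<close>

definition few_cycles :: "nat \<Rightarrow> nat \<Rightarrow> nat \<Rightarrow> (nat \<Rightarrow> nat \<Rightarrow> nat) \<Rightarrow> bool" where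
  "few_cycles d k n f \<longleftrightarrow> (\<forall>L. 2 * L \<le> n \<longrightarrow>
     real (card (cycle_starts d n f L)) \<le> (\<Sum>l\<le>L. real (d * 2 ^ d * k) ^ l) * 2 ^ Suc L * sqrt n)"

lemma few_cycles_typical:
  assumes n: "0 < n"
  shows "real (card {f \<in> {1..d} \<rightarrow>\<^sub>E kperms k n. \<not> few_cycles d k n f})
    \<le> real (card (kperms k n)) ^ d * (1 / sqrt n)"
proof -
  let ?C = "kperms k n"
  let ?F = "{1..d} \<rightarrow>\<^sub>E ?C"
  define S where "S L = (\<Sum>l\<le>L. real (d * 2 ^ d * k) ^ l)" for L
  have S: "S L \<ge> 1" for L
  proof -
    have "real (d * 2 ^ d * k) ^ 0 \<le> S L" unfolding S_def by (rule member_le_sum) auto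
    then show ?thesis by simp
  qed
  have finF: "finite ?F" by (intro finite_PiE) (auto simp: finite_kperms)
  define B where "B L = {f \<in> ?F. real (card (cycle_starts d n f L)) > S L * 2 ^ Suc L * sqrt n}" for L
  have bound: "real (card (B L)) \<le> real (card ?C) ^ d * (1 / sqrt n) * (1 / 2) ^ Suc L" if L: "2 * L \<le> n" for L
  proof -
    have pos: "0 < S L * 2 ^ Suc L * sqrt n" using S[of L] n by simp
    have "real (card (B L)) * (S L * 2 ^ Suc L * sqrt n) = (\<Sum>f\<in>B L. S L * 2 ^ Suc L * sqrt n)" by simp
    also have "\<dots> \<le> (\<Sum>f\<in>B L. real (card (cycle_starts d n f L)))"
      by (rule sum_mono) (auto simp: B_def)
    also have "\<dots> \<le> (\<Sum>f\<in>?F. real (card (cycle_starts d n f L)))"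
      using finF by (intro sum_mono2) (auto simp: B_def)
    also have "\<dots> \<le> real (card ?C) ^ d * S L"
      unfolding S_def by (rule expected_cycle_starts[OF L n])
    finally have "real (card (B L)) \<le> real (card ?C) ^ d * S L / (S L * 2 ^ Suc L * sqrt n)"
      using pos by (simp only: pos_le_divide_eq)
    also have "\<dots> = real (card ?C) ^ d * (1 / sqrt n) * (1 / 2) ^ Suc L"
      using S[of L] by (simp add: power_divide)
    finally show ?thesis .
  qed
  have "{f \<in> ?F. \<not> few_cycles d k n f} \<subseteq> (\<Union>L\<in>{L. 2 * L \<le> n}. B L)"
    by (auto simp: few_cycles_def B_def S_def not_le)
  moreover have fin: "finite {L. 2 * L \<le> n}" by (rule finite_subset[of _ "{..n}"]) auto
  ultimately have "card {f \<in> ?F. \<not> few_cycles d k n f} \<le> card (\<Union>L\<in>{L. 2 * L \<le> n}. B L)"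
    using finF by (intro card_mono finite_UN_I) (auto simp: B_def)
  also have "\<dots> \<le> (\<Sum>L\<in>{L. 2 * L \<le> n}. card (B L))" by (rule card_UN_le[OF fin])
  finally have "real (card {f \<in> ?F. \<not> few_cycles d k n f}) \<le> (\<Sum>L\<in>{L. 2 * L \<le> n}. real (card (B L)))"
    by (simp only: of_nat_sum[symmetric] of_nat_le_iff)
  also have "\<dots> \<le> (\<Sum>L\<in>{L. 2 * L \<le> n}. real (card ?C) ^ d * (1 / sqrt n) * (1 / 2) ^ Suc L)"
    by (intro sum_mono bound) auto
  also have "\<dots> = real (card ?C) ^ d * (1 / sqrt n) * (\<Sum>L\<in>{L. 2 * L \<le> n}. (1 / 2) ^ Suc L)"
    by (simp only: sum_distrib_left)
  also have "\<dots> \<le> real (card ?C) ^ d * (1 / sqrt n) * 1"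
  proof (rule mult_left_mono)
    have "(\<Sum>L\<in>{L. 2 * L \<le> n}. (1 / 2 :: real) ^ Suc L) \<le> (\<Sum>L. (1 / 2) ^ Suc L)"
      using power_half_series by (intro sum_le_suminf fin) (auto simp: sums_iff)
    also have "\<dots> = 1" using power_half_series by (simp add: sums_iff)
    finally show "(\<Sum>L\<in>{L. 2 * L \<le> n}. (1 / 2 :: real) ^ Suc L) \<le> 1" .
  qed simp
  finally show ?thesis by simp
qed

text \<open>A shortest closed walk with non-backtracking colours is a nice cycle: repeated vertices split
  the walk, and equal first and last colours allow the base point to be skipped.\<close>

lemma closed_walk_nice_cycle:
  assumes f: "\<And>i. i \<in> {1..d} \<Longrightarrow> f i \<in> kperms k n"
    and "0 < l" "p l = p 0" "\<And>a. a \<le> l \<Longrightarrow> p a \<in> {1..n}" "\<And>a. a < l \<Longrightarrow> c a \<in> {1..d}"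
    "\<And>a. a < l \<Longrightarrow> p (Suc a) \<in> orbit (f (c a)) (p a)" "\<And>a. a < l \<Longrightarrow> p (Suc a) \<noteq> p a"
    "\<And>a. Suc a < l \<Longrightarrow> c a \<noteq> c (Suc a)"
  shows "\<exists>a\<le>l. p a \<in> cycle_starts d n f l"
  using assms(2-)
proof (induction l arbitrary: p c rule: less_induct)
  case (less l)
  note prems = less.prems
  have mono: "cycle_starts d n f l' \<subseteq> cycle_starts d n f l" if "l' \<le> l" for l'
    using that unfolding cycle_starts_def by force
  show ?case
  proof (cases "inj_on p {..<l}")
    case False
    then obtain a b where ab: "a < b" "b < l" "p a = p b"
      unfolding inj_on_def by (metis lessThan_iff linorder_neqE_nat)
    have "\<exists>x\<le>b - a. p (a + x) \<in> cycle_starts d n f (b - a)"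
      by (rule less.IH[of "b - a" "\<lambda>x. p (a + x)" "\<lambda>x. c (a + x)"])
        (use ab prems(3-) in \<open>auto simp: less_diff_conv add.commute\<close>)
    then obtain x where "x \<le> b - a" "p (a + x) \<in> cycle_starts d n f (b - a)" by blast
    moreover have "b - a \<le> l" using ab by simp
    ultimately show ?thesis using mono[of "b - a"] ab by (intro exI[of _ "a + x"]) auto
  next
    case inj: True
    have "l \<noteq> 1" using prems(2) prems(6)[of 0] prems(1) by auto
    then have l2: "2 \<le> l" using prems(1) by simp
    show ?thesis
    proof (cases "c (l - 1) = c 0")
      case False
      define xs where "xs = map p [0..<l]"
      define cs where "cs = map c [0..<l]"
      have "nice_cycle d n f cs xs"
        unfolding nice_cycle_def Let_def
      proof (intro conjI allI impI)
        show "distinct xs" using inj by (simp add: xs_def distinct_map atLeast0LessThan)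
        fix a assume a: "a < length xs"
        show "cs ! a \<noteq> cs ! (Suc a mod length xs)"
        proof (cases "Suc a = l")
          case True
          then have "a = l - 1" by simp
          then show ?thesis using False True l2 a by (simp add: cs_def xs_def)
        qed (use prems(7)[of a] a in \<open>simp add: cs_def xs_def\<close>)
        show "xs ! (Suc a mod length xs) \<in> orbit (f (cs ! a)) (xs ! a)"
        proof (cases "Suc a = l")
          case True
          then show ?thesis using prems(5)[of a] prems(2) a by (simp add: cs_def xs_def)
        qed (use prems(5)[of a] a in \<open>simp add: cs_def xs_def\<close>)
      qed (use l2 prems(3,4) in \<open>auto simp: xs_def cs_def\<close>)
      then have "xs ! 0 \<in> cycle_starts d n f l" unfolding cycle_starts_def by (force simp: xs_def)
      then show ?thesis using l2 by (intro exI[of _ 0]) (simp add: xs_def)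
    next
      case True
      have l3: "3 \<le> l"
      proof (rule ccontr)
        assume "\<not> 3 \<le> l"
        then have "l = 2" using l2 by simp
        then show False using True prems(7)[of 0] by simp
      qed
      define p' where "p' x = (if x = l - 1 then p 1 else p (Suc x))" for x
      have "\<exists>x\<le>l - 1. p' x \<in> cycle_starts d n f (l - 1)"
      proof (rule less.IH[of "l - 1" p' "\<lambda>x. c (Suc x)"])
        show "p' (l - 1) = p' 0" using l3 by (simp add: p'_def)
        show "p' a \<in> {1..n}" if "a \<le> l - 1" for a using prems(3) that l3 by (auto simp: p'_def)
        show "c (Suc a) \<in> {1..d}" if "a < l - 1" for a using prems(4)[of "Suc a"] that by simp
        show "p' (Suc a) \<in> orbit (f (c (Suc a))) (p' a)" if "a < l - 1" for a
        proof (cases "Suc a = l - 1")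
          case eq: True
          have "p l \<in> orbit (f (c (l - 1))) (p (l - 1))" using prems(5)[of "l - 1"] l3 by simp
          moreover have "p 1 \<in> orbit (f (c 0)) (p 0)" using prems(5)[of 0] l3 by simp
          ultimately have "p 1 \<in> orbit (f (c 0)) (p (l - 1))"
            using True prems(2) by (metis orbit_trans)
          then show ?thesis using eq True that by (simp add: p'_def)
        qed (use prems(5)[of "Suc a"] that in \<open>simp add: p'_def\<close>)
        show "p' (Suc a) \<noteq> p' a" if "a < l - 1" for a
        proof (cases "Suc a = l - 1")
          case eq: True
          then have "p (l - 1) \<noteq> p 1" using inj l3 unfolding inj_on_def by force
          then show ?thesis using eq that by (auto simp: p'_def)
        qed (use prems(6)[of "Suc a"] that in \<open>simp add: p'_def\<close>)
        show "c (Suc a) \<noteq> c (Suc (Suc a))" if "Suc a < l - 1" for a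
          using prems(7)[of "Suc a"] that by simp
      qed (use l3 in auto)
      then obtain x where x: "x \<le> l - 1" "p' x \<in> cycle_starts d n f (l - 1)" by blast
      then have "p' x \<in> cycle_starts d n f l" using mono[of "l - 1"] by auto
      moreover have "\<exists>a\<le>l. p' x = p a" using x l3 by (auto simp: p'_def intro: exI[of _ 1] exI[of _ "Suc x"])
      ultimately show ?thesis by metis
    qed
  qed
qed

section \<open>The free product and its codes\<close>

definition gcoset :: "nat \<Rightarrow> nat \<Rightarrow> nat list set \<Rightarrow> nat \<Rightarrow> nat list set set" where
  "gcoset d k g i = (\<lambda>j. g \<otimes>\<^bsub>\<Gamma> d k\<^esub> (gen d k i [^]\<^bsub>\<Gamma> d k\<^esub> j)) ` {..<k}"

definition cosets :: "nat \<Rightarrow> nat \<Rightarrow> nat list set set set" where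
  "cosets d k = {gcoset d k g i | g i. g \<in> carrier (\<Gamma> d k) \<and> i \<in> {1..d}}"

definition gball :: "nat \<Rightarrow> nat \<Rightarrow> nat \<Rightarrow> nat list set set" where
  "gball d k r = word_ball (\<Gamma> d k) (gens d k) (real r)"

section \<open>Word metric and reduced words in the free product\<close>

locale free_product =
  fixes d k :: nat
  assumes k2: "2 \<le> k"
begin

abbreviation G where "G \<equiv> \<Gamma> d k"
abbreviation mul (infixl "\<odot>" 70) where "x \<odot> y \<equiv> x \<otimes>\<^bsub>G\<^esub> y"
abbreviation gpow where "gpow i j \<equiv> gen d k i [^]\<^bsub>G\<^esub> (j::nat)"
abbreviation prd where "prd ws \<equiv> foldr (\<lambda>x y. x \<odot> y) ws \<one>\<^bsub>G\<^esub>"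

lemma k0: "0 < k"
  using k2 by simp

sublocale group G
  by (rule group_\<Gamma>[OF k0])

lemma gpow_closed: "i \<in> {1..d} \<Longrightarrow> gpow i j \<in> carrier G"
  using gen_closed by simp

lemma gpow_k: "i \<in> {1..d} \<Longrightarrow> gpow i k = \<one>\<^bsub>G\<^esub>"
  by (rule gen_pow[OF k0])

lemma gpow_add: "i \<in> {1..d} \<Longrightarrow> gpow i a \<odot> gpow i b = gpow i (a + b)"
  using nat_pow_mult[OF gen_closed] by simp

lemma gpow_inv:
  assumes "i \<in> {1..d}" "j \<le> k"
  shows "inv\<^bsub>G\<^esub> gpow i j = gpow i (k - j)"
proof (rule inv_equality)
  show "gpow i (k - j) \<odot> gpow i j = \<one>\<^bsub>G\<^esub>" using gpow_add gpow_k assms by simp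
qed (use gpow_closed assms in auto)

lemma gens_eq: "gens d k = (\<lambda>(i, j). gpow i j) ` ({1..d} \<times> {1..k - 1})"
proof (intro equalityI subsetI)
  fix t assume "t \<in> (\<lambda>(i, j). gpow i j) ` ({1..d} \<times> {1..k - 1})"
  then obtain i j where "i \<in> {1..d}" "j \<in> {1..k - 1}" "t = gpow i j" by auto
  then show "t \<in> gens d k" unfolding gens_def by blast
qed (auto simp: gens_def)

lemma gens_carrier: "gens d k \<subseteq> carrier G"
  by (auto simp: gens_def intro!: gpow_closed)

lemma prd_closed: "set ws \<subseteq> carrier G \<Longrightarrow> prd ws \<in> carrier G"
  by (induction ws) auto

lemma prd_append: "set ws \<subseteq> carrier G \<Longrightarrow> set vs \<subseteq> carrier G \<Longrightarrow> prd (ws @ vs) = prd ws \<odot> prd vs"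
  by (induction ws) (auto simp: m_assoc prd_closed)

lemma prd_inv: "set ws \<subseteq> carrier G \<Longrightarrow> inv\<^bsub>G\<^esub> prd ws = prd (rev (map (\<lambda>x. inv\<^bsub>G\<^esub> x) ws))"
proof (induction ws)
  case (Cons w ws)
  have "prd (rev (map (\<lambda>x. inv\<^bsub>G\<^esub> x) (w # ws))) = prd (rev (map (\<lambda>x. inv\<^bsub>G\<^esub> x) ws)) \<odot> prd [inv\<^bsub>G\<^esub> w]"
    using Cons.prems by (simp only: list.map rev.simps) (subst prd_append, auto)
  also have "\<dots> = inv\<^bsub>G\<^esub> prd ws \<odot> inv\<^bsub>G\<^esub> w" using Cons by simp
  also have "\<dots> = inv\<^bsub>G\<^esub> prd (w # ws)" using Cons.prems prd_closed[of ws] by (simp add: inv_mult_group)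
  finally show ?case ..
qed simp

lemma carrier_prd:
  assumes "g \<in> carrier G"
  shows "\<exists>ws. set ws \<subseteq> gens d k \<and> g = prd ws"
proof -
  have "\<exists>ws. set ws \<subseteq> gens d k \<and> word_class d k u = prd ws" if "set u \<subseteq> {1..d}" for u
    using that
  proof (induction u)
    case Nil
    show ?case by (intro exI[of _ "[]"]) (simp add: one_\<Gamma>)
  next
    case (Cons i u)
    then obtain ws where ws: "set ws \<subseteq> gens d k" "word_class d k u = prd ws" by auto
    have i: "i \<in> {1..d}" using Cons.prems by simp
    have "word_class d k (i # u) = gen d k i \<odot> word_class d k u"
      unfolding gen_def by (subst mult_\<Gamma>) (use Cons.prems in auto)
    moreover have "gen d k i = gpow i 1" using gen_closed[OF i] by simp
    moreover have "gpow i 1 \<in> gens d k" unfolding gens_def using i k2 by force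
    ultimately show ?case using ws by (intro exI[of _ "gen d k i # ws"]) auto
  qed
  then show ?thesis using assms by (auto simp: carrier_\<Gamma>)
qed

lemma ball_iff: "g \<in> gball d k r \<longleftrightarrow> (\<exists>ws. length ws \<le> r \<and> set ws \<subseteq> gens d k \<and> g = prd ws)"
proof
  assume "g \<in> gball d k r"
  then have g: "g \<in> carrier G" "word_length G (gens d k) g \<le> r" by (auto simp: gball_def word_ball_def)
  from carrier_prd[OF g(1)] have "\<exists>m ws. length ws = m \<and> set ws \<subseteq> gens d k \<and> g = prd ws" by auto
  from LeastI_ex[OF this] obtain ws where "length ws = word_length G (gens d k) g"
    "set ws \<subseteq> gens d k" "g = prd ws" unfolding word_length_def by blast
  then show "\<exists>ws. length ws \<le> r \<and> set ws \<subseteq> gens d k \<and> g = prd ws"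
    using g(2) by (intro exI[of _ ws]) simp
next
  assume "\<exists>ws. length ws \<le> r \<and> set ws \<subseteq> gens d k \<and> g = prd ws"
  then obtain ws where ws: "length ws \<le> r" "set ws \<subseteq> gens d k" "g = prd ws" by blast
  have "word_length G (gens d k) g \<le> length ws"
    unfolding word_length_def by (rule Least_le) (use ws in auto)
  then show "g \<in> gball d k r"
    using ws prd_closed[of ws] gens_carrier by (auto simp: gball_def word_ball_def)
qed

lemma word_ball_eq_ball: "0 \<le> r \<Longrightarrow> word_ball G (gens d k) r = gball d k (nat \<lfloor>r\<rfloor>)"
proof -
  assume "0 \<le> r"
  then have "real m \<le> r \<longleftrightarrow> real m \<le> real (nat \<lfloor>r\<rfloor>)" for m
    unfolding of_nat_le_iff by (subst le_nat_iff) (auto simp: le_floor_iff)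
  then show ?thesis unfolding gball_def word_ball_def by blast
qed

lemma ball_carrier: "gball d k r \<subseteq> carrier G"
  by (auto simp: gball_def word_ball_def)

lemma ball_mono: "r \<le> r' \<Longrightarrow> gball d k r \<subseteq> gball d k r'"
  by (auto simp: gball_def word_ball_def)

lemma finite_ball: "finite (gball d k r)"
proof -
  have "finite (gens d k)" by (simp add: gens_eq)
  then have "finite (prd ` {ws. set ws \<subseteq> gens d k \<and> length ws \<le> r})"
    by (intro finite_imageI finite_lists_length_le)
  moreover have "gball d k r \<subseteq> prd ` {ws. set ws \<subseteq> gens d k \<and> length ws \<le> r}"
    by (auto simp: ball_iff)
  ultimately show ?thesis by (rule finite_subset[rotated])
qed

lemma one_in_ball: "\<one>\<^bsub>G\<^esub> \<in> gball d k r"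
  unfolding ball_iff by (intro exI[of _ "[]"]) simp

lemma ball_mult: "g \<in> gball d k r \<Longrightarrow> h \<in> gball d k s \<Longrightarrow> g \<odot> h \<in> gball d k (r + s)"
proof -
  assume "g \<in> gball d k r" "h \<in> gball d k s"
  then obtain ws vs where "length ws \<le> r" "set ws \<subseteq> gens d k" "g = prd ws"
    "length vs \<le> s" "set vs \<subseteq> gens d k" "h = prd vs" unfolding ball_iff by blast
  then show ?thesis unfolding ball_iff
    using prd_append[of ws vs] gens_carrier by (intro exI[of _ "ws @ vs"]) auto
qed

lemma ball_inv: "g \<in> gball d k r \<Longrightarrow> inv\<^bsub>G\<^esub> g \<in> gball d k r"
proof -
  assume "g \<in> gball d k r"
  then obtain ws where ws: "length ws \<le> r" "set ws \<subseteq> gens d k" "g = prd ws" unfolding ball_iff by blast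
  have "inv\<^bsub>G\<^esub> t \<in> gens d k" if t: "t \<in> gens d k" for t
  proof -
    obtain i j where ij: "i \<in> {1..d}" "j \<in> {1..k - 1}" "t = gpow i j" using t unfolding gens_def by blast
    then have "inv\<^bsub>G\<^esub> t = gpow i (k - j)" using gpow_inv by auto
    moreover have "k - j \<in> {1..k - 1}" using ij k2 by auto
    ultimately show ?thesis using ij(1) unfolding gens_def by blast
  qed
  then show ?thesis unfolding ball_iff
    using ws prd_inv[of ws] gens_carrier by (intro exI[of _ "rev (map (\<lambda>x. inv\<^bsub>G\<^esub> x) ws)"]) auto
qed

lemma carrier_in_ball: "g \<in> carrier G \<Longrightarrow> \<exists>r. g \<in> gball d k r"
  by (auto simp: gball_def word_ball_def)

lemma finite_subset_ball: "finite u \<Longrightarrow> u \<subseteq> carrier G \<Longrightarrow> \<exists>r. u \<subseteq> gball d k r"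
proof (induction u rule: finite_induct)
  case (insert g u)
  then obtain r where "u \<subseteq> gball d k r" by auto
  moreover obtain s where "g \<in> gball d k s" using carrier_in_ball[of g] insert.prems by auto
  ultimately show ?case using ball_mono[of r "max r s"] ball_mono[of s "max r s"]
    by (intro exI[of _ "max r s"]) auto
qed simp

lemma coset_ball:
  assumes "g \<in> gball d k r" "i \<in> {1..d}"
  shows "gcoset d k g i \<subseteq> gball d k (Suc r)"
proof
  fix h assume "h \<in> gcoset d k g i"
  then obtain j where j: "j < k" "h = g \<odot> gpow i j" by (auto simp: gcoset_def)
  have "gpow i j \<in> gball d k 1"
  proof (cases "j = 0")
    case True
    then show ?thesis using one_in_ball by simp
  next
    case False
    then have "gpow i j \<in> gens d k" unfolding gens_def using j assms(2) by force
    then show ?thesis unfolding ball_iff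
      by (intro exI[of _ "[gpow i j]"]) (use gpow_closed[OF assms(2)] in auto)
  qed
  then show "h \<in> gball d k (Suc r)" using ball_mult[OF assms(1), of "gpow i j" 1] j by simp
qed

lemma coset_carrier: "g \<in> carrier G \<Longrightarrow> i \<in> {1..d} \<Longrightarrow> gcoset d k g i \<subseteq> carrier G"
  using gpow_closed by (auto simp: gcoset_def)

lemma cosets_finite: "c \<in> cosets d k \<Longrightarrow> finite c \<and> c \<subseteq> carrier G"
  using coset_carrier by (auto simp: cosets_def gcoset_def)

lemma countable_carrier: "countable (carrier G)"
  unfolding carrier_\<Gamma> by (rule countable_image) simp

lemma coset_translate:
  assumes "h \<in> carrier G" "g \<in> carrier G" "i \<in> {1..d}"
  shows "(\<odot>) h ` gcoset d k g i = gcoset d k (h \<odot> g) i"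
  unfolding gcoset_def image_image using assms gpow_closed by (intro image_cong) (auto simp: m_assoc)

lemma bspan_cosets_translate:
  assumes "h \<in> carrier G" "u \<in> bspan (cosets d k)"
  shows "(\<odot>) h ` u \<in> bspan (cosets d k)"
  using assms(2)
proof induction
  case (step c u)
  have c: "c \<subseteq> carrier G" using cosets_finite step.hyps(1) by auto
  have u: "u \<subseteq> carrier G" using bspan_sub[OF step.hyps(2) cosets_finite] by auto
  have inj: "inj_on ((\<odot>) h) (carrier G)" using assms(1) by (intro inj_onI) simp
  have "(\<odot>) h ` sym_diff c u = sym_diff ((\<odot>) h ` c) ((\<odot>) h ` u)"
    unfolding image_Un using c u
    by (subst (1 2) inj_on_image_set_diff[OF inj]) auto
  moreover have "(\<odot>) h ` c \<in> cosets d k"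
  proof -
    obtain g i where "g \<in> carrier G" "i \<in> {1..d}" "c = gcoset d k g i"
      using step.hyps(1) unfolding cosets_def by blast
    then have "(\<odot>) h ` c = gcoset d k (h \<odot> g) i" "h \<odot> g \<in> carrier G" "i \<in> {1..d}"
      using coset_translate assms(1) by auto
    then show ?thesis unfolding cosets_def by blast
  qed
  ultimately show ?case using step.IH bspan.step by metis
qed (simp add: bspan.empty)

definition ev where "ev ps = foldr (\<lambda>(i, j) y. gpow i j \<odot> y) ps \<one>\<^bsub>G\<^esub>"

lemma ev_simps [simp]: "ev [] = \<one>\<^bsub>G\<^esub>" "ev ((i, j) # ps) = gpow i j \<odot> ev ps"
  by (simp_all add: ev_def)

lemma ev_in_ball:
  assumes "set ps \<subseteq> {1..d} \<times> {1..k - 1}"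
  shows "ev ps \<in> gball d k (length ps)"
  using assms
proof (induction ps)
  case (Cons p ps)
  obtain i j where p: "p = (i, j)" by (cases p)
  then have "gpow i j \<in> gens d k" unfolding gens_def using Cons.prems by force
  then have "gpow i j \<in> gball d k 1" unfolding ball_iff
    by (intro exI[of _ "[gpow i j]"]) (use gpow_closed Cons.prems p in auto)
  then show ?case using ball_mult[of "gpow i j" 1 "ev ps" "length ps"] Cons p by simp
qed (simp add: one_in_ball)

text \<open>Multiplying a reduced word on the left by a power of a generator adds a syllable, merges
  with a first syllable of the same colour, or cancels it when the exponents add up to
  \<open>k\<close>; the syllables never outnumber the factors. Distinct neighbouring colours make
  the associated walks non-backtracking.\<close>

lemma reduced_word:
  assumes "g \<in> gball d k r"
  shows "\<exists>ps. length ps \<le> r \<and> set ps \<subseteq> {1..d} \<times> {1..k - 1} \<and> ev ps = g \<and>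
    (\<forall>a. Suc a < length ps \<longrightarrow> fst (ps ! a) \<noteq> fst (ps ! Suc a))"
proof -
  let ?red = "\<lambda>ps. \<forall>a. Suc a < length ps \<longrightarrow> fst (ps ! a) \<noteq> fst (ps ! Suc a)"
  have red_Cons: "?red (p # ps) \<longleftrightarrow> ?red ps \<and> (ps = [] \<or> fst p \<noteq> fst (hd ps))"
    for p :: "nat \<times> nat" and ps
  proof -
    have split: "(\<forall>a. Q a) \<longleftrightarrow> Q 0 \<and> (\<forall>a. Q (Suc a))" for Q :: "nat \<Rightarrow> bool"
      by (metis not0_implies_Suc)
    show ?thesis
      by (subst split[of "\<lambda>a. Suc a < length (p # ps) \<longrightarrow> fst ((p # ps) ! a) \<noteq> fst ((p # ps) ! Suc a)"])
        (cases ps, auto)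
  qed
  have "\<exists>ps. length ps \<le> length ws \<and> set ps \<subseteq> {1..d} \<times> {1..k - 1} \<and> ev ps = prd ws \<and> ?red ps"
    if "set ws \<subseteq> gens d k" for ws
    using that
  proof (induction ws)
    case Nil
    show ?case by (intro exI[of _ "[]"]) simp
  next
    case (Cons w ws)
    then obtain ps where ps: "length ps \<le> length ws" "set ps \<subseteq> {1..d} \<times> {1..k - 1}" "ev ps = prd ws" "?red ps"
      by auto
    obtain i j where ij: "i \<in> {1..d}" "j \<in> {1..k - 1}" "w = gpow i j"
      using Cons.prems by (auto simp: gens_def)
    show ?case
    proof (cases "ps = [] \<or> i \<noteq> fst (hd ps)")
      case True
      then have "?red ((i, j) # ps)" unfolding red_Cons using ps(4) by auto
      then show ?thesis using ps ij by (intro exI[of _ "(i, j) # ps"]) auto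
    next
      case False
      then obtain j' qs where qs: "ps = (i, j') # qs" by (cases ps) auto
      have j': "j' \<in> {1..k - 1}" and sq: "set qs \<subseteq> {1..d} \<times> {1..k - 1}" using ps(2) qs by auto
      have evq: "ev qs \<in> carrier G" using ev_in_ball[OF sq] ball_carrier by blast
      have "prd (w # ws) = gpow i j \<odot> (gpow i j' \<odot> ev qs)"
        using ps(3) qs ij by simp
      also have "\<dots> = gpow i (j + j') \<odot> ev qs"
        using m_assoc[of "gpow i j" "gpow i j'" "ev qs"] gpow_closed[OF ij(1)] evq gpow_add[OF ij(1)] by simp
      finally have e: "prd (w # ws) = gpow i (j + j') \<odot> ev qs" .
      have rq: "?red qs" "qs = [] \<or> i \<noteq> fst (hd qs)" using ps(4) unfolding qs red_Cons by auto
      show ?thesis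
      proof (cases "j + j' = k")
        case True
        then have "prd (w # ws) = ev qs" using e gpow_k[OF ij(1)] evq by simp
        then show ?thesis using ps(1) qs sq rq by (intro exI[of _ qs]) auto
      next
        case nk: False
        \<comment> \<open>Both exponents lie between 1 and \<open>k - 1\<close> and do not add up to
          \<open>k\<close>, so subtracting \<open>k\<close> at most once reduces their sum.\<close>
        define m where "m = (if j + j' < k then j + j' else j + j' - k)"
        have m: "m \<in> {1..k - 1}" using ij(2) j' nk by (auto simp: m_def)
        have "gpow i (j + j') = gpow i m"
        proof (cases "j + j' < k")
          case False
          then have "gpow i (j + j') = gpow i k \<odot> gpow i (j + j' - k)" using gpow_add[OF ij(1)] by simp
          then show ?thesis using False gpow_k[OF ij(1)] gpow_closed[OF ij(1)] by (simp add: m_def)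
        qed (simp add: m_def)
        then have "prd (w # ws) = ev ((i, m) # qs)" using e by simp
        moreover have "?red ((i, m) # qs)" unfolding red_Cons using rq by auto
        ultimately show ?thesis using ps(1) qs sq ij(1) m by (intro exI[of _ "(i, m) # qs"]) auto
      qed
    qed
  qed
  moreover obtain ws where ws: "length ws \<le> r" "set ws \<subseteq> gens d k" "g = prd ws"
    using assms unfolding ball_iff by blast
  ultimately obtain ps where "length ps \<le> length ws" "set ps \<subseteq> {1..d} \<times> {1..k - 1}"
    "ev ps = prd ws" "?red ps" by blast
  then show ?thesis using ws(1,3) by (intro exI[of _ ps] conjI) auto
qed

end

section \<open>The code of a fixed homomorphism and its local structure\<close>

locale code = free_product +
  fixes n :: nat and \<sigma> :: "nat list set \<Rightarrow> nat \<Rightarrow> nat"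
  assumes n0: "0 < n" and \<sigma>: "\<sigma> \<in> Hom_unif d k n"
begin

abbreviation V where "V \<equiv> {1..n}"
abbreviation \<phi> where "\<phi> v g \<equiv> \<sigma> (inv\<^bsub>G\<^esub> g) v"

definition perm where "perm = (\<lambda>i\<in>{1..d}. \<sigma> (gen d k i))"

definition checks :: "(nat \<times> nat set) set" where
  "checks = {(i, orbit (perm i) v) | i v. i \<in> {1..d} \<and> v \<in> V}"

abbreviation dual where "dual \<equiv> bspan (snd ` checks)"
abbreviation gdual where "gdual \<equiv> bspan (cosets d k)"

text \<open>Since \<open>\<phi> v\<close> maps every coset onto a cycle, injectivity alone makes the
  neighbourhood of \<open>v\<close> a faithful copy of the ball.\<close>

definition good where "good R = {v \<in> V. inj_on (\<phi> v) (gball d k R)}"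
definition nbhd where "nbhd v r = \<phi> v ` gball d k r"

lemma perm_eq: "i \<in> {1..d} \<Longrightarrow> perm i = \<sigma> (gen d k i)"
  by (simp add: perm_def)

lemma perm_kperms: "i \<in> {1..d} \<Longrightarrow> perm i \<in> kperms k n"
  using bij_betw_apply[OF Hom_unif_bij[OF k0] \<sigma>] by (auto simp: perm_def PiE_iff)

lemma \<sigma>_hom: "\<sigma> \<in> hom G (sym_group n)"
  using \<sigma> by (simp add: Hom_unif_def)

lemma \<sigma>_mult: "g \<in> carrier G \<Longrightarrow> h \<in> carrier G \<Longrightarrow> \<sigma> (g \<odot> h) v = \<sigma> g (\<sigma> h v)"
  using hom_mult[OF \<sigma>_hom] by (simp add: sym_group_mult)

lemma \<sigma>_one: "\<sigma> \<one>\<^bsub>G\<^esub> v = v"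
  using hom_one[OF \<sigma>_hom is_group sym_group_is_group] by (simp add: sym_group_one)

lemma \<sigma>_permutes: "g \<in> carrier G \<Longrightarrow> \<sigma> g permutes V"
  using hom_in_carrier[OF \<sigma>_hom] by (simp add: sym_group_carrier)

lemma \<sigma>_in: "g \<in> carrier G \<Longrightarrow> v \<in> V \<Longrightarrow> \<sigma> g v \<in> V"
  using \<sigma>_permutes permutes_in_image by metis

lemma \<phi>_in: "g \<in> carrier G \<Longrightarrow> v \<in> V \<Longrightarrow> \<phi> v g \<in> V"
  using \<sigma>_in by simp

lemma \<sigma>_\<phi>: "g \<in> carrier G \<Longrightarrow> \<sigma> g (\<phi> v g) = v"
  using \<sigma>_mult[of g "inv\<^bsub>G\<^esub> g" v] by (simp add: \<sigma>_one)

lemma \<sigma>_gpow: "i \<in> {1..d} \<Longrightarrow> \<sigma> (gpow i j) v = (perm i ^^ j) v"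
proof (induction j arbitrary: v)
  case (Suc j)
  then have "\<sigma> (gpow i (Suc j)) v = \<sigma> (gpow i j) (perm i v)"
    using \<sigma>_mult[OF gpow_closed gen_closed] by (simp add: perm_def)
  then show ?case using Suc by (simp add: funpow_swap1)
qed (simp add: \<sigma>_one)

lemma orbit_perm_V: "i \<in> {1..d} \<Longrightarrow> v \<in> V \<Longrightarrow> orbit (perm i) v \<subseteq> V"
  by (rule orbit_in[OF perm_kperms])

lemma checks_sub: "c \<in> snd ` checks \<Longrightarrow> finite c \<and> c \<subseteq> V"
proof -
  assume "c \<in> snd ` checks"
  then obtain i v where iv: "i \<in> {1..d}" "v \<in> V" "c = orbit (perm i) v" by (auto simp: checks_def)
  then have "c \<subseteq> V" using orbit_perm_V by metis
  then show ?thesis using finite_subset by blast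
qed

lemma finite_checks: "finite checks"
proof -
  have "checks = (\<lambda>(i, v). (i, orbit (perm i) v)) ` ({1..d} \<times> V)" by (auto simp: checks_def)
  then show ?thesis by simp
qed

text \<open>Right multiplication by a generator moves along a cycle backwards.\<close>

lemma \<phi>_coset:
  assumes "g \<in> carrier G" "v \<in> V" "i \<in> {1..d}"
  shows "\<phi> v ` gcoset d k g i = orbit (perm i) (\<phi> v g)"
    and "inj_on (\<lambda>j. \<phi> v (g \<odot> gpow i j)) {..<k}"
proof -
  have return: "(perm i ^^ j) (\<phi> v (g \<odot> gpow i j)) = \<phi> v g" for j
  proof -
    have "\<phi> v (g \<odot> gpow i j) = \<phi> (\<phi> v g) (gpow i j)"
      using assms gpow_closed[OF assms(3)] by (simp add: inv_mult_group \<sigma>_mult)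
    then have "\<sigma> (gpow i j) (\<phi> v (g \<odot> gpow i j)) = \<phi> v g"
      using \<sigma>_\<phi>[OF gpow_closed[OF assms(3)]] by simp
    then show ?thesis by (simp add: \<sigma>_gpow[OF assms(3)])
  qed
  have p: "perm i \<in> kperms k n" by (rule perm_kperms[OF assms(3)])
  have w: "\<phi> v g \<in> V" by (rule \<phi>_in[OF assms(1,2)])
  have inV: "\<phi> v (g \<odot> gpow i j) \<in> V" for j
    using assms gpow_closed[OF assms(3)] by (intro \<phi>_in) auto
  show inj: "inj_on (\<lambda>j. \<phi> v (g \<odot> gpow i j)) {..<k}"
  proof (rule inj_onI)
    fix a b assume ab: "a \<in> {..<k}" "b \<in> {..<k}" "\<phi> v (g \<odot> gpow i a) = \<phi> v (g \<odot> gpow i b)"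
    then have "(perm i ^^ a) (\<phi> v (g \<odot> gpow i a)) = (perm i ^^ b) (\<phi> v (g \<odot> gpow i a))"
      using return[of a] return[of b] by simp
    then show "a = b" using inj_onD[OF kperms_funpow(2)[OF p inV]] ab(1,2) by blast
  qed
  have "\<phi> v (g \<odot> gpow i j) \<in> orbit (perm i) (\<phi> v g)" if "j < k" for j
  proof -
    have "\<phi> v g \<in> orbit (perm i) (\<phi> v (g \<odot> gpow i j))"
      unfolding kperms_funpow(3)[OF p inV] using return[of j] that by force
    then show ?thesis by (rule orbit_sym[OF p])
  qed
  then have sub: "\<phi> v ` gcoset d k g i \<subseteq> orbit (perm i) (\<phi> v g)" by (auto simp: gcoset_def)
  have "\<phi> v ` gcoset d k g i = (\<lambda>j. \<phi> v (g \<odot> gpow i j)) ` {..<k}"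
    by (simp add: gcoset_def image_image)
  then have "card (\<phi> v ` gcoset d k g i) = k" using card_image[OF inj] by simp
  then show "\<phi> v ` gcoset d k g i = orbit (perm i) (\<phi> v g)"
    using card_subset_eq[OF finite_orbit'[OF p w] sub] card_orbit[OF p w] by simp
qed

text \<open>That the \<open>k\<close> elements of a coset are distinct is read off from the finite
  action: the points to which they take 1 are distinct because the cycles of the generators have
  length \<open>k\<close>.\<close>

lemma sum_gcoset:
  assumes "g \<in> carrier G" "i \<in> {1..d}"
  shows "(\<Sum>j<k. x (g \<odot> gpow i j)) = sum x (gcoset d k g i)"
proof -
  have "inj_on (\<lambda>j. \<phi> 1 (g \<odot> gpow i j)) {..<k}" using \<phi>_coset(2)[OF assms(1) _ assms(2)] n0 by simp
  then have "inj_on (\<lambda>j. g \<odot> gpow i j) {..<k}" by (rule inj_on_imageI2[unfolded comp_def])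
  then show ?thesis by (simp add: gcoset_def sum.reindex)
qed

lemma X_sys_eq: "X_sys d k = annihilator (carrier G) (cosets d k)"
proof -
  have "(\<forall>c\<in>cosets d k. sum x c = 0) \<longleftrightarrow>
      (\<forall>g\<in>carrier G. \<forall>i\<in>{1..d}. (\<Sum>j<k. x (g \<odot> gpow i j)) = 0)" for x :: "nat list set \<Rightarrow> bit"
  proof -
    have "(\<forall>c\<in>cosets d k. sum x c = 0) \<longleftrightarrow> (\<forall>g\<in>carrier G. \<forall>i\<in>{1..d}. sum x (gcoset d k g i) = 0)"
      unfolding cosets_def by blast
    then show ?thesis using sum_gcoset[where x = x] by simp
  qed
  then show ?thesis unfolding X_sys_def annihilator_def by simp
qed

lemma X_code_eq: "X_code d k n \<sigma> = annihilator V (snd ` checks)"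
proof -
  have "(\<forall>c\<in>snd ` checks. sum x c = 0) \<longleftrightarrow>
      (\<forall>v\<in>V. \<forall>i\<in>{1..d}. sum x (orbit (perm i) v) = 0)" for x :: "nat \<Rightarrow> bit"
  proof -
    have eq: "snd ` checks = {orbit (perm i) v | i v. i \<in> {1..d} \<and> v \<in> V}"
    proof (intro equalityI subsetI)
      fix c assume "c \<in> {orbit (perm i) v | i v. i \<in> {1..d} \<and> v \<in> V}"
      then obtain i v where "i \<in> {1..d}" "v \<in> V" "c = orbit (perm i) v" by blast
      then show "c \<in> snd ` checks" unfolding checks_def by (intro image_eqI[of _ _ "(i, c)"]) auto
    next
      fix c assume "c \<in> snd ` checks"
      then obtain i v where "i \<in> {1..d}" "v \<in> V" "c = orbit (perm i) v" unfolding checks_def by auto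
      then show "c \<in> {orbit (perm i) v | i v. i \<in> {1..d} \<and> v \<in> V}" by blast
    qed
    show ?thesis unfolding eq by blast
  qed
  moreover have "sum x (orbit (perm i) v) = (\<Sum>j<k. x ((\<sigma> (gen d k i) ^^ j) v))"
    if "i \<in> {1..d}" "v \<in> V" for x :: "nat \<Rightarrow> bit" and i v
    using sum_orbit[OF perm_kperms[OF that(1)] that(2), of x] perm_eq[OF that(1)] by simp
  ultimately show ?thesis unfolding X_code_def annihilator_def by simp
qed

lemma m_X_has_dual: "has_dual (carrier G) gdual (m_X d k)"
  unfolding m_X_def X_sys_eq
  by (rule haar_the_has_dual[OF countable_carrier cosets_finite])

lemma m_X_Prob: "m_X d k \<in> Prob (carrier G)"
  using m_X_has_dual by (simp add: has_dual_def)

lemma shift_measurable: "g \<in> carrier G \<Longrightarrow> shift G g \<in> measurable (config (carrier G)) (config (carrier G))"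
  unfolding shift_def config_def
  by (intro measurable_restrict measurable_component_singleton) auto

text \<open>The shift turns \<open>chi u\<close> into the character of a translate of
  \<open>u\<close>; left translation maps cosets to cosets and hence preserves their span.\<close>

lemma m_X_shift_invariant: "shift_invariant G (m_X d k)"
  unfolding shift_invariant_def
proof (intro conjI ballI m_X_Prob)
  fix g assume g: "g \<in> carrier G"
  have P: "prob_space (m_X d k)" using m_X_Prob by (simp add: Prob_def)
  have meas: "shift G g \<in> measurable (m_X d k) (config (carrier G))"
    using shift_measurable[OF g] Prob_measurable_iff[OF m_X_Prob] by blast
  show "distr (m_X d k) (config (carrier G)) (shift G g) = m_X d k"
  proof (rule Prob_eqI[of _ "carrier G"])
    show "distr (m_X d k) (config (carrier G)) (shift G g) \<in> Prob (carrier G)"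
      using prob_space.prob_space_distr[OF P meas] by (simp add: Prob_def)
    fix u assume u: "finite u" "u \<subseteq> carrier G"
    let ?w = "(\<odot>) (inv\<^bsub>G\<^esub> g) ` u"
    have w: "finite ?w" "?w \<subseteq> carrier G" using u g by auto
    have "chi u (shift G g x) = chi ?w x" for x :: "nat list set \<Rightarrow> bit"
    proof -
      have "inj_on ((\<odot>) (inv\<^bsub>G\<^esub> g)) (carrier G)" using g by (intro inj_onI) simp
      then have "inj_on ((\<odot>) (inv\<^bsub>G\<^esub> g)) u" using u(2) by (rule inj_on_subset)
      then show ?thesis unfolding chi_def using u
        by (subst prod.reindex) (auto simp: shift_def intro!: prod.cong)
    qed
    then have "(\<integral>x. chi u x \<partial>distr (m_X d k) (config (carrier G)) (shift G g)) = (\<integral>x. chi ?w x \<partial>m_X d k)"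
      by (subst integral_distr[OF meas measurable_chi[OF u(2)]]) simp
    also have "\<dots> = of_bool (?w \<in> gdual)" using m_X_has_dual w by (simp add: has_dual_def)
    also have "?w \<in> gdual \<longleftrightarrow> u \<in> gdual"
    proof
      assume "?w \<in> gdual"
      from bspan_cosets_translate[OF g this] have "(\<odot>) g ` ?w \<in> gdual" .
      also have "(\<odot>) g ` ?w = (\<lambda>x. x) ` u" unfolding image_image
        using u g by (intro image_cong) (auto simp: m_assoc[symmetric])
      finally show "u \<in> gdual" by simp
    qed (rule bspan_cosets_translate[OF inv_closed[OF g]])
    also have "of_bool (u \<in> gdual) = (\<integral>x. chi u x \<partial>m_X d k)" using m_X_has_dual u by (simp add: has_dual_def)
    finally show "(\<integral>x. chi u x \<partial>distr (m_X d k) (config (carrier G)) (shift G g)) = (\<integral>x. chi u x \<partial>m_X d k)" .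
  qed (rule m_X_Prob)
qed

text \<open>Two elements of the ball with the same image give a nontrivial \<open>w\<close> in the
  ball of radius \<open>2 * R\<close> that fixes \<open>v\<close>. A reduced word for
  \<open>w\<close> traces a closed walk without backtracking, some vertex of which starts a short
  cycle, and that vertex is reached from \<open>v\<close> by a final segment of the word.\<close>

lemma bad_vertices:
  "V - good R \<subseteq> (\<Union>h\<in>gball d k (2 * R). {v. \<sigma> h v \<in> cycle_starts d n perm (2 * R)})"
proof
  fix v assume v: "v \<in> V - good R"
  then obtain g h where gh: "g \<in> gball d k R" "h \<in> gball d k R" "g \<noteq> h" "\<phi> v g = \<phi> v h"
    by (auto simp: good_def inj_on_def)
  have gc: "g \<in> carrier G" "h \<in> carrier G" using gh ball_carrier by auto
  define w where "w = h \<odot> inv\<^bsub>G\<^esub> g"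
  have wb: "w \<in> gball d k (2 * R)" unfolding w_def using ball_mult[OF gh(2) ball_inv[OF gh(1)]] by (simp add: mult_2)
  have w1: "w \<noteq> \<one>\<^bsub>G\<^esub>"
  proof
    assume "w = \<one>\<^bsub>G\<^esub>"
    then have "w \<odot> g = g" using gc by simp
    then show False using gh(3) gc by (simp add: w_def m_assoc)
  qed
  have fixed: "\<sigma> w v = v" unfolding w_def using \<sigma>_mult gc gh(4) \<sigma>_\<phi>[OF gc(2)] by simp
  obtain ps where ps: "length ps \<le> 2 * R" "set ps \<subseteq> {1..d} \<times> {1..k - 1}" "ev ps = w"
    "\<And>a. Suc a < length ps \<Longrightarrow> fst (ps ! a) \<noteq> fst (ps ! Suc a)"
    using reduced_word[OF wb] by blast
  define l where "l = length ps"
  \<comment> \<open>Words act from their right end: after \<open>a\<close> steps the last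
    \<open>a\<close> syllables have been applied, and the colour of step \<open>a\<close> stands at
    position \<open>l - 1 - a\<close>.\<close>
  define p where "p a = \<sigma> (ev (drop (l - a) ps)) v" for a
  define c where "c a = fst (ps ! (l - 1 - a))" for a
  have sub: "set (drop m ps) \<subseteq> {1..d} \<times> {1..k - 1}" for m
    using ps(2) set_drop_subset by fastforce
  have evc: "ev (drop m ps) \<in> carrier G" for m using ev_in_ball[OF sub] ball_carrier by blast
  have l0: "0 < l" using w1 ps(3) by (cases ps) (auto simp: l_def)
  have step: "c a \<in> {1..d} \<and> (\<exists>j\<in>{1..k - 1}. p (Suc a) = (perm (c a) ^^ j) (p a))" if a: "a < l" for a
  proof -
    obtain i j where ij: "ps ! (l - 1 - a) = (i, j)" by fastforce
    have "ps ! (l - 1 - a) \<in> set ps" using a by (simp add: l_def)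
    then have ij': "i \<in> {1..d}" "j \<in> {1..k - 1}" using ps(2) ij by auto
    have "drop (l - Suc a) ps = ps ! (l - 1 - a) # drop (l - a) ps"
      using a Cons_nth_drop_Suc[of "l - Suc a" ps] by (simp add: l_def Suc_diff_Suc)
    then have "p (Suc a) = \<sigma> (gpow i j \<odot> ev (drop (l - a) ps)) v" by (simp only: p_def ij ev_simps)
    also have "\<dots> = (perm i ^^ j) (p a)"
      using \<sigma>_mult[OF gpow_closed[OF ij'(1)] evc] \<sigma>_gpow[OF ij'(1)] by (simp add: p_def)
    finally show ?thesis using ij ij' by (auto simp: c_def)
  qed
  have pV: "p a \<in> V" for a unfolding p_def using \<sigma>_in[OF evc] v by auto
  have "\<exists>a\<le>l. p a \<in> cycle_starts d n perm l"
  proof (rule closed_walk_nice_cycle[where c = c])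
    show "p l = p 0" using fixed ps(3) by (simp add: p_def l_def \<sigma>_one)
    fix a assume a: "a < l"
    obtain j where j: "j \<in> {1..k - 1}" "p (Suc a) = (perm (c a) ^^ j) (p a)" using step[OF a] by blast
    have ci: "c a \<in> {1..d}" using step[OF a] by blast
    note K = perm_kperms[OF ci]
    show "p (Suc a) \<in> orbit (perm (c a)) (p a)"
      unfolding kperms_funpow(3)[OF K pV] j(2) using j(1) by force
    show "p (Suc a) \<noteq> p a"
    proof
      assume "p (Suc a) = p a"
      then have "(perm (c a) ^^ j) (p a) = (perm (c a) ^^ 0) (p a)" using j(2) by simp
      then have "j = 0" using inj_onD[OF kperms_funpow(2)[OF K pV]] j(1) k0 by fastforce
      then show False using j(1) by simp
    qed
    show "c a \<in> {1..d}" by (rule ci)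
  next
    fix a assume a: "Suc a < l"
    then have "Suc (l - 1 - Suc a) = l - 1 - a" "Suc (l - 1 - Suc a) < length ps"
      by (auto simp: l_def)
    then show "c a \<noteq> c (Suc a)" using ps(4)[of "l - 1 - Suc a"] by (simp add: c_def)
  qed (use perm_kperms pV l0 in auto)
  then obtain a where a: "a \<le> l" "p a \<in> cycle_starts d n perm l" by blast
  have "ev (drop (l - a) ps) \<in> gball d k (length (drop (l - a) ps))" by (rule ev_in_ball[OF sub])
  moreover have "length (drop (l - a) ps) \<le> 2 * R" using ps(1) by simp
  ultimately have "ev (drop (l - a) ps) \<in> gball d k (2 * R)" using ball_mono by blast
  moreover have "\<sigma> (ev (drop (l - a) ps)) v \<in> cycle_starts d n perm (2 * R)"
    using a(2) ps(1) unfolding p_def cycle_starts_def l_def by force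
  ultimately show "v \<in> (\<Union>h\<in>gball d k (2 * R). {v. \<sigma> h v \<in> cycle_starts d n perm (2 * R)})" by blast
qed

lemma cycle_starts_sub: "cycle_starts d n perm L \<subseteq> V"
proof
  fix v assume "v \<in> cycle_starts d n perm L"
  then obtain cs xs where "v = xs ! 0" "nice_cycle d n perm cs xs" by (auto simp: cycle_starts_def)
  moreover from this have "xs ! 0 \<in> set xs" "set xs \<subseteq> V"
    by (auto simp: nice_cycle_def Let_def intro!: nth_mem)
  ultimately show "v \<in> V" by blast
qed

lemma card_bad_vertices:
  "card (V - good R) \<le> card (gball d k (2 * R)) * card (cycle_starts d n perm (2 * R))"
proof -
  let ?C = "cycle_starts d n perm (2 * R)"
  have fin: "finite ?C" using cycle_starts_sub by (rule finite_subset) simp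
  have 1: "finite {v. \<sigma> h v \<in> ?C} \<and> card {v. \<sigma> h v \<in> ?C} \<le> card ?C" if "h \<in> gball d k (2 * R)" for h
  proof -
    have inj: "inj (\<sigma> h)" using \<sigma>_permutes[of h] that ball_carrier permutes_inj by blast
    have "{v. \<sigma> h v \<in> ?C} = \<sigma> h -` ?C" by auto
    then show ?thesis using finite_vimageI[OF fin inj] card_vimage_inj_on_le[OF inj fin] by simp
  qed
  have "card (V - good R) \<le> card (\<Union>h\<in>gball d k (2 * R). {v. \<sigma> h v \<in> ?C})"
    by (rule card_mono[OF _ bad_vertices]) (use 1 finite_ball in auto)
  also have "\<dots> \<le> (\<Sum>h\<in>gball d k (2 * R). card {v. \<sigma> h v \<in> ?C})" by (rule card_UN_le[OF finite_ball])
  also have "\<dots> \<le> (\<Sum>h\<in>gball d k (2 * R). card ?C)" using 1 by (intro sum_mono) auto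
  finally show ?thesis by simp
qed

lemma check_nbhd:
  assumes "q \<in> checks" "snd q \<inter> nbhd s r \<noteq> {}" "s \<in> V"
  obtains g i where "g \<in> gball d k r" "i \<in> {1..d}" "snd q = \<phi> s ` gcoset d k g i"
proof -
  obtain i v where q: "i \<in> {1..d}" "v \<in> V" "q = (i, orbit (perm i) v)" using assms(1) by (auto simp: checks_def)
  obtain g where g: "g \<in> gball d k r" "\<phi> s g \<in> orbit (perm i) v" using assms(2) q by (auto simp: nbhd_def)
  have "snd q = orbit (perm i) (\<phi> s g)" using orbit_eq[OF perm_kperms[OF q(1)] g(2)] q by simp
  also have "\<dots> = \<phi> s ` gcoset d k g i" using \<phi>_coset(1)[OF _ assms(3) q(1)] g(1) ball_carrier by blast
  finally show ?thesis using that g q by blast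
qed

lemma check_sub_nbhd:
  assumes "q \<in> checks" "snd q \<inter> nbhd s r \<noteq> {}" "s \<in> V" "Suc r \<le> r'"
  shows "snd q \<subseteq> nbhd s r'"
proof -
  obtain g i where *: "g \<in> gball d k r" "i \<in> {1..d}" "snd q = \<phi> s ` gcoset d k g i"
    by (rule check_nbhd[OF assms(1-3)])
  then show ?thesis using coset_ball[OF *(1,2)] ball_mono[OF assms(4)] by (auto simp: nbhd_def)
qed

text \<open>The check is the image of a coset lying inside the ball of radius \<open>R\<close>, and
  injectivity on that ball keeps its other elements from landing in the check.\<close>

lemma check_lift:
  assumes "q \<in> checks" "snd q \<inter> nbhd s r \<noteq> {}" "s \<in> good R" "Suc r \<le> R"
  shows "{g \<in> gball d k R. \<phi> s g \<in> snd q} \<in> gdual"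
proof -
  have s: "s \<in> V" "inj_on (\<phi> s) (gball d k R)" using assms(3) by (auto simp: good_def)
  obtain g i where *: "g \<in> gball d k r" "i \<in> {1..d}" "snd q = \<phi> s ` gcoset d k g i"
    by (rule check_nbhd[OF assms(1,2) s(1)])
  have sub: "gcoset d k g i \<subseteq> gball d k R" using coset_ball[OF *(1,2)] ball_mono[OF assms(4)] by auto
  have "{g \<in> gball d k R. \<phi> s g \<in> snd q} = gcoset d k g i"
    unfolding *(3) using sub inj_on_image_mem_iff[OF s(2) _ sub] by auto
  moreover have "g \<in> carrier G" using *(1) ball_carrier by auto
  ultimately show ?thesis using *(2) bspan_base[of "gcoset d k g i" "cosets d k"] by (auto simp: cosets_def)
qed

lemma osum_lift:
  assumes "Q \<subseteq> checks" "\<And>q. q \<in> Q \<Longrightarrow> snd q \<inter> nbhd s r \<noteq> {}" "s \<in> good R" "Suc r \<le> R"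
  shows "{g \<in> gball d k R. \<phi> s g \<in> osum Q snd} \<in> gdual"
proof -
  have finQ: "finite Q" using assms(1) finite_checks finite_subset by blast
  have "osum Q (\<lambda>q. {g \<in> gball d k R. \<phi> s g \<in> snd q}) \<in> gdual"
    by (rule osum_in_bspan[OF finQ]) (use check_lift assms in blast)
  moreover have "osum Q (\<lambda>q. {g \<in> gball d k R. \<phi> s g \<in> snd q}) = {g \<in> gball d k R. \<phi> s g \<in> osum Q snd}"
  proof (rule Set.set_eqI)
    fix g
    show "g \<in> osum Q (\<lambda>q. {g \<in> gball d k R. \<phi> s g \<in> snd q})
        \<longleftrightarrow> g \<in> {g \<in> gball d k R. \<phi> s g \<in> osum Q snd}"
      by (cases "g \<in> gball d k R") (simp_all add: osum_def)
  qed
  ultimately show ?thesis by simp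
qed

end

section \<open>Localisation of dual words\<close>

lemma odd_card_sym_diff:
  assumes "finite A" "finite B"
  shows "odd (card (sym_diff A B)) \<longleftrightarrow> (odd (card A) \<noteq> odd (card B))"
proof -
  have "card (sym_diff A B) = card (A - B) + card (B - A)"
    by (rule card_Un_disjoint) (use assms in auto)
  moreover have "card A = card (A - B) + card (A \<inter> B)"
    by (subst card_Un_disjoint[symmetric]) (use assms in \<open>auto intro: arg_cong[of _ _ card]\<close>)
  moreover have "card B = card (B - A) + card (A \<inter> B)"
    by (subst card_Un_disjoint[symmetric]) (use assms in \<open>auto intro: arg_cong[of _ _ card]\<close>)
  ultimately show ?thesis by auto
qed

context code
begin

definition colour_union where "colour_union Q i = \<Union> {c. (i, c) \<in> Q}"

lemma checks_meet:
  assumes "(i, c) \<in> checks" "(i, c') \<in> checks" "v \<in> c" "v \<in> c'"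
  shows "c = c'"
proof -
  obtain w w' where "i \<in> {1..d}" "c = orbit (perm i) w" "c' = orbit (perm i) w'"
    using assms(1,2) by (auto simp: checks_def)
  then show ?thesis using orbit_disjoint[OF perm_kperms] assms(3,4) by blast
qed

lemma checks_nonempty: "q \<in> checks \<Longrightarrow> snd q \<noteq> {}"
proof -
  assume "q \<in> checks"
  then obtain i v where "q = (i, orbit (perm i) v)" by (auto simp: checks_def)
  then show ?thesis using orbit_nonempty[of "perm i" v] by simp
qed

text \<open>The checks of \<open>Q\<close> through a fixed vertex have distinct colours, so they
  correspond to the colours whose union contains that vertex.\<close>

lemma osum_eq_parity_set:
  assumes "Q \<subseteq> checks"
  shows "osum Q snd = parity_set d V (colour_union Q)"
proof -
  have "bij_betw fst {q \<in> Q. v \<in> snd q} {i \<in> {1..d}. v \<in> colour_union Q i}" for v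
    unfolding bij_betw_def
  proof
    show "inj_on fst {q \<in> Q. v \<in> snd q}"
    proof (rule inj_onI)
      fix q q' assume q: "q \<in> {q \<in> Q. v \<in> snd q}" "q' \<in> {q \<in> Q. v \<in> snd q}" "fst q = fst q'"
      have "q \<in> checks" "q' \<in> checks" using q assms by auto
      then have "(fst q, snd q) \<in> checks" "(fst q, snd q') \<in> checks" using q(3) by (metis prod.collapse)+
      from checks_meet[OF this, of v] have "snd q = snd q'" using q by blast
      then show "q = q'" using q(3) by (simp add: prod_eq_iff)
    qed
    show "fst ` {q \<in> Q. v \<in> snd q} = {i \<in> {1..d}. v \<in> colour_union Q i}"
    proof (intro equalityI subsetI)
      fix i assume "i \<in> fst ` {q \<in> Q. v \<in> snd q}"
      then obtain c where c: "(i, c) \<in> Q" "v \<in> c" by auto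
      then have "i \<in> {1..d}" using assms by (auto simp: checks_def)
      then show "i \<in> {i \<in> {1..d}. v \<in> colour_union Q i}" using c by (auto simp: colour_union_def)
    next
      fix i assume "i \<in> {i \<in> {1..d}. v \<in> colour_union Q i}"
      then obtain c where "(i, c) \<in> Q" "v \<in> c" by (auto simp: colour_union_def)
      then show "i \<in> fst ` {q \<in> Q. v \<in> snd q}" by (intro image_eqI[of _ _ "(i, c)"]) auto
    qed
  qed
  then have *: "card {q \<in> Q. v \<in> snd q} = card {i \<in> {1..d}. v \<in> colour_union Q i}" for v
    by (rule bij_betw_same_card)
  have "v \<in> V" if "odd (card {q \<in> Q. v \<in> snd q})" for v
  proof -
    have "{q \<in> Q. v \<in> snd q} \<noteq> {}" using that by (metis card.empty even_zero)
    then obtain q where "q \<in> Q" "v \<in> snd q" by blast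
    then have "snd q \<subseteq> V" using checks_sub[of "snd q"] assms by blast
    then show ?thesis using \<open>v \<in> snd q\<close> by blast
  qed
  then show ?thesis unfolding osum_def parity_set_def *[symmetric] by auto
qed

lemma colour_union_closed:
  assumes "Q \<subseteq> checks" "i \<in> {1..d}"
  shows "colour_union Q i \<subseteq> V" "orbit_closed (perm i) (colour_union Q i)"
proof -
  show "colour_union Q i \<subseteq> V" using assms checks_sub unfolding colour_union_def by fastforce
  show "orbit_closed (perm i) (colour_union Q i)"
    unfolding orbit_closed_def
  proof
    fix v assume "v \<in> colour_union Q i"
    then obtain c where c: "(i, c) \<in> Q" "v \<in> c" by (auto simp: colour_union_def)
    then obtain w where "c = orbit (perm i) w" using assms(1) by (auto simp: checks_def)
    then have "orbit (perm i) v = c" using orbit_eq[OF perm_kperms[OF assms(2)]] c(2) by blast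
    then show "orbit (perm i) v \<subseteq> colour_union Q i" using c(1) by (auto simp: colour_union_def)
  qed
qed

text \<open>Cycles of one colour are disjoint and nonempty, so picking a point from each is
  injective.\<close>

lemma card_checks_le:
  assumes "Q \<subseteq> checks"
  shows "card Q \<le> (\<Sum>i\<in>{1..d}. card (colour_union Q i))"
proof -
  have finQ: "finite Q" using assms finite_checks finite_subset by blast
  have fin: "finite {c. (i, c) \<in> Q}" for i
  proof (rule finite_subset)
    show "{c. (i, c) \<in> Q} \<subseteq> snd ` Q" by force
  qed (use finQ in simp)
  have "Q = Sigma {1..d} (\<lambda>i. {c. (i, c) \<in> Q})" using assms by (auto simp: checks_def)
  then have "card Q = (\<Sum>i\<in>{1..d}. card {c. (i, c) \<in> Q})"
    using fin card_SigmaI[of "{1..d}" "\<lambda>i. {c. (i, c) \<in> Q}"] by simp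
  also have "\<dots> \<le> (\<Sum>i\<in>{1..d}. card (colour_union Q i))"
  proof (rule sum_mono)
    fix i assume i: "i \<in> {1..d}"
    have finU: "finite (colour_union Q i)" using colour_union_closed(1)[OF assms i] finite_subset by blast
    show "card {c. (i, c) \<in> Q} \<le> card (colour_union Q i)"
    proof (rule card_inj_on_le[OF _ _ finU])
      define e where "e c = (SOME v. v \<in> c)" for c :: "nat set"
      have e: "e c \<in> c" if "(i, c) \<in> Q" for c
        unfolding e_def using checks_nonempty[of "(i, c)"] that assms by (auto intro: some_in_eq[THEN iffD2])
      show "inj_on e {c. (i, c) \<in> Q}"
        using e assms checks_meet[of i] by (intro inj_onI) (metis mem_Collect_eq subsetD)
      show "e ` {c. (i, c) \<in> Q} \<subseteq> colour_union Q i" using e by (auto simp: colour_union_def)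
    qed
  qed
  finally show ?thesis .
qed

text \<open>Replacing a colour class by its complement adds the all-ones vector, so a light dual word
  is a sum of few checks, and so are all its partial sums.\<close>

lemma light_dual_word:
  assumes exp: "dual_expanding d n c perm" and c: "0 < c" and u: "u \<in> dual"
    and light: "real (card u) * (1 + c) < c * n"
  obtains Q where "Q \<subseteq> checks" "u = osum Q snd"
    "\<And>Q'. Q' \<subseteq> Q \<Longrightarrow> c * card Q' \<le> card (osum Q' snd)"
proof -
  obtain Q0 where Q0: "Q0 \<subseteq> checks" "u = osum Q0 snd" using bspan_osum[OF u] by metis
  define A where "A = colour_union Q0"
  define F where "F = {i \<in> {1..d}. 2 * card (A i) > n}"
  define A' where "A' i = (if i \<in> F then V - A i else A i)" for i
  define Q where "Q = {q \<in> checks. snd q \<subseteq> A' (fst q)}"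
  have AV: "A i \<subseteq> V" "orbit_closed (perm i) (A i)" if "i \<in> {1..d}" for i
    using colour_union_closed[OF Q0(1) that] by (auto simp: A_def)
  have A'V: "A' i \<subseteq> V" "2 * card (A' i) \<le> n" if "i \<in> {1..d}" for i
  proof -
    have finA: "finite (A i)" using AV(1)[OF that] by (rule finite_subset) simp
    have "card (V - A i) = n - card (A i)" using card_Diff_subset[OF finA AV(1)[OF that]] by simp
    then show "A' i \<subseteq> V" "2 * card (A' i) \<le> n" using AV(1)[OF that] that by (auto simp: A'_def F_def)
  qed
  have A'c: "orbit_closed (perm i) (A' i)" if i: "i \<in> {1..d}" for i
  proof -
    have "orbit (perm i) v \<subseteq> V - A i" if "v \<in> V - A i" for v
    proof -
      have "orbit (perm i) v \<subseteq> V" using orbit_perm_V[OF i] that by blast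
      moreover have "w \<notin> A i" if w: "w \<in> orbit (perm i) v" for w
        using orbit_sym[OF perm_kperms[OF i] w] AV(2)[OF i] \<open>v \<in> V - A i\<close> by (auto simp: orbit_closed_def)
      ultimately show ?thesis by blast
    qed
    then show ?thesis using AV(2)[OF i] by (auto simp: A'_def orbit_closed_def)
  qed
  have Qc: "Q \<subseteq> checks" by (auto simp: Q_def)
  have QA': "colour_union Q i = A' i" if i: "i \<in> {1..d}" for i
  proof
    show "colour_union Q i \<subseteq> A' i" by (auto simp: colour_union_def Q_def)
    show "A' i \<subseteq> colour_union Q i"
    proof
      fix v assume v: "v \<in> A' i"
      then have "orbit (perm i) v \<subseteq> A' i" "v \<in> V" using A'c[OF i] A'V(1)[OF i] by (auto simp: orbit_closed_def)
      then have "(i, orbit (perm i) v) \<in> Q" using i by (auto simp: Q_def checks_def)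
      then show "v \<in> colour_union Q i"
        using self_in_orbit[OF perm_kperms[OF i], of v] by (auto simp: colour_union_def)
    qed
  qed
  \<comment> \<open>A subfamily occupies no more points of each colour than \<open>A'\<close>, so it
    respects the bound of one half and expansion applies to it as well.\<close>
  have expand: "c * card Q' \<le> card (osum Q' snd)" "card (osum Q' snd) \<le> n - c * card Q'"
    "c * real (\<Sum>i\<in>{1..d}. card (colour_union Q' i)) \<le> real n - real (card (osum Q' snd))"
    if Q': "Q' \<subseteq> Q" for Q'
  proof -
    have Q'c: "Q' \<subseteq> checks" using Q' Qc by auto
    have "colour_union Q' i \<subseteq> V \<and> orbit_closed (perm i) (colour_union Q' i) \<and> 2 * card (colour_union Q' i) \<le> n"
      if i: "i \<in> {1..d}" for i
    proof -
      have "colour_union Q' i \<subseteq> A' i" using Q' QA'[OF i] by (auto simp: colour_union_def)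
      moreover have "finite (A' i)" using A'V(1)[OF i] finite_subset by blast
      ultimately have "card (colour_union Q' i) \<le> card (A' i)" by (rule card_mono[rotated])
      then show ?thesis using A'V(2)[OF i] colour_union_closed[OF Q'c i] by simp
    qed
    then have e: "c * real (\<Sum>i\<in>{1..d}. card (colour_union Q' i)) \<le> real (card (osum Q' snd))"
      "real (card (osum Q' snd)) \<le> real n - c * real (\<Sum>i\<in>{1..d}. card (colour_union Q' i))"
      using exp unfolding dual_expanding_def osum_eq_parity_set[OF Q'c] by blast+
    have "c * real (card Q') \<le> c * real (\<Sum>i\<in>{1..d}. card (colour_union Q' i))"
      using c card_checks_le[OF Q'c] by (intro mult_left_mono of_nat_mono) auto
    then show "c * card Q' \<le> card (osum Q' snd)" "card (osum Q' snd) \<le> n - c * card Q'"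
      "c * real (\<Sum>i\<in>{1..d}. card (colour_union Q' i)) \<le> real n - real (card (osum Q' snd))"
      using e by linarith+
  qed
  have par: "parity_set d V A' = (if odd (card F) then V - u else u)"
  proof -
    have "{i \<in> {1..d}. v \<in> A' i} = sym_diff {i \<in> {1..d}. v \<in> A i} F" if "v \<in> V" for v
    proof -
      have "v \<in> A' i \<longleftrightarrow> (v \<in> A i \<longleftrightarrow> i \<notin> F)" for i using that by (simp add: A'_def)
      moreover have "F \<subseteq> {1..d}" by (auto simp: F_def)
      ultimately show ?thesis by blast
    qed
    then have "odd (card {i \<in> {1..d}. v \<in> A' i}) \<longleftrightarrow> (odd (card {i \<in> {1..d}. v \<in> A i}) \<noteq> odd (card F))"
      if "v \<in> V" for v
      using odd_card_sym_diff[of "{i \<in> {1..d}. v \<in> A i}" F] that by (simp add: F_def)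
    then have 1: "parity_set d V A' = {v \<in> V. odd (card {i \<in> {1..d}. v \<in> A i}) \<noteq> odd (card F)}"
      unfolding parity_set_def by blast
    have 2: "u = {v \<in> V. odd (card {i \<in> {1..d}. v \<in> A i})}"
      unfolding Q0(2) osum_eq_parity_set[OF Q0(1)] A_def[symmetric] parity_set_def ..
    have "p = (if b then V - w else w)" if "p = {v \<in> V. P v \<noteq> b}" "w = {v \<in> V. P v}" for p w P b
      using that by (cases b) auto
    from this[OF 1 2] show ?thesis .
  qed
  have parQ: "osum Q snd = parity_set d V A'"
  proof -
    have "{i \<in> {1..d}. v \<in> colour_union Q i} = {i \<in> {1..d}. v \<in> A' i}" for v using QA' by blast
    then show ?thesis unfolding osum_eq_parity_set[OF Qc] parity_set_def by simp
  qed
  show ?thesis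
  proof (cases "odd (card F)")
    case False
    then have "u = osum Q snd" using par parQ by simp
    then show ?thesis using that[OF Qc _ expand(1)] by blast
  next
    \<comment> \<open>After an odd number of complementations the sum of \<open>Q\<close> would be
      the complement of \<open>u\<close>, hence nearly everything, and it is covered by the colour
      classes of \<open>Q\<close>. The upper bound of expansion then gives
      \<open>c * (n - card u) \<le> card u\<close>, against lightness.\<close>
    case True
    then have Vu: "osum Q snd = V - u" using par parQ by simp
    have uV: "u \<subseteq> V" using bspan_sub[OF u checks_sub] by blast
    then have cV: "card (V - u) = n - card u" "card u \<le> n"
      using card_mono[OF _ uV] card_Diff_subset[OF finite_subset[OF uV] uV] by simp_all
    have "V - u \<subseteq> (\<Union>i\<in>{1..d}. colour_union Q i)"
    proof
      fix v assume "v \<in> V - u"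
      then have "v \<in> osum Q snd" using Vu by simp
      then obtain i c where "(i, c) \<in> Q" "v \<in> c" using osum_subset[of Q snd] by fastforce
      moreover have "i \<in> {1..d}" using calculation(1) Qc by (auto simp: checks_def)
      ultimately show "v \<in> (\<Union>i\<in>{1..d}. colour_union Q i)" by (auto simp: colour_union_def)
    qed
    then have "card (V - u) \<le> card (\<Union>i\<in>{1..d}. colour_union Q i)"
    proof (rule card_mono[rotated])
      have "(\<Union>i\<in>{1..d}. colour_union Q i) \<subseteq> V" using colour_union_closed(1)[OF Qc] by blast
      then show "finite (\<Union>i\<in>{1..d}. colour_union Q i)" by (rule finite_subset) simp
    qed
    also have "\<dots> \<le> (\<Sum>i\<in>{1..d}. card (colour_union Q i))" by (rule card_UN_le) simp
    finally have "c * real (n - card u) \<le> c * real (\<Sum>i\<in>{1..d}. card (colour_union Q i))"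
      using c cV by (intro mult_left_mono of_nat_mono) auto
    also have "\<dots> \<le> real n - real (card (osum Q snd))" using expand(3)[of Q] by blast
    also have "\<dots> = real (card u)" using cV Vu by (simp add: of_nat_diff)
    finally have "c * (real n - real (card u)) \<le> real (card u)" using cV by (simp add: of_nat_diff)
    then show ?thesis using light by (simp add: algebra_simps)
  qed
qed

end

context code
begin

lemma nbhd_mono: "r \<le> r' \<Longrightarrow> nbhd s r \<subseteq> nbhd s r'"
  using ball_mono by (auto simp: nbhd_def)

lemma card_nbhd_le: "card (nbhd s r) \<le> card (gball d k r)"
  unfolding nbhd_def by (rule card_image_le[OF finite_ball])

lemma finite_nbhd: "finite (nbhd s r)"
  unfolding nbhd_def using finite_ball by simp

text \<open>A connected family of checks whose sum lives on the small neighbourhoods of \<open>S\<close> has too few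
  checks to cross all shells around the points of \<open>S\<close> it touches; so it misses a shell, and then it
  is contained in a single large neighbourhood.\<close>

lemma local_component:
  fixes c :: real
  assumes S: "finite S" "S \<subseteq> V" and disj: "\<And>s s'. s \<in> S \<Longrightarrow> s' \<in> S \<Longrightarrow> s \<noteq> s' \<Longrightarrow> nbhd s R \<inter> nbhd s' R = {}"
    and C: "C \<subseteq> checks" "C \<noteq> {}"
    and conn: "\<And>C'. C' \<subseteq> C \<Longrightarrow> C' \<noteq> {} \<Longrightarrow> C' \<noteq> C \<Longrightarrow> \<exists>q\<in>C'. \<exists>q'\<in>C - C'. snd q \<inter> snd q' \<noteq> {}"
    and exp: "c * card C \<le> card (osum C snd)" and c: "0 < c"
    and R: "card (gball d k r) < c * (real R - real r - 1)"
    and supp: "osum C snd \<subseteq> (\<Union>s\<in>S. nbhd s r)"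
  obtains s \<rho> where "s \<in> S" "Suc \<rho> < R" "\<And>q. q \<in> C \<Longrightarrow> snd q \<inter> nbhd s \<rho> \<noteq> {}"
proof -
  have finC: "finite C" using C(1) finite_checks finite_subset by blast
  have rR: "r + 1 < R"
  proof -
    have "0 < c * (real R - real r - 1)" using R by (meson of_nat_0_le_iff order_le_less_trans)
    then have "0 < real R - real r - 1" using c by (simp add: zero_less_mult_iff)
    then show ?thesis by linarith
  qed
  \<comment> \<open>Only the points of \<open>S\<close> whose small neighbourhood the family touches
    are counted, so that the bound on the support and the number of layers are both proportional to
    \<open>card T\<close>.\<close>
  define T where "T = {s \<in> S. \<exists>q\<in>C. snd q \<inter> nbhd s r \<noteq> {}}"
  have finT: "finite T" using S by (simp add: T_def)
  have "osum C snd \<subseteq> (\<Union>s\<in>T. nbhd s r)"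
  proof
    fix v assume v: "v \<in> osum C snd"
    then obtain s where "s \<in> S" "v \<in> nbhd s r" using supp by blast
    moreover obtain q where "q \<in> C" "v \<in> snd q" using v osum_subset[of C snd] by blast
    ultimately have "s \<in> T" by (auto simp: T_def)
    then show "v \<in> (\<Union>s\<in>T. nbhd s r)" using \<open>v \<in> nbhd s r\<close> by blast
  qed
  then have "card (osum C snd) \<le> card (\<Union>s\<in>T. nbhd s r)"
    by (rule card_mono[rotated]) (simp add: finT finite_nbhd)
  also have "\<dots> \<le> (\<Sum>s\<in>T. card (nbhd s r))" by (rule card_UN_le[OF finT])
  also have "\<dots> \<le> (\<Sum>s\<in>T. card (gball d k r))" by (rule sum_mono[OF card_nbhd_le])
  also have "\<dots> = card T * card (gball d k r)" by simp
  finally have "real (card (osum C snd)) \<le> real (card T * card (gball d k r))"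
    by (rule of_nat_mono)
  then have up: "c * card C \<le> real (card T) * real (card (gball d k r))" using exp by simp
  have "0 < c * card C" using c C(2) finC by (simp add: card_gt_0_iff)
  then have T0: "0 < card T" using up by (cases "card T = 0") auto
  \<comment> \<open>A check in one of these layers stays within radius \<open>R\<close> of its
    centre, so layers of different pairs are disjoint. If none were empty, \<open>C\<close> would
    have at least \<open>card T * (R - 1 - r)\<close> checks, against expansion and the choice of
    \<open>R\<close>.\<close>
  define layer where "layer s \<rho> = {q \<in> C. snd q \<inter> nbhd s \<rho> \<noteq> {} \<and> snd q \<inter> nbhd s (\<rho> - 1) = {}}" for s \<rho>
  have "\<exists>s\<in>T. \<exists>\<rho>\<in>{r + 1..R - 1}. layer s \<rho> = {}"
  proof (rule ccontr)
    assume "\<not> ?thesis"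
    then have "\<forall>x\<in>T \<times> {r + 1..R - 1}. \<exists>q. q \<in> layer (fst x) (snd x)"
      unfolding ex_in_conv by auto
    then obtain e where e: "\<forall>x\<in>T \<times> {r + 1..R - 1}. e x \<in> layer (fst x) (snd x)" by metis
    have "card (T \<times> {r + 1..R - 1}) \<le> card C"
    proof (rule card_inj_on_le[OF _ _ finC])
      show "e ` (T \<times> {r + 1..R - 1}) \<subseteq> C" using e by (auto simp: layer_def)
      show "inj_on e (T \<times> {r + 1..R - 1})"
      proof (rule inj_onI)
        fix x y assume xy: "x \<in> T \<times> {r + 1..R - 1}" "y \<in> T \<times> {r + 1..R - 1}" "e x = e y"
        obtain s \<rho> s' \<rho>' where x: "x = (s, \<rho>)" and y: "y = (s', \<rho>')" by fastforce
        have l: "e x \<in> layer s \<rho>" "e x \<in> layer s' \<rho>'"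
          using bspec[OF e xy(1)] bspec[OF e xy(2)] xy(3) x y by auto
        have ss: "s \<in> S" "s' \<in> S" "s \<in> V" "s' \<in> V" using xy x y S by (auto simp: T_def)
        have qc: "e x \<in> checks" using l C by (auto simp: layer_def)
        have "snd (e x) \<subseteq> nbhd s R"
          by (rule check_sub_nbhd[OF qc _ ss(3), of \<rho>]) (use l xy x in \<open>auto simp: layer_def\<close>)
        moreover have "snd (e x) \<subseteq> nbhd s' R"
          by (rule check_sub_nbhd[OF qc _ ss(4), of \<rho>']) (use l xy y in \<open>auto simp: layer_def\<close>)
        ultimately have s: "s = s'" using disj[OF ss(1,2)] checks_nonempty[OF qc] by blast
        have lt: "\<not> a < b" if "e x \<in> layer s a" "e x \<in> layer s b" for a b
        proof
          assume "a < b"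
          then have "a \<le> b - 1" by simp
          from nbhd_mono[OF this, of s] show False using that unfolding layer_def by blast
        qed
        have "\<not> \<rho> < \<rho>'" "\<not> \<rho>' < \<rho>" using lt l s by auto
        then show "x = y" using s x y by simp
      qed
    qed
    then have "real (card T * (R - 1 - r)) \<le> real (card C)"
      by (intro of_nat_mono) (simp add: card_cartesian_product)
    moreover have "real (R - 1 - r) = real R - real r - 1" using rR by linarith
    ultimately have "real (card T) * (real R - real r - 1) \<le> real (card C)" by (simp only: of_nat_mult)
    then have "c * (real (card T) * (real R - real r - 1)) \<le> c * real (card C)" using c by simp
    also have "\<dots> \<le> real (card T) * real (card (gball d k r))" using up .
    also have "\<dots> < real (card T) * (c * (real R - real r - 1))" using T0 R by simp
    finally show False by (simp add: algebra_simps)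
  qed
  then obtain s \<rho> where s: "s \<in> T" and \<rho>: "\<rho> \<in> {r + 1..R - 1}" and empty: "layer s \<rho> = {}" by blast
  have sS: "s \<in> S" "s \<in> V" using s S by (auto simp: T_def)
  \<comment> \<open>By connectivity these are all of \<open>C\<close>: a further check of
    \<open>C\<close> touching one of them would lie in the empty layer.\<close>
  define C' where "C' = {q \<in> C. snd q \<inter> nbhd s (\<rho> - 1) \<noteq> {}}"
  have C'0: "C' \<noteq> {}"
    using s nbhd_mono[of r "\<rho> - 1" s] \<rho> unfolding C'_def T_def by fastforce
  have "C' = C"
  proof (rule ccontr)
    assume "C' \<noteq> C"
    then obtain q q' where q: "q \<in> C'" "q' \<in> C - C'" "snd q \<inter> snd q' \<noteq> {}"
    proof -
      have "C' \<subseteq> C" by (auto simp: C'_def)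
      from conn[OF this C'0 \<open>C' \<noteq> C\<close>] show ?thesis using that by blast
    qed
    have "snd q \<subseteq> nbhd s \<rho>"
      by (rule check_sub_nbhd[of q s "\<rho> - 1"]) (use q C sS \<rho> in \<open>auto simp: C'_def\<close>)
    then have "q' \<in> layer s \<rho>" using q by (auto simp: layer_def C'_def)
    then show False using empty by simp
  qed
  then have "snd q \<inter> nbhd s (\<rho> - 1) \<noteq> {}" if "q \<in> C" for q using that unfolding C'_def by blast
  moreover have "Suc (\<rho> - 1) < R" using \<rho> rR by auto
  ultimately show ?thesis using that sS(1) by blast
qed

text \<open>Induction over \<open>Q\<close>, splitting off one connected component at a time.
  Different components have disjoint sums, so each inherits the support condition, and each
  component stays near a single \<open>s0\<close>: for \<open>s = s0\<close> it lifts to a sum of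
  cosets, for any other \<open>s\<close> its lift is empty.\<close>

lemma local_duality:
  fixes c :: real
  assumes S: "S \<subseteq> good R" and disj: "\<And>s s'. s \<in> S \<Longrightarrow> s' \<in> S \<Longrightarrow> s \<noteq> s' \<Longrightarrow> nbhd s R \<inter> nbhd s' R = {}"
    and c: "0 < c" and R: "card (gball d k r) < c * (real R - real r - 1)"
    and Q: "Q \<subseteq> checks" "\<And>Q'. Q' \<subseteq> Q \<Longrightarrow> c * card Q' \<le> card (osum Q' snd)"
      "osum Q snd \<subseteq> (\<Union>s\<in>S. nbhd s r)" and s: "s \<in> S"
  shows "{g \<in> gball d k R. \<phi> s g \<in> osum Q snd} \<in> gdual"
proof -
  have SV: "S \<subseteq> V" using S by (auto simp: good_def)
  have finS: "finite S" by (rule finite_subset[OF SV]) simp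
  have "finite Q" using Q(1) finite_checks finite_subset by blast
  then show ?thesis using Q
  proof (induction Q rule: finite_psubset_induct)
    case (psubset Q)
    show ?case
    proof (cases "Q = {}")
      case True
      then show ?thesis by (simp add: bspan.empty)
    next
      case False
      \<comment> \<open>A component is obtained as a closed subfamily of least cardinality: a proper
        part of it without links to the rest would be closed and smaller.\<close>
      define closed where "closed C \<longleftrightarrow> C \<subseteq> Q \<and> C \<noteq> {} \<and> (\<forall>q\<in>C. \<forall>q'\<in>Q - C. snd q \<inter> snd q' = {})" for C
      have "closed Q" using False by (simp add: closed_def)
      then obtain C where C: "closed C" "\<And>C'. closed C' \<Longrightarrow> card C \<le> card C'"
        using ex_has_least_nat[of closed Q card] by blast
      have CQ: "C \<subseteq> Q" "C \<noteq> {}" using C(1) by (auto simp: closed_def)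
      have finC: "finite C" using CQ psubset.hyps finite_subset by blast
      have conn: "\<exists>q\<in>C'. \<exists>q'\<in>C - C'. snd q \<inter> snd q' \<noteq> {}"
        if C': "C' \<subseteq> C" "C' \<noteq> {}" "C' \<noteq> C" for C'
      proof (rule ccontr)
        assume no: "\<not> ?thesis"
        have "snd q \<inter> snd q' = {}" if "q \<in> C'" "q' \<in> Q - C'" for q q'
          using no C(1) that C'(1) unfolding closed_def by (cases "q' \<in> C") blast+
        then have "closed C'" using C' CQ unfolding closed_def by blast
        then have "card C \<le> card C'" by (rule C(2))
        then show False using C' finC by (metis card_seteq)
      qed
      have oQ: "osum Q snd = sym_diff (osum C snd) (osum (Q - C) snd)"
      proof -
        have "osum (C \<union> (Q - C)) snd = sym_diff (osum C snd) (osum (Q - C) snd)"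
          by (rule osum_Un_disjoint) (use finC psubset.hyps in auto)
        moreover have "C \<union> (Q - C) = Q" using CQ by auto
        ultimately show ?thesis by simp
      qed
      have "osum C snd \<inter> osum (Q - C) snd = {}"
        using osum_subset[of C snd] osum_subset[of "Q - C" snd] C(1) unfolding closed_def by blast
      then have sub: "osum C snd \<subseteq> osum Q snd" "osum (Q - C) snd \<subseteq> osum Q snd" using oQ by auto
      have Cc: "C \<subseteq> checks" using CQ psubset.prems(1) by auto
      obtain s0 \<rho> where s0: "s0 \<in> S" "Suc \<rho> < R" "\<And>q. q \<in> C \<Longrightarrow> snd q \<inter> nbhd s0 \<rho> \<noteq> {}"
      proof (rule local_component[OF finS SV disj Cc CQ(2) conn _ c R])
        show "c * card C \<le> card (osum C snd)" using psubset.prems(2)[OF CQ(1)] .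
        show "osum C snd \<subseteq> (\<Union>s\<in>S. nbhd s r)" using sub(1) psubset.prems(3) by blast
      qed blast+
      have 1: "{g \<in> gball d k R. \<phi> s g \<in> osum C snd} \<in> gdual"
      proof (cases "s = s0")
        case True
        have "s0 \<in> good R" using s0(1) S by blast
        from osum_lift[OF Cc s0(3) this] show ?thesis using s0(2) True by simp
      next
        case False
        have "snd q \<subseteq> nbhd s0 R" if "q \<in> C" for q
        proof (rule check_sub_nbhd[of q s0 \<rho> R])
          show "q \<in> checks" "s0 \<in> V" using that Cc s0(1) SV by blast+
        qed (use s0(2) s0(3)[OF that] in auto)
        then have "osum C snd \<subseteq> nbhd s0 R" using osum_subset[of C snd] by blast
        then have eq: "{g \<in> gball d k R. \<phi> s g \<in> osum C snd} = {}"
          using disj[OF s s0(1) False] by (auto simp: nbhd_def)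
        show ?thesis unfolding eq by (rule bspan.empty)
      qed
      have 2: "{g \<in> gball d k R. \<phi> s g \<in> osum (Q - C) snd} \<in> gdual"
      proof (rule psubset.IH)
        show "Q - C \<subset> Q" using CQ by auto
        show "c * card Q' \<le> card (osum Q' snd)" if "Q' \<subseteq> Q - C" for Q'
          using psubset.prems(2)[of Q'] that by auto
      qed (use psubset.prems sub in auto)
      have "{g \<in> gball d k R. \<phi> s g \<in> osum Q snd} = sym_diff {g \<in> gball d k R. \<phi> s g \<in> osum C snd}
          {g \<in> gball d k R. \<phi> s g \<in> osum (Q - C) snd}"
        unfolding oQ by auto
      then show ?thesis using bspan_sym_diff[OF 1 2] by simp
    qed
  qed
qed

text \<open>Near well-separated good points the code satisfies no relation that the group does not
  impose. The smallness of \<open>S\<close> makes \<open>u\<close> light, and this supplies a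
  representation by checks all of whose subfamilies expand.\<close>

lemma dual_localises:
  fixes c :: real
  assumes exp: "dual_expanding d n c perm" and c: "0 < c"
    and R: "card (gball d k r) < c * (real R - real r - 1)"
    and S: "S \<subseteq> good R" and disj: "\<And>s s'. s \<in> S \<Longrightarrow> s' \<in> S \<Longrightarrow> s \<noteq> s' \<Longrightarrow> nbhd s R \<inter> nbhd s' R = {}"
    and small: "real (card S) * card (gball d k r) * (1 + c) < c * n"
    and u: "u \<in> dual" "u \<subseteq> (\<Union>s\<in>S. nbhd s r)" and s: "s \<in> S"
  shows "{g \<in> gball d k r. \<phi> s g \<in> u} \<in> gdual"
proof -
  have "S \<subseteq> V" using S by (auto simp: good_def)
  then have finS: "finite S" by (rule finite_subset) simp
  have "card u \<le> card (\<Union>s\<in>S. nbhd s r)" by (rule card_mono[OF _ u(2)]) (simp add: finS finite_nbhd)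
  also have "\<dots> \<le> (\<Sum>s\<in>S. card (nbhd s r))" by (rule card_UN_le[OF finS])
  also have "\<dots> \<le> (\<Sum>s\<in>S. card (gball d k r))" by (rule sum_mono[OF card_nbhd_le])
  also have "\<dots> = card S * card (gball d k r)" by simp
  finally have "real (card u) \<le> real (card S * card (gball d k r))"
    by (rule of_nat_mono)
  then have "real (card u) * (1 + c) \<le> real (card S) * card (gball d k r) * (1 + c)"
    using c by (simp add: mult_right_mono)
  then have light: "real (card u) * (1 + c) < c * n" using small by linarith
  obtain Q where Q: "Q \<subseteq> checks" "u = osum Q snd"
    "\<And>Q'. Q' \<subseteq> Q \<Longrightarrow> c * card Q' \<le> card (osum Q' snd)"
    by (rule light_dual_word[OF exp c u(1) light]) blast
  have "{g \<in> gball d k R. \<phi> s g \<in> u} \<in> gdual"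
    using local_duality[OF S disj c R Q(1,3) _ s] u(2) unfolding Q(2) by blast
  \<comment> \<open>Back from radius \<open>R\<close> to \<open>r\<close>: \<open>u\<close> lives on
    the small neighbourhoods, the large ones are disjoint, and \<open>\<phi> s\<close> is injective
    on the large ball.\<close>
  moreover have "{g \<in> gball d k R. \<phi> s g \<in> u} = {g \<in> gball d k r. \<phi> s g \<in> u}"
  proof -
    have rR: "r \<le> R"
    proof -
      have "0 < c * (real R - real r - 1)" using R by (meson of_nat_0_le_iff order_le_less_trans)
      then have "0 < real R - real r - 1" using c by (simp add: zero_less_mult_iff)
      then show ?thesis by linarith
    qed
    have "g \<in> gball d k r" if g: "g \<in> gball d k R" "\<phi> s g \<in> u" for g
    proof -
      obtain s' where s': "s' \<in> S" "\<phi> s g \<in> nbhd s' r" using u(2) g(2) by blast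
      have "\<phi> s g \<in> nbhd s' R" "\<phi> s g \<in> nbhd s R" using s'(2) nbhd_mono[OF rR] g(1) by (auto simp: nbhd_def)
      then have "s' = s" using disj[OF s s'(1)] by blast
      then obtain h where "h \<in> gball d k r" "\<phi> s g = \<phi> s h" using s'(2) by (auto simp: nbhd_def)
      moreover have "inj_on (\<phi> s) (gball d k R)" using s S by (auto simp: good_def)
      ultimately show ?thesis using g(1) ball_mono[OF rR] by (metis inj_onD subsetD)
    qed
    then show ?thesis using ball_mono[OF rR] by blast
  qed
  ultimately show ?thesis by simp
qed

end

section \<open>Local statistics and entropy of the uniform measure on a code\<close>

lemma config_finite: "finite I \<Longrightarrow> config I = (count_space (I \<rightarrow>\<^sub>E UNIV) :: ('i \<Rightarrow> 'a::finite) measure)"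
  unfolding config_def by (rule count_space_PiM_finite) auto

lemma marginal_has_dual:
  assumes \<nu>: "has_dual I D \<nu>" and F: "F \<subseteq> I"
  shows "has_dual F D (marginal F \<nu>)"
proof -
  have P: "\<nu> \<in> Prob I" using \<nu> by (simp add: has_dual_def)
  have ps: "prob_space \<nu>" using P by (simp add: Prob_def)
  have "(\<lambda>x. restrict x F) \<in> measurable (config I) (config F)"
    unfolding config_def by (rule measurable_restrict_subset[OF F])
  then have meas: "(\<lambda>x. restrict x F) \<in> measurable \<nu> (config F)"
    using Prob_measurable_iff[OF P] by blast
  show ?thesis
    unfolding has_dual_def marginal_def
  proof (intro conjI allI impI)
    show "distr \<nu> (config F) (\<lambda>x. restrict x F) \<in> Prob F"
      using prob_space.prob_space_distr[OF ps meas] by (simp add: Prob_def)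
    fix u assume u: "finite u" "u \<subseteq> F"
    have "(\<integral>x. chi u x \<partial>distr \<nu> (config F) (\<lambda>x. restrict x F)) = (\<integral>x. chi u (restrict x F) \<partial>\<nu>)"
      by (rule integral_distr[OF meas measurable_chi[OF u(2)]])
    also have "\<dots> = (\<integral>x. chi u x \<partial>\<nu>)"
      by (intro Bochner_Integration.integral_cong chi_cong) (use u in auto)
    also have "\<dots> = of_bool (u \<in> D)" using \<nu> u F by (simp add: has_dual_def)
    finally show "(\<integral>x. chi u x \<partial>distr \<nu> (config F) (\<lambda>x. restrict x F)) = of_bool (u \<in> D)" .
  qed
qed

context code
begin

abbreviation \<mu> where "\<mu> \<equiv> code_measure d k n \<sigma>"
abbreviation X where "X \<equiv> X_code d k n \<sigma>"
abbreviation P where "P v \<equiv> pullback_name G \<sigma> v"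

lemma finite_space: "finite (V \<rightarrow>\<^sub>E (UNIV :: bit set))"
  by (intro finite_PiE) auto

lemma X_sub: "X \<subseteq> V \<rightarrow>\<^sub>E UNIV"
  by (auto simp: X_code_def)

lemma finite_X: "finite X"
  using X_sub finite_space by (rule finite_subset)

lemma X_nonempty: "X \<noteq> {}"
proof -
  have "(\<lambda>v\<in>V. 0) \<in> annihilator V (snd ` checks)"
    unfolding annihilator_def
  proof (rule CollectI, intro conjI ballI)
    fix c assume "c \<in> snd ` checks"
    then show "sum (\<lambda>v\<in>V. 0) c = (0 :: bit)" using checks_sub by (intro sum.neutral) fastforce
  qed auto
  then show ?thesis unfolding X_code_eq by blast
qed

lemma card_X_pos: "0 < card X"
  using finite_X X_nonempty by (simp add: card_gt_0_iff)

lemma space_\<mu>: "space \<mu> = V \<rightarrow>\<^sub>E UNIV"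
  by (simp add: code_measure_def)

lemma sets_\<mu>: "sets \<mu> = Pow (V \<rightarrow>\<^sub>E UNIV)"
  by (simp add: code_measure_def)

lemma prob_space_\<mu>: "prob_space \<mu>"
  unfolding code_measure_def
  by (rule prob_space_uniform_measure)
    (use X_sub finite_X X_nonempty in \<open>auto simp: emeasure_count_space\<close>)

lemma measurable_\<mu>: "f \<in> measurable \<mu> N \<longleftrightarrow> f \<in> (V \<rightarrow>\<^sub>E UNIV) \<rightarrow> space N"
  using measurable_cong_sets[of \<mu> "count_space (V \<rightarrow>\<^sub>E UNIV)" N N] by (simp add: sets_\<mu>)

lemma integral_\<mu>: "(\<integral>x. f x \<partial>\<mu>) = (\<Sum>x\<in>X. f x) / card X" for f :: "_ \<Rightarrow> real"
proof -
  let ?N = "count_space (V \<rightarrow>\<^sub>E (UNIV :: bit set))"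
  have "emeasure ?N X = of_nat (card X)" using X_sub finite_X by (simp add: emeasure_count_space)
  then have "indicator X x / emeasure ?N X = ennreal (indicator X x / real (card X))" for x
    using card_X_pos
    by (simp add: divide_ennreal[symmetric] ennreal_of_nat_eq_real_of_nat ennreal_indicator)
  then have "\<mu> = density ?N (\<lambda>x. ennreal (indicator X x / real (card X)))"
    by (simp add: code_measure_def uniform_measure_def)
  then have "(\<integral>x. f x \<partial>\<mu>) = (\<integral>x. (indicator X x / real (card X)) *\<^sub>R f x \<partial>?N)"
    by (simp only:) (rule integral_density, auto)
  also have "\<dots> = (\<Sum>x\<in>V \<rightarrow>\<^sub>E UNIV. indicator X x * (f x / real (card X)))"
    by (subst lebesgue_integral_count_space_finite[OF finite_space]) simp
  also have "\<dots> = (\<Sum>x\<in>X. f x / real (card X))"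
    using X_sub finite_space by (intro sum.mono_neutral_cong_right) auto
  finally show ?thesis by (simp add: sum_divide_distrib)
qed

text \<open>As for Haar measure: adding a codeword whose sum over \<open>u\<close> is 1 is an
  involution of the code that changes the sign of \<open>chi u\<close>.\<close>

lemma \<mu>_has_dual: "has_dual V dual \<mu>"
  unfolding has_dual_def
proof (intro conjI allI impI)
  show "\<mu> \<in> Prob V" using prob_space_\<mu> by (simp add: Prob_def sets_\<mu> config_finite)
  fix u assume u: "finite u" "u \<subseteq> V"
  show "(\<integral>x. chi u x \<partial>\<mu>) = of_bool (u \<in> dual)"
  proof (cases "u \<in> dual")
    case True
    have "chi u x = 1" if "x \<in> X" for x
      using annihilator_bspan[of x V "snd ` checks" u] that True checks_sub u
      by (simp add: chi_eq X_code_eq)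
    then have "(\<Sum>x\<in>X. chi u x) = real (card X)" by simp
    then show ?thesis using True card_X_pos by (simp add: integral_\<mu>)
  next
    case False
    obtain y where y: "y \<in> annihilator V (snd ` checks)" "sum y u = 1"
      by (rule annihilator_separates[of V "snd ` checks" u]) (use u False checks_sub in auto)
    define t where "t x = (\<lambda>v\<in>V. y v + x v)" for x
    have tX: "t x \<in> X" if x: "x \<in> X" for x
    proof -
      have "sum (t x) c = 0" if c: "c \<in> snd ` checks" for c
      proof -
        have "sum (t x) c = (\<Sum>v\<in>c. y v + x v)"
          unfolding t_def using checks_sub[OF c] by (intro sum.cong) auto
        also have "\<dots> = sum y c + sum x c" by (rule sum.distrib)
        also have "sum y c = 0" using y c unfolding annihilator_def by blast
        also have "sum x c = 0" using x c unfolding X_code_eq annihilator_def by blast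
        also have "(0 :: bit) + 0 = 0" by simp
        finally show ?thesis .
      qed
      then show ?thesis unfolding X_code_eq annihilator_def by (auto simp: t_def)
    qed
    have tt: "t (t x) = x" if x: "x \<in> X" for x
    proof (rule PiE_ext[of _ V "\<lambda>_. UNIV"])
      show "t (t x) \<in> V \<rightarrow>\<^sub>E UNIV" by (auto simp: t_def)
      show "x \<in> V \<rightarrow>\<^sub>E UNIV" using x X_sub by blast
      fix v assume "v \<in> V"
      then show "t (t x) v = x v" by (cases "y v"; cases "x v") (simp_all add: t_def)
    qed
    have "(\<Sum>x\<in>X. chi u x) = (\<Sum>x\<in>X. chi u (t x))"
      by (rule sum.reindex_bij_witness[of _ t t]) (use tX tt in auto)
    also have "\<dots> = (\<Sum>x\<in>X. - chi u x)"
      unfolding t_def chi_add[OF u(2)] using y(2) by (simp add: chi_eq[OF u(1), of y])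
    also have "\<dots> = - (\<Sum>x\<in>X. chi u x)" by (rule sum_negf)
    finally show ?thesis using False by (simp add: integral_\<mu>)
  qed
qed

lemma pullback_in: "P v x \<in> carrier G \<rightarrow>\<^sub>E UNIV"
  by (auto simp: pullback_name_def)

lemma chi_pullback:
  assumes "u \<subseteq> carrier G" "inj_on (\<phi> v) u"
  shows "chi u (P v x) = chi (\<phi> v ` u) x"
proof -
  have "chi (\<phi> v ` u) x = (\<Prod>g\<in>u. if x (\<phi> v g) = 0 then 1 else - 1)"
    unfolding chi_def by (simp add: prod.reindex[OF assms(2)])
  also have "\<dots> = chi u (P v x)"
    unfolding chi_def pullback_name_def using assms(1) by (intro prod.cong) auto
  finally show ?thesis ..
qed

lemma inj_on_gcoset:
  assumes "g \<in> carrier G" "v \<in> V" "i \<in> {1..d}"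
  shows "inj_on (\<phi> v) (gcoset d k g i)"
proof -
  have "inj_on (\<phi> v \<circ> (\<lambda>j. g \<odot> gpow i j)) {..<k}" using \<phi>_coset(2)[OF assms] by (simp only: comp_def)
  then show ?thesis unfolding gcoset_def by (rule inj_on_imageI)
qed

text \<open>Holds at every vertex, good or not, since \<open>\<phi> v\<close> is injective on each
  single coset. Characters in \<open>gdual\<close> therefore take the value 1 on all names of
  codewords.\<close>

lemma pullback_X_sys:
  assumes "x \<in> X" "v \<in> V"
  shows "P v x \<in> X_sys d k"
proof -
  have "sum (P v x) c = 0" if cc: "c \<in> cosets d k" for c
  proof -
    obtain g i where c: "g \<in> carrier G" "i \<in> {1..d}" "c = gcoset d k g i"
      using cc unfolding cosets_def by blast
    have "sum (P v x) c = (\<Sum>h\<in>c. x (\<phi> v h))"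
      unfolding pullback_name_def using coset_carrier[OF c(1,2)] c(3) by (intro sum.cong) auto
    also have "\<dots> = sum x (\<phi> v ` c)"
      using sum.reindex[OF inj_on_gcoset[OF c(1) assms(2) c(2)], of x] c(3) by simp
    also have "\<phi> v ` c = orbit (perm i) (\<phi> v g)" using \<phi>_coset(1)[OF c(1) assms(2) c(2)] c(3) by simp
    finally have "sum (P v x) c = sum x (orbit (perm i) (\<phi> v g))" .
    moreover have "orbit (perm i) (\<phi> v g) \<in> snd ` checks"
    proof (rule image_eqI)
      show "(i, orbit (perm i) (\<phi> v g)) \<in> checks" using c(2) \<phi>_in[OF c(1) assms(2)] by (auto simp: checks_def)
    qed simp
    moreover have "\<forall>c\<in>snd ` checks. sum x c = 0"
      using assms(1) unfolding X_code_eq annihilator_def by blast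
    ultimately show ?thesis by metis
  qed
  then show ?thesis unfolding X_sys_eq annihilator_def by (intro CollectI conjI ballI pullback_in)
qed

lemma chi_pullback_gdual:
  assumes "u \<in> gdual" "x \<in> X" "v \<in> V"
  shows "chi u (P v x) = 1"
proof -
  have "finite u" using bspan_sub[OF assms(1) cosets_finite] by blast
  then show ?thesis
    using annihilator_bspan[of "P v x" "carrier G" "cosets d k" u] assms(1) pullback_X_sys[OF assms(2,3)]
      cosets_finite by (simp add: chi_eq X_sys_eq)
qed

lemma pullback_measurable: "P v \<in> measurable \<mu> (config (carrier G))"
  unfolding measurable_\<mu> space_config by (intro Pi_I pullback_in)

lemma distr_pullback_Prob: "distr \<mu> (config (carrier G)) (P v) \<in> Prob (carrier G)"
  using prob_space.prob_space_distr[OF prob_space_\<mu> pullback_measurable] by (simp add: Prob_def)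

lemma integral_distr_pullback:
  "u \<subseteq> carrier G \<Longrightarrow> (\<integral>y. chi u y \<partial>distr \<mu> (config (carrier G)) (P v)) = (\<Sum>x\<in>X. chi u (P v x)) / card X"
  by (subst integral_distr[OF pullback_measurable measurable_chi]) (auto simp: integral_\<mu>)

text \<open>The radius \<open>R\<close> is large enough for \<open>r\<close>, and \<open>n\<close> is large enough for two points.\<close>

definition localising :: "real \<Rightarrow> nat \<Rightarrow> nat \<Rightarrow> bool" where
  "localising c r R \<longleftrightarrow> dual_expanding d n c perm \<and> 0 < c \<and>
     real (card (gball d k r)) < c * (real R - real r - 1) \<and>
     2 * real (card (gball d k r)) * (1 + c) < c * real n"

lemma localising_le:
  assumes "localising c r R"
  shows "r \<le> R"
proof -
  have *: "0 < c" "real (card (gball d k r)) < c * (real R - real r - 1)" using assms by (auto simp: localising_def)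
  then have "0 < c * (real R - real r - 1)" by (meson of_nat_0_le_iff order_le_less_trans)
  then have "0 < real R - real r - 1" using *(1) by (simp add: zero_less_mult_iff)
  then show ?thesis by linarith
qed

lemma good_inj: "v \<in> good R \<Longrightarrow> r \<le> R \<Longrightarrow> inj_on (\<phi> v) (gball d k r)"
  using inj_on_subset[OF _ ball_mono, of "\<phi> v" R r] by (simp add: good_def)

lemma ball_sub: "u \<subseteq> gball d k r \<Longrightarrow> u \<subseteq> carrier G \<and> finite u"
  using ball_carrier finite_ball finite_subset by (meson order_trans)

lemma good_V: "v \<in> good R \<Longrightarrow> v \<in> V"
  by (simp add: good_def)

text \<open>At a good vertex the local law agrees with \<open>m_X\<close> on the ball exactly, not
  just approximately: localisation at the single point \<open>v\<close> shows that a set outside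
  \<open>gdual\<close> has its image outside the dual code.\<close>

lemma local_characters:
  assumes loc: "localising c r R" and v: "v \<in> good R" and u: "u \<subseteq> gball d k r"
  shows "(\<integral>y. chi u y \<partial>distr \<mu> (config (carrier G)) (P v)) = of_bool (u \<in> gdual)"
proof -
  have uc: "u \<subseteq> carrier G" "finite u" using ball_sub u by auto
  have inj: "inj_on (\<phi> v) (gball d k r)" by (rule good_inj[OF v localising_le[OF loc]])
  have \<phi>u: "finite (\<phi> v ` u)" "\<phi> v ` u \<subseteq> V" using uc \<phi>_in[OF _ good_V[OF v]] by auto
  show ?thesis
  proof (cases "u \<in> gdual")
    case True
    then have "(\<Sum>x\<in>X. chi u (P v x)) = real (card X)" using chi_pullback_gdual good_V[OF v] by simp
    then show ?thesis using True card_X_pos by (simp add: integral_distr_pullback[OF uc(1)])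
  next
    case False
    have "\<phi> v ` u \<notin> dual"
    proof
      assume d: "\<phi> v ` u \<in> dual"
      have "{g \<in> gball d k r. \<phi> v g \<in> \<phi> v ` u} \<in> gdual"
      proof (rule dual_localises[where S = "{v}" and R = R and c = c])
        have "real (card (gball d k r)) * (1 + c) \<le> 2 * real (card (gball d k r)) * (1 + c)"
          using loc by (intro mult_right_mono) (auto simp: localising_def)
        also have "\<dots> < c * real n" using loc unfolding localising_def by blast
        finally show "real (card {v}) * real (card (gball d k r)) * (1 + c) < c * real n" by simp
        show "\<phi> v ` u \<subseteq> (\<Union>s\<in>{v}. nbhd s r)" using u by (auto simp: nbhd_def)
      qed (use loc v d in \<open>auto simp: localising_def\<close>)
      moreover have "{g \<in> gball d k r. \<phi> v g \<in> \<phi> v ` u} = u"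
        using u inj_on_image_mem_iff[OF inj _ u] by auto
      ultimately show False using False by simp
    qed
    then have "(\<integral>x. chi (\<phi> v ` u) x \<partial>\<mu>) = 0" using \<mu>_has_dual \<phi>u by (simp add: has_dual_def)
    then show ?thesis
      using False by (simp add: integral_distr_pullback[OF uc(1)] integral_\<mu>
          chi_pullback[OF uc(1) inj_on_subset[OF inj u]])
  qed
qed

text \<open>The product of the two characters is the character of a disjoint union; if that were a
  dual word, localising it at \<open>v\<close> would put \<open>u\<close> itself into
  \<open>gdual\<close>.\<close>

lemma pair_characters:
  assumes loc: "localising c r R" and vw: "v \<in> good R" "w \<in> good R" "nbhd v R \<inter> nbhd w R = {}"
    and u: "u \<subseteq> gball d k r" "u \<notin> gdual"
  shows "(\<Sum>x\<in>X. chi u (P v x) * chi u (P w x)) = 0"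
proof -
  have rR: "r \<le> R" by (rule localising_le[OF loc])
  have uc: "u \<subseteq> carrier G" "finite u" using ball_sub u by auto
  have inj: "inj_on (\<phi> v) (gball d k r)" "inj_on (\<phi> w) (gball d k r)"
    using good_inj[OF _ rR] vw by auto
  have sub: "\<phi> v ` u \<subseteq> nbhd v r" "\<phi> w ` u \<subseteq> nbhd w r" using u by (auto simp: nbhd_def)
  then have sub': "\<phi> v ` u \<subseteq> nbhd v R" "\<phi> w ` u \<subseteq> nbhd w R"
    using nbhd_mono[OF rR] order_trans by metis+
  then have disj: "\<phi> v ` u \<inter> \<phi> w ` u = {}" using vw(3) by (metis Int_mono subset_empty)
  have "v \<noteq> w"
  proof
    assume "v = w"
    then have "nbhd v R = {}" using vw(3) by simp
    then show False using one_in_ball[of R] by (auto simp: nbhd_def)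
  qed
  let ?U = "\<phi> v ` u \<union> \<phi> w ` u"
  have U: "finite ?U" "?U \<subseteq> V" using uc \<phi>_in good_V vw by auto
  have "?U \<notin> dual"
  proof
    assume d: "?U \<in> dual"
    have "{g \<in> gball d k r. \<phi> v g \<in> ?U} \<in> gdual"
    proof (rule dual_localises[where S = "{v, w}" and R = R and c = c])
      show "real (card {v, w}) * real (card (gball d k r)) * (1 + c) < c * real n"
        using loc \<open>v \<noteq> w\<close> by (simp add: localising_def)
      show "?U \<subseteq> (\<Union>s\<in>{v, w}. nbhd s r)" using sub by auto
      fix s s' assume "s \<in> {v, w}" "s' \<in> {v, w}" "s \<noteq> s'"
      then show "nbhd s R \<inter> nbhd s' R = {}" using vw(3) by auto
    qed (use loc vw d in \<open>auto simp: localising_def\<close>)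
    moreover have "{g \<in> gball d k r. \<phi> v g \<in> ?U} = u"
    proof -
      have "\<phi> v g \<notin> \<phi> w ` u" if g: "g \<in> gball d k r" for g
      proof -
        have "\<phi> v g \<in> nbhd v R" unfolding nbhd_def by (rule imageI, rule subsetD[OF ball_mono[OF rR] g])
        then show ?thesis using sub'(2) vw(3) by blast
      qed
      then have "{g \<in> gball d k r. \<phi> v g \<in> ?U} = {g \<in> gball d k r. \<phi> v g \<in> \<phi> v ` u}" by blast
      also have "\<dots> = u" using u inj_on_image_mem_iff[OF inj(1) _ u(1)] by blast
      finally show ?thesis .
    qed
    ultimately show False using u(2) by simp
  qed
  then have "(\<integral>x. chi ?U x \<partial>\<mu>) = 0" using \<mu>_has_dual U by (simp add: has_dual_def)
  then have "(\<Sum>x\<in>X. chi ?U x) = 0" using card_X_pos by (simp add: integral_\<mu>)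
  moreover have "chi ?U x = chi u (P v x) * chi u (P w x)" for x
    unfolding chi_pullback[OF uc(1) inj_on_subset[OF inj(1) u(1)]]
      chi_pullback[OF uc(1) inj_on_subset[OF inj(2) u(1)]] unfolding chi_def
    by (rule prod.union_disjoint) (use uc disj in auto)
  ultimately show ?thesis by simp
qed

lemma card_meeting:
  "card {w \<in> V. nbhd v R \<inter> nbhd w R \<noteq> {}} \<le> card (gball d k R) ^ 2"
proof -
  let ?B = "gball d k R"
  have "{w \<in> V. nbhd v R \<inter> nbhd w R \<noteq> {}} \<subseteq> (\<lambda>(g, h). \<sigma> h (\<phi> v g)) ` (?B \<times> ?B)"
  proof
    fix w assume "w \<in> {w \<in> V. nbhd v R \<inter> nbhd w R \<noteq> {}}"
    then obtain g h where gh: "g \<in> ?B" "h \<in> ?B" "\<phi> v g = \<phi> w h" by (auto simp: nbhd_def)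
    then have "w = \<sigma> h (\<phi> v g)" using \<sigma>_\<phi>[of h w] subsetD[OF ball_carrier gh(2)] by simp
    then show "w \<in> (\<lambda>(g, h). \<sigma> h (\<phi> v g)) ` (?B \<times> ?B)" using gh by (intro image_eqI[of _ _ "(g, h)"]) auto
  qed
  then have "card {w \<in> V. nbhd v R \<inter> nbhd w R \<noteq> {}} \<le> card (?B \<times> ?B)"
    using finite_ball by (intro order_trans[OF card_mono card_image_le]) auto
  then show ?thesis by (simp add: card_cartesian_product power2_eq_square)
qed

text \<open>After expanding the square only pairs with a bad vertex or with intersecting
  neighbourhoods contribute, each at most 1; a vertex has at most
  \<open>card (gball d k R) ^ 2\<close> partners of the second kind.\<close>

lemma second_moment:
  assumes loc: "localising c r R" and u: "u \<subseteq> gball d k r" "u \<notin> gdual"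
  shows "(\<integral>x. ((\<Sum>v\<in>V. chi u (P v x)) / n)\<^sup>2 \<partial>\<mu>)
    \<le> (2 * real n * card (V - good R) + n * card (gball d k R) ^ 2) / (real n)\<^sup>2"
proof -
  define E where "E v w = (\<Sum>x\<in>X. chi u (P v x) * chi u (P w x)) / card X" for v w
  have E1: "E v w \<le> 1" for v w
  proof -
    have "chi u (P v x) * chi u (P w x) \<le> 1" for x
      using abs_ge_self[of "chi u (P v x) * chi u (P w x)"] by (simp add: abs_mult)
    then have "(\<Sum>x\<in>X. chi u (P v x) * chi u (P w x)) \<le> (\<Sum>x\<in>X. 1)" by (intro sum_mono)
    then show ?thesis using card_X_pos by (simp add: E_def)
  qed
  have Ew: "E v w \<le> of_bool (v \<notin> good R) + of_bool (w \<notin> good R) + of_bool (nbhd v R \<inter> nbhd w R \<noteq> {})" for v w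
  proof (cases "v \<in> good R \<and> w \<in> good R \<and> nbhd v R \<inter> nbhd w R = {}")
    case True
    then have "E v w = 0" using pair_characters[OF loc _ _ _ u] by (simp add: E_def)
    then show ?thesis by simp
  next
    case False
    then have "1 \<le> (of_bool (v \<notin> good R) + of_bool (w \<notin> good R) + of_bool (nbhd v R \<inter> nbhd w R \<noteq> {}) :: real)"
      by auto
    then show ?thesis using E1[of v w] by linarith
  qed
  have bad: "(\<Sum>v\<in>V. of_bool (v \<notin> good R)) = real (card (V - good R))"
    by (simp add: Int_def set_diff_eq)
  have meet: "(\<Sum>w\<in>V. of_bool (nbhd v R \<inter> nbhd w R \<noteq> {})) = real (card {w \<in> V. nbhd v R \<inter> nbhd w R \<noteq> {}})" for v
    by (simp add: Int_def)
  have "(\<integral>x. ((\<Sum>v\<in>V. chi u (P v x)) / n)\<^sup>2 \<partial>\<mu>) = (\<Sum>x\<in>X. (\<Sum>v\<in>V. \<Sum>w\<in>V. chi u (P v x) * chi u (P w x))) / card X / (real n)\<^sup>2"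
  proof -
    have "(\<Sum>x\<in>X. ((\<Sum>v\<in>V. chi u (P v x)) / n)\<^sup>2)
        = (\<Sum>x\<in>X. (\<Sum>v\<in>V. \<Sum>w\<in>V. chi u (P v x) * chi u (P w x)) / (real n)\<^sup>2)"
      by (simp only: power_divide) (simp only: power2_eq_square sum_product)
    also have "\<dots> = (\<Sum>x\<in>X. (\<Sum>v\<in>V. \<Sum>w\<in>V. chi u (P v x) * chi u (P w x))) / (real n)\<^sup>2"
      by (rule sum_divide_distrib[symmetric])
    finally show ?thesis unfolding integral_\<mu> by simp
  qed
  moreover have "(\<Sum>x\<in>X. (\<Sum>v\<in>V. \<Sum>w\<in>V. chi u (P v x) * chi u (P w x))) / card X = (\<Sum>v\<in>V. \<Sum>w\<in>V. E v w)"
  proof -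
    have "(\<Sum>x\<in>X. (\<Sum>v\<in>V. \<Sum>w\<in>V. chi u (P v x) * chi u (P w x)))
        = (\<Sum>v\<in>V. \<Sum>x\<in>X. \<Sum>w\<in>V. chi u (P v x) * chi u (P w x))"
      by (rule sum.swap)
    also have "\<dots> = (\<Sum>v\<in>V. \<Sum>w\<in>V. \<Sum>x\<in>X. chi u (P v x) * chi u (P w x))"
      by (intro sum.cong HOL.refl sum.swap)
    finally show ?thesis by (simp only: E_def sum_divide_distrib)
  qed
  ultimately have eq: "(\<integral>x. ((\<Sum>v\<in>V. chi u (P v x)) / n)\<^sup>2 \<partial>\<mu>) = (\<Sum>v\<in>V. \<Sum>w\<in>V. E v w) / (real n)\<^sup>2"
    by (simp only:)
  have "(\<Sum>v\<in>V. \<Sum>w\<in>V. E v w)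
      \<le> (\<Sum>v\<in>V. \<Sum>w\<in>V. of_bool (v \<notin> good R) + of_bool (w \<notin> good R) + of_bool (nbhd v R \<inter> nbhd w R \<noteq> {}))"
    by (intro sum_mono Ew)
  also have "\<dots> = 2 * real n * card (V - good R) + (\<Sum>v\<in>V. real (card {w \<in> V. nbhd v R \<inter> nbhd w R \<noteq> {}}))"
    unfolding sum.distrib sum_constant meet sum_distrib_left[symmetric] bad by simp
  also have "\<dots> \<le> 2 * real n * card (V - good R) + (\<Sum>v\<in>V. real (card (gball d k R) ^ 2))"
    by (intro add_left_mono sum_mono of_nat_mono card_meeting)
  finally show ?thesis unfolding eq by (intro divide_right_mono) simp_all
qed

lemma empirical_measurable:
  fixes x :: "nat \<Rightarrow> bit"
  shows "(\<lambda>v. P v x) \<in> measurable (uniform_count_measure V) (config (carrier G))"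
proof -
  have "(\<lambda>v. P v x) \<in> measurable (count_space V) (config (carrier G))"
    unfolding measurable_count_space_eq1 space_config by (intro Pi_I pullback_in)
  then show ?thesis
    using measurable_cong_sets[OF sets_uniform_count_measure_count_space HOL.refl] by blast
qed

lemma empirical_Prob: "empirical G V \<sigma> x \<in> Prob (carrier G)" for x :: "nat \<Rightarrow> bit"
proof -
  have "prob_space (uniform_count_measure V)" using n0 by (intro prob_space_uniform_count_measure) auto
  from prob_space.prob_space_distr[OF this empirical_measurable]
  show ?thesis by (simp add: empirical_def Prob_def)
qed

lemma integral_empirical:
  "u \<subseteq> carrier G \<Longrightarrow> (\<integral>y. chi u y \<partial>empirical G V \<sigma> x) = (\<Sum>v\<in>V. chi u (P v x)) / n"
  unfolding empirical_def
  by (subst integral_distr[OF empirical_measurable measurable_chi]) (auto simp: integral_uniform_count_measure)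

text \<open>Characters in \<open>gdual\<close> have empirical mean exactly 1 on codewords; the
  others in the finite family are controlled by Chebyshev's inequality from the second
  moment.\<close>

lemma empirical_concentration:
  assumes loc: "localising c r R" and \<F>: "finite \<F>" "\<And>u. u \<in> \<F> \<Longrightarrow> u \<subseteq> gball d k r" and \<eta>: "0 < \<eta>"
    and W: "\<And>\<nu>. \<nu> \<in> Prob (carrier G) \<Longrightarrow> chi_close \<F> \<eta> (m_X d k) \<nu> \<Longrightarrow> \<nu> \<in> W"
  shows "1 - card \<F> * ((2 * real n * card (V - good R) + n * card (gball d k R) ^ 2) / (real n)\<^sup>2 / \<eta>\<^sup>2)
    \<le> measure \<mu> {x \<in> space \<mu>. empirical G V \<sigma> x \<in> W}"
proof -
  interpret \<mu>: prob_space \<mu> by (rule prob_space_\<mu>)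
  define Z where "Z u x = (\<Sum>v\<in>V. chi u (P v x)) / n" for u x
  define b where "b = (2 * real n * card (V - good R) + n * card (gball d k R) ^ 2) / (real n)\<^sup>2 / \<eta>\<^sup>2"
  have b0: "0 \<le> b" by (simp add: b_def)
  define A where "A u = {x \<in> space \<mu>. \<eta>\<^sup>2 \<le> (Z u x)\<^sup>2}" for u
  have meas: "S \<subseteq> space \<mu> \<Longrightarrow> S \<in> sets \<mu>" for S by (simp add: sets_\<mu> space_\<mu>)
  have A: "measure \<mu> (A u) \<le> b" if u: "u \<in> \<F>" "u \<notin> gdual" for u
  proof -
    have "measure \<mu> (A u) \<le> (\<integral>x. (Z u x)\<^sup>2 \<partial>\<mu>) / \<eta>\<^sup>2"
      unfolding A_def
    proof (rule integral_Markov_inequality_measure[where A = "{}"])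
      have "\<bar>Z u x\<bar> \<le> 1" for x
      proof -
        have "\<bar>\<Sum>v\<in>V. chi u (P v x)\<bar> \<le> (\<Sum>v\<in>V. 1)"
          by (rule order_trans[OF sum_abs]) simp
        then show ?thesis using n0 by (simp add: Z_def)
      qed
      then have "norm ((Z u x)\<^sup>2) \<le> 1" for x by (simp add: abs_square_le_1)
      then show "integrable \<mu> (\<lambda>x. (Z u x)\<^sup>2)"
        by (intro \<mu>.integrable_const_bound[of _ 1]) (auto simp: measurable_\<mu>)
    qed (use \<eta> in auto)
    also have "\<dots> \<le> b"
      unfolding b_def Z_def using second_moment[OF loc \<F>(2)[OF u(1)] u(2)] by (intro divide_right_mono) auto
    finally show ?thesis .
  qed
  define \<F>' where "\<F>' = \<F> - gdual"
  have "X \<subseteq> space \<mu>" using X_sub by (simp add: space_\<mu>)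
  have X1: "measure \<mu> X = 1"
  proof -
    have "(\<integral>x. indicator X x \<partial>\<mu>) = (1 :: real)" unfolding integral_\<mu> using card_X_pos by simp
    moreover have "(\<integral>x. indicator X x \<partial>\<mu>) = measure \<mu> (X \<inter> space \<mu>)" by simp
    ultimately show ?thesis using \<open>X \<subseteq> space \<mu>\<close> by (simp only: Int_absorb2)
  qed
  have "measure \<mu> X \<le> measure \<mu> ({x \<in> space \<mu>. empirical G V \<sigma> x \<in> W} \<union> (\<Union>u\<in>\<F>'. A u))"
  proof (rule \<mu>.finite_measure_mono)
    show "X \<subseteq> {x \<in> space \<mu>. empirical G V \<sigma> x \<in> W} \<union> (\<Union>u\<in>\<F>'. A u)"
    proof
      fix x assume x: "x \<in> X"
      show "x \<in> {x \<in> space \<mu>. empirical G V \<sigma> x \<in> W} \<union> (\<Union>u\<in>\<F>'. A u)"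
      proof (cases "x \<in> (\<Union>u\<in>\<F>'. A u)")
        case False
        have "chi_close \<F> \<eta> (m_X d k) (empirical G V \<sigma> x)"
          unfolding chi_close_def
        proof
          fix u assume u: "u \<in> \<F>"
          then have uc: "u \<subseteq> carrier G" "finite u" using ball_sub[OF \<F>(2)] by auto
          have m: "(\<integral>y. chi u y \<partial>m_X d k) = of_bool (u \<in> gdual)" using m_X_has_dual uc by (simp add: has_dual_def)
          show "\<bar>(\<integral>y. chi u y \<partial>empirical G V \<sigma> x) - (\<integral>y. chi u y \<partial>m_X d k)\<bar> < \<eta>"
          proof (cases "u \<in> gdual")
            case True
            then show ?thesis
              unfolding m integral_empirical[OF uc(1)] using chi_pullback_gdual[OF True x] n0 \<eta> by simp
          next
            case nd: False
            then have "\<not> \<eta>\<^sup>2 \<le> (Z u x)\<^sup>2"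
              using False u x \<open>X \<subseteq> space \<mu>\<close> by (auto simp: A_def \<F>'_def)
            then have "\<bar>Z u x\<bar> < \<eta>" using \<eta> by (metis abs_le_square_iff abs_of_pos not_le)
            then show ?thesis unfolding m integral_empirical[OF uc(1)] using nd by (simp add: Z_def)
          qed
        qed
        then have "empirical G V \<sigma> x \<in> W" by (rule W[OF empirical_Prob])
        then show ?thesis using x \<open>X \<subseteq> space \<mu>\<close> by auto
      qed simp
    qed
    show "{x \<in> space \<mu>. empirical G V \<sigma> x \<in> W} \<union> (\<Union>u\<in>\<F>'. A u) \<in> sets \<mu>"
      by (rule meas) (auto simp: A_def)
  qed
  also have "\<dots> \<le> measure \<mu> {x \<in> space \<mu>. empirical G V \<sigma> x \<in> W} + measure \<mu> (\<Union>u\<in>\<F>'. A u)"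
    by (rule measure_Un_le) (auto intro!: meas simp: A_def)
  also have "measure \<mu> (\<Union>u\<in>\<F>'. A u) \<le> (\<Sum>u\<in>\<F>'. measure \<mu> (A u))"
    using \<F>(1) by (intro measure_UNION_le) (auto intro!: meas simp: A_def \<F>'_def)
  also have "\<dots> \<le> (\<Sum>u\<in>\<F>'. b)" by (rule sum_mono) (use A in \<open>auto simp: \<F>'_def\<close>)
  also have "\<dots> \<le> card \<F> * b"
    using \<F>(1) b0 by (simp add: \<F>'_def card_mono mult_right_mono)
  finally show ?thesis unfolding X1 b_def by linarith
qed

lemma card_local_convergence:
  assumes loc: "localising c r R" and \<F>: "\<And>u. u \<in> \<F> \<Longrightarrow> u \<subseteq> gball d k r" and \<eta>: "0 < \<eta>"
    and W: "\<And>\<nu>. \<nu> \<in> Prob (carrier G) \<Longrightarrow> chi_close \<F> \<eta> (m_X d k) \<nu> \<Longrightarrow> \<nu> \<in> W"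
  shows "real n - card (V - good R) \<le> card {v \<in> V. distr \<mu> (config (carrier G)) (P v) \<in> W}"
proof -
  have "good R \<subseteq> {v \<in> V. distr \<mu> (config (carrier G)) (P v) \<in> W}"
  proof
    fix v assume v: "v \<in> good R"
    have "chi_close \<F> \<eta> (m_X d k) (distr \<mu> (config (carrier G)) (P v))"
      unfolding chi_close_def
    proof
      fix u assume "u \<in> \<F>"
      then have u: "u \<subseteq> gball d k r" by (rule \<F>)
      then have "u \<subseteq> carrier G" "finite u" using ball_sub by auto
      then have "(\<integral>y. chi u y \<partial>m_X d k) = of_bool (u \<in> gdual)" using m_X_has_dual by (simp add: has_dual_def)
      then show "\<bar>(\<integral>y. chi u y \<partial>distr \<mu> (config (carrier G)) (P v)) - (\<integral>y. chi u y \<partial>m_X d k)\<bar> < \<eta>"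
        using local_characters[OF loc v u] \<eta> by simp
    qed
    from W[OF distr_pullback_Prob this] show "v \<in> {v \<in> V. distr \<mu> (config (carrier G)) (P v) \<in> W}"
      using good_V[OF v] by simp
  qed
  then have "card (good R) \<le> card {v \<in> V. distr \<mu> (config (carrier G)) (P v) \<in> W}"
    by (rule card_mono[rotated]) simp
  moreover have "good R \<subseteq> V" by (auto simp: good_def)
  then have "card (V - good R) = n - card (good R)"
    using card_Diff_subset[of "good R" V] finite_subset[of "good R" V] by simp
  ultimately show ?thesis by simp
qed

text \<open>Take a separated set of greatest size: the neighbourhood of every good vertex meets that
  of one of its points, and each point accounts for at most \<open>card (gball d k R) ^ 2\<close>
  vertices.\<close>

lemma separated_set:
  obtains S where "S \<subseteq> good R" "\<And>s s'. s \<in> S \<Longrightarrow> s' \<in> S \<Longrightarrow> s \<noteq> s' \<Longrightarrow> nbhd s R \<inter> nbhd s' R = {}"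
    "card (good R) \<le> card S * card (gball d k R) ^ 2"
proof -
  have gV: "good R \<subseteq> V" by (auto simp: good_def)
  have fing: "finite (good R)" using gV by (rule finite_subset) simp
  define sep where "sep S \<longleftrightarrow> S \<subseteq> good R \<and> (\<forall>s\<in>S. \<forall>s'\<in>S. s \<noteq> s' \<longrightarrow> nbhd s R \<inter> nbhd s' R = {})" for S
  have "\<exists>S. sep S \<and> (\<forall>S'. sep S' \<longrightarrow> card S' \<le> card S)"
  proof (rule ex_has_greatest_nat)
    show "sep {}" by (simp add: sep_def)
    show "\<forall>S. sep S \<longrightarrow> card S < Suc (card (good R))"
      using fing by (auto simp: sep_def less_Suc_eq_le intro: card_mono)
  qed
  then obtain S where S: "sep S" "\<And>S'. sep S' \<Longrightarrow> card S' \<le> card S" by blast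
  have finS: "finite S" using S(1) fing finite_subset by (auto simp: sep_def)
  have "good R \<subseteq> (\<Union>s\<in>S. {w \<in> V. nbhd s R \<inter> nbhd w R \<noteq> {}})"
  proof (rule ccontr)
    assume "\<not> ?thesis"
    then obtain w where w: "w \<in> good R" "\<And>s. s \<in> S \<Longrightarrow> nbhd s R \<inter> nbhd w R = {}" using gV by blast
    have "nbhd w R \<noteq> {}" using one_in_ball by (auto simp: nbhd_def)
    then have "w \<notin> S" using w(2)[of w] by auto
    moreover have "sep (insert w S)" using S(1) w unfolding sep_def by (auto simp: Int_commute)
    ultimately show False using S(2)[of "insert w S"] finS by simp
  qed
  then have "card (good R) \<le> card (\<Union>s\<in>S. {w \<in> V. nbhd s R \<inter> nbhd w R \<noteq> {}})"
    by (rule card_mono[rotated]) (simp add: finS)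
  also have "\<dots> \<le> (\<Sum>s\<in>S. card {w \<in> V. nbhd s R \<inter> nbhd w R \<noteq> {}})" by (rule card_UN_le[OF finS])
  also have "\<dots> \<le> (\<Sum>s\<in>S. card (gball d k R) ^ 2)" by (intro sum_mono card_meeting)
  finally have "card (good R) \<le> card S * card (gball d k R) ^ 2" by simp
  then show ?thesis using that[of S] S(1) unfolding sep_def by blast
qed

text \<open>Both entropies equal \<open>ln 2\<close> times the number of coordinates minus the
  logarithm of the number of dual words. The coordinates form \<open>card S\<close> disjoint copies
  of the ball, and a dual word is determined by its lifts, all of which lie in \<open>gdual\<close>;
  so there are at most as many dual words as for \<open>card S\<close> independent copies.\<close>

lemma entropy_lower_bound:
  assumes loc: "localising c r R" and S: "S \<subseteq> good R"
    and disj: "\<And>s s'. s \<in> S \<Longrightarrow> s' \<in> S \<Longrightarrow> s \<noteq> s' \<Longrightarrow> nbhd s R \<inter> nbhd s' R = {}"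
    and small: "real (card S) * real (card (gball d k r)) * (1 + c) < c * real n"
  shows "card S * shannon (marginal (gball d k r) (m_X d k))
    \<le> shannon (marginal {\<sigma> f s | f s. f \<in> gball d k r \<and> s \<in> S} \<mu>)"
proof -
  let ?B = "gball d k r"
  have rR: "r \<le> R" by (rule localising_le[OF loc])
  have SV: "S \<subseteq> V" using S by (auto simp: good_def)
  have finS: "finite S" using SV by (rule finite_subset) simp
  define T where "T = (\<Union>s\<in>S. nbhd s r)"
  have T: "{\<sigma> f s | f s. f \<in> ?B \<and> s \<in> S} = T"
  proof (intro equalityI subsetI)
    fix v assume "v \<in> {\<sigma> f s | f s. f \<in> ?B \<and> s \<in> S}"
    then obtain f s where f: "f \<in> ?B" "s \<in> S" "v = \<sigma> f s" by blast
    then have "v = \<phi> s (inv\<^bsub>G\<^esub> f)" using subsetD[OF ball_carrier f(1)] by simp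
    then show "v \<in> T" using ball_inv[OF f(1)] f(2) by (auto simp: T_def nbhd_def)
  next
    fix v assume "v \<in> T"
    then obtain g s where "g \<in> ?B" "s \<in> S" "v = \<sigma> (inv\<^bsub>G\<^esub> g) s" by (auto simp: T_def nbhd_def)
    then show "v \<in> {\<sigma> f s | f s. f \<in> ?B \<and> s \<in> S}" using ball_inv by blast
  qed
  have "nbhd s r \<subseteq> V" if "s \<in> S" for s
    unfolding nbhd_def using \<phi>_in subsetD[OF ball_carrier] subsetD[OF SV that] by blast
  then have TV: "T \<subseteq> V" unfolding T_def by (rule UN_least)
  have finT: "finite T" using TV by (rule finite_subset) simp
  have disj': "nbhd s r \<inter> nbhd s' r = {}" if "s \<in> S" "s' \<in> S" "s \<noteq> s'" for s s'
    using disj[OF that] nbhd_mono[OF rR] by blast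
  have cT: "card T = card S * card ?B"
  proof -
    have "card T = (\<Sum>s\<in>S. card (nbhd s r))"
      unfolding T_def by (rule card_UN_disjoint) (use finS finite_nbhd disj' in auto)
    also have "\<dots> = (\<Sum>s\<in>S. card ?B)"
      unfolding nbhd_def using good_inj[OF _ rR] S by (intro sum.cong card_image) auto
    finally show ?thesis by simp
  qed
  define lift where "lift u = (\<lambda>s\<in>S. {g \<in> ?B. \<phi> s g \<in> u})" for u
  have "card (dual \<inter> Pow T) \<le> card (S \<rightarrow>\<^sub>E (gdual \<inter> Pow ?B))"
  proof (rule card_inj_on_le[of lift])
    show "inj_on lift (dual \<inter> Pow T)"
    proof (rule inj_onI)
      fix u w assume uw: "u \<in> dual \<inter> Pow T" "w \<in> dual \<inter> Pow T" "lift u = lift w"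
      have "v \<in> u \<longleftrightarrow> v \<in> w" if "v \<in> T" for v
      proof -
        obtain s g where sg: "s \<in> S" "g \<in> ?B" "v = \<phi> s g" using \<open>v \<in> T\<close> by (auto simp: T_def nbhd_def)
        have "{g \<in> ?B. \<phi> s g \<in> u} = {g \<in> ?B. \<phi> s g \<in> w}"
          using fun_cong[OF uw(3), of s] sg(1) by (simp add: lift_def)
        then show ?thesis using sg by blast
      qed
      then show "u = w" using uw by blast
    qed
    show "lift ` (dual \<inter> Pow T) \<subseteq> S \<rightarrow>\<^sub>E (gdual \<inter> Pow ?B)"
    proof (rule image_subsetI)
      fix u assume u: "u \<in> dual \<inter> Pow T"
      have "{g \<in> ?B. \<phi> s g \<in> u} \<in> gdual" if "s \<in> S" for s
        using loc by (intro dual_localises[OF _ _ _ S disj small _ _ that])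
          (use u in \<open>auto simp: localising_def T_def\<close>)
      then show "lift u \<in> S \<rightarrow>\<^sub>E (gdual \<inter> Pow ?B)" by (auto simp: lift_def)
    qed
    show "finite (S \<rightarrow>\<^sub>E (gdual \<inter> Pow ?B))" using finS finite_ball by (intro finite_PiE) auto
  qed
  then have le: "card (dual \<inter> Pow T) \<le> card (gdual \<inter> Pow ?B) ^ card S" by (simp add: card_PiE finS)
  have pos: "0 < card (dual \<inter> Pow T)" "0 < card (gdual \<inter> Pow ?B)"
    using finT finite_ball bspan.empty by (auto simp: card_gt_0_iff)
  have "real (card (dual \<inter> Pow T)) \<le> real (card (gdual \<inter> Pow ?B)) ^ card S"
    using of_nat_mono[OF le, where 'a = real] by simp
  then have "ln (real (card (dual \<inter> Pow T))) \<le> ln (real (card (gdual \<inter> Pow ?B)) ^ card S)"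
    using pos by (subst ln_le_cancel_iff) auto
  also have "\<dots> = card S * ln (card (gdual \<inter> Pow ?B))" using pos by (simp add: ln_realpow)
  finally have lnle: "ln (card (dual \<inter> Pow T)) \<le> card S * ln (card (gdual \<inter> Pow ?B))" .
  have "shannon (marginal T \<mu>) = card T * ln 2 - ln (card (dual \<inter> Pow T))"
    by (rule shannon_has_dual[OF finT marginal_has_dual[OF \<mu>_has_dual TV]])
      (use bspan_sym_diff bspan.empty in auto)
  moreover have "shannon (marginal ?B (m_X d k)) = card ?B * ln 2 - ln (card (gdual \<inter> Pow ?B))"
    by (rule shannon_has_dual[OF finite_ball marginal_has_dual[OF m_X_has_dual ball_carrier]])
      (use bspan_sym_diff bspan.empty in auto)
  moreover have "real (card T) * ln 2 = real (card S) * (real (card ?B) * ln 2)" by (simp add: cT)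
  ultimately show ?thesis using lnle unfolding T by (simp add: right_diff_distrib)
qed

end

section \<open>Differences of good microstates\<close>

lemma of_nat_bit: "(of_nat m :: bit) = (if odd m then 1 else 0)"
  by (induction m) auto

context code
begin

text \<open>The character of a coset through the identity, evaluated at the name of
  \<open>v\<close>, is - 1 exactly when the cycle through \<open>v\<close> is violated, and every
  violated cycle accounts for \<open>k\<close> such vertices.\<close>

lemma parity_failures:
  fixes x :: "nat \<Rightarrow> bit"
  assumes i: "i \<in> {1..d}" and int: "(\<integral>y. chi (gcoset d k \<one>\<^bsub>G\<^esub> i) y \<partial>empirical G V \<sigma> x) > 1 - \<eta>"
  shows "2 * real k * real (card {c \<in> orbit (perm i) ` V. sum x c = 1}) < \<eta> * real n"
proof -
  let ?u = "gcoset d k \<one>\<^bsub>G\<^esub> i"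
  have p: "perm i \<in> kperms k n" by (rule perm_kperms[OF i])
  define A where "A = {v \<in> V. sum x (orbit (perm i) v) = 1}"
  have chi: "chi ?u (P v x) = 1 - 2 * of_bool (v \<in> A)" if v: "v \<in> V" for v
  proof -
    have "\<phi> v ` ?u = orbit (perm i) v" using \<phi>_coset(1)[OF one_closed v i] by (simp add: \<sigma>_one)
    then have "chi ?u (P v x) = chi (orbit (perm i) v) x"
      using chi_pullback[OF coset_carrier[OF one_closed i] inj_on_gcoset[OF one_closed v i]] by simp
    then show ?thesis using v finite_orbit'[OF p v] by (simp add: chi_eq A_def)
  qed
  have "(\<Sum>v\<in>V. chi ?u (P v x)) = (\<Sum>v\<in>V. 1 - 2 * of_bool (v \<in> A))" by (rule sum.cong) (simp_all add: chi)
  also have "\<dots> = real n - 2 * real (card A)"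
    by (simp add: sum_subtractf sum_distrib_left[symmetric] A_def Int_def)
  finally have "1 - \<eta> < (real n - 2 * real (card A)) / n"
    using int integral_empirical[OF coset_carrier[OF one_closed i], of x] by simp
  then have *: "2 * real (card A) < \<eta> * real n" using n0 by (simp add: field_simps)
  have "A \<subseteq> V" by (auto simp: A_def)
  moreover have "orbit_closed (perm i) A"
    unfolding orbit_closed_def
  proof
    fix v assume v: "v \<in> A"
    then have "orbit (perm i) v \<subseteq> V" using orbit_perm_V[OF i] by (auto simp: A_def)
    then show "orbit (perm i) v \<subseteq> A" using v orbit_eq[OF p] by (auto simp: A_def)
  qed
  ultimately have "k * card (orbit (perm i) ` A) = card A" by (rule card_orbits[OF p])
  moreover have "orbit (perm i) ` A = {c \<in> orbit (perm i) ` V. sum x c = 1}" by (auto simp: A_def)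
  ultimately have "real k * real (card {c \<in> orbit (perm i) ` V. sum x c = 1}) = real (card A)"
    by (metis of_nat_mult)
  then show ?thesis using * by simp
qed

text \<open>A cycle meeting the set of differences oddly has different parities under
  \<open>x\<close> and \<open>y\<close>, so one of them violates it, and
  \<open>parity_failures\<close> leaves fewer than \<open>\<eta> * n\<close> such cycles of each
  colour. If the set is small enough for \<open>sparse_detecting\<close>, it has fewer than 9 times
  that many points.\<close>

lemma difference_dichotomy:
  fixes x y :: "nat \<Rightarrow> bit" and \<eta> \<beta> :: real
  assumes sd: "sparse_detecting d n \<beta> perm"
    and x: "\<And>i. i \<in> {1..d} \<Longrightarrow> (\<integral>z. chi (gcoset d k \<one>\<^bsub>G\<^esub> i) z \<partial>empirical G V \<sigma> x) > 1 - \<eta>"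
    and y: "\<And>i. i \<in> {1..d} \<Longrightarrow> (\<integral>z. chi (gcoset d k \<one>\<^bsub>G\<^esub> i) z \<partial>empirical G V \<sigma> y) > 1 - \<eta>"
    and \<eta>: "0 < \<eta>"
  shows "\<beta> < card {v \<in> V. x v \<noteq> y v} \<or> card {v \<in> V. x v \<noteq> y v} < 9 * \<eta> * n"
proof -
  define B where "B = {v \<in> V. x v \<noteq> y v}"
  have small: "real (card B) < 9 * \<eta> * real n" if le: "real (card B) \<le> \<beta>"
  proof (cases "B = {}")
    case True
    then show ?thesis using \<eta> n0 by simp
  next
    case False
    then obtain i where i: "i \<in> {1..d}" "card B < 9 * card (odd_orbits (perm i) n B)"
    proof -
      have "B \<subseteq> V" by (auto simp: B_def)
      then have "\<exists>i\<in>{1..d}. card B < 9 * card (odd_orbits (perm i) n B)"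
        using sd le False unfolding sparse_detecting_def by blast
      then show ?thesis using that by blast
    qed
    let ?F = "\<lambda>x. {c \<in> orbit (perm i) ` V. sum x c = 1}"
    have "odd_orbits (perm i) n B \<subseteq> ?F x \<union> ?F y"
    proof
      fix c assume "c \<in> odd_orbits (perm i) n B"
      then have c: "c \<in> orbit (perm i) ` V" "odd (card (c \<inter> B))" by (auto simp: odd_orbits_def)
      obtain v where "v \<in> V" "c = orbit (perm i) v" using c(1) by blast
      then have cV: "c \<subseteq> V" using orbit_perm_V[OF i(1)] by metis
      have finc: "finite c" using cV by (rule finite_subset) simp
      have "x v + y v = (if v \<in> B then 1 else 0)" if "v \<in> c" for v
        using that cV by (cases "x v"; cases "y v") (auto simp: B_def)
      then have "(\<Sum>v\<in>c. x v + y v) = (\<Sum>v\<in>c. if v \<in> B then 1 else 0)" by (rule sum.cong[OF HOL.refl])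
      also have "\<dots> = of_nat (card (c \<inter> B))" using finc by (simp add: sum.If_cases)
      also have "\<dots> = 1" using c(2) by (simp add: of_nat_bit)
      finally have "sum x c + sum y c = 1" by (simp only: sum.distrib)
      then have "sum x c = 1 \<or> sum y c = 1" by (cases "sum x c"; cases "sum y c") auto
      then show "c \<in> ?F x \<union> ?F y" using c(1) by blast
    qed
    then have "card (odd_orbits (perm i) n B) \<le> card (?F x \<union> ?F y)" by (rule card_mono[rotated]) simp
    also have "\<dots> \<le> card (?F x) + card (?F y)" by (rule card_Un_le)
    finally have "2 * real k * real (card (odd_orbits (perm i) n B)) \<le> 2 * real k * real (card (?F x) + card (?F y))"
      by (intro mult_left_mono of_nat_mono) auto
    also have "\<dots> = 2 * real k * real (card (?F x)) + 2 * real k * real (card (?F y))"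
      by (simp add: distrib_left)
    also have "\<dots> < \<eta> * n + \<eta> * n"
      using parity_failures[OF i(1) x[OF i(1)]] parity_failures[OF i(1) y[OF i(1)]] by (rule add_strict_mono)
    finally have "real k * real (card (odd_orbits (perm i) n B)) < \<eta> * n" by simp
    moreover have "1 * real (card (odd_orbits (perm i) n B)) \<le> real k * real (card (odd_orbits (perm i) n B))"
      using k2 by (intro mult_right_mono) auto
    ultimately have "real (card (odd_orbits (perm i) n B)) < \<eta> * n" by linarith
    moreover have "real (card B) < 9 * real (card (odd_orbits (perm i) n B))" using i(2) by linarith
    ultimately show ?thesis by linarith
  qed
  show ?thesis
  proof (cases "real (card B) \<le> \<beta>")
    case True
    from small[OF this] show ?thesis unfolding B_def by blast
  qed (simp add: B_def)
qed

end

section \<open>Typical homomorphisms\<close>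

definition typical :: "nat \<Rightarrow> nat \<Rightarrow> real \<Rightarrow> real \<Rightarrow> nat \<Rightarrow> (nat list set \<Rightarrow> nat \<Rightarrow> nat) set" where
  "typical d k c \<delta> n = {\<sigma> \<in> Hom_unif d k n. let f = \<lambda>i\<in>{1..d}. \<sigma> (gen d k i) in
     dual_expanding d n c f \<and> sparse_detecting d n (\<delta> * real (n div k)) f \<and> few_cycles d k n f}"

lemma finite_Hom_unif: "0 < k \<Longrightarrow> finite (Hom_unif d k n)"
  using bij_betw_finite[OF Hom_unif_bij[of k d n]] by (simp add: finite_PiE finite_kperms)

lemma card_Hom_unif: "0 < k \<Longrightarrow> card (Hom_unif d k n) = card (kperms k n) ^ d"
  using bij_betw_same_card[OF Hom_unif_bij[of k d n]] by (simp add: card_PiE)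

lemma card_kperms_pos: "0 < k \<Longrightarrow> k dvd n \<Longrightarrow> 0 < card (kperms k n)"
  using kperms_nonempty finite_kperms by (simp add: card_gt_0_iff)

lemma Hom_unif_nonempty: "0 < k \<Longrightarrow> k dvd n \<Longrightarrow> Hom_unif d k n \<noteq> {}"
  using card_Hom_unif[of k d n] card_kperms_pos[of k n] by auto

lemma card_Hom_unif_Collect:
  assumes "0 < k"
  shows "card {\<sigma> \<in> Hom_unif d k n. Q (\<lambda>i\<in>{1..d}. \<sigma> (gen d k i))} = card {f \<in> {1..d} \<rightarrow>\<^sub>E kperms k n. Q f}"
proof (rule bij_betw_same_card)
  let ?F = "\<lambda>\<sigma>. \<lambda>i\<in>{1..d}. \<sigma> (gen d k i)"
  have b: "bij_betw ?F (Hom_unif d k n) ({1..d} \<rightarrow>\<^sub>E kperms k n)" by (rule Hom_unif_bij[OF assms])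
  show "bij_betw ?F {\<sigma> \<in> Hom_unif d k n. Q (?F \<sigma>)} {f \<in> {1..d} \<rightarrow>\<^sub>E kperms k n. Q f}"
    unfolding bij_betw_def
  proof
    show "inj_on ?F {\<sigma> \<in> Hom_unif d k n. Q (?F \<sigma>)}"
      using bij_betw_imp_inj_on[OF b] by (rule inj_on_subset) blast
    show "?F ` {\<sigma> \<in> Hom_unif d k n. Q (?F \<sigma>)} = {f \<in> {1..d} \<rightarrow>\<^sub>E kperms k n. Q f}"
      unfolding bij_betw_imp_surj_on[OF b, symmetric] by blast
  qed
qed

lemma typical_limit:
  assumes d: "3 \<le> d" and dk: "d < k"
  obtains c \<delta> where "0 < c" "0 < \<delta>"
    "(\<lambda>m. measure (uniform_count_measure (Hom_unif d k (k * Suc m))) (typical d k c \<delta> (k * Suc m))) \<longlonglongrightarrow> 1"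
proof -
  have k: "0 < k" and d0: "0 < d" using d dk by auto
  obtain c K1 where c: "0 < c" "\<And>M. 0 < M \<Longrightarrow>
      real (card {f \<in> {1..d} \<rightarrow>\<^sub>E kperms k (k * M). \<not> dual_expanding d (k * M) c f})
      \<le> real (card (kperms k (k * M))) ^ d * (K1 * real M powr (- 1 / 4))"
    by (rule dual_expanding_typical[OF d0 dk]) blast
  obtain \<delta> K2 :: real where \<delta>: "0 < \<delta>" "\<And>M. 0 < M \<Longrightarrow>
      real (card {f \<in> {1..d} \<rightarrow>\<^sub>E kperms k (k * M). \<not> sparse_detecting d (k * M) (\<delta> * M) f})
      \<le> real (card (kperms k (k * M))) ^ d * (K2 * real M powr (- 1 / 6))"
    by (rule sparse_detecting_typical[OF d k]) blast
  define b where "b m = K1 * real (Suc m) powr (- 1 / 4) + K2 * real (Suc m) powr (- 1 / 6) + 1 / sqrt (k * Suc m)" for m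
  have lower: "1 - b m \<le> measure (uniform_count_measure (Hom_unif d k (k * Suc m))) (typical d k c \<delta> (k * Suc m))" for m
  proof -
    define M where "M = Suc m"
    define n where "n = k * M"
    have M: "0 < M" and n: "0 < n" using k by (auto simp: M_def n_def)
    define H where "H = Hom_unif d k n"
    have finH: "finite H" unfolding H_def by (rule finite_Hom_unif[OF k])
    define h where "h = real (card (kperms k n)) ^ d"
    have h: "real (card H) = h" "0 < h"
      using card_Hom_unif[OF k, of d n] card_kperms_pos[OF k, of n] by (auto simp: H_def h_def n_def)
    let ?F = "\<lambda>\<sigma>. \<lambda>i\<in>{1..d}. \<sigma> (gen d k i)"
    define B1 where "B1 = {\<sigma> \<in> H. \<not> dual_expanding d n c (?F \<sigma>)}"
    define B2 where "B2 = {\<sigma> \<in> H. \<not> sparse_detecting d n (\<delta> * M) (?F \<sigma>)}"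
    define B3 where "B3 = {\<sigma> \<in> H. \<not> few_cycles d k n (?F \<sigma>)}"
    define T where "T = typical d k c \<delta> n"
    have TH: "T \<subseteq> H" by (auto simp: T_def typical_def H_def)
    have b1: "real (card B1) \<le> h * (K1 * real M powr (- 1 / 4))"
      unfolding B1_def H_def card_Hom_unif_Collect[OF k, of d n "\<lambda>f. \<not> dual_expanding d n c f"]
      using c(2)[OF M] by (simp add: n_def h_def)
    have b2: "real (card B2) \<le> h * (K2 * real M powr (- 1 / 6))"
      unfolding B2_def H_def card_Hom_unif_Collect[OF k, of d n "\<lambda>f. \<not> sparse_detecting d n (\<delta> * M) f"]
      using \<delta>(2)[OF M] by (simp add: n_def h_def)
    have b3: "real (card B3) \<le> h * (1 / sqrt n)"
      unfolding B3_def H_def card_Hom_unif_Collect[OF k, of d n "\<lambda>f. \<not> few_cycles d k n f"]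
      using few_cycles_typical[OF n, of d k] by (simp add: h_def)
    have "n div k = M" using k by (simp add: n_def)
    then have "H \<subseteq> T \<union> (B1 \<union> B2 \<union> B3)"
      by (auto simp: T_def typical_def H_def B1_def B2_def B3_def Let_def)
    then have "card H \<le> card (T \<union> (B1 \<union> B2 \<union> B3))"
      using finH TH by (intro card_mono) (auto simp: B1_def B2_def B3_def intro: finite_subset)
    also have "\<dots> \<le> card T + (card B1 + card B2 + card B3)"
      using card_Un_le[of T "B1 \<union> B2 \<union> B3"] card_Un_le[of "B1 \<union> B2" B3] card_Un_le[of B1 B2] by linarith
    finally have "h \<le> real (card T) + (real (card B1) + real (card B2) + real (card B3))"
      unfolding h(1)[symmetric] by (simp flip: of_nat_add)
    also have "\<dots> \<le> real (card T) + h * b m"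
      using b1 b2 b3 by (simp add: b_def M_def n_def distrib_left)
    finally have "h * (1 - b m) \<le> real (card T)" by (simp add: right_diff_distrib)
    then have "1 - b m \<le> real (card T) / h" using h(2) by (simp add: pos_le_divide_eq mult.commute)
    also have "\<dots> = measure (uniform_count_measure H) T"
      unfolding measure_uniform_count_measure[OF finH TH] h(1) ..
    finally show ?thesis by (simp add: H_def T_def n_def M_def)
  qed
  have upper: "measure (uniform_count_measure (Hom_unif d k (k * Suc m))) A \<le> 1" for m A
    by (rule prob_space.prob_le_1[OF prob_space_uniform_count_measure[OF finite_Hom_unif[OF k] Hom_unif_nonempty[OF k]]]) simp
  have "b \<longlonglongrightarrow> 0" unfolding b_def using k by real_asymp
  then have "(\<lambda>m. 1 - b m) \<longlonglongrightarrow> 1" using tendsto_diff[OF tendsto_const, of b 0 sequentially 1] by simp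
  then have "(\<lambda>m. measure (uniform_count_measure (Hom_unif d k (k * Suc m))) (typical d k c \<delta> (k * Suc m))) \<longlonglongrightarrow> 1"
    by (rule tendsto_sandwich[rotated 2, OF _ tendsto_const]) (use lower upper in auto)
  then show ?thesis by (rule that[OF c(1) \<delta>(1)])
qed

text \<open>Typicality is asked for only eventually, because the sets of the theorem have to be
  nonempty for every \<open>n\<close> and fall back on all homomorphisms where nothing is
  typical.\<close>

locale typical_sequence = free_product +
  fixes \<Sigma> :: "nat \<Rightarrow> nat list set \<Rightarrow> nat \<Rightarrow> nat" and c \<delta> :: real
  assumes hom: "\<And>m. \<Sigma> m \<in> Hom_unif d k (k * Suc m)"
    and mem: "\<forall>\<^sub>F m in sequentially. \<Sigma> m \<in> typical d k c \<delta> (k * Suc m)"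
    and c0: "0 < c" and \<delta>0: "0 < \<delta>"
begin

abbreviation N where "N m \<equiv> k * Suc m"
abbreviation V where "V m \<equiv> {1..N m}"
abbreviation \<mu> where "\<mu> m \<equiv> code_measure d k (N m) (\<Sigma> m)"
abbreviation good where "good m \<equiv> code.good d k (N m) (\<Sigma> m)"
abbreviation perm where "perm m \<equiv> code.perm d k (\<Sigma> m)"

lemma N_limits:
  fixes a K :: real
  shows eventually_N: "\<forall>\<^sub>F m in sequentially. a \<le> real (N m)"
    and "(\<lambda>m. 1 / real (N m)) \<longlonglongrightarrow> 0" "(\<lambda>m. K / sqrt (real (N m))) \<longlonglongrightarrow> 0"
proof -
  have "filterlim (\<lambda>m. real (N m)) at_top sequentially" using k0 by real_asymp
  then show "\<forall>\<^sub>F m in sequentially. a \<le> real (N m)" by (simp add: filterlim_at_top)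
  show "(\<lambda>m. 1 / real (N m)) \<longlonglongrightarrow> 0" "(\<lambda>m. K / sqrt (real (N m))) \<longlonglongrightarrow> 0"
    using k0 by real_asymp+
qed

declare mult_Suc_right [simp del] of_nat_Suc [simp del]

lemma code: "code d k (N m) (\<Sigma> m)"
  using hom k2 by unfold_locales auto

lemma N0: "0 < N m"
  using k0 by simp

lemma typical_perm:
  "\<forall>\<^sub>F m in sequentially. dual_expanding d (N m) c (perm m) \<and> sparse_detecting d (N m) (\<delta> * real (Suc m)) (perm m) \<and>
     few_cycles d k (N m) (perm m)"
  using mem
proof eventually_elim
  case (elim m)
  have "N m div k = Suc m" using k0 by simp
  then show ?case using elim unfolding typical_def Let_def code.perm_def[OF code] by simp
qed

text \<open>Bad vertices number at most a constant times \<open>sqrt (N m)\<close>, by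
  \<open>few_cycles\<close> with \<open>L = 2 * R\<close>.\<close>

lemma few_bad_vertices: "(\<lambda>m. real (card (V m - good m R)) / real (N m)) \<longlonglongrightarrow> 0"
proof -
  define K where "K = real (card (gball d k (2 * R))) * ((\<Sum>l\<le>2 * R. real (d * 2 ^ d * k) ^ l) * 2 ^ Suc (2 * R))"
  have "\<forall>\<^sub>F m in sequentially. real (card (V m - good m R)) / real (N m) \<le> K / sqrt (real (N m))"
    using typical_perm eventually_N[of "real (2 * (2 * R))"]
  proof eventually_elim
    case (elim m)
    then have "2 * (2 * R) \<le> N m" by (simp only: of_nat_le_iff)
    then have le: "real (card (cycle_starts d (N m) (perm m) (2 * R)))
        \<le> (\<Sum>l\<le>2 * R. real (d * 2 ^ d * k) ^ l) * 2 ^ Suc (2 * R) * sqrt (N m)"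
      using elim(1) unfolding few_cycles_def by blast
    have "real (card (V m - good m R)) \<le> real (card (gball d k (2 * R)) * card (cycle_starts d (N m) (perm m) (2 * R)))"
      by (rule of_nat_mono[OF code.card_bad_vertices[OF code]])
    also have "\<dots> = real (card (gball d k (2 * R))) * real (card (cycle_starts d (N m) (perm m) (2 * R)))"
      by (rule of_nat_mult)
    also have "\<dots> \<le> real (card (gball d k (2 * R))) *
        ((\<Sum>l\<le>2 * R. real (d * 2 ^ d * k) ^ l) * 2 ^ Suc (2 * R) * sqrt (N m))"
      by (rule mult_left_mono[OF le]) simp
    also have "\<dots> = K * sqrt (N m)" by (simp only: K_def mult.assoc)
    finally have "real (card (V m - good m R)) / real (N m) \<le> K * sqrt (N m) / real (N m)"
      by (intro divide_right_mono) auto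
    also have "K * sqrt (N m) / real (N m) = K / sqrt (N m)"
    proof -
      have cancel: "y * x / (x * x) = y / x" if "0 < x" for x y :: real using that by simp
      have "0 < sqrt (N m)" using N0[of m] by (simp only: real_sqrt_gt_0_iff of_nat_0_less_iff)
      from cancel[OF this, of K] show ?thesis by (simp only: real_sqrt_mult_self abs_of_nat)
    qed
    finally show ?case .
  qed
  then show ?thesis
    by (rule tendsto_sandwich[OF _ _ tendsto_const N_limits(3), rotated]) (rule always_eventually, simp)
qed

lemma eventually_localising: "\<exists>R. \<forall>\<^sub>F m in sequentially. code.localising d k (N m) (\<Sigma> m) c r R"
proof -
  let ?b = "real (card (gball d k r))"
  \<comment> \<open>\<open>r\<close> is given by the neighbourhood or the entropy at hand;
    \<open>R\<close> is then taken so large that the shells between them, weighted by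
    \<open>c\<close>, outnumber the points of the small ball.\<close>
  obtain R :: nat where R: "?b / c + real r + 1 < real R" using reals_Archimedean2 by blast
  then have "?b / c < real R - real r - 1" by linarith
  then have Rb: "?b < c * (real R - real r - 1)" using c0 by (simp add: pos_divide_less_eq mult.commute)
  have "\<forall>\<^sub>F m in sequentially. code.localising d k (N m) (\<Sigma> m) c r R"
    using typical_perm eventually_N[of "(2 * ?b * (1 + c) + 1) / c"]
  proof eventually_elim
    case (elim m)
    then have "2 * ?b * (1 + c) < c * real (N m)" using c0 by (simp add: pos_divide_le_eq mult.commute)
    then show ?case using elim(1) Rb c0 unfolding code.localising_def[OF code] by blast
  qed
  then show ?thesis by blast
qed

lemma m_X_Prob: "m_X d k \<in> Prob (carrier G)"
  by (rule code.m_X_Prob[OF code[of 0]])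

lemma m_X_shift_invariant: "shift_invariant G (m_X d k)"
  by (rule code.m_X_shift_invariant[OF code[of 0]])

lemma nhd_data:
  assumes "openin (weak_star (carrier G)) W" "m_X d k \<in> W"
  obtains \<F> \<eta> r where "finite \<F>" "\<And>u. u \<in> \<F> \<Longrightarrow> u \<subseteq> gball d k r" "0 < \<eta>"
    "\<And>\<nu>. \<nu> \<in> Prob (carrier G) \<Longrightarrow> chi_close \<F> \<eta> (m_X d k) \<nu> \<Longrightarrow> \<nu> \<in> W"
proof -
  obtain \<F> \<eta> where F: "finite \<F>" "\<And>u. u \<in> \<F> \<Longrightarrow> finite u \<and> u \<subseteq> carrier G" "0 < \<eta>"
    "\<And>\<nu>. \<nu> \<in> Prob (carrier G) \<Longrightarrow> chi_close \<F> \<eta> (m_X d k) \<nu> \<Longrightarrow> \<nu> \<in> W"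
    by (rule weak_star_nhd[OF assms]) blast
  have "finite (\<Union>\<F>)" "\<Union>\<F> \<subseteq> carrier G" using F(1,2) by auto
  then obtain r where "\<Union>\<F> \<subseteq> gball d k r" using finite_subset_ball by blast
  then have "\<And>u. u \<in> \<F> \<Longrightarrow> u \<subseteq> gball d k r" by blast
  then show ?thesis using that F(1,3,4) by blast
qed

lemma local_convergence:
  assumes "openin (weak_star (carrier G)) W" "m_X d k \<in> W"
  shows "(\<lambda>m. card {v \<in> V m. distr (\<mu> m) (config (carrier G)) (pullback_name G (\<Sigma> m) v) \<in> W} / card (V m)) \<longlonglongrightarrow> 1"
proof -
  obtain \<F> \<eta> r where F: "finite \<F>" "\<And>u. u \<in> \<F> \<Longrightarrow> u \<subseteq> gball d k r" "0 < \<eta>"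
    "\<And>\<nu>. \<nu> \<in> Prob (carrier G) \<Longrightarrow> chi_close \<F> \<eta> (m_X d k) \<nu> \<Longrightarrow> \<nu> \<in> W"
    by (rule nhd_data[OF assms]) blast
  obtain R where R: "\<forall>\<^sub>F m in sequentially. code.localising d k (N m) (\<Sigma> m) c r R"
    using eventually_localising by blast
  have "\<forall>\<^sub>F m in sequentially. 1 - real (card (V m - good m R)) / real (N m)
      \<le> card {v \<in> V m. distr (\<mu> m) (config (carrier G)) (pullback_name G (\<Sigma> m) v) \<in> W} / card (V m)"
    using R
  proof eventually_elim
    case (elim m)
    have "real (N m) - card (V m - good m R)
        \<le> card {v \<in> V m. distr (\<mu> m) (config (carrier G)) (pullback_name G (\<Sigma> m) v) \<in> W}"
      by (rule code.card_local_convergence[OF code elim F(2,3,4)])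
    then have "(real (N m) - card (V m - good m R)) / real (N m)
        \<le> card {v \<in> V m. distr (\<mu> m) (config (carrier G)) (pullback_name G (\<Sigma> m) v) \<in> W} / real (N m)"
      by (rule divide_right_mono) simp
    moreover have "(real (N m) - card (V m - good m R)) / real (N m) = 1 - real (card (V m - good m R)) / real (N m)"
      using N0[of m] by (subst diff_divide_distrib, subst divide_self) (simp_all only: of_nat_eq_0_iff not_gr_zero)
    ultimately show ?case by (simp only: card_atLeastAtMost) simp
  qed
  moreover have "card {v \<in> V m. distr (\<mu> m) (config (carrier G)) (pullback_name G (\<Sigma> m) v) \<in> W} / card (V m) \<le> (1 :: real)" for m
  proof -
    have "card {v \<in> V m. distr (\<mu> m) (config (carrier G)) (pullback_name G (\<Sigma> m) v) \<in> W} \<le> card (V m)"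
      by (rule card_mono) auto
    also have "card (V m) = N m" by simp
    finally show ?thesis using k0 by (simp add: divide_le_eq_1 del: of_nat_mult)
  qed
  moreover have "(\<lambda>m. 1 - real (card (V m - good m R)) / real (N m)) \<longlonglongrightarrow> 1"
    using tendsto_diff[OF tendsto_const few_bad_vertices, of 1 R] by simp
  ultimately show ?thesis by (rule tendsto_sandwich[OF _ always_eventually[OF allI] _ tendsto_const])
qed

lemma empirical_convergence:
  assumes "openin (weak_star (carrier G)) W" "m_X d k \<in> W"
  shows "(\<lambda>m. measure (\<mu> m) {x \<in> space (\<mu> m). empirical G (V m) (\<Sigma> m) x \<in> W}) \<longlonglongrightarrow> 1"
proof -
  obtain \<F> \<eta> r where F: "finite \<F>" "\<And>u. u \<in> \<F> \<Longrightarrow> u \<subseteq> gball d k r" "0 < \<eta>"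
    "\<And>\<nu>. \<nu> \<in> Prob (carrier G) \<Longrightarrow> chi_close \<F> \<eta> (m_X d k) \<nu> \<Longrightarrow> \<nu> \<in> W"
    by (rule nhd_data[OF assms]) blast
  obtain R where R: "\<forall>\<^sub>F m in sequentially. code.localising d k (N m) (\<Sigma> m) c r R"
    using eventually_localising by blast
  define e where "e m = real (card \<F>) *
    ((2 * real (N m) * card (V m - good m R) + N m * card (gball d k R) ^ 2) / (real (N m))\<^sup>2 / \<eta>\<^sup>2)" for m
  have "\<forall>\<^sub>F m in sequentially. 1 - e m \<le> measure (\<mu> m) {x \<in> space (\<mu> m). empirical G (V m) (\<Sigma> m) x \<in> W}"
    using R unfolding e_def
  proof eventually_elim
    case (elim m)
    show ?case by (rule code.empirical_concentration[OF code elim F])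
  qed
  moreover have "measure (\<mu> m) A \<le> 1" for m A
    by (rule prob_space.prob_le_1[OF code.prob_space_\<mu>[OF code]])
  moreover have "e \<longlonglongrightarrow> 0"
  proof -
    have eq: "e m = real (card \<F>) / \<eta>\<^sup>2 * (2 * (real (card (V m - good m R)) / real (N m)) +
        real (card (gball d k R) ^ 2) * (1 / real (N m)))" for m
    proof -
      have "f * ((2 * x * b + x * g) / x\<^sup>2 / h) = f / h * (2 * (b / x) + g * (1 / x))"
        if "x \<noteq> 0" for f x b g h :: real
        using that by (simp add: power2_eq_square add_divide_distrib distrib_left mult.commute)
      from this[of "real (N m)" "real (card \<F>)" "real (card (V m - good m R))" "real (card (gball d k R) ^ 2)" "\<eta>\<^sup>2"] k0
      show ?thesis unfolding e_def by simp
    qed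
    have "(\<lambda>m. real (card \<F>) / \<eta>\<^sup>2 * (2 * (real (card (V m - good m R)) / real (N m)) +
        real (card (gball d k R) ^ 2) * (1 / real (N m))))
      \<longlonglongrightarrow> real (card \<F>) / \<eta>\<^sup>2 * (2 * 0 + real (card (gball d k R) ^ 2) * 0)"
      by (intro tendsto_intros few_bad_vertices N_limits)
    then show ?thesis unfolding eq[abs_def] by simp
  qed
  then have "(\<lambda>m. 1 - e m) \<longlonglongrightarrow> 1" using tendsto_diff[OF tendsto_const, of e 0 sequentially 1] by simp
  ultimately show ?thesis by (rule tendsto_sandwich[OF _ always_eventually[OF allI] _ tendsto_const])
qed

lemma converges: "converges_locally_empirically G V \<Sigma> \<mu> (m_X d k)"
  unfolding converges_locally_empirically_def using local_convergence empirical_convergence by blast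

lemma microstates_exist: "has_microstates G V \<Sigma> (m_X d k)"
  unfolding has_microstates_def
proof (intro allI impI, elim conjE)
  fix W assume W: "openin (weak_star (carrier G)) W" "m_X d k \<in> W"
  have "\<forall>\<^sub>F m in sequentially. 0 < measure (\<mu> m) {x \<in> space (\<mu> m). empirical G (V m) (\<Sigma> m) x \<in> W}"
    by (rule order_tendstoD(1)[OF empirical_convergence[OF W]]) simp
  then show "\<forall>\<^sub>F m in sequentially. microstates G (V m) (\<Sigma> m) W \<noteq> {}"
  proof eventually_elim
    case (elim m)
    then have "{x \<in> space (\<mu> m). empirical G (V m) (\<Sigma> m) x \<in> W} \<noteq> {}"
      by (metis measure_empty order_less_irrefl)
    then show ?case unfolding microstates_def code.space_\<mu>[OF code] by blast
  qed
qed

lemma property_M: "property_M G (gens d k) V \<Sigma> \<mu> (m_X d k)"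
  unfolding property_M_def
proof (intro conjI allI impI m_X_shift_invariant)
  fix \<epsilon> r' :: real assume \<epsilon>: "0 < \<epsilon>" and r': "0 < r'"
  define r where "r = nat \<lfloor>r'\<rfloor>"
  have ball: "word_ball G (gens d k) r' = gball d k r" unfolding r_def by (rule word_ball_eq_ball) (use r' in simp)
  let ?h = "shannon (marginal (gball d k r) (m_X d k))"
  let ?T = "\<lambda>m S. {\<Sigma> m f s | f s. f \<in> gball d k r \<and> s \<in> S}"
  obtain R where R: "\<forall>\<^sub>F m in sequentially. code.localising d k (N m) (\<Sigma> m) c r R"
    using eventually_localising by blast
  define b where "b s = real (card (gball d k s))" for s
  have b: "0 < b s" for s using finite_ball one_in_ball[of s] by (auto simp: b_def card_gt_0_iff)
  \<comment> \<open>The first bound is the density of a separated set that is available once half of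
    the vertices are good. The second keeps words on its neighbourhoods light, with a factor 2 to
    spare for the strict inequality.\<close>
  define \<kappa> where "\<kappa> = min (1 / (2 * (b R)\<^sup>2)) (c / (2 * b r * (1 + c)))"
  have \<kappa>: "0 < \<kappa>" using b[of r] b[of R] c0 by (simp add: \<kappa>_def)
  define ok where "ok m S \<longleftrightarrow> S \<subseteq> V m \<and> \<kappa> * real (N m) - 1 \<le> card S \<and>
      card S * ?h \<le> shannon (marginal (?T m S) (\<mu> m))" for m S
  have "\<forall>\<^sub>F m in sequentially. real (card (V m - good m R)) / real (N m) < 1 / 2"
    by (rule order_tendstoD(2)[OF few_bad_vertices]) simp
  then have ev: "\<forall>\<^sub>F m in sequentially. \<exists>S. ok m S"
    using R
  proof eventually_elim
    case (elim m)
    interpret C: code d k "N m" "\<Sigma> m" by (rule code)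
    obtain S0 where S0: "S0 \<subseteq> good m R" "\<And>s s'. s \<in> S0 \<Longrightarrow> s' \<in> S0 \<Longrightarrow> s \<noteq> s' \<Longrightarrow> C.nbhd s R \<inter> C.nbhd s' R = {}"
      "card (good m R) \<le> card S0 * card (gball d k R) ^ 2"
      by (rule C.separated_set[of R]) blast
    have gV: "good m R \<subseteq> V m" unfolding C.good_def by blast
    then have fing: "finite (good m R)" by (rule finite_subset) simp
    have cV: "card (good m R) \<le> N m" using card_mono[OF _ gV] by simp
    have "card (V m - good m R) = N m - card (good m R)" using card_Diff_subset[OF fing gV] by simp
    then have "real (card (V m - good m R)) = real (N m) - real (card (good m R))" using cV by (simp only: of_nat_diff)
    moreover have "real (card (V m - good m R)) < 1 / 2 * real (N m)"
      using elim(1) N0[of m] by (simp only: pos_divide_less_eq of_nat_0_less_iff)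
    ultimately have half: "real (N m) / 2 \<le> real (card (good m R))" by linarith
    have "real (card (good m R)) \<le> real (card S0) * (b R)\<^sup>2"
      using of_nat_mono[OF S0(3), where 'a = real] by (simp add: b_def)
    then have "real (N m) / 2 \<le> real (card S0) * (b R)\<^sup>2" using half by linarith
    then have "1 / (2 * (b R)\<^sup>2) * real (N m) \<le> real (card S0)"
      using b[of R] by (simp add: field_simps)
    moreover have "\<kappa> * real (N m) \<le> 1 / (2 * (b R)\<^sup>2) * real (N m)"
      by (rule mult_right_mono) (simp_all add: \<kappa>_def)
    ultimately have "\<kappa> * real (N m) \<le> real (card S0)" by linarith
    then have "nat \<lfloor>\<kappa> * real (N m)\<rfloor> \<le> card S0" by linarith
    \<comment> \<open>Lightness needs an upper bound on \<open>card S\<close>, so the separated set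
      is cut down to the rounded value of \<open>\<kappa> * N m\<close>.\<close>
    then obtain S where S: "S \<subseteq> S0" "card S = nat \<lfloor>\<kappa> * real (N m)\<rfloor>"
      by (meson obtain_subset_with_card_n)
    have k1: "\<kappa> * real (N m) - 1 \<le> card S" "card S \<le> \<kappa> * real (N m)"
    proof -
      have "0 \<le> \<kappa> * real (N m)" using \<kappa> by simp
      then show "\<kappa> * real (N m) - 1 \<le> card S" "card S \<le> \<kappa> * real (N m)"
        unfolding S(2) by linarith+
    qed
    have "real (card S) * real (card (gball d k r)) * (1 + c) < c * real (N m)"
    proof -
      have pos: "0 < 2 * b r * (1 + c)" using b[of r] c0 by simp
      have "\<kappa> \<le> c / (2 * b r * (1 + c))" by (simp add: \<kappa>_def)
      then have "\<kappa> * (2 * b r * (1 + c)) \<le> c" by (simp only: pos_le_divide_eq[OF pos])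
      then have "real (N m) * (\<kappa> * (2 * b r * (1 + c))) \<le> real (N m) * c" by (rule mult_left_mono) simp
      moreover have "real (card S) * (b r * (1 + c)) \<le> \<kappa> * real (N m) * (b r * (1 + c))"
        using k1(2) b[of r] c0 by (intro mult_right_mono) auto
      moreover have "0 < real (N m) * c" using N0[of m] c0 by simp
      moreover have "real (N m) * (\<kappa> * (2 * b r * (1 + c))) = 2 * (\<kappa> * real (N m) * (b r * (1 + c)))"
        by (simp only: mult_ac)
      ultimately have "real (card S) * (b r * (1 + c)) < real (N m) * c" by linarith
      then show ?thesis by (simp only: b_def mult_ac)
    qed
    from C.entropy_lower_bound[OF elim(2) _ _ this] S0(1,2) S(1)
    have "card S * ?h \<le> shannon (marginal (?T m S) (\<mu> m))" by (meson subset_iff)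
    then have "ok m S" unfolding ok_def using k1(1) S(1) S0(1) gV by blast
    then show ?case by blast
  qed
  \<comment> \<open>The entropy inequality is demanded for every \<open>m\<close>. Where no suitable
    set exists, which happens only finitely often, the empty set is used, for which both sides are
    0.\<close>
  define S where "S m = (if \<exists>S. ok m S then SOME S. ok m S else {})" for m
  have okS: "ok m (S m)" if "\<exists>S. ok m S" for m
    using someI_ex[OF that] that by (simp add: S_def)
  have S: "S m \<subseteq> V m \<and> card (S m) * ?h \<le> shannon (marginal (?T m (S m)) (\<mu> m))" for m
  proof (cases "\<exists>S. ok m S")
    case True
    then show ?thesis using okS unfolding ok_def by blast
  next
    case False
    interpret C: code d k "N m" "\<Sigma> m" by (rule code)
    have "shannon (marginal {} (\<mu> m)) = card ({} :: nat set) * ln 2 - ln (card (C.dual \<inter> Pow {}))"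
      by (rule shannon_has_dual[OF _ marginal_has_dual[OF C.\<mu>_has_dual]])
        (use bspan_sym_diff bspan.empty in auto)
    also have "C.dual \<inter> Pow {} = {{}}" using bspan.empty by auto
    finally have "shannon (marginal {} (\<mu> m)) = 0" by simp
    moreover have "?T m {} = {}" by blast
    ultimately show ?thesis using False by (simp add: S_def)
  qed
  show "\<exists>S. (\<forall>m. S m \<subseteq> V m) \<and> 0 < liminf (\<lambda>m. ereal (card (S m) / card (V m))) \<and>
      (\<forall>m. card (S m) * (shannon (marginal (word_ball G (gens d k) r') (m_X d k)) - \<epsilon>)
        \<le> shannon (marginal {\<Sigma> m f s | f s. f \<in> word_ball G (gens d k) r' \<and> s \<in> S m} (\<mu> m)))"
  proof (intro exI[of _ S] conjI allI)
    show "S m \<subseteq> V m" for m using S by blast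
    show "card (S m) * (shannon (marginal (word_ball G (gens d k) r') (m_X d k)) - \<epsilon>)
        \<le> shannon (marginal {\<Sigma> m f s | f s. f \<in> word_ball G (gens d k) r' \<and> s \<in> S m} (\<mu> m))" for m
    proof -
      have "real (card (S m)) * (?h - \<epsilon>) \<le> real (card (S m)) * ?h" using \<epsilon> by (intro mult_left_mono) auto
      then show ?thesis unfolding ball using S[of m] by linarith
    qed
    have "\<forall>\<^sub>F m in sequentially. ereal (\<kappa> / 2) \<le> ereal (card (S m) / card (V m))"
      using ev eventually_N[of "2 / \<kappa>"]
    proof eventually_elim
      case (elim m)
      \<comment> \<open>From \<open>N m \<ge> 2 / \<kappa>\<close> on, the 1 lost by rounding is at
        most half of \<open>\<kappa> * N m\<close>.\<close>
      then have "2 \<le> \<kappa> * real (N m)" using \<kappa> by (simp add: pos_divide_le_eq mult.commute)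
      moreover have "\<kappa> * real (N m) - 1 \<le> card (S m)" using okS[OF elim(1)] by (simp add: ok_def)
      ultimately have "\<kappa> / 2 * real (N m) \<le> card (S m)" by simp
      then have "\<kappa> / 2 \<le> card (S m) / real (N m)" using N0[of m] by (simp only: pos_le_divide_eq of_nat_0_less_iff)
      then show ?case by simp
    qed
    then have "ereal (\<kappa> / 2) \<le> liminf (\<lambda>m. ereal (card (S m) / card (V m)))" by (rule Liminf_bounded)
    moreover have "0 < ereal (\<kappa> / 2)" using \<kappa> by simp
    ultimately show "0 < liminf (\<lambda>m. ereal (card (S m) / card (V m)))" by (rule order_less_le_trans[rotated])
  qed
qed

text \<open>The neighbourhood only asks the characters of the \<open>d\<close> cosets through the
  identity to have mean close to 1, that is, it asks microstates to violate few checks of each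
  colour.\<close>

lemma shattered: "totally_shattered G V \<Sigma> (m_X d k)"
  unfolding totally_shattered_def
proof (intro conjI m_X_shift_invariant microstates_exist exI[of _ "\<delta> / k"] allI impI)
  \<comment> \<open>\<open>sparse_detecting\<close> covers sets of up to
    \<open>\<delta> * Suc m\<close> points, which is the proportion \<open>\<delta> / k\<close> of
    all \<open>k * Suc m\<close>.\<close>
  show "0 < \<delta> / k" using \<delta>0 k0 by simp
  fix \<epsilon> :: real assume \<epsilon>: "0 < \<epsilon>"
  \<comment> \<open>Compensates the factor 9 in the dichotomy.\<close>
  define \<eta> where "\<eta> = \<epsilon> / 9"
  have \<eta>: "0 < \<eta>" using \<epsilon> by (simp add: \<eta>_def)
  let ?u = "gcoset d k \<one>\<^bsub>G\<^esub>"
  define W where "W = Prob (carrier G) \<inter> (\<Inter>i\<in>{1..d}. {\<nu> \<in> Prob (carrier G). (\<integral>x. chi (?u i) x \<partial>\<nu>) \<in> {1 - \<eta><..}})"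
  have u: "finite (?u i)" "?u i \<subseteq> carrier G" if "i \<in> {1..d}" for i
    using coset_carrier[OF one_closed that] by (auto simp: gcoset_def)
  \<comment> \<open>\<open>chi {}\<close> is constant, so this open set is all of
    \<open>Prob\<close>; it is the starting point for intersecting the \<open>d\<close> conditions
    one by one.\<close>
  have top: "openin (weak_star (carrier G)) {\<nu> \<in> Prob (carrier G). (\<integral>x. chi {} x \<partial>\<nu>) \<in> (UNIV :: real set)}"
    by (rule openin_weak_star_chi) auto
  have "openin (weak_star (carrier G)) ({\<nu> \<in> Prob (carrier G). (\<integral>x. chi {} x \<partial>\<nu>) \<in> (UNIV :: real set)} \<inter>
      (\<Inter>i\<in>J. {\<nu> \<in> Prob (carrier G). (\<integral>x. chi (?u i) x \<partial>\<nu>) \<in> {1 - \<eta><..}}))"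
    if "finite J" "J \<subseteq> {1..d}" for J
    using that
  proof (induction J)
    case (insert i J)
    have "openin (weak_star (carrier G)) {\<nu> \<in> Prob (carrier G). (\<integral>x. chi (?u i) x \<partial>\<nu>) \<in> {1 - \<eta><..}}"
      by (rule openin_weak_star_chi) (use u[of i] insert.prems in auto)
    then have "openin (weak_star (carrier G)) ({\<nu> \<in> Prob (carrier G). (\<integral>x. chi (?u i) x \<partial>\<nu>) \<in> {1 - \<eta><..}} \<inter>
      ({\<nu> \<in> Prob (carrier G). (\<integral>x. chi {} x \<partial>\<nu>) \<in> (UNIV :: real set)} \<inter>
      (\<Inter>i\<in>J. {\<nu> \<in> Prob (carrier G). (\<integral>x. chi (?u i) x \<partial>\<nu>) \<in> {1 - \<eta><..}})))"
      by (rule openin_Int) (use insert in auto)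
    then show ?case by (simp only: INT_insert Int_left_commute)
  qed (use top in simp)
  from this[of "{1..d}"] have Wopen: "openin (weak_star (carrier G)) W" by (simp add: W_def)
  have "(\<integral>x. chi (?u i) x \<partial>m_X d k) = 1" if i: "i \<in> {1..d}" for i
  proof -
    have "?u i \<in> cosets d k" using i one_closed unfolding cosets_def by blast
    then have "?u i \<in> bspan (cosets d k)" by (rule bspan_base)
    then show ?thesis using code.m_X_has_dual[OF code[of 0]] u[OF i] by (simp add: has_dual_def)
  qed
  then have mW: "m_X d k \<in> W" using m_X_Prob \<eta> by (simp add: W_def)
  have "\<forall>\<^sub>F m in sequentially. sparse_detecting d (N m) (\<delta> * real (Suc m)) (perm m)"
    using typical_perm by (rule eventually_mono) (elim conjE)
  then have "\<exists>m0. \<forall>m\<ge>m0. sparse_detecting d (N m) (\<delta> * real (Suc m)) (perm m)"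
    by (simp only: eventually_sequentially)
  then obtain m0 where m0: "\<forall>m\<ge>m0. sparse_detecting d (N m) (\<delta> * real (Suc m)) (perm m)" by (rule exE)
  show "\<exists>W m0. openin (weak_star (carrier G)) W \<and> m_X d k \<in> W \<and>
      (\<forall>m\<ge>m0. \<forall>x\<in>microstates G (V m) (\<Sigma> m) W. \<forall>y\<in>microstates G (V m) (\<Sigma> m) W.
        \<delta> / k \<le> hamming (V m) x y \<or> hamming (V m) x y < \<epsilon>)"
  proof (intro exI[of _ W] exI[of _ m0] conjI Wopen mW allI impI ballI)
    fix m x y assume m: "m0 \<le> m" and x: "x \<in> microstates G (V m) (\<Sigma> m) W" and y: "y \<in> microstates G (V m) (\<Sigma> m) W"
    have xi: "(\<integral>z. chi (?u i) z \<partial>empirical G (V m) (\<Sigma> m) x) > 1 - \<eta>"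
      and yi: "(\<integral>z. chi (?u i) z \<partial>empirical G (V m) (\<Sigma> m) y) > 1 - \<eta>" if "i \<in> {1..d}" for i
      using x y that by (auto simp: microstates_def W_def)
    have h: "hamming (V m) x y = real (card {v \<in> V m. x v \<noteq> y v}) / real (N m)"
      by (simp only: hamming_def card_atLeastAtMost diff_Suc_1)
    have Npos: "0 < real (N m)" using N0[of m] by (simp only: of_nat_0_less_iff)
    consider "\<delta> * real (Suc m) < card {v \<in> V m. x v \<noteq> y v}" | "card {v \<in> V m. x v \<noteq> y v} < 9 * \<eta> * real (N m)"
      using code.difference_dichotomy[OF code m0[rule_format, OF m] xi yi \<eta>] by blast
    then show "\<delta> / k \<le> hamming (V m) x y \<or> hamming (V m) x y < \<epsilon>"
    proof cases
      case 1
      have "\<delta> / k * real (N m) = \<delta> * real (Suc m)" using k0 by simp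
      then have "\<delta> / k * real (N m) \<le> real (card {v \<in> V m. x v \<noteq> y v})" using 1 by linarith
      then show ?thesis unfolding h pos_le_divide_eq[OF Npos] by blast
    next
      case 2
      then have "real (card {v \<in> V m. x v \<noteq> y v}) < \<epsilon> * real (N m)" by (simp add: \<eta>_def)
      then show ?thesis unfolding h pos_divide_less_eq[OF Npos] by blast
    qed
  qed
qed

end

theorem theorem6p1:
  fixes d k :: nat
  assumes "3 \<le> d" and "d < k"
  shows "\<exists>\<Omega>' :: nat \<Rightarrow> (nat list set \<Rightarrow> nat \<Rightarrow> nat) set.
    (\<forall>n. 0 < n \<and> k dvd n \<longrightarrow> \<Omega>' n \<subseteq> Hom_unif d k n \<and> \<Omega>' n \<noteq> {}) \<and>
    (\<lambda>m. measure (uniform_count_measure (Hom_unif d k (k * Suc m))) (\<Omega>' (k * Suc m)))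
      \<longlonglongrightarrow> 1 \<and>
    (\<forall>\<sigma> :: nat \<Rightarrow> nat list set \<Rightarrow> nat \<Rightarrow> nat.
      (\<forall>n. 0 < n \<and> k dvd n \<longrightarrow> \<sigma> n \<in> \<Omega>' n) \<longrightarrow>
      (let N = (\<lambda>m. k * Suc m);
           V = (\<lambda>m. {1..N m});
           \<Sigma> = (\<lambda>m. \<sigma> (N m));
           \<mu> = (\<lambda>m. code_measure d k (N m) (\<sigma> (N m)))
       in property_M (\<Gamma> d k) (gens d k) V \<Sigma> \<mu> (m_X d k) \<and>
          converges_locally_empirically (\<Gamma> d k) V \<Sigma> \<mu> (m_X d k) \<and>
          totally_shattered (\<Gamma> d k) V \<Sigma> (m_X d k)))"
proof -
  have k: "0 < k" "2 \<le> k" using assms by auto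
  obtain c \<delta> where c: "0 < c" "0 < \<delta>"
    "(\<lambda>m. measure (uniform_count_measure (Hom_unif d k (k * Suc m))) (typical d k c \<delta> (k * Suc m))) \<longlonglongrightarrow> 1"
    by (rule typical_limit[OF assms]) blast
  define \<Omega>' where "\<Omega>' n = (if typical d k c \<delta> n = {} then Hom_unif d k n else typical d k c \<delta> n)" for n
  have sub: "typical d k c \<delta> n \<subseteq> Hom_unif d k n" for n by (auto simp: typical_def)
  have \<Omega>: "\<Omega>' n \<subseteq> Hom_unif d k n \<and> \<Omega>' n \<noteq> {}" if "k dvd n" for n
    using sub[of n] Hom_unif_nonempty[OF k(1) that, of d] by (auto simp: \<Omega>'_def)
  have ev: "\<forall>\<^sub>F m in sequentially. \<Omega>' (k * Suc m) = typical d k c \<delta> (k * Suc m)"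
  proof -
    have "\<forall>\<^sub>F m in sequentially. 0 < measure (uniform_count_measure (Hom_unif d k (k * Suc m))) (typical d k c \<delta> (k * Suc m))"
      by (rule order_tendstoD(1)[OF c(3)]) simp
    then show ?thesis
    proof eventually_elim
      case (elim m)
      then have "typical d k c \<delta> (k * Suc m) \<noteq> {}" by (metis measure_empty order_less_irrefl)
      then show ?case by (simp add: \<Omega>'_def)
    qed
  qed
  have lim: "(\<lambda>m. measure (uniform_count_measure (Hom_unif d k (k * Suc m))) (\<Omega>' (k * Suc m))) \<longlonglongrightarrow> 1"
  proof (rule Lim_transform_eventually[OF c(3)])
    show "\<forall>\<^sub>F m in sequentially. measure (uniform_count_measure (Hom_unif d k (k * Suc m))) (typical d k c \<delta> (k * Suc m))
        = measure (uniform_count_measure (Hom_unif d k (k * Suc m))) (\<Omega>' (k * Suc m))"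
      using ev by eventually_elim simp
  qed
  have main: "property_M (\<Gamma> d k) (gens d k) (\<lambda>m. {1..k * Suc m}) (\<lambda>m. \<sigma> (k * Suc m))
        (\<lambda>m. code_measure d k (k * Suc m) (\<sigma> (k * Suc m))) (m_X d k) \<and>
      converges_locally_empirically (\<Gamma> d k) (\<lambda>m. {1..k * Suc m}) (\<lambda>m. \<sigma> (k * Suc m))
        (\<lambda>m. code_measure d k (k * Suc m) (\<sigma> (k * Suc m))) (m_X d k) \<and>
      totally_shattered (\<Gamma> d k) (\<lambda>m. {1..k * Suc m}) (\<lambda>m. \<sigma> (k * Suc m)) (m_X d k)"
    if \<sigma>: "\<forall>n. 0 < n \<and> k dvd n \<longrightarrow> \<sigma> n \<in> \<Omega>' n" for \<sigma>
  proof -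
    have in\<Omega>: "\<sigma> (k * Suc m) \<in> \<Omega>' (k * Suc m)" for m using \<sigma> k(1) by simp
    interpret typical_sequence d k "\<lambda>m. \<sigma> (k * Suc m)" c \<delta>
    proof
      show "\<sigma> (k * Suc m) \<in> Hom_unif d k (k * Suc m)" for m using in\<Omega>[of m] \<Omega>[of "k * Suc m"] by auto
      show "\<forall>\<^sub>F m in sequentially. \<sigma> (k * Suc m) \<in> typical d k c \<delta> (k * Suc m)"
        using ev
      proof eventually_elim
        case (elim m)
        then show ?case using in\<Omega>[of m] by simp
      qed
    qed (use k c in auto)
    show ?thesis using property_M converges shattered by blast
  qed
  show ?thesis
    unfolding Let_def using \<Omega> lim main by (intro exI[of _ \<Omega>'] conjI allI impI) auto
qed

end
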